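(* (1) Suppose $m\ge 3$ is odd. Let the data $\Pi=(k,\alpha)$ be generic so that $Br_{D_m}(\Pi)$ is a semisimple algebra, and let $(V,\rho)$ be a finite dimensional representation of $Br_{D_m}(\Pi)$. Then for generic $\kappa$, the monodromy representation $T_\rho:A_{D_m}\to GL(V)$ of the flat connection induced by $\rho(\Omega_{D_m})=\kappa\sum_{i=0}^{m-1}(k\rho(T_{s_i})-\rho(e_{s_i}))\omega_i$ factors through the algebra $B_{D_m}(\Pi,\kappa)$. (2) Suppose $m\ge 4$ is even, $m=2h$. Let the data $\Pi=(k_0,k_1,\alpha_0,\alpha_1)$ be generic so that $Br_{D_m}(\Pi)$ is a semisimple algebra, and let $(V,\rho)$ be a finite dimensional representation of $Br_{D_m}(\Pi)$. Then for generic $\kappa$, the monodromy representation $T_\rho:A_{D_m}\to GL(V)$ of the flat connection induced by $\rho(\Omega_{D_m})=\kappa\big[\sum_{i=0}^{h-1}(k_0\rho(T_{s_{2i}})-\rho(e_{s_{2i}}))\omega_{2i}+\sum_{i=0}^{h-1}(k_1\rho(T_{s_{2i+1}})-\rho(e_{s_{2i+1}}))\omega_{2i+1}\big]$ factors through the algebra $B_{D_m}(\Pi,\kappa)$. Here "factors through" means that there is an algebra morphism $B_{D_m}(\Pi,\kappa)\to\mathrm{End}(V)$ sending $X_i$ to $T_\rho(\sigma_i)$ for $i=0,1$.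
   Context: **Words.** $[xy\cdots]_r$ is the word of length $r$ in which $x,y$ alternate, beginning with $x$. **Dihedral setting.** $D_m$ is the dihedral group of order $2m$ acting on $\mathbb{R}^2$ and on its complexification $\mathbb{C}^2$. For $0\le i\le m-1$ let $H_i$ be the line through $0$ making angle $i\pi/m$ (anticlockwise) with the $x$-axis (and also its complexification), $s_i$ the reflection in $H_i$, $f_i$ a linear form on $\mathbb{C}^2$ with kernel $H_i$, $\omega_i=df_i/f_i$, and $M_m=\mathbb{C}^2\setminus\bigcup_i H_i$. Write $w(H_i)=H_{w(i)}$ for $w\in D_m$. The Artin group is $A_{D_m}=\pi_1(M_m/D_m)=\langle \sigma_0,\sigma_1\mid[\sigma_0\sigma_1\cdots]_m=[\sigma_1\sigma_0\cdots]_m\rangle$; the base point is the image of a point $p$ in the open real sector between $H_0$ and $H_1$, and $\sigma_i$ ($i=0,1$) is the class of the image of the path which follows the segment from $p$ to $s_i(p)$ except that near $H_i$ it follows the small half circle $t\mapsto p_i'-(1-e^{\pi\sqrt{-1}t})\frac{\langle p_i',a_i\rangle}{\langle a_i,a_i\rangle}a_i$, $t\in[0,1]$, where $a_i=s_i(p)-p$ and $p_i'$ is the point of the segment slightly before it meets $H_i$. **Monodromy.** Given a representation $\rho$ of $D_m$ on $V$ and a flat connection $\Omega=\kappa\sum_iX_i\omega_i$ on $M_m\times V$ which is $D_m$-invariant ($\rho(w)X_i\rho(w)^{-1}=X_{w(i)}$), $\Omega$ induces a flat connection on the quotient bundle $(M_m\times V)/D_m$ over $M_m/D_m$, and we take its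 monodromy representation $T$ of $A_{D_m}$ (flat sections satisfy $dF=\Omega F$, so that for generic $\kappa$, $T(\sigma_i)$ is conjugate to $\rho(s_i)\exp(\kappa\pi\sqrt{-1}X_i)$). **Parameters.** If $m$ is odd, $\Pi=(k,\alpha)\in\mathbb{C}^\times\times\mathbb{C}$ and $k_i=k,\alpha_i=\alpha$ for all $0\le i\le m-1$. If $m$ is even, $\Pi=(k_0,k_1,\alpha_0,\alpha_1)\in(\mathbb{C}^\times)^2\times\mathbb{C}^2$, and $(k_i,\alpha_i)$ equals $(k_0,\alpha_0)$ for $i$ even and $(k_1,\alpha_1)$ for $i$ odd. **The Brauer type algebra $Br_{D_m}(\Pi)$ ($m\ge3$).** It is the $\mathbb{C}$-algebra generated by $T_w$ ($w\in D_m$) and $e_{s_i}$ ($0\le i\le m-1$) with relations: $T_{w_1}T_{w_2}=T_{w_1w_2}$, $T_1=1$; $T_{s_i}e_{s_i}=e_{s_i}T_{s_i}=e_{s_i}$; $T_we_{s_i}=e_{s_i}T_w=e_{s_i}$ if $w(H_i)=H_i$ and $H_i\cap\{v\in \mathbb{C}^2:w(v)=v\}=\{0\}$; $e_{s_i}^2=\alpha_ie_{s_i}$; $T_we_{s_j}=e_{s_i}T_w$ if $w(H_j)=H_i$; for $i\ne j$, with $R(i,j)=\{t: s_t(H_j)=H_i\}$, $e_{s_i}e_{s_j}=\big(\sum_{t\in R(i,j)}k_tT_{s_t}\big)e_{s_j}=e_{s_i}\big(\sum_{t\in R(i,j)}k_tT_{s_t}\big)$ if $R(i,j)\neq\emptyset$,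 and $e_{s_i}e_{s_j}=0$ if $R(i,j)=\emptyset$. For a representation $(V,\rho)$ of $Br_{D_m}(\Pi)$, $\rho(\Omega_{D_m})$ is flat and $D_m$-invariant ($D_m$ acting on $V$ by $\rho(T_w)$), and $T_\rho$ is its monodromy representation. **Lawrence-Krammer representation and $\Phi$.** Let $V_{D_m}$ have basis $v_0,\dots,v_{m-1}$, $\iota(w)v_i=v_{w(i)}$, and $p_i(v_i)=\alpha_iv_i$, $p_i(v_j)=\big(\sum_{t\in R(i,j)}k_t\big)v_i$ for $j\neq i$. $T_{LK}:A_{D_m}\to GL(V_{D_m})$ is the monodromy representation of the flat $D_m$-invariant connection $\kappa\sum_{i=0}^{m-1}(k_i\iota(s_i)-p_i)\omega_i$. For $i=0,1$ put $q_i=\exp(\kappa k_i\pi\sqrt{-1})$, $l_i=\exp(\kappa\alpha_i\pi\sqrt{-1})/q_i$, $e_i=\frac{l_i}{q_i^{-1}-q_i}(T_{LK}(\sigma_i)-q_i)(T_{LK}(\sigma_i)+q_i^{-1})$; for generic parameters $e_i$ has rank one. Let $\Lambda$ be the free monoid on $X_0,X_1,E_0,E_1$ and $f:\Lambda\to\mathrm{End}(V_{D_m})$ the monoid morphism with $f(X_i)=T_{LK}(\sigma_i)$, $f(E_i)=e_i$. $\Phi^i_{m,\Pi,\kappa}:\Lambda\to\mathbb{C}$ is defined by $e_if(X)e_i=\Phi^i_{m,\Pi,\kappa}(X)e_i$. **The algebra $B_{D_m}(\Pi,\kappa)$.** It is the $\mathbb{C}$-algebra generated by $X_0^{\pm},X_1^{\pm},E_0,E_1$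 with relations, for $i=0,1$: (1) $X_iX_i^-=X_i^-X_i=1$; (2) $[X_0X_1\cdots]_m=[X_1X_0\cdots]_m$; (3) $(q_i^{-1}-q_i)E_i=l_i(X_i-q_i)(X_i+q_i^{-1})$; (4) $X_iE_i=E_iX_i=l_i^{-1}E_i$; (5) $E_iXE_i=\Phi^i_{m,\Pi,\kappa}(X)E_i$ for all $X\in\Lambda$; and, only when $m$ is even, (6) $E_0XE_1=0=E_1XE_0$ for all $X\in\Lambda$. "Generic" means outside a proper closed complex-analytic subset of the relevant parameter space. *)

theory Defs
  imports
    "HOL-Complex_Analysis.Complex_Analysis"
    "HOL-Library.Poly_Mapping"
    "HOL-Algebra.QuotRing"
    "Jordan_Normal_Form.Matrix"
begin

section \<open>Algebras given by generators and relations\<close>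

text \<open>The free monoid is written additively, so that finitely supported functions on it carry the
  convolution product of \<^theory>\<open>HOL-Library.Poly_Mapping\<close>, that is, form the free
  associative algebra.\<close>

datatype 'g fmon = Word (letters: "'g list")

instantiation fmon :: (type) monoid_add
begin

definition zero_fmon :: "'a fmon" where "zero_fmon = Word []"

definition plus_fmon :: "'a fmon \<Rightarrow> 'a fmon \<Rightarrow> 'a fmon"
  where "plus_fmon u v = Word (letters u @ letters v)"

instance
  by standard (auto simp: zero_fmon_def plus_fmon_def)

end

type_synonym 'g ncpoly = "'g fmon \<Rightarrow>\<^sub>0 complex"

definition const :: "complex \<Rightarrow> 'g ncpoly"
  where "const c = Poly_Mapping.single (Word []) c"

definition word :: "'g list \<Rightarrow> 'g ncpoly"
  where "word u = Poly_Mapping.single (Word u) 1"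

definition gen :: "'g \<Rightarrow> 'g ncpoly"
  where "gen g = word [g]"

definition free_algebra :: "'g set \<Rightarrow> 'g ncpoly ring"
  where "free_algebra G =
    \<lparr>carrier = {x. \<forall>u \<in> Poly_Mapping.keys x. set (letters u) \<subseteq> G},
     monoid.mult = (*), one = 1, zero = 0, add = (+)\<rparr>"

text \<open>An algebra is presented by a set \<open>G\<close> of generators and a set \<open>S\<close> of elements of the free
  algebra that are to become \<open>0\<close>. Ideals in \<^theory>\<open>HOL-Algebra.QuotRing\<close> are two-sided.\<close>

definition presented_algebra :: "'g set \<Rightarrow> 'g ncpoly set \<Rightarrow> 'g ncpoly set ring"
  where "presented_algebra G S = free_algebra G Quot (genideal (free_algebra G) S)"

definition cls :: "'g set \<Rightarrow> 'g ncpoly set \<Rightarrow> 'g ncpoly \<Rightarrow> 'g ncpoly set"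
  where "cls G S x = a_r_coset (free_algebra G) (genideal (free_algebra G) S) x"

text \<open>Morphisms of unital complex algebras to \<open>End(\<complex>\<^sup>n)\<close>, i.e. representations on \<open>\<complex>\<^sup>n\<close>;
  a unital ring morphism is \<open>\<complex>\<close>-linear iff it is compatible with the structure maps from \<open>\<complex>\<close>.\<close>

definition matrix_rep ::
    "'g set \<Rightarrow> 'g ncpoly set \<Rightarrow> nat \<Rightarrow> ('g ncpoly set \<Rightarrow> complex mat) \<Rightarrow> bool"
  where "matrix_rep G S n \<rho> \<longleftrightarrow>
    \<rho> \<in> Ring.ring_hom (presented_algebra G S) (ring_mat TYPE(complex) n ()) \<and>
    (\<forall>c. \<rho> (cls G S (const c)) = c \<cdot>\<^sub>m 1\<^sub>m n)"

definition left_ideal :: "'a set \<Rightarrow> ('a, 'b) ring_scheme \<Rightarrow> bool"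
  where "left_ideal I R \<longleftrightarrow>
    additive_subgroup I R \<and> (\<forall>a \<in> carrier R. \<forall>x \<in> I. a \<otimes>\<^bsub>R\<^esub> x \<in> I)"

text \<open>The regular left module is semisimple: every submodule has a complement.\<close>

definition semisimple :: "('a, 'b) ring_scheme \<Rightarrow> bool"
  where "semisimple R \<longleftrightarrow>
    (\<forall>I. left_ideal I R \<longrightarrow>
      (\<exists>J. left_ideal J R \<and> I \<inter> J = {\<zero>\<^bsub>R\<^esub>} \<and> I <+>\<^bsub>R\<^esub> J = carrier R))"


section \<open>The dihedral arrangement\<close>

type_synonym c2 = "complex \<times> complex"

definition angle :: "nat \<Rightarrow> nat \<Rightarrow> real"
  where "angle m i = real i * pi / real m"

definition line :: "nat \<Rightarrow> nat \<Rightarrow> c2 set"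
  where "line m i =
    {(c * of_real (cos (angle m i)), c * of_real (sin (angle m i))) | c. True}"

definition reflection :: "nat \<Rightarrow> nat \<Rightarrow> c2 \<Rightarrow> c2"
  where "reflection m i = (\<lambda>(x, y).
    (of_real (cos (2 * angle m i)) * x + of_real (sin (2 * angle m i)) * y,
     of_real (sin (2 * angle m i)) * x - of_real (cos (2 * angle m i)) * y))"

definition rotation :: "nat \<Rightarrow> nat \<Rightarrow> c2 \<Rightarrow> c2"
  where "rotation m i = (\<lambda>(x, y).
    (of_real (cos (2 * angle m i)) * x - of_real (sin (2 * angle m i)) * y,
     of_real (sin (2 * angle m i)) * x + of_real (cos (2 * angle m i)) * y))"

definition dihedral :: "nat \<Rightarrow> (c2 \<Rightarrow> c2) set"
  where "dihedral m = reflection m ` {..<m} \<union> rotation m ` {..<m}"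

definition line_act :: "nat \<Rightarrow> (c2 \<Rightarrow> c2) \<Rightarrow> nat \<Rightarrow> nat"
  where "line_act m w i = (THE j. j < m \<and> w ` line m i = line m j)"

definition refls_between :: "nat \<Rightarrow> nat \<Rightarrow> nat \<Rightarrow> nat set"
  where "refls_between m i j = {t. t < m \<and> reflection m t ` line m j = line m i}"

definition lform :: "nat \<Rightarrow> nat \<Rightarrow> c2 \<Rightarrow> complex"
  where "lform m i = (\<lambda>(x, y). of_real (cos (angle m i)) * y - of_real (sin (angle m i)) * x)"

text \<open>The logarithmic form \<open>df\<^sub>i / f\<^sub>i\<close> at the point \<open>z\<close>, evaluated on the tangent vector \<open>u\<close>.\<close>

definition omega :: "nat \<Rightarrow> nat \<Rightarrow> c2 \<Rightarrow> c2 \<Rightarrow> complex"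
  where "omega m i z u = lform m i u / lform m i z"

text \<open>The open real sector between the lines \<open>0\<close> and \<open>1\<close>.\<close>

definition chamber :: "nat \<Rightarrow> c2 set"
  where "chamber m =
    {(of_real (r * cos \<theta>), of_real (r * sin \<theta>)) | r \<theta>. 0 < r \<and> 0 < \<theta> \<and> \<theta> < pi / real m}"


section \<open>Monodromy\<close>

text \<open>The connection form \<open>\<kappa> \<Sum>\<^sub>i X\<^sub>i \<omega>\<^sub>i\<close> on the trivial bundle with fibre \<open>\<complex>\<^sup>n\<close>.\<close>

definition connection ::
    "nat \<Rightarrow> nat \<Rightarrow> complex \<Rightarrow> (nat \<Rightarrow> complex mat) \<Rightarrow> c2 \<Rightarrow> c2 \<Rightarrow> complex mat"
  where "connection m n \<kappa> X z u =
    mat n n (\<lambda>(r, c). \<kappa> * (\<Sum>i<m. X i $$ (r, c) * omega m i z u))"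

text \<open>\<open>transports n \<Omega> \<gamma> A\<close>: the sections along the piecewise smooth path \<open>\<gamma>\<close> that satisfy
  \<open>dF = \<Omega> F\<close> have \<open>F(1) = A F(0)\<close>. The columns of \<open>Y\<close> are such sections.\<close>

definition transports ::
    "nat \<Rightarrow> (c2 \<Rightarrow> c2 \<Rightarrow> complex mat) \<Rightarrow> (real \<Rightarrow> c2) \<Rightarrow> complex mat \<Rightarrow> bool"
  where "transports n \<Omega> \<gamma> A \<longleftrightarrow>
    (\<exists>Y S. finite S \<and> (\<forall>t \<in> {0..1}. Y t \<in> carrier_mat n n) \<and> Y 0 = 1\<^sub>m n \<and> Y 1 = A \<and>
      (\<forall>r<n. \<forall>c<n. continuous_on {0..1} (\<lambda>t. Y t $$ (r, c))) \<and>
      (\<forall>t \<in> {0<..<1} - S. \<gamma> differentiable at t \<and>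
        (\<forall>r<n. \<forall>c<n.
          ((\<lambda>t. Y t $$ (r, c)) has_vector_derivative
            (\<Omega> (\<gamma> t) (vector_derivative \<gamma> (at t)) * Y t) $$ (r, c)) (at t))))"

definition parallel_transport ::
    "nat \<Rightarrow> (c2 \<Rightarrow> c2 \<Rightarrow> complex mat) \<Rightarrow> (real \<Rightarrow> c2) \<Rightarrow> complex mat"
  where "parallel_transport n \<Omega> \<gamma> = (THE A. transports n \<Omega> \<gamma> A)"

text \<open>Let \<open>\<gamma>\<close> be a path from \<open>p\<close> to \<open>w p\<close> in the complement of the lines, with \<open>w\<close> in the dihedral
  group; its image is a loop in the orbit space. In the quotient bundle the point \<open>(w p, v)\<close> is
  identified with \<open>(p, \<rho>(w)\<^sup>-\<^sup>1 v)\<close>, whence the monodromy of this loop on the fibre over \<open>p\<close>.\<close>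

definition quotient_monodromy ::
    "nat \<Rightarrow> ((c2 \<Rightarrow> c2) \<Rightarrow> complex mat) \<Rightarrow> (c2 \<Rightarrow> c2 \<Rightarrow> complex mat) \<Rightarrow>
      (c2 \<Rightarrow> c2) \<Rightarrow> (real \<Rightarrow> c2) \<Rightarrow> complex mat"
  where "quotient_monodromy n \<rho> \<Omega> w \<gamma> = \<rho> (inv_into UNIV w) * parallel_transport n \<Omega> \<gamma>"

definition cscale :: "complex \<Rightarrow> c2 \<Rightarrow> c2"
  where "cscale c = (\<lambda>(x, y). (c * x, c * y))"

text \<open>The lift, starting at \<open>p\<close>, of the Artin generator \<open>\<sigma>\<^sub>i\<close>. The segment from \<open>p\<close> to \<open>s\<^sub>i p\<close> meets
  the line \<open>i\<close> in its midpoint; the detour starts at the point \<open>b\<close>, before the midpoint by the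
  fraction \<open>\<epsilon>\<close> of half the segment. All vectors here are real, so that \<open>inner\<close> is the Euclidean
  scalar product of the plane.\<close>

definition half_circle :: "c2 \<Rightarrow> c2 \<Rightarrow> real \<Rightarrow> c2"
  where "half_circle a b = (\<lambda>t.
    b - cscale ((1 - exp (of_real pi * \<i> * of_real t)) * of_real (inner b a / inner a a)) a)"

definition sigma_path :: "nat \<Rightarrow> c2 \<Rightarrow> real \<Rightarrow> nat \<Rightarrow> real \<Rightarrow> c2"
  where "sigma_path m p \<epsilon> i =
    (let a = reflection m i p - p; b = p + ((1 - \<epsilon>) / 2) *\<^sub>R a
     in linepath p b +++ half_circle a b +++ linepath (reflection m i b) (reflection m i p))"

text \<open>The images of the generators \<open>\<sigma>\<^sub>0\<close>, \<open>\<sigma>\<^sub>1\<close> of the Artin group under the monodromy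
  representation.\<close>

definition artin_monodromy ::
    "nat \<Rightarrow> c2 \<Rightarrow> real \<Rightarrow> nat \<Rightarrow> ((c2 \<Rightarrow> c2) \<Rightarrow> complex mat) \<Rightarrow>
      (c2 \<Rightarrow> c2 \<Rightarrow> complex mat) \<Rightarrow> nat \<Rightarrow> complex mat"
  where "artin_monodromy m p \<epsilon> n \<rho> \<Omega> i =
    quotient_monodromy n \<rho> \<Omega> (reflection m i) (sigma_path m p \<epsilon> i)"


section \<open>The Brauer type algebra\<close>

text \<open>From here on, \<open>k\<close> and \<open>\<alpha>\<close> are the families \<open>(k\<^sub>i)\<close>, \<open>(\<alpha>\<^sub>i)\<close> determined by the data \<open>\<Pi>\<close>.\<close>

datatype br_gen = GenT "c2 \<Rightarrow> c2" | Gene nat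

definition br_gens :: "nat \<Rightarrow> br_gen set"
  where "br_gens m = GenT ` dihedral m \<union> Gene ` {..<m}"

abbreviation gen_T :: "(c2 \<Rightarrow> c2) \<Rightarrow> br_gen ncpoly"
  where "gen_T w \<equiv> gen (GenT w)"

abbreviation gen_e :: "nat \<Rightarrow> br_gen ncpoly"
  where "gen_e i \<equiv> gen (Gene i)"

definition br_rels :: "nat \<Rightarrow> (nat \<Rightarrow> complex) \<Rightarrow> (nat \<Rightarrow> complex) \<Rightarrow> br_gen ncpoly set"
  where "br_rels m k \<alpha> =
    {gen_T w1 * gen_T w2 - gen_T (w1 \<circ> w2) | w1 w2. w1 \<in> dihedral m \<and> w2 \<in> dihedral m} \<union>
    {gen_T id - 1} \<union>
    {gen_T (reflection m i) * gen_e i - gen_e i | i. i < m} \<union>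
    {gen_e i * gen_T (reflection m i) - gen_e i | i. i < m} \<union>
    {gen_T w * gen_e i - gen_e i | w i. w \<in> dihedral m \<and> i < m \<and>
        w ` line m i = line m i \<and> line m i \<inter> {v. w v = v} = {(0, 0)}} \<union>
    {gen_e i * gen_T w - gen_e i | w i. w \<in> dihedral m \<and> i < m \<and>
        w ` line m i = line m i \<and> line m i \<inter> {v. w v = v} = {(0, 0)}} \<union>
    {gen_e i * gen_e i - const (\<alpha> i) * gen_e i | i. i < m} \<union>
    {gen_T w * gen_e j - gen_e i * gen_T w | w i j. w \<in> dihedral m \<and> i < m \<and> j < m \<and>
        w ` line m j = line m i} \<union>
    {gen_e i * gen_e j - (\<Sum>t\<in>refls_between m i j. const (k t) * gen_T (reflection m t)) * gen_e j | i j.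
        i < m \<and> j < m \<and> i \<noteq> j \<and> refls_between m i j \<noteq> {}} \<union>
    {gen_e i * gen_e j - gen_e i * (\<Sum>t\<in>refls_between m i j. const (k t) * gen_T (reflection m t)) | i j.
        i < m \<and> j < m \<and> i \<noteq> j \<and> refls_between m i j \<noteq> {}} \<union>
    {gen_e i * gen_e j | i j. i < m \<and> j < m \<and> i \<noteq> j \<and> refls_between m i j = {}}"

definition Br :: "nat \<Rightarrow> (nat \<Rightarrow> complex) \<Rightarrow> (nat \<Rightarrow> complex) \<Rightarrow> br_gen ncpoly set ring"
  where "Br m k \<alpha> = presented_algebra (br_gens m) (br_rels m k \<alpha>)"

definition Br_rep ::
    "nat \<Rightarrow> (nat \<Rightarrow> complex) \<Rightarrow> (nat \<Rightarrow> complex) \<Rightarrow> nat \<Rightarrow>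
      (br_gen ncpoly set \<Rightarrow> complex mat) \<Rightarrow> bool"
  where "Br_rep m k \<alpha> n \<rho> \<longleftrightarrow> matrix_rep (br_gens m) (br_rels m k \<alpha>) n \<rho>"

definition rep_T ::
    "nat \<Rightarrow> (nat \<Rightarrow> complex) \<Rightarrow> (nat \<Rightarrow> complex) \<Rightarrow>
      (br_gen ncpoly set \<Rightarrow> complex mat) \<Rightarrow> (c2 \<Rightarrow> c2) \<Rightarrow> complex mat"
  where "rep_T m k \<alpha> \<rho> w = \<rho> (cls (br_gens m) (br_rels m k \<alpha>) (gen_T w))"

definition rep_e ::
    "nat \<Rightarrow> (nat \<Rightarrow> complex) \<Rightarrow> (nat \<Rightarrow> complex) \<Rightarrow>
      (br_gen ncpoly set \<Rightarrow> complex mat) \<Rightarrow> nat \<Rightarrow> complex mat"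
  where "rep_e m k \<alpha> \<rho> i = \<rho> (cls (br_gens m) (br_rels m k \<alpha>) (gen_e i))"

definition Omega ::
    "nat \<Rightarrow> (nat \<Rightarrow> complex) \<Rightarrow> (nat \<Rightarrow> complex) \<Rightarrow> complex \<Rightarrow> nat \<Rightarrow>
      (br_gen ncpoly set \<Rightarrow> complex mat) \<Rightarrow> c2 \<Rightarrow> c2 \<Rightarrow> complex mat"
  where "Omega m k \<alpha> \<kappa> n \<rho> =
    connection m n \<kappa> (\<lambda>i. k i \<cdot>\<^sub>m rep_T m k \<alpha> \<rho> (reflection m i) - rep_e m k \<alpha> \<rho> i)"

definition T_rho ::
    "nat \<Rightarrow> (nat \<Rightarrow> complex) \<Rightarrow> (nat \<Rightarrow> complex) \<Rightarrow> complex \<Rightarrow> c2 \<Rightarrow> real \<Rightarrow> nat \<Rightarrow>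
      (br_gen ncpoly set \<Rightarrow> complex mat) \<Rightarrow> nat \<Rightarrow> complex mat"
  where "T_rho m k \<alpha> \<kappa> p \<epsilon> n \<rho> =
    artin_monodromy m p \<epsilon> n (rep_T m k \<alpha> \<rho>) (Omega m k \<alpha> \<kappa> n \<rho>)"


section \<open>The Lawrence-Krammer representation\<close>

definition LK_iota :: "nat \<Rightarrow> (c2 \<Rightarrow> c2) \<Rightarrow> complex mat"
  where "LK_iota m w = mat m m (\<lambda>(r, c). if r = line_act m w c then 1 else 0)"

definition LK_p :: "nat \<Rightarrow> (nat \<Rightarrow> complex) \<Rightarrow> (nat \<Rightarrow> complex) \<Rightarrow> nat \<Rightarrow> complex mat"
  where "LK_p m k \<alpha> i = mat m m (\<lambda>(r, c).
    if r = i then (if c = i then \<alpha> i else (\<Sum>t\<in>refls_between m i c. k t)) else 0)"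

definition T_LK ::
    "nat \<Rightarrow> (nat \<Rightarrow> complex) \<Rightarrow> (nat \<Rightarrow> complex) \<Rightarrow> complex \<Rightarrow> c2 \<Rightarrow> real \<Rightarrow> nat \<Rightarrow> complex mat"
  where "T_LK m k \<alpha> \<kappa> p \<epsilon> =
    artin_monodromy m p \<epsilon> m (LK_iota m)
      (connection m m \<kappa> (\<lambda>i. k i \<cdot>\<^sub>m LK_iota m (reflection m i) - LK_p m k \<alpha> i))"

definition q_par :: "(nat \<Rightarrow> complex) \<Rightarrow> complex \<Rightarrow> nat \<Rightarrow> complex"
  where "q_par k \<kappa> i = exp (\<kappa> * k i * of_real pi * \<i>)"

definition l_par :: "(nat \<Rightarrow> complex) \<Rightarrow> (nat \<Rightarrow> complex) \<Rightarrow> complex \<Rightarrow> nat \<Rightarrow> complex"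
  where "l_par k \<alpha> \<kappa> i = exp (\<kappa> * \<alpha> i * of_real pi * \<i>) / q_par k \<kappa> i"

definition LK_e ::
    "nat \<Rightarrow> (nat \<Rightarrow> complex) \<Rightarrow> (nat \<Rightarrow> complex) \<Rightarrow> complex \<Rightarrow> c2 \<Rightarrow> real \<Rightarrow> nat \<Rightarrow> complex mat"
  where "LK_e m k \<alpha> \<kappa> p \<epsilon> i =
    (l_par k \<alpha> \<kappa> i / (inverse (q_par k \<kappa> i) - q_par k \<kappa> i)) \<cdot>\<^sub>m
      ((T_LK m k \<alpha> \<kappa> p \<epsilon> i - q_par k \<kappa> i \<cdot>\<^sub>m 1\<^sub>m m) *
       (T_LK m k \<alpha> \<kappa> p \<epsilon> i + inverse (q_par k \<kappa> i) \<cdot>\<^sub>m 1\<^sub>m m))"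

datatype letter = GenX nat | GenE nat

definition Lambda :: "letter list set"
  where "Lambda = lists {GenX 0, GenX 1, GenE 0, GenE 1}"

fun LK_letter ::
    "nat \<Rightarrow> (nat \<Rightarrow> complex) \<Rightarrow> (nat \<Rightarrow> complex) \<Rightarrow> complex \<Rightarrow> c2 \<Rightarrow> real \<Rightarrow> letter \<Rightarrow> complex mat"
  where
    "LK_letter m k \<alpha> \<kappa> p \<epsilon> (GenX i) = T_LK m k \<alpha> \<kappa> p \<epsilon> i"
  | "LK_letter m k \<alpha> \<kappa> p \<epsilon> (GenE i) = LK_e m k \<alpha> \<kappa> p \<epsilon> i"

definition LK_word ::
    "nat \<Rightarrow> (nat \<Rightarrow> complex) \<Rightarrow> (nat \<Rightarrow> complex) \<Rightarrow> complex \<Rightarrow> c2 \<Rightarrow> real \<Rightarrow> letter list \<Rightarrow> complex mat"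
  where "LK_word m k \<alpha> \<kappa> p \<epsilon> u = foldr (\<lambda>g A. LK_letter m k \<alpha> \<kappa> p \<epsilon> g * A) u (1\<^sub>m m)"

definition Phi ::
    "nat \<Rightarrow> (nat \<Rightarrow> complex) \<Rightarrow> (nat \<Rightarrow> complex) \<Rightarrow> complex \<Rightarrow> c2 \<Rightarrow> real \<Rightarrow> nat \<Rightarrow> letter list \<Rightarrow> complex"
  where "Phi m k \<alpha> \<kappa> p \<epsilon> i u =
    (THE c. LK_e m k \<alpha> \<kappa> p \<epsilon> i * LK_word m k \<alpha> \<kappa> p \<epsilon> u * LK_e m k \<alpha> \<kappa> p \<epsilon> i =
      c \<cdot>\<^sub>m LK_e m k \<alpha> \<kappa> p \<epsilon> i)"


section \<open>The deformed algebra\<close>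

datatype b_gen = Pos letter | Xinv nat

definition b_gens :: "b_gen set"
  where "b_gens = {Pos (GenX 0), Pos (GenX 1), Xinv 0, Xinv 1, Pos (GenE 0), Pos (GenE 1)}"

abbreviation gen_X :: "nat \<Rightarrow> b_gen ncpoly"
  where "gen_X i \<equiv> gen (Pos (GenX i))"

abbreviation gen_Xinv :: "nat \<Rightarrow> b_gen ncpoly"
  where "gen_Xinv i \<equiv> gen (Xinv i)"

abbreviation gen_E :: "nat \<Rightarrow> b_gen ncpoly"
  where "gen_E i \<equiv> gen (Pos (GenE i))"

fun alternating :: "nat \<Rightarrow> 'g \<Rightarrow> 'g \<Rightarrow> 'g list"
  where
    "alternating 0 x y = []"
  | "alternating (Suc r) x y = x # alternating r y x"

definition b_rels ::
    "nat \<Rightarrow> (nat \<Rightarrow> complex) \<Rightarrow> (nat \<Rightarrow> complex) \<Rightarrow> complex \<Rightarrow> c2 \<Rightarrow> real \<Rightarrow> b_gen ncpoly set"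
  where "b_rels m k \<alpha> \<kappa> p \<epsilon> =
    {gen_X i * gen_Xinv i - 1 | i. i < 2} \<union>
    {gen_Xinv i * gen_X i - 1 | i. i < 2} \<union>
    {word (alternating m (Pos (GenX 0)) (Pos (GenX 1))) -
       word (alternating m (Pos (GenX 1)) (Pos (GenX 0)))} \<union>
    {const (inverse (q_par k \<kappa> i) - q_par k \<kappa> i) * gen_E i -
       const (l_par k \<alpha> \<kappa> i) * (gen_X i - const (q_par k \<kappa> i)) * (gen_X i + const (inverse (q_par k \<kappa> i)))
       | i. i < 2} \<union>
    {gen_X i * gen_E i - const (inverse (l_par k \<alpha> \<kappa> i)) * gen_E i | i. i < 2} \<union>
    {gen_E i * gen_X i - const (inverse (l_par k \<alpha> \<kappa> i)) * gen_E i | i. i < 2} \<union>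
    {gen_E i * word (map Pos u) * gen_E i - const (Phi m k \<alpha> \<kappa> p \<epsilon> i u) * gen_E i | i u.
       i < 2 \<and> u \<in> Lambda} \<union>
    (if even m then
      {gen_E 0 * word (map Pos u) * gen_E 1 | u. u \<in> Lambda} \<union>
      {gen_E 1 * word (map Pos u) * gen_E 0 | u. u \<in> Lambda}
     else {})"

text \<open>The assignment \<open>X\<^sub>i \<mapsto> M i\<close> extends to a morphism of algebras to \<open>End(\<complex>\<^sup>n)\<close>.\<close>

definition factors_through_B ::
    "nat \<Rightarrow> (nat \<Rightarrow> complex) \<Rightarrow> (nat \<Rightarrow> complex) \<Rightarrow> complex \<Rightarrow> c2 \<Rightarrow> real \<Rightarrow> nat \<Rightarrow>
      (nat \<Rightarrow> complex mat) \<Rightarrow> bool"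
  where "factors_through_B m k \<alpha> \<kappa> p \<epsilon> n M \<longleftrightarrow>
    (\<exists>h. matrix_rep b_gens (b_rels m k \<alpha> \<kappa> p \<epsilon>) n h \<and>
      (\<forall>i<2. h (cls b_gens (b_rels m k \<alpha> \<kappa> p \<epsilon>) (gen_X i)) = M i))"


section \<open>Genericity\<close>

definition closed_analytic :: "complex set \<Rightarrow> bool"
  where "closed_analytic Z \<longleftrightarrow>
    closed Z \<and>
    (\<forall>z. \<exists>U F. open U \<and> z \<in> U \<and> finite F \<and> (\<forall>f \<in> F. f holomorphic_on U) \<and>
      Z \<inter> U = {x \<in> U. \<forall>f \<in> F. f x = 0})"

definition for_generic :: "(complex \<Rightarrow> bool) \<Rightarrow> bool"
  where "for_generic P \<longleftrightarrow> (\<exists>Z. closed_analytic Z \<and> Z \<noteq> UNIV \<and> (\<forall>\<kappa>. \<kappa> \<notin> Z \<longrightarrow> P \<kappa>))"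

end

theory Submission
  imports
    Defs
    "Jordan_Normal_Form.Determinant"
    "HOL-Complex_Analysis.Riemann_Mapping"
begin

text \<open>The monodromy depends only on the matrices \<open>S\<^sub>l\<close> and \<open>e\<^sub>l\<close> by which the reflections and the
  elements \<open>e\<close> act. The analysis is therefore carried out for arbitrary matrices that satisfy the
  relations of the Brauer type algebra (\<open>brauer_matrices\<close>); the given representation and the
  Lawrence-Krammer representation (\<open>LK_brauer\<close>) are two instances. The relations of the deformed
  algebra come from three sources.

  The quadratic relation and the relations between \<open>X\<^sub>i\<close> and \<open>E\<^sub>i\<close> are local. The residue
  \<open>\<kappa> (k\<^sub>i S\<^sub>i - e\<^sub>i)\<close> at the line \<open>i\<close> has the eigenvalues \<open>\<plusminus> \<kappa> k\<^sub>i\<close> and \<open>\<kappa> (k\<^sub>i - \<alpha>\<^sub>i)\<close>, so that for generic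
  \<open>\<kappa>\<close> there is no resonance and a holomorphic gauge transformation \<open>H\<close> brings the connection to the
  constant form (\<open>frobenius_exists\<close>). Hence \<open>T(\<sigma>\<^sub>i)\<close> is conjugate to \<open>S\<^sub>i exp (\<pi> \<i> \<kappa> (k\<^sub>i S\<^sub>i - e\<^sub>i))\<close>, an
  element of the commutative algebra spanned by \<open>1\<close>, \<open>S\<^sub>i\<close> and \<open>e\<^sub>i\<close>, where the relations are verified
  directly (\<open>T_normal_form\<close>). As \<open>H\<close> is unique, the monodromy is compatible with all intertwining
  matrices (\<open>W_intertwine\<close>), and the conjugating matrix commutes with all symmetries.

  The braid relation is global. In the coordinates \<open>a = x + \<i> y\<close> and \<open>\<tau> = (x - \<i> y) / a\<close> the
  connection is the sum of a constant multiple of \<open>da / a\<close> and a form in \<open>\<tau>\<close>, since the sum of the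
  residues commutes with each of them. This yields a solution \<open>\<Psi>\<close> on the universal cover
  of a circle in the real plane; both generators are expressed by its values
  (\<open>sigma_monodromy_Psi\<close>), and the relation follows from the behaviour of \<open>\<Psi>\<close> under rotations and
  reflections (\<open>braid_relation\<close>).

  The relations with arbitrary words are transferred from the Lawrence-Krammer representation.
  There \<open>E\<^sub>i\<close> is conjugate to a multiple of \<open>p\<^sub>i\<close>, which has rank one, so that \<open>E\<^sub>i W E\<^sub>i\<close> is a
  multiple of \<open>E\<^sub>i\<close> (\<open>Phi\<close>); for even \<open>m\<close> the lines of even and of odd index do not interact
  (\<open>E_W_E_parity\<close>). On a representation \<open>V\<close> the defect \<open>D\<close> of such a relation vanishes on all
  images of the Lawrence-Krammer representation, and these contain the columns of all \<open>e\<^sub>a\<close>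
  (\<open>kills_e\<close>). Hence \<open>D\<close> annihilates the image of the ideal generated by the \<open>e\<^sub>a\<close> (\<open>kills_ideal\<close>).
  By semisimplicity this ideal has a unit \<open>\<eta>\<close>, which is central in the whole algebra
  (\<open>semisimple_ideal_unit\<close>), and \<open>e\<^sub>i \<eta> = e\<^sub>i\<close> implies \<open>E\<^sub>i \<eta> = E\<^sub>i\<close> for the monodromy. So
  \<open>D = D \<eta> = 0\<close> (\<open>vanish\<close>).\<close>

section \<open>Calculus of holomorphic matrix functions\<close>

lemma mat_assoc:
  "dim_col A = dim_row B \<Longrightarrow> dim_col B = dim_row C \<Longrightarrow> A * B * C = A * (B * (C :: complex mat))"
  by (rule assoc_mult_mat[of A "dim_row A" "dim_col A" B "dim_col B" C "dim_col C"]) auto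

lemma mat_add_distrib:
  fixes A B C :: "complex mat"
  shows "dim_col A = dim_row B \<Longrightarrow> dim_row B = dim_row C \<Longrightarrow> dim_col B = dim_col C \<Longrightarrow>
      A * (B + C) = A * B + A * C"
    and "dim_col A = dim_row C \<Longrightarrow> dim_row A = dim_row B \<Longrightarrow> dim_col A = dim_col B \<Longrightarrow>
      (A + B) * C = A * C + B * C"
    and "dim_col A = dim_row B \<Longrightarrow> dim_row B = dim_row C \<Longrightarrow> dim_col B = dim_col C \<Longrightarrow>
      A * (B - C) = A * B - A * C"
    and "dim_col A = dim_row C \<Longrightarrow> dim_row A = dim_row B \<Longrightarrow> dim_col A = dim_col B \<Longrightarrow>
      (A - B) * C = A * C - B * C"
proof -
  show "A * (B + C) = A * B + A * C"
    if "dim_col A = dim_row B" "dim_row B = dim_row C" "dim_col B = dim_col C"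
    using that by (intro mult_add_distrib_mat[of A "dim_row A" "dim_col A" B "dim_col B" C]) auto
  show "(A + B) * C = A * C + B * C"
    if "dim_col A = dim_row C" "dim_row A = dim_row B" "dim_col A = dim_col B"
    using that by (intro add_mult_distrib_mat[of A "dim_row A" "dim_col A" B C "dim_col C"]) auto
  show "A * (B - C) = A * B - A * C"
    if "dim_col A = dim_row B" "dim_row B = dim_row C" "dim_col B = dim_col C"
    using that by (intro mult_minus_distrib_mat[of A "dim_row A" "dim_col A" B "dim_col B" C]) auto
  show "(A - B) * C = A * C - B * C"
    if "dim_col A = dim_row C" "dim_row A = dim_row B" "dim_col A = dim_col B"
    using that by (intro minus_mult_distrib_mat[of A "dim_row A" "dim_col A" B C "dim_col C"]) auto
qed

lemma mat_smult_mult: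
  fixes A B :: "complex mat"
  shows "dim_col A = dim_row B \<Longrightarrow> (c \<cdot>\<^sub>m A) * B = c \<cdot>\<^sub>m (A * B)"
    and "dim_col A = dim_row B \<Longrightarrow> A * (c \<cdot>\<^sub>m B) = c \<cdot>\<^sub>m (A * B)"
  by (auto intro!: eq_matI simp: scalar_prod_def sum_distrib_left mult_ac)

lemma mat_uminus_mult:
  fixes A B :: "complex mat"
  shows "dim_col A = dim_row B \<Longrightarrow> (- A) * B = - (A * B)"
    and "dim_col A = dim_row B \<Longrightarrow> A * (- B) = - (A * B)"
  by (auto intro!: eq_matI simp: scalar_prod_def sum_negf)

lemma mat_one_mult:
  fixes A :: "complex mat"
  shows "dim_row A = n \<Longrightarrow> 1\<^sub>m n * A = A" and "dim_col A = n \<Longrightarrow> A * 1\<^sub>m n = A"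
  by (auto intro!: eq_matI)

lemma mat_zero_mult:
  fixes A :: "complex mat"
  shows "dim_row A = l \<Longrightarrow> 0\<^sub>m n l * A = 0\<^sub>m n (dim_col A)"
    and "dim_col A = l \<Longrightarrow> A * 0\<^sub>m l n = 0\<^sub>m (dim_row A) n"
  by (auto intro!: eq_matI simp: scalar_prod_def)

lemma mat_smult_smult: "a \<cdot>\<^sub>m (b \<cdot>\<^sub>m (A :: complex mat)) = (a * b) \<cdot>\<^sub>m A"
  by (auto intro!: eq_matI)

lemmas mat_ring = mat_assoc mat_add_distrib mat_smult_mult mat_uminus_mult mat_one_mult
  mat_zero_mult mat_smult_smult

definition mat_hol :: "nat \<Rightarrow> nat \<Rightarrow> (complex \<Rightarrow> complex mat) \<Rightarrow> complex set \<Rightarrow> bool"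
  where "mat_hol n l F A \<longleftrightarrow> (\<forall>x. F x \<in> carrier_mat n l) \<and>
    (\<forall>r<n. \<forall>c<l. (\<lambda>x. F x $$ (r, c)) holomorphic_on A)"

definition mat_deriv :: "nat \<Rightarrow> nat \<Rightarrow> (complex \<Rightarrow> complex mat) \<Rightarrow> complex \<Rightarrow> complex mat"
  where "mat_deriv n l F x = mat n l (\<lambda>(r, c). deriv (\<lambda>y. F y $$ (r, c)) x)"

lemma mat_hol_carrier: "mat_hol n l F A \<Longrightarrow> F x \<in> carrier_mat n l"
  by (auto simp: mat_hol_def)

lemma mat_hol_dim [simp]:
  "mat_hol n l F A \<Longrightarrow> dim_row (F x) = n" "mat_hol n l F A \<Longrightarrow> dim_col (F x) = l"
  by (auto simp: mat_hol_def dest!: spec[of _ x])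

lemma mat_deriv_dim [simp]:
  "dim_row (mat_deriv n l F x) = n" "dim_col (mat_deriv n l F x) = l"
  "mat_deriv n l F x \<in> carrier_mat n l"
  by (auto simp: mat_deriv_def)

lemma mat_hol_subset: "mat_hol n l F A \<Longrightarrow> B \<subseteq> A \<Longrightarrow> mat_hol n l F B"
  unfolding mat_hol_def by (meson holomorphic_on_subset)

lemma mat_hol_entry:
  "mat_hol n l F A \<Longrightarrow> r < n \<Longrightarrow> c < l \<Longrightarrow> (\<lambda>x. F x $$ (r, c)) holomorphic_on A"
  by (auto simp: mat_hol_def)

lemma mat_hol_has_deriv:
  assumes "mat_hol n l F A" "open A" "x \<in> A" "r < n" "c < l"
  shows "((\<lambda>x. F x $$ (r, c)) has_field_derivative mat_deriv n l F x $$ (r, c)) (at x)"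
  using assms by (auto simp: mat_deriv_def intro!: holomorphic_derivI[OF mat_hol_entry])

lemma mat_deriv_eqI:
  assumes "M \<in> carrier_mat n l"
    and "\<And>r c. r < n \<Longrightarrow> c < l \<Longrightarrow>
      ((\<lambda>x. F x $$ (r, c)) has_field_derivative M $$ (r, c)) (at x)"
  shows "mat_deriv n l F x = M"
  by (rule eq_matI) (use assms in \<open>auto simp: mat_deriv_def intro!: DERIV_imp_deriv\<close>)

lemma mat_holI:
  assumes "open A" "\<And>x. F x \<in> carrier_mat n l"
    and "\<And>x r c. x \<in> A \<Longrightarrow> r < n \<Longrightarrow> c < l \<Longrightarrow>
      ((\<lambda>x. F x $$ (r, c)) has_field_derivative D x r c) (at x)"
  shows "mat_hol n l F A"
  using assms unfolding mat_hol_def by (auto simp: holomorphic_on_open) blast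

lemma mult_entry:
  assumes "A \<in> carrier_mat n l" "B \<in> carrier_mat l k" "r < n" "c < k"
  shows "(A * B) $$ (r, c) = (\<Sum>d<l. A $$ (r, d) * B $$ (d, c) :: complex)"
  using assms by (auto simp: scalar_prod_def atLeast0LessThan)

lemma mat_hol_mult:
  assumes "mat_hol n l F A" "mat_hol l k G A"
  shows "mat_hol n k (\<lambda>x. F x * G x) A"
proof -
  have "(\<lambda>x. (F x * G x) $$ (r, c)) = (\<lambda>x. \<Sum>d<l. F x $$ (r, d) * G x $$ (d, c))"
    if "r < n" "c < k" for r c
    using assms that by (intro ext mult_entry) (auto dest: mat_hol_carrier)
  then show ?thesis
    using assms by (auto simp: mat_hol_def intro!: holomorphic_intros mult_carrier_mat)
qed

lemma mat_deriv_mult: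
  assumes "mat_hol n l F A" "mat_hol l k G A" "open A" "x \<in> A"
  shows "mat_deriv n k (\<lambda>x. F x * G x) x = mat_deriv n l F x * G x + F x * mat_deriv l k G x"
proof (rule mat_deriv_eqI)
  show "mat_deriv n l F x * G x + F x * mat_deriv l k G x \<in> carrier_mat n k"
    using assms by (auto dest!: mat_hol_carrier[of _ _ _ _ x])
  fix r c assume rc: "r < n" "c < k"
  have *: "(\<lambda>x. (F x * G x) $$ (r, c)) = (\<lambda>x. \<Sum>d<l. F x $$ (r, d) * G x $$ (d, c))"
    using assms rc by (intro ext mult_entry) (auto dest: mat_hol_carrier)
  have **: "(mat_deriv n l F x * G x + F x * mat_deriv l k G x) $$ (r, c) =
     (\<Sum>d<l. mat_deriv n l F x $$ (r, d) * G x $$ (d, c) + mat_deriv l k G x $$ (d, c) * F x $$ (r, d))"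
    using assms rc
    by (auto simp: scalar_prod_def atLeast0LessThan sum.distrib mult_ac dest!: mat_hol_carrier[of _ _ _ _ x])
  show "((\<lambda>x. (F x * G x) $$ (r, c)) has_field_derivative
    (mat_deriv n l F x * G x + F x * mat_deriv l k G x) $$ (r, c)) (at x)"
    unfolding * ** using assms rc
    by (intro DERIV_sum DERIV_mult mat_hol_has_deriv) auto
qed

lemma mat_hol_const [simp]: "C \<in> carrier_mat n l \<Longrightarrow> mat_hol n l (\<lambda>_. C) A"
  by (auto simp: mat_hol_def)

lemma mat_deriv_const [simp]: "mat_deriv n l (\<lambda>_. C) x = 0\<^sub>m n l"
  by (auto simp: mat_deriv_def intro!: eq_matI)

lemma mat_hol_smult:
  assumes "g holomorphic_on A" "mat_hol n l F A"
  shows "mat_hol n l (\<lambda>x. g x \<cdot>\<^sub>m F x) A"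
proof -
  have "(\<lambda>x. (g x \<cdot>\<^sub>m F x) $$ (r, c)) = (\<lambda>x. g x * F x $$ (r, c))" if "r < n" "c < l" for r c
    using assms(2) that by (intro ext) auto
  then show ?thesis
    using assms by (auto simp: mat_hol_def intro!: holomorphic_intros)
qed

lemma mat_hol_add:
  assumes "mat_hol n l F A" "mat_hol n l G A"
  shows "mat_hol n l (\<lambda>x. F x + G x) A"
proof -
  have "(\<lambda>x. (F x + G x) $$ (r, c)) = (\<lambda>x. F x $$ (r, c) + G x $$ (r, c))" if "r < n" "c < l" for r c
    using assms that by (intro ext) auto
  then show ?thesis
    using assms by (auto simp: mat_hol_def intro!: holomorphic_intros)
qed

lemma mat_hol_compose:
  assumes "mat_hol n l F B" "g holomorphic_on A" "g ` A \<subseteq> B"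
  shows "mat_hol n l (\<lambda>x. F (g x)) A"
  using assms holomorphic_on_compose_gen[OF assms(2), of "\<lambda>x. F x $$ (_, _)" B]
  by (auto simp: mat_hol_def o_def)

lemma mat_deriv_compose:
  assumes "mat_hol n l F B" "open B" "(g has_field_derivative g') (at x)" "g x \<in> B"
  shows "mat_deriv n l (\<lambda>x. F (g x)) x = g' \<cdot>\<^sub>m mat_deriv n l F (g x)"
proof (rule mat_deriv_eqI)
  fix r c assume "r < n" "c < l"
  then show "((\<lambda>x. F (g x) $$ (r, c)) has_field_derivative
      (g' \<cdot>\<^sub>m mat_deriv n l F (g x)) $$ (r, c)) (at x)"
    using DERIV_chain2[OF mat_hol_has_deriv[OF assms(1,2,4)] assms(3), of r c]
    by (simp add: mult_ac)
qed auto

lemma mat_hol_transpose: "mat_hol n l F A \<Longrightarrow> mat_hol l n (\<lambda>x. transpose_mat (F x)) A"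
proof -
  assume F: "mat_hol n l F A"
  then have "(\<lambda>x. transpose_mat (F x) $$ (r, c)) = (\<lambda>x. F x $$ (c, r))" if "r < l" "c < n" for r c
    using that by (intro ext) auto
  then show ?thesis using F by (auto simp: mat_hol_def)
qed

lemma mat_deriv_transpose:
  assumes "mat_hol n l F A"
  shows "mat_deriv l n (\<lambda>x. transpose_mat (F x)) x = transpose_mat (mat_deriv n l F x)"
proof (rule eq_matI)
  fix r c assume "r < dim_row (transpose_mat (mat_deriv n l F x))"
    "c < dim_col (transpose_mat (mat_deriv n l F x))"
  moreover then have "(\<lambda>x. transpose_mat (F x) $$ (r, c)) = (\<lambda>x. F x $$ (c, r))"
    using assms by (intro ext) auto
  ultimately show "mat_deriv l n (\<lambda>x. transpose_mat (F x)) x $$ (r, c) =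
      transpose_mat (mat_deriv n l F x) $$ (r, c)"
    by (simp add: mat_deriv_def)
qed auto

lemma mat_deriv_cong:
  assumes "\<And>y. y \<in> A \<Longrightarrow> F y = G y" "open A" "x \<in> A"
  shows "mat_deriv n l F x = mat_deriv n l G x"
proof -
  have "deriv (\<lambda>y. F y $$ (r, c)) x = deriv (\<lambda>y. G y $$ (r, c)) x" for r c
    by (rule deriv_cong_ev) (use assms in \<open>auto simp: eventually_nhds intro!: exI[of _ A]\<close>)
  then show ?thesis by (simp add: mat_deriv_def)
qed

lemma mat_deriv_zero_const:
  assumes "mat_hol n l F A" "open A" "connected A" "\<And>x. x \<in> A \<Longrightarrow> mat_deriv n l F x = 0\<^sub>m n l"
    and "x \<in> A" "y \<in> A"
  shows "F x = F y"
proof (rule eq_matI)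
  fix r c assume "r < dim_row (F y)" "c < dim_col (F y)"
  with assms(1) have rc: "r < n" "c < l" by auto
  have "((\<lambda>x. F x $$ (r, c)) has_field_derivative 0) (at z)" if "z \<in> A" for z
    using mat_hol_has_deriv[OF assms(1,2) that rc] assms(4)[OF that] rc by simp
  then show "F x $$ (r, c) = F y $$ (r, c)"
    using DERIV_zero_connected_constant[of A "{}" "\<lambda>x. F x $$ (r, c)"] assms rc
      holomorphic_on_imp_continuous_on[OF mat_hol_entry[OF assms(1) rc]]
    by (metis Diff_empty finite.emptyI)
qed (use assms in auto)

text \<open>A sum of matrices weighted by scalars; the values of a connection form are of this kind.\<close>

definition lin_comb :: "nat \<Rightarrow> nat \<Rightarrow> nat set \<Rightarrow> (nat \<Rightarrow> complex) \<Rightarrow> (nat \<Rightarrow> complex mat) \<Rightarrow> complex mat"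
  where "lin_comb n l I c X = mat n l (\<lambda>(r, s). \<Sum>i\<in>I. c i * X i $$ (r, s))"

lemma lin_comb_dim [simp]:
  "dim_row (lin_comb n l I c X) = n" "dim_col (lin_comb n l I c X) = l"
  "lin_comb n l I c X \<in> carrier_mat n l"
  by (auto simp: lin_comb_def)

lemma lin_comb_entry [simp]:
  "r < n \<Longrightarrow> s < l \<Longrightarrow> lin_comb n l I c X $$ (r, s) = (\<Sum>i\<in>I. c i * X i $$ (r, s))"
  by (simp add: lin_comb_def)

lemma lin_comb_cong:
  "(\<And>i. i \<in> I \<Longrightarrow> c i = c' i) \<Longrightarrow> (\<And>i. i \<in> I \<Longrightarrow> X i = X' i) \<Longrightarrow>
    lin_comb n l I c X = lin_comb n l I c' X'"
  by (auto intro!: eq_matI sum.cong)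

lemma lin_comb_mult_right:
  assumes "\<And>i. i \<in> I \<Longrightarrow> X i \<in> carrier_mat n l" "M \<in> carrier_mat l k"
  shows "lin_comb n l I c X * M = lin_comb n k I c (\<lambda>i. X i * M)"
proof (rule eq_matI)
  fix r s assume "r < dim_row (lin_comb n k I c (\<lambda>i. X i * M))"
    "s < dim_col (lin_comb n k I c (\<lambda>i. X i * M))"
  then have rs: "r < n" "s < k" by auto
  have "(lin_comb n l I c X * M) $$ (r, s) = (\<Sum>d<l. (\<Sum>i\<in>I. c i * X i $$ (r, d)) * M $$ (d, s))"
    using rs assms(2) by (subst mult_entry[of _ n l _ k]) auto
  also have "\<dots> = (\<Sum>i\<in>I. c i * (\<Sum>d<l. X i $$ (r, d) * M $$ (d, s)))"
    by (simp only: sum_distrib_left sum_distrib_right, subst sum.swap) (simp add: mult_ac)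
  also have "\<dots> = lin_comb n k I c (\<lambda>i. X i * M) $$ (r, s)"
    using rs assms by (auto intro!: sum.cong simp: mult_entry[of _ n l _ k])
  finally show "(lin_comb n l I c X * M) $$ (r, s) = lin_comb n k I c (\<lambda>i. X i * M) $$ (r, s)" .
qed (use assms in auto)

lemma lin_comb_mult_left:
  assumes "\<And>i. i \<in> I \<Longrightarrow> X i \<in> carrier_mat l k" "M \<in> carrier_mat n l"
  shows "M * lin_comb l k I c X = lin_comb n k I c (\<lambda>i. M * X i)"
proof (rule eq_matI)
  fix r s assume "r < dim_row (lin_comb n k I c (\<lambda>i. M * X i))"
    "s < dim_col (lin_comb n k I c (\<lambda>i. M * X i))"
  then have rs: "r < n" "s < k" by auto
  have "(M * lin_comb l k I c X) $$ (r, s) = (\<Sum>d<l. M $$ (r, d) * (\<Sum>i\<in>I. c i * X i $$ (d, s)))"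
    using rs assms(2) by (subst mult_entry[of _ n l _ k]) auto
  also have "\<dots> = (\<Sum>i\<in>I. c i * (\<Sum>d<l. M $$ (r, d) * X i $$ (d, s)))"
    by (simp only: sum_distrib_left, subst sum.swap) (simp add: mult_ac)
  also have "\<dots> = lin_comb n k I c (\<lambda>i. M * X i) $$ (r, s)"
    using rs assms by (auto intro!: sum.cong simp: mult_entry[of _ n l _ k])
  finally show "(M * lin_comb l k I c X) $$ (r, s) = lin_comb n k I c (\<lambda>i. M * X i) $$ (r, s)" .
qed (use assms in auto)

lemma lin_comb_reindex:
  assumes "bij_betw \<pi> I J"
  shows "lin_comb n l J c X = lin_comb n l I (\<lambda>i. c (\<pi> i)) (\<lambda>i. X (\<pi> i))"
  by (auto intro!: eq_matI simp: sum.reindex_bij_betw[OF assms, symmetric])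

lemma lin_comb_smult: "a \<cdot>\<^sub>m lin_comb n l I c X = lin_comb n l I (\<lambda>i. a * c i) X"
  by (auto intro!: eq_matI simp: sum_distrib_left mult_ac)

lemma mat_hol_lin_comb:
  assumes "\<And>i. i \<in> I \<Longrightarrow> (\<lambda>x. c x i) holomorphic_on A"
  shows "mat_hol n l (\<lambda>x. lin_comb n l I (c x) X) A"
  using assms by (auto simp: mat_hol_def intro!: holomorphic_intros)

lemma connection_lin_comb:
  "connection m n \<kappa> X z u = lin_comb n n {..<m} (\<lambda>i. \<kappa> * omega m i z u) X"
  by (auto intro!: eq_matI simp: connection_def sum_distrib_left mult_ac)

section \<open>Linear differential equations with a regular singular point\<close>

definition mat_size :: "nat \<Rightarrow> complex mat \<Rightarrow> real"
  where "mat_size n M = (\<Sum>r<n. \<Sum>c<n. cmod (M $$ (r, c)))"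

lemma mat_size_nonneg: "0 \<le> mat_size n M"
  by (auto simp: mat_size_def intro!: sum_nonneg)

lemma entry_le_mat_size: "r < n \<Longrightarrow> c < n \<Longrightarrow> cmod (M $$ (r, c)) \<le> mat_size n M"
  unfolding mat_size_def
  by (rule order_trans[OF member_le_sum[of c "{..<n}" "\<lambda>c. cmod (M $$ (r, c))"]
        member_le_sum[of r "{..<n}" "\<lambda>r. \<Sum>c<n. cmod (M $$ (r, c))"]])
    (auto intro!: sum_nonneg)

lemma mat_size_mult:
  assumes "A \<in> carrier_mat n n" "B \<in> carrier_mat n n"
  shows "mat_size n (A * B) \<le> mat_size n A * mat_size n B"
proof -
  have "mat_size n (A * B) \<le> (\<Sum>r<n. \<Sum>c<n. \<Sum>d<n. cmod (A $$ (r, d)) * cmod (B $$ (d, c)))"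
    unfolding mat_size_def
    by (intro sum_mono) (auto simp: mult_entry[OF assms] norm_mult[symmetric] intro!: norm_sum)
  also have "\<dots> = (\<Sum>r<n. \<Sum>d<n. cmod (A $$ (r, d)) * (\<Sum>c<n. cmod (B $$ (d, c))))"
    unfolding sum_distrib_left by (intro sum.cong refl sum.swap)
  also have "\<dots> \<le> (\<Sum>r<n. \<Sum>d<n. cmod (A $$ (r, d)) * mat_size n B)"
  proof (intro sum_mono mult_left_mono)
    fix d assume "d \<in> {..<n}"
    then show "(\<Sum>c<n. cmod (B $$ (d, c))) \<le> mat_size n B"
      unfolding mat_size_def
      by (intro member_le_sum[of d "{..<n}" "\<lambda>d. \<Sum>c<n. cmod (B $$ (d, c))"])
        (auto intro!: sum_nonneg)
  qed auto
  also have "\<dots> = mat_size n A * mat_size n B"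
    by (simp add: mat_size_def sum_distrib_right)
  finally show ?thesis .
qed

lemma mat_size_add: "A \<in> carrier_mat n n \<Longrightarrow> B \<in> carrier_mat n n \<Longrightarrow>
    mat_size n (A + B) \<le> mat_size n A + mat_size n B"
  by (auto simp: mat_size_def sum.distrib[symmetric] intro!: sum_mono norm_triangle_ineq)

lemma mat_size_diff: "A \<in> carrier_mat n n \<Longrightarrow> B \<in> carrier_mat n n \<Longrightarrow>
    mat_size n (A - B) \<le> mat_size n A + mat_size n B"
  by (auto simp: mat_size_def sum.distrib[symmetric] intro!: sum_mono norm_triangle_ineq4)

lemma mat_size_smult: "A \<in> carrier_mat n n \<Longrightarrow> mat_size n (c \<cdot>\<^sub>m A) = cmod c * mat_size n A"
  by (auto simp: mat_size_def sum_distrib_left norm_mult)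

lemma mat_size_lin_comb:
  "finite I \<Longrightarrow> mat_size n (lin_comb n n I (\<lambda>_. 1) X) \<le> (\<Sum>i\<in>I. mat_size n (X i))"
proof -
  assume "finite I"
  have "mat_size n (lin_comb n n I (\<lambda>_. 1) X) \<le> (\<Sum>r<n. \<Sum>c<n. \<Sum>i\<in>I. cmod (X i $$ (r, c)))"
    unfolding mat_size_def by (intro sum_mono) (auto intro!: norm_sum)
  also have "\<dots> = (\<Sum>i\<in>I. mat_size n (X i))"
    unfolding mat_size_def by (simp add: sum.swap[of _ I])
  finally show ?thesis .
qed

text \<open>As soon as \<open>x > A + s C / (1 - t)\<close>, the recursion and the geometric series bound \<open>g x\<close> by any
  common bound of the preceding values.\<close>

lemma majorant_bounded:
  fixes g b :: "nat \<Rightarrow> real"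
  assumes g: "\<And>x. 0 \<le> g x" and A: "0 \<le> A" and s: "0 \<le> s" and t: "0 < t" "t < 1"
    and b: "\<And>l. 0 \<le> b l" "\<And>l. b l \<le> C * t ^ l"
    and rec: "\<And>x. x \<ge> 1 \<Longrightarrow> real x * g x \<le> A * g x + s * (\<Sum>l<x. b (x - 1 - l) * g l)"
  shows "\<exists>K. \<forall>x. g x \<le> K"
proof -
  have C: "0 \<le> C" using b[of 0] by simp
  define N where "N = nat \<lceil>A + s * C / (1 - t)\<rceil> + 1"
  define K where "K = (\<Sum>l<N. g l)"
  have K: "0 \<le> K" by (simp add: K_def g sum_nonneg)
  have "g x \<le> K" for x
  proof (induction x rule: less_induct)
    case (less x)
    show ?case
    proof (cases "x < N")
      case True
      then show ?thesis unfolding K_def by (intro member_le_sum) (auto simp: g)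
    next
      case False
      then have x: "x \<ge> 1" "real x \<ge> A + s * C / (1 - t) + (1::real) - 1"
        by (auto simp: N_def) linarith
      have Nx: "real x > A + s * C / (1 - t)"
        using False by (simp add: N_def not_less) linarith
      have "(\<Sum>l<x. b (x - 1 - l) * g l) \<le> (\<Sum>l<x. (C * t ^ (x - 1 - l)) * K)"
        using less b C K g t by (intro sum_mono mult_mono) auto
      also have "\<dots> = C * K * (\<Sum>l<x. t ^ (x - Suc l))"
        by (simp add: sum_distrib_left mult_ac)
      also have "(\<Sum>l<x. t ^ (x - Suc l)) = (\<Sum>l<x. t ^ l)"
        by (rule sum.nat_diff_reindex)
      also have "\<dots> \<le> 1 / (1 - t)"
        using t by (simp add: sum_gp_strict divide_right_mono)
      finally have sum_le: "(\<Sum>l<x. b (x - 1 - l) * g l) \<le> C * K * (1 / (1 - t))"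
        using C K by (simp add: mult_left_mono)
      have "(real x - A) * g x \<le> s * (C * K * (1 / (1 - t)))"
        using rec[OF x(1)] mult_left_mono[OF sum_le s] by (simp add: algebra_simps)
      also have "\<dots> = (s * C / (1 - t)) * K" by simp
      also have "\<dots> \<le> (real x - A) * K"
        using Nx K by (intro mult_right_mono) auto
      finally show ?thesis
        using Nx A s C t
        by (smt (verit, best) divide_nonneg_pos mult_le_cancel_left mult_nonneg_nonneg)
    qed
  qed
  then show ?thesis by blast
qed

text \<open>The operator \<open>r - ad X\<close> is onto for all \<open>r \<ge> 1\<close>, so that the recursion for the Taylor coefficients
  of a gauge transformation can be solved.\<close>

definition nonresonant :: "nat \<Rightarrow> complex mat \<Rightarrow> bool"
  where "nonresonant n X \<longleftrightarrow>
    (\<forall>r\<ge>1. \<forall>N\<in>carrier_mat n n. \<exists>M\<in>carrier_mat n n. of_nat r \<cdot>\<^sub>m M - (X * M - M * X) = N)"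

lemma frobenius_coefficients:
  assumes X: "X \<in> carrier_mat n n" and nonres: "nonresonant n X"
    and B: "\<And>l. B l \<in> carrier_mat n n"
  obtains H where "\<And>x. H x \<in> carrier_mat n n" "H 0 = 1\<^sub>m n"
    "\<And>x. x \<ge> 1 \<Longrightarrow> of_nat x \<cdot>\<^sub>m H x - (X * H x - H x * X) =
      lin_comb n n {..<x} (\<lambda>_. 1) (\<lambda>l. B (x - 1 - l) * H l)"
proof -
  define P where "P H x M \<longleftrightarrow> M \<in> carrier_mat n n \<and> (if x = 0 then M = 1\<^sub>m n else
    of_nat x \<cdot>\<^sub>m M - (X * M - M * X) = lin_comb n n {..<x} (\<lambda>_. 1) (\<lambda>l. B (x - 1 - l) * H l))"
    for H :: "nat \<Rightarrow> complex mat" and x :: nat and M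
  have "\<exists>H. \<forall>x. P H x (H x)"
  proof (rule dependent_wellorder_choice)
    fix r :: "complex mat" and f g :: "nat \<Rightarrow> complex mat" and x :: nat assume "\<And>y. y < x \<Longrightarrow> f y = g y"
    then have "lin_comb n n {..<x} (\<lambda>_. 1) (\<lambda>l. B (x - 1 - l) * f l) =
        lin_comb n n {..<x} (\<lambda>_. 1) (\<lambda>l. B (x - 1 - l) * g l)"
      by (intro lin_comb_cong) auto
    then show "P f x r = P g x r" by (simp add: P_def)
  next
    fix x :: nat and f
    show "\<exists>r. P f x r"
    proof (cases "x = 0")
      case False
      then have "\<exists>M\<in>carrier_mat n n. of_nat x \<cdot>\<^sub>m M - (X * M - M * X) =
          lin_comb n n {..<x} (\<lambda>_. 1) (\<lambda>l. B (x - 1 - l) * f l)"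
        using nonres unfolding nonresonant_def by auto
      then show ?thesis using False by (auto simp: P_def)
    qed (auto simp: P_def)
  qed
  then obtain H where H: "\<And>x. P H x (H x)" by blast
  show thesis
  proof (rule that)
    show "H x \<in> carrier_mat n n" for x using H[of x] by (simp add: P_def)
    show "H 0 = 1\<^sub>m n" using H[of 0] by (simp add: P_def)
    show "of_nat x \<cdot>\<^sub>m H x - (X * H x - H x * X) =
      lin_comb n n {..<x} (\<lambda>_. 1) (\<lambda>l. B (x - 1 - l) * H l)" if "x \<ge> 1" for x
      using H[of x] that by (simp add: P_def)
  qed
qed

lemma frobenius_bound:
  assumes X: "X \<in> carrier_mat n n" and B: "\<And>l. B l \<in> carrier_mat n n"
    and H: "\<And>x. H x \<in> carrier_mat n n"
    and rec: "\<And>x. x \<ge> 1 \<Longrightarrow> of_nat x \<cdot>\<^sub>m H x - (X * H x - H x * X) =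
      lin_comb n n {..<x} (\<lambda>_. 1) (\<lambda>l. B (x - 1 - l) * H l)"
    and \<sigma>: "0 < \<sigma>" "\<sigma> < \<rho>" and bnd: "\<And>l. mat_size n (B l) * \<rho> ^ l \<le> C"
  shows "\<exists>K. \<forall>x. mat_size n (H x) * \<sigma> ^ x \<le> K"
proof (rule majorant_bounded)
  show "0 \<le> mat_size n (H x) * \<sigma> ^ x" for x
    using \<sigma> by (simp add: mat_size_nonneg)
  show "0 \<le> 2 * mat_size n X" by (simp add: mat_size_nonneg)
  show "0 < \<sigma> / \<rho>" "\<sigma> / \<rho> < 1" "0 \<le> \<sigma>" using \<sigma> by auto
  show "0 \<le> mat_size n (B l) * \<sigma> ^ l" for l using \<sigma> by (simp add: mat_size_nonneg)
  show "mat_size n (B l) * \<sigma> ^ l \<le> C * (\<sigma> / \<rho>) ^ l" for l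
  proof -
    have "mat_size n (B l) * \<sigma> ^ l = (mat_size n (B l) * \<rho> ^ l) * (\<sigma> / \<rho>) ^ l"
      using \<sigma> by (simp add: power_divide)
    also have "\<dots> \<le> C * (\<sigma> / \<rho>) ^ l"
      using \<sigma> bnd by (intro mult_right_mono) auto
    finally show ?thesis .
  qed
  fix x :: nat assume x: "x \<ge> 1"
  let ?L = "lin_comb n n {..<x} (\<lambda>_. 1) (\<lambda>l. B (x - 1 - l) * H l)"
  have "of_nat x \<cdot>\<^sub>m H x = ?L + (X * H x - H x * X)"
    unfolding rec[OF x, symmetric] using X H[of x] by (intro eq_matI) auto
  then have "real x * mat_size n (H x) = mat_size n (?L + (X * H x - H x * X))"
    using H[of x] by (metis mat_size_smult norm_of_nat)
  also have "\<dots> \<le> mat_size n ?L + mat_size n (X * H x - H x * X)"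
    using X H[of x] by (intro mat_size_add) auto
  also have "mat_size n (X * H x - H x * X) \<le> mat_size n (X * H x) + mat_size n (H x * X)"
    using X H[of x] by (intro mat_size_diff) auto
  also have "\<dots> \<le> 2 * mat_size n X * mat_size n (H x)"
    using mat_size_mult[OF X H[of x]] mat_size_mult[OF H[of x] X] by (simp add: mult_ac)
  also have "mat_size n ?L \<le> (\<Sum>l<x. mat_size n (B (x - 1 - l)) * mat_size n (H l))"
    using B H by (intro order_trans[OF mat_size_lin_comb] sum_mono mat_size_mult) auto
  finally have "real x * mat_size n (H x) \<le> (\<Sum>l<x. mat_size n (B (x - 1 - l)) * mat_size n (H l)) +
      2 * mat_size n X * mat_size n (H x)" by simp
  then have "(real x * mat_size n (H x)) * \<sigma> ^ x \<le> ((\<Sum>l<x. mat_size n (B (x - 1 - l)) * mat_size n (H l)) +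
      2 * mat_size n X * mat_size n (H x)) * \<sigma> ^ x"
    using \<sigma> by (intro mult_right_mono) auto
  also have "\<dots> = 2 * mat_size n X * (mat_size n (H x) * \<sigma> ^ x) +
      (\<Sum>l<x. mat_size n (B (x - 1 - l)) * mat_size n (H l)) * \<sigma> ^ x"
    by (simp add: algebra_simps)
  also have "(\<Sum>l<x. mat_size n (B (x - 1 - l)) * mat_size n (H l)) * \<sigma> ^ x =
      \<sigma> * (\<Sum>l<x. (mat_size n (B (x - 1 - l)) * \<sigma> ^ (x - 1 - l)) * (mat_size n (H l) * \<sigma> ^ l))"
    unfolding sum_distrib_left sum_distrib_right
  proof (intro sum.cong refl)
    fix l assume "l \<in> {..<x}"
    then have "x = Suc ((x - 1 - l) + l)" by auto
    then have "\<sigma> ^ x = \<sigma> * \<sigma> ^ (x - 1 - l) * \<sigma> ^ l" by (metis power_Suc power_add mult.assoc)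
    then show "mat_size n (B (x - 1 - l)) * mat_size n (H l) * \<sigma> ^ x =
        \<sigma> * (mat_size n (B (x - 1 - l)) * \<sigma> ^ (x - 1 - l) * (mat_size n (H l) * \<sigma> ^ l))"
      by simp
  qed
  finally show "real x * (mat_size n (H x) * \<sigma> ^ x) \<le> 2 * mat_size n X * (mat_size n (H x) * \<sigma> ^ x) +
      \<sigma> * (\<Sum>l<x. mat_size n (B (x - 1 - l)) * \<sigma> ^ (x - 1 - l) * (mat_size n (H l) * \<sigma> ^ l))"
    by (simp add: mult_ac)
qed

lemma coefficient_bound:
  assumes "fps_conv_radius f > ereal \<rho>" "\<rho> \<ge> 0"
  shows "\<exists>C. \<forall>l. cmod (fps_nth f l) * \<rho> ^ l \<le> C"
proof -
  have "summable (\<lambda>l. norm (fps_nth f l * of_real \<rho> ^ l))"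
    using assms by (intro norm_summable_fps) auto
  then have "Bseq (\<lambda>l. norm (fps_nth f l * of_real \<rho> ^ l))"
    by (rule convergent_imp_Bseq[OF convergentI, OF summable_LIMSEQ_zero])
  then show ?thesis using assms(2) by (auto simp: Bseq_def norm_mult norm_power)
qed

text \<open>Near a regular singular point without resonance, the equation can be brought to the constant
  form \<open>x F' = X F\<close> by a holomorphic gauge transformation \<open>H\<close>: its Taylor coefficients are
  determined one after the other, and the estimate of the coefficients shows that the series
  converges in the whole disc in which the regular part \<open>B\<close> is holomorphic.\<close>

theorem frobenius_exists:
  assumes X: "X \<in> carrier_mat n n" and nonres: "nonresonant n X" and R: "0 < R"
    and B: "mat_hol n n B (eball 0 R)"
  obtains H where "mat_hol n n H (eball 0 R)" "H 0 = 1\<^sub>m n"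
    "\<And>x. x \<in> eball 0 R \<Longrightarrow> x \<cdot>\<^sub>m mat_deriv n n H x = X * H x - H x * X + x \<cdot>\<^sub>m (B x * H x)"
proof -
  define b where "b a d = fps_expansion (\<lambda>x. B x $$ (a, d)) 0" for a d
  have b_rad: "fps_conv_radius (b a d) \<ge> R" if "a < n" "d < n" for a d
    unfolding b_def using mat_hol_entry[OF B that] by (rule conv_radius_fps_expansion)
  have b_exp: "(\<lambda>x. B x $$ (a, d)) has_fps_expansion b a d" if "a < n" "d < n" for a d
    unfolding b_def using mat_hol_entry[OF B that] R
    by (intro has_fps_expansion_fps_expansion[of "eball 0 R"]) (auto simp: zero_ereal_def)
  define Bc where "Bc l = mat n n (\<lambda>(a, d). fps_nth (b a d) l)" for l
  have Bc: "Bc l \<in> carrier_mat n n" for l by (auto simp: Bc_def)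
  obtain Hc where Hc: "\<And>x. Hc x \<in> carrier_mat n n" "Hc 0 = 1\<^sub>m n" and
    rec: "\<And>x. x \<ge> 1 \<Longrightarrow> of_nat x \<cdot>\<^sub>m Hc x - (X * Hc x - Hc x * X) =
      lin_comb n n {..<x} (\<lambda>_. 1) (\<lambda>l. Bc (x - 1 - l) * Hc l)"
    by (rule frobenius_coefficients[where B = Bc, OF X nonres Bc]) blast
  define h where "h a c = Abs_fps (\<lambda>x. Hc x $$ (a, c))" for a c
  have h_rad: "fps_conv_radius (h a c) \<ge> R" if ac: "a < n" "c < n" for a c
    unfolding fps_conv_radius_def
  proof (rule conv_radius_geI_ex')
    fix r assume r: "0 < r" "ereal r < R"
    obtain \<rho> where \<rho>: "r < \<rho>" "ereal \<rho> < R" using ereal_dense2[OF r(2)] by auto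
    define \<sigma> where "\<sigma> = (r + \<rho>) / 2"
    have \<sigma>: "0 < \<sigma>" "r < \<sigma>" "\<sigma> < \<rho>" using r \<rho> by (auto simp: \<sigma>_def)
    have "\<exists>C. \<forall>l. cmod (fps_nth (b a d) l) * \<rho> ^ l \<le> C" if "a < n" "d < n" for a d
      using b_rad[OF that] \<rho> r by (intro coefficient_bound) (auto intro: less_le_trans)
    then obtain C where C: "\<And>a d l. a < n \<Longrightarrow> d < n \<Longrightarrow> cmod (fps_nth (b a d) l) * \<rho> ^ l \<le> C a d"
      by metis
    have "\<exists>K. \<forall>x. mat_size n (Hc x) * \<sigma> ^ x \<le> K"
    proof (rule frobenius_bound[OF X Bc Hc(1) rec \<sigma>(1,3)])
      show "mat_size n (Bc l) * \<rho> ^ l \<le> (\<Sum>a<n. \<Sum>d<n. C a d)" for l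
        unfolding mat_size_def sum_distrib_right
        by (intro sum_mono) (use C in \<open>auto simp: Bc_def\<close>)
    qed
    then obtain K where K: "\<And>x. mat_size n (Hc x) * \<sigma> ^ x \<le> K" by blast
    show "summable (\<lambda>x. fps_nth (h a c) x * of_real r ^ x)"
    proof (rule summable_comparison_test)
      show "summable (\<lambda>x. K * (r / \<sigma>) ^ x)"
        using r \<sigma> by (intro summable_mult summable_geometric) auto
      have "cmod (Hc x $$ (a, c)) * r ^ x \<le> K * (r / \<sigma>) ^ x" for x
      proof -
        have "cmod (Hc x $$ (a, c)) * r ^ x \<le> mat_size n (Hc x) * r ^ x"
          using r entry_le_mat_size[OF ac] by (intro mult_right_mono) auto
        also have "\<dots> = (mat_size n (Hc x) * \<sigma> ^ x) * (r / \<sigma>) ^ x"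
          using \<sigma> by (simp add: power_divide)
        also have "\<dots> \<le> K * (r / \<sigma>) ^ x"
          using K r \<sigma> by (intro mult_right_mono) auto
        finally show ?thesis .
      qed
      then show "\<exists>N. \<forall>x\<ge>N. norm (fps_nth (h a c) x * of_real r ^ x) \<le> K * (r / \<sigma>) ^ x"
        using r by (auto simp: h_def norm_mult norm_power)
    qed
  qed
  define H where "H x = mat n n (\<lambda>(a, c). eval_fps (h a c) x)" for x
  have H: "mat_hol n n H (eball 0 R)"
    unfolding mat_hol_def
  proof safe
    fix a c assume ac: "a < n" "c < n"
    have "eval_fps (h a c) holomorphic_on eball 0 R"
      by (intro holomorphic_on_eval_fps eball_mono h_rad ac)
    then show "(\<lambda>x. H x $$ (a, c)) holomorphic_on eball 0 R" using ac by (simp add: H_def)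
  qed (auto simp: H_def)
  have h_exp: "(\<lambda>x. H x $$ (a, c)) has_fps_expansion h a c" if "a < n" "c < n" for a c
    using eval_fps_has_fps_expansion[of "h a c"] h_rad[OF that] that R by (simp add: H_def)
  show thesis
  proof (rule that[OF H])
    show "H 0 = 1\<^sub>m n"
      by (rule eq_matI) (auto simp: H_def eval_fps_at_0 h_def Hc)
    fix x :: complex assume x: "x \<in> eball 0 R"
    show "x \<cdot>\<^sub>m mat_deriv n n H x = X * H x - H x * X + x \<cdot>\<^sub>m (B x * H x)"
    proof (rule eq_matI)
      fix a c assume "a < dim_row (X * H x - H x * X + x \<cdot>\<^sub>m (B x * H x))"
        "c < dim_col (X * H x - H x * X + x \<cdot>\<^sub>m (B x * H x))"
      then have ac: "a < n" "c < n" using B H by auto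
      define f where "f y = y * deriv (\<lambda>y. H y $$ (a, c)) y - ((\<Sum>d<n. X $$ (a, d) * H y $$ (d, c)) -
        (\<Sum>d<n. H y $$ (a, d) * X $$ (d, c)) + y * (\<Sum>d<n. H y $$ (d, c) * B y $$ (a, d)))" for y
      define F where "F = fps_X * fps_deriv (h a c) - ((\<Sum>d<n. fps_const (X $$ (a, d)) * h d c) -
        (\<Sum>d<n. h a d * fps_const (X $$ (d, c))) + fps_X * (\<Sum>d<n. h d c * b a d))"
      have "f has_fps_expansion F"
        unfolding f_def F_def using ac
        by (intro fps_expansion_intros h_exp b_exp) auto
      moreover have "F = 0"
      proof (rule fps_ext)
        fix x
        show "fps_nth F x = fps_nth 0 x"
        proof (cases "x = 0")
          case True
          then show ?thesis using ac X
            by (simp add: F_def fps_sum_nth h_def Hc one_mat_def if_distrib if_distribR sum.delta cong: if_cong)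
        next
          case False
          then have x: "x \<ge> 1" by simp
          have "(of_nat x \<cdot>\<^sub>m Hc x - (X * Hc x - Hc x * X)) $$ (a, c) =
            of_nat x * Hc x $$ (a, c) - ((\<Sum>d<n. X $$ (a, d) * Hc x $$ (d, c)) -
              (\<Sum>d<n. Hc x $$ (a, d) * X $$ (d, c)))"
            using ac X Hc(1)[of x] by (simp add: mult_entry[of _ n n _ n] del: index_mult_mat(1))
          moreover have "lin_comb n n {..<x} (\<lambda>_. 1) (\<lambda>l. Bc (x - 1 - l) * Hc l) $$ (a, c) =
            (\<Sum>d<n. \<Sum>l=0..x - 1. Hc l $$ (d, c) * fps_nth (b a d) (x - 1 - l))"
          proof -
            have "lin_comb n n {..<x} (\<lambda>_. 1) (\<lambda>l. Bc (x - 1 - l) * Hc l) $$ (a, c) =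
              (\<Sum>l<x. \<Sum>d<n. Hc l $$ (d, c) * fps_nth (b a d) (x - 1 - l))"
            proof -
              have "(Bc j * Hc l) $$ (a, c) = (\<Sum>d<n. Hc l $$ (d, c) * fps_nth (b a d) j)" for j l
                unfolding mult_entry[OF Bc Hc(1) ac] using ac by (simp add: Bc_def mult_ac)
              then show ?thesis using ac by (simp del: index_mult_mat(1))
            qed
            also have "\<dots> = (\<Sum>l=0..x - 1. \<Sum>d<n. Hc l $$ (d, c) * fps_nth (b a d) (x - 1 - l))"
              using x by (intro sum.cong) auto
            finally show ?thesis by (simp only: sum.swap[of _ "{..<n}"])
          qed
          moreover have "fps_nth F x = of_nat x * Hc x $$ (a, c) - ((\<Sum>d<n. X $$ (a, d) * Hc x $$ (d, c)) -
              (\<Sum>d<n. Hc x $$ (a, d) * X $$ (d, c)) + (\<Sum>d<n. fps_nth (h d c * b a d) (x - 1)))"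
            using x by (simp add: F_def fps_sum_nth h_def)
          moreover have "fps_nth (h d c * b a d) (x - 1) =
              (\<Sum>l=0..x - 1. Hc l $$ (d, c) * fps_nth (b a d) (x - 1 - l))" for d
            by (simp only: fps_mult_nth) (simp add: h_def)
          ultimately show ?thesis
            using rec[OF x] x by (simp add: algebra_simps)
        qed
      qed
      ultimately have "f x = 0"
      proof (intro has_fps_expansion_0_analytic_continuation[of f "eball 0 R" x])
        show "f holomorphic_on eball 0 R"
          unfolding f_def using ac
          by (intro holomorphic_intros mat_hol_entry[OF H] mat_hol_entry[OF B]) auto
      qed (use x R in \<open>auto simp: zero_ereal_def\<close>)
      then show "(x \<cdot>\<^sub>m mat_deriv n n H x) $$ (a, c) =
          (X * H x - H x * X + x \<cdot>\<^sub>m (B x * H x)) $$ (a, c)"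
        using ac X mat_hol_carrier[OF H, of x] mat_hol_carrier[OF B, of x]
        by (simp add: f_def mult_entry[of _ n n _ n] mat_deriv_def mult.commute[of "H x $$ _" "B x $$ _"]
            del: index_mult_mat(1))
    qed (use B H in auto)
  qed
qed

text \<open>The Taylor coefficient \<open>M\<close> of order \<open>r\<close> of a solution satisfies \<open>r M = X M - M X'\<close>.\<close>

lemma frobenius_zero:
  assumes X: "X \<in> carrier_mat n n" and X': "X' \<in> carrier_mat l l" and R: "0 < R"
    and inj: "\<And>r M. r \<ge> 1 \<Longrightarrow> M \<in> carrier_mat n l \<Longrightarrow> of_nat r \<cdot>\<^sub>m M = X * M - M * X' \<Longrightarrow> M = 0\<^sub>m n l"
    and Z: "mat_hol n l Z (eball 0 R)" "Z 0 = 0\<^sub>m n l"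
    and eq: "\<And>x. x \<in> eball 0 R \<Longrightarrow> x \<cdot>\<^sub>m mat_deriv n l Z x = X * Z x - Z x * X'"
    and x: "x \<in> eball 0 R"
  shows "Z x = 0\<^sub>m n l"
proof -
  define z where "z a c = fps_expansion (\<lambda>x. Z x $$ (a, c)) 0" for a c
  have z_exp: "(\<lambda>x. Z x $$ (a, c)) has_fps_expansion z a c" if "a < n" "c < l" for a c
    unfolding z_def using mat_hol_entry[OF Z(1) that] R
    by (intro has_fps_expansion_fps_expansion[of "eball 0 R"]) (auto simp: zero_ereal_def)
  define Zc where "Zc r = mat n l (\<lambda>(a, c). fps_nth (z a c) r)" for r
  have "Zc r = 0\<^sub>m n l" for r
  proof (cases "r = 0")
    case True
    have "fps_nth (z a c) 0 = 0" if "a < n" "c < l" for a c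
      using fps_nth_fps_expansion[OF z_exp[OF that], of 0] Z(2) that by simp
    with True show ?thesis by (auto simp: Zc_def intro!: eq_matI)
  next
    case False
    have "of_nat r \<cdot>\<^sub>m Zc r = X * Zc r - Zc r * X'"
    proof (rule eq_matI)
      fix a c assume "a < dim_row (X * Zc r - Zc r * X')" "c < dim_col (X * Zc r - Zc r * X')"
      then have ac: "a < n" "c < l" using X' by (auto simp: Zc_def)
      have "(\<lambda>y. y * deriv (\<lambda>y. Z y $$ (a, c)) y - ((\<Sum>d<n. X $$ (a, d) * Z y $$ (d, c)) -
        (\<Sum>d<l. Z y $$ (a, d) * X' $$ (d, c)))) has_fps_expansion
        (fps_X * fps_deriv (z a c) - ((\<Sum>d<n. fps_const (X $$ (a, d)) * z d c) -
        (\<Sum>d<l. z a d * fps_const (X' $$ (d, c)))))" (is "?f has_fps_expansion ?F")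
        using ac by (intro fps_expansion_intros z_exp) auto
      moreover have "?f has_fps_expansion 0"
        unfolding has_fps_expansion_0_iff eventually_nhds
      proof (intro exI[of _ "eball 0 R"] conjI ballI)
        fix y :: complex assume y: "y \<in> eball 0 R"
        show "?f y = 0"
          using arg_cong[OF eq[OF y], of "\<lambda>M. M $$ (a, c)"] ac X X' mat_hol_carrier[OF Z(1), of y]
          by (simp add: mult_entry[of _ n n _ l] mult_entry[of _ n l _ l] mat_deriv_def
              del: index_mult_mat(1))
      qed (use R in \<open>auto simp: zero_ereal_def\<close>)
      ultimately have "?F = 0" by (rule fps_expansion_unique_complex)
      then have "fps_nth ?F r = 0" by simp
      then show "(of_nat r \<cdot>\<^sub>m Zc r) $$ (a, c) = (X * Zc r - Zc r * X') $$ (a, c)"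
        using ac False X X'
        by (simp add: mult_entry[of _ n n _ l] mult_entry[of _ n l _ l] Zc_def fps_sum_nth
            del: index_mult_mat(1))
    qed (use X X' in \<open>auto simp: Zc_def\<close>)
    then show ?thesis using False by (intro inj[of r]) (auto simp: Zc_def)
  qed
  then have "Zc r $$ (a, c) = 0" if "a < n" "c < l" for a c r
    using that by simp
  then have "fps_nth (z a c) r = 0" if "a < n" "c < l" for a c r
    using that by (simp add: Zc_def)
  then have "z a c = 0" if "a < n" "c < l" for a c using that by (intro fps_ext) auto
  then have "Z x $$ (a, c) = 0" if "a < n" "c < l" for a c
    using z_exp[OF that] that x R
    by (intro has_fps_expansion_0_analytic_continuation[OF _ mat_hol_entry[OF Z(1) that]])
      (auto simp: zero_ereal_def)
  then show ?thesis using mat_hol_carrier[OF Z(1), of x] by (intro eq_matI) auto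
qed

lemma mat_add_zero [simp]:
  fixes A :: "complex mat"
  shows "dim_row A = n \<Longrightarrow> dim_col A = l \<Longrightarrow> A + 0\<^sub>m n l = A"
    and "dim_row A = n \<Longrightarrow> dim_col A = l \<Longrightarrow> 0\<^sub>m n l + A = A"
  by auto

lemma mat_hol_add_const:
  assumes "mat_hol n l F A" "C \<in> carrier_mat n l"
  shows "mat_hol n l (\<lambda>x. F x + C) A" "mat_deriv n l (\<lambda>x. F x + C) x = mat_deriv n l F x"
proof -
  have *: "(\<lambda>y. (F y + C) $$ (r, c)) = (\<lambda>y. F y $$ (r, c) + C $$ (r, c))" if "r < n" "c < l" for r c
    using assms that by (intro ext) auto
  show "mat_hol n l (\<lambda>x. F x + C) A" using assms by (intro mat_hol_add mat_hol_const)
  have "deriv (\<lambda>y. F y $$ (r, c) + C $$ (r, c)) x = deriv (\<lambda>y. F y $$ (r, c)) x" for r c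
    by (simp add: deriv_def has_field_derivative_def has_derivative_add_const)
      (simp add: has_derivative_def algebra_simps)
  then show "mat_deriv n l (\<lambda>x. F x + C) x = mat_deriv n l F x"
    using * by (auto simp: mat_deriv_def intro!: eq_matI)
qed

text \<open>The dual condition, injectivity, is what uniqueness needs. It involves two residues, which act on
  the source and the target of an intertwining matrix.\<close>

definition no_resonance :: "nat \<Rightarrow> nat \<Rightarrow> complex mat \<Rightarrow> complex mat \<Rightarrow> bool"
  where "no_resonance n l X X' \<longleftrightarrow>
    (\<forall>r\<ge>1. \<forall>M\<in>carrier_mat n l. of_nat r \<cdot>\<^sub>m M = X * M - M * X' \<longrightarrow> M = 0\<^sub>m n l)"

lemma frobenius_const:
  assumes X: "X \<in> carrier_mat n n" and X': "X' \<in> carrier_mat l l" and R: "0 < R"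
    and inj: "no_resonance n l X X'"
    and Z: "mat_hol n l Z (eball 0 R)" and comm: "X * Z 0 = Z 0 * X'"
    and eq: "\<And>x. x \<in> eball 0 R \<Longrightarrow> x \<cdot>\<^sub>m mat_deriv n l Z x = X * Z x - Z x * X'"
    and x: "x \<in> eball 0 R"
  shows "Z x = Z 0"
proof -
  note Z0 = mat_hol_carrier[OF Z, of 0]
  define W where "W = (\<lambda>x. Z x + (- Z 0))"
  have W: "mat_hol n l W (eball 0 R)" "\<And>x. mat_deriv n l W x = mat_deriv n l Z x"
    unfolding W_def using mat_hol_add_const[OF Z, of "- Z 0"] Z0 by auto
  have "W x = 0\<^sub>m n l"
  proof (rule frobenius_zero[OF X X' R _ W(1) _ _ x])
    show "M = 0\<^sub>m n l" if "r \<ge> 1" "M \<in> carrier_mat n l" "of_nat r \<cdot>\<^sub>m M = X * M - M * X'" for r M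
      using inj that by (auto simp: no_resonance_def)
    show "W 0 = 0\<^sub>m n l" using Z0 by (auto simp: W_def)
    fix y :: complex assume y: "y \<in> eball 0 R"
    have "X * W y - W y * X' = (X * Z y - Z y * X') - (X * Z 0 - Z 0 * X')"
      using X X' Z mat_hol_carrier[OF Z, of y] Z0
      by (intro eq_matI) (simp_all add: W_def mat_ring del: index_mult_mat(1))
    then show "y \<cdot>\<^sub>m mat_deriv n l W y = X * W y - W y * X'"
      using eq[OF y] comm X X' mat_hol_carrier[OF Z, of y] Z0 by (intro eq_matI) (auto simp: W(2))
  qed
  then show ?thesis
    using mat_hol_carrier[OF Z, of x] Z0 by (auto simp: W_def mat_eq_iff)
qed

text \<open>A normalising gauge transformation \<open>H\<close> together with its inverse \<open>K\<close>.\<close>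

definition frobenius_pair ::
    "nat \<Rightarrow> complex mat \<Rightarrow> (complex \<Rightarrow> complex mat) \<Rightarrow> ereal \<Rightarrow>
      (complex \<Rightarrow> complex mat) \<Rightarrow> (complex \<Rightarrow> complex mat) \<Rightarrow> bool"
  where "frobenius_pair n X B R H K \<longleftrightarrow>
    mat_hol n n H (eball 0 R) \<and> mat_hol n n K (eball 0 R) \<and> H 0 = 1\<^sub>m n \<and> K 0 = 1\<^sub>m n \<and>
    (\<forall>x\<in>eball 0 R. K x * H x = 1\<^sub>m n \<and> H x * K x = 1\<^sub>m n \<and>
      x \<cdot>\<^sub>m mat_deriv n n H x = X * H x - H x * X + x \<cdot>\<^sub>m (B x * H x) \<and>
      x \<cdot>\<^sub>m mat_deriv n n K x = X * K x - K x * X - x \<cdot>\<^sub>m (K x * B x))"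

text \<open>The inverse satisfies a dual equation, which is of the same kind after transposition; the
  product of the two solutions is constant because \<open>r - ad X\<close> has no kernel for \<open>r \<ge> 1\<close>.\<close>

theorem frobenius_pair_exists:
  assumes X: "X \<in> carrier_mat n n" and nonres: "nonresonant n X" and inj: "no_resonance n n X X"
    and R: "0 < R" and B: "mat_hol n n B (eball 0 R)"
  obtains H K where "frobenius_pair n X B R H K"
proof -
  obtain H where H: "mat_hol n n H (eball 0 R)" "H 0 = 1\<^sub>m n"
    "\<And>x. x \<in> eball 0 R \<Longrightarrow> x \<cdot>\<^sub>m mat_deriv n n H x = X * H x - H x * X + x \<cdot>\<^sub>m (B x * H x)"
    by (rule frobenius_exists[OF X nonres R B]) (rule that)
  define X2 where "X2 = - transpose_mat X"
  define B2 where "B2 = (\<lambda>x. (-1) \<cdot>\<^sub>m transpose_mat (B x))"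
  have X2: "X2 \<in> carrier_mat n n" using X by (simp add: X2_def)
  have B2: "mat_hol n n B2 (eball 0 R)"
    unfolding B2_def by (intro mat_hol_smult mat_hol_transpose B holomorphic_intros)
  have "nonresonant n X2"
    unfolding nonresonant_def
  proof safe
    fix r :: nat and N :: "complex mat" assume r: "1 \<le> r" and N: "N \<in> carrier_mat n n"
    obtain M where M: "M \<in> carrier_mat n n" "of_nat r \<cdot>\<^sub>m M - (X * M - M * X) = transpose_mat N"
      using nonres r N unfolding nonresonant_def by (meson transpose_carrier_mat)
    have "of_nat r \<cdot>\<^sub>m transpose_mat M - (X2 * transpose_mat M - transpose_mat M * X2) =
        transpose_mat (of_nat r \<cdot>\<^sub>m M - (X * M - M * X))"
      using M(1) X by (intro eq_matI)
        (simp_all add: X2_def transpose_mult[of _ n n _ n, symmetric] mat_uminus_mult del: index_mult_mat(1))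
    then show "\<exists>M\<in>carrier_mat n n. of_nat r \<cdot>\<^sub>m M - (X2 * M - M * X2) = N"
      using M by (intro bexI[of _ "transpose_mat M"]) auto
  qed
  then obtain L where L: "mat_hol n n L (eball 0 R)" "L 0 = 1\<^sub>m n"
    "\<And>x. x \<in> eball 0 R \<Longrightarrow> x \<cdot>\<^sub>m mat_deriv n n L x = X2 * L x - L x * X2 + x \<cdot>\<^sub>m (B2 x * L x)"
    by (rule frobenius_exists[OF X2 _ R B2]) (rule that)
  define K where "K x = transpose_mat (L x)" for x
  have K: "mat_hol n n K (eball 0 R)" "K 0 = 1\<^sub>m n"
    using mat_hol_transpose[OF L(1)] L(2) by (auto simp: K_def[abs_def])
  have K': "x \<cdot>\<^sub>m mat_deriv n n K x = X * K x - K x * X - x \<cdot>\<^sub>m (K x * B x)"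
    if x: "x \<in> eball 0 R" for x
  proof -
    note c = mat_hol_carrier[OF L(1), of x] mat_hol_carrier[OF B, of x]
    have "x \<cdot>\<^sub>m mat_deriv n n K x = transpose_mat (x \<cdot>\<^sub>m mat_deriv n n L x)"
      unfolding K_def by (subst mat_deriv_transpose[OF L(1)]) auto
    also have "\<dots> = X * K x - K x * X - x \<cdot>\<^sub>m (K x * B x)"
    proof -
      have "transpose_mat (X2 * L x - L x * X2 + x \<cdot>\<^sub>m (B2 x * L x)) =
          transpose_mat (X2 * L x) - transpose_mat (L x * X2) + x \<cdot>\<^sub>m transpose_mat (B2 x * L x)"
        using c X by (intro eq_matI) (simp_all add: X2_def B2_def del: index_mult_mat(1))
      also have "transpose_mat (X2 * L x) = K x * transpose_mat X2"
        using transpose_mult[OF X2 c(1)] by (simp add: K_def)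
      also have "transpose_mat (L x * X2) = transpose_mat X2 * K x"
        using transpose_mult[OF c(1) X2] by (simp add: K_def)
      also have "transpose_mat (B2 x * L x) = K x * transpose_mat (B2 x)"
        using transpose_mult[OF mat_hol_carrier[OF B2] c(1)] by (simp add: K_def)
      also have "transpose_mat X2 = - X" using X by (auto simp: X2_def)
      also have "transpose_mat (B2 x) = - B x" using c by (auto simp: B2_def)
      also have "K x * - X - - X * K x + x \<cdot>\<^sub>m (K x * - B x) = X * K x - K x * X - x \<cdot>\<^sub>m (K x * B x)"
        using c X mat_hol_carrier[OF K(1), of x]
        by (intro eq_matI) (simp_all add: mat_uminus_mult del: index_mult_mat(1))
      finally show ?thesis unfolding L(3)[OF x] .
    qed
    finally show ?thesis .
  qed
  have KH: "K x * H x = 1\<^sub>m n" if x: "x \<in> eball 0 R" for x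
  proof -
    have "K x * H x = K 0 * H 0"
    proof (rule frobenius_const[OF X X R inj _ _ _ x])
      show "mat_hol n n (\<lambda>x. K x * H x) (eball 0 R)" by (intro mat_hol_mult[OF K(1) H(1)])
      show "X * (K 0 * H 0) = K 0 * H 0 * X" using X K H by (simp add: mat_ring)
      fix y :: complex assume y: "y \<in> eball 0 R"
      note c = mat_hol_carrier[OF K(1), of y] mat_hol_carrier[OF B, of y] mat_hol_carrier[OF H(1), of y]
      have "y \<cdot>\<^sub>m mat_deriv n n (\<lambda>x. K x * H x) y =
          (y \<cdot>\<^sub>m mat_deriv n n K y) * H y + K y * (y \<cdot>\<^sub>m mat_deriv n n H y)"
        unfolding mat_deriv_mult[OF K(1) H(1) open_eball y] using c
        by (intro eq_matI) (simp_all add: mat_ring distrib_left del: index_mult_mat(1))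
      also have "\<dots> = X * (K y * H y) - (K y * H y) * X"
        unfolding K'[OF y] H(3)[OF y] using c X
        by (intro eq_matI) (simp_all add: mat_ring algebra_simps del: index_mult_mat(1))
      finally show "y \<cdot>\<^sub>m mat_deriv n n (\<lambda>x. K x * H x) y = X * (K y * H y) - (K y * H y) * X" .
    qed
    then show ?thesis using K H by simp
  qed
  have HK: "H x * K x = 1\<^sub>m n" if x: "x \<in> eball 0 R" for x
    using mat_mult_left_right_inverse[OF mat_hol_carrier[OF K(1)] mat_hol_carrier[OF H(1)] KH[OF x]] .
  show thesis
    by (rule that[of H K]) (simp add: frobenius_pair_def H K K' KH HK)
qed

text \<open>The normalising gauge transformation is unique and hence compatible with every matrix that
  intertwines two equations.\<close>

theorem frobenius_intertwine:
  assumes X: "X \<in> carrier_mat n n" and X': "X' \<in> carrier_mat l l" and R: "0 < R"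
    and inj: "no_resonance n l X X'"
    and HK: "frobenius_pair n X B R H K"
    and B: "mat_hol n n B (eball 0 R)" and B': "mat_hol l l B' (eball 0 R)"
    and H': "mat_hol l l H' (eball 0 R)" "H' 0 = 1\<^sub>m l"
      "\<And>x. x \<in> eball 0 R \<Longrightarrow> x \<cdot>\<^sub>m mat_deriv l l H' x = X' * H' x - H' x * X' + x \<cdot>\<^sub>m (B' x * H' x)"
    and g: "g \<in> carrier_mat n l" "X * g = g * X'" "\<And>x. x \<in> eball 0 R \<Longrightarrow> B x * g = g * B' x"
    and x: "x \<in> eball 0 R"
  shows "H x * g = g * H' x"
proof -
  have H: "mat_hol n n H (eball 0 R)" and K: "mat_hol n n K (eball 0 R)" "K 0 = 1\<^sub>m n"
    and K': "\<And>x. x \<in> eball 0 R \<Longrightarrow>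
      x \<cdot>\<^sub>m mat_deriv n n K x = X * K x - K x * X - x \<cdot>\<^sub>m (K x * B x)"
    and inv: "H x * K x = 1\<^sub>m n"
    using HK x by (auto simp: frobenius_pair_def)
  have gH: "mat_hol n l (\<lambda>x. g * H' x) (eball 0 R)"
    using g by (intro mat_hol_mult[OF mat_hol_const H'(1)])
  have "K x * (g * H' x) = K 0 * (g * H' 0)"
  proof (rule frobenius_const[OF X X' R inj _ _ _ x])
    show "mat_hol n l (\<lambda>x. K x * (g * H' x)) (eball 0 R)" by (intro mat_hol_mult[OF K(1) gH])
    show "X * (K 0 * (g * H' 0)) = K 0 * (g * H' 0) * X'"
      using X X' K H' g by (simp add: mat_ring)
    fix y :: complex assume y: "y \<in> eball 0 R"
    note c = mat_hol_carrier[OF K(1), of y] mat_hol_carrier[OF B, of y] mat_hol_carrier[OF B', of y]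
      mat_hol_carrier[OF H'(1), of y]
    have dg: "mat_deriv n l (\<lambda>x. g * H' x) y = g * mat_deriv l l H' y"
      using mat_deriv_mult[OF mat_hol_const[OF g(1)] H'(1) open_eball y] g c
      by (auto simp: mat_ring)
    have "y \<cdot>\<^sub>m mat_deriv n l (\<lambda>x. K x * (g * H' x)) y =
        (y \<cdot>\<^sub>m mat_deriv n n K y) * (g * H' y) + K y * (g * (y \<cdot>\<^sub>m mat_deriv l l H' y))"
      unfolding mat_deriv_mult[OF K(1) gH open_eball y] dg using c g
      by (intro eq_matI) (simp_all add: mat_ring distrib_left del: index_mult_mat(1))
    also have "\<dots> = X * K y * g * H' y - K y * (X * g) * H' y - y \<cdot>\<^sub>m (K y * (B y * g) * H' y)
       + (K y * (g * X') * H' y - K y * g * H' y * X' + y \<cdot>\<^sub>m (K y * (g * B' y) * H' y))"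
      unfolding K'[OF y] H'(3)[OF y] using c X X' g(1)
      by (intro eq_matI) (simp_all add: mat_ring algebra_simps del: index_mult_mat(1))
    also have "\<dots> = X * (K y * (g * H' y)) - (K y * (g * H' y)) * X'"
      unfolding g(2) g(3)[OF y] using c X X' g(1)
      by (intro eq_matI) (simp_all add: mat_ring algebra_simps del: index_mult_mat(1))
    finally show "y \<cdot>\<^sub>m mat_deriv n l (\<lambda>x. K x * (g * H' x)) y =
      X * (K y * (g * H' y)) - (K y * (g * H' y)) * X'" .
  qed
  also have "\<dots> = g" using K H' g by (simp add: mat_ring)
  finally have "H x * (K x * (g * H' x)) = H x * g" by simp
  moreover have "H x * (K x * (g * H' x)) = g * H' x"
    using inv g mat_hol_carrier[OF H, of x] mat_hol_carrier[OF K(1), of x] mat_hol_carrier[OF H'(1), of x]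
      mat_assoc[of "H x" "K x" "g * H' x"]
    by (simp add: mat_one_mult)
  ultimately show ?thesis by simp
qed

section \<open>Linear differential equations without singular points\<close>

text \<open>A fundamental solution of \<open>F' = B F\<close> together with its inverse.\<close>

definition regular_pair ::
    "nat \<Rightarrow> (complex \<Rightarrow> complex mat) \<Rightarrow> complex set \<Rightarrow>
      (complex \<Rightarrow> complex mat) \<Rightarrow> (complex \<Rightarrow> complex mat) \<Rightarrow> bool"
  where "regular_pair n B A F K \<longleftrightarrow>
    mat_hol n n F A \<and> mat_hol n n K A \<and>
    (\<forall>x\<in>A. K x * F x = 1\<^sub>m n \<and> F x * K x = 1\<^sub>m n \<and>
      mat_deriv n n F x = B x * F x \<and> mat_deriv n n K x = - (K x * B x))"

text \<open>The derivative of \<open>K g F'\<close> is \<open>K (g B' - B g) F'\<close>.\<close>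

theorem regular_intertwine:
  assumes A: "open A" "connected A" and FK: "regular_pair n B A F K"
    and B: "\<And>x. B x \<in> carrier_mat n n" and B': "\<And>x. B' x \<in> carrier_mat l l"
    and F': "mat_hol l l F' A" "\<And>x. x \<in> A \<Longrightarrow> mat_deriv l l F' x = B' x * F' x"
    and g: "g \<in> carrier_mat n l" "\<And>x. x \<in> A \<Longrightarrow> B x * g = g * B' x"
    and x: "x \<in> A" and y: "y \<in> A"
  shows "K x * g * F' x = K y * g * F' y"
proof -
  have K: "mat_hol n n K A" "\<And>x. x \<in> A \<Longrightarrow> mat_deriv n n K x = - (K x * B x)"
    using FK by (auto simp: regular_pair_def)
  have Kg: "mat_hol n l (\<lambda>x. K x * g) A"
    using g by (intro mat_hol_mult[OF K(1) mat_hol_const])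
  show ?thesis
  proof (rule mat_deriv_zero_const[OF mat_hol_mult[OF Kg F'(1)] A _ x y])
    fix z assume z: "z \<in> A"
    note c = mat_hol_carrier[OF K(1), of z] mat_hol_carrier[OF F'(1), of z] B[of z] B'[of z]
    have dg: "mat_deriv n l (\<lambda>x. K x * g) z = mat_deriv n n K z * g"
      using mat_deriv_mult[OF K(1) mat_hol_const[OF g(1)] A(1) z] g c by (auto simp: mat_ring)
    have "mat_deriv n l (\<lambda>x. K x * g * F' x) z = K z * (g * B' z) * F' z - K z * (B z * g) * F' z"
      unfolding mat_deriv_mult[OF Kg F'(1) A(1) z] dg K(2)[OF z] F'(2)[OF z] using c g(1)
      by (intro eq_matI) (simp_all add: mat_ring algebra_simps del: index_mult_mat(1))
    then show "mat_deriv n l (\<lambda>x. K x * g * F' x) z = 0\<^sub>m n l"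
      unfolding g(2)[OF z] using c g(1) by auto
  qed
qed

lemma continuous_zero_at_0:
  fixes f :: "complex \<Rightarrow> complex"
  assumes "open A" "0 \<in> A" "f holomorphic_on A" "\<And>x. x \<in> A \<Longrightarrow> x * f x = 0"
  shows "f 0 = 0"
proof -
  have "isCont f 0"
    using assms holomorphic_on_imp_continuous_on continuous_on_eq_continuous_at by blast
  then have "f \<midarrow>0\<rightarrow> f 0" by (simp add: isCont_def)
  moreover have "f \<midarrow>0\<rightarrow> 0"
  proof (rule tendsto_eventually)
    show "\<forall>\<^sub>F x in at 0. f x = 0"
      using assms unfolding eventually_at_topological by (intro exI[of _ A]) auto
  qed
  ultimately show ?thesis by (rule LIM_unique)
qed

text \<open>This is the normal form theorem with residue \<open>0\<close>.\<close>

lemma regular_pair_disc: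
  assumes B: "mat_hol n n B (eball 0 R)" and R: "0 < R"
  obtains F K where "regular_pair n B (eball 0 R) F K" "F 0 = 1\<^sub>m n" "K 0 = 1\<^sub>m n"
proof -
  have smult_zero: "M = 0\<^sub>m n n" if "r \<ge> 1" "M \<in> carrier_mat n n"
    "of_nat r \<cdot>\<^sub>m M = 0\<^sub>m n n * M - M * 0\<^sub>m n n" for r :: nat and M :: "complex mat"
    using that by (auto simp: mat_zero_mult mat_eq_iff)
  have "nonresonant n (0\<^sub>m n n)"
    unfolding nonresonant_def
  proof safe
    fix r :: nat and N :: "complex mat" assume "1 \<le> r" "N \<in> carrier_mat n n"
    then show "\<exists>M\<in>carrier_mat n n. of_nat r \<cdot>\<^sub>m M - (0\<^sub>m n n * M - M * 0\<^sub>m n n) = N"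
      by (intro bexI[of _ "(1 / of_nat r) \<cdot>\<^sub>m N"] eq_matI) (auto simp: mat_zero_mult)
  qed
  moreover have "no_resonance n n (0\<^sub>m n n) (0\<^sub>m n n)"
    using smult_zero by (auto simp: no_resonance_def)
  ultimately obtain F K where FK: "frobenius_pair n (0\<^sub>m n n) B R F K"
    using frobenius_pair_exists[OF _ _ _ R B, of "0\<^sub>m n n"] by (metis zero_carrier_mat)
  then have F: "mat_hol n n F (eball 0 R)" and K: "mat_hol n n K (eball 0 R)"
    and inv: "\<And>x. x \<in> eball 0 R \<Longrightarrow> K x * F x = 1\<^sub>m n \<and> F x * K x = 1\<^sub>m n"
    and dF0: "\<And>x. x \<in> eball 0 R \<Longrightarrow> x \<cdot>\<^sub>m mat_deriv n n F x =
      0\<^sub>m n n * F x - F x * 0\<^sub>m n n + x \<cdot>\<^sub>m (B x * F x)"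
    and dK0: "\<And>x. x \<in> eball 0 R \<Longrightarrow> x \<cdot>\<^sub>m mat_deriv n n K x =
      0\<^sub>m n n * K x - K x * 0\<^sub>m n n - x \<cdot>\<^sub>m (K x * B x)"
    unfolding frobenius_pair_def by blast+
  have dF: "x \<cdot>\<^sub>m mat_deriv n n F x = x \<cdot>\<^sub>m (B x * F x)" if "x \<in> eball 0 R" for x
    unfolding dF0[OF that] using F B by (intro eq_matI) (simp_all add: mat_zero_mult del: index_mult_mat(1))
  have dK: "x \<cdot>\<^sub>m mat_deriv n n K x = - (x \<cdot>\<^sub>m (K x * B x))" if "x \<in> eball 0 R" for x
    unfolding dK0[OF that] using K B by (intro eq_matI) (simp_all add: mat_zero_mult del: index_mult_mat(1))
  have *: "G x = 0" if "G holomorphic_on eball 0 R" "\<And>x. x \<in> eball 0 R \<Longrightarrow> x * G x = 0"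
    "x \<in> eball 0 R" for G :: "complex \<Rightarrow> complex" and x
  proof (cases "x = 0")
    case True
    then show ?thesis
      using continuous_zero_at_0[OF open_eball _ that(1,2)] R by (auto simp: zero_ereal_def)
  qed (use that in auto)
  have "mat_deriv n n F x = B x * F x" if x: "x \<in> eball 0 R" for x
  proof (rule eq_matI)
    fix r c assume "r < dim_row (B x * F x)" "c < dim_col (B x * F x)"
    then have rc: "r < n" "c < n" using B F by auto
    have "(\<lambda>x. deriv (\<lambda>y. F y $$ (r, c)) x - (B x * F x) $$ (r, c)) x = 0"
    proof (rule *[OF _ _ x])
      show "(\<lambda>x. deriv (\<lambda>y. F y $$ (r, c)) x - (B x * F x) $$ (r, c)) holomorphic_on eball 0 R"
        using rc by (intro holomorphic_intros mat_hol_entry[OF F] mat_hol_entry[OF mat_hol_mult[OF B F]]) auto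
      fix y :: complex assume y: "y \<in> eball 0 R"
      then show "y * (deriv (\<lambda>y. F y $$ (r, c)) y - (B y * F y) $$ (r, c)) = 0"
        using arg_cong[OF dF[OF y], of "\<lambda>M. M $$ (r, c)"] rc B F
        by (simp add: mat_deriv_def algebra_simps del: index_mult_mat(1))
    qed
    then show "mat_deriv n n F x $$ (r, c) = (B x * F x) $$ (r, c)"
      using rc by (simp add: mat_deriv_def)
  qed (use B F in auto)
  moreover have "mat_deriv n n K x = - (K x * B x)" if x: "x \<in> eball 0 R" for x
  proof (rule eq_matI)
    fix r c assume "r < dim_row (- (K x * B x))" "c < dim_col (- (K x * B x))"
    then have rc: "r < n" "c < n" using B K by auto
    have "(\<lambda>x. deriv (\<lambda>y. K y $$ (r, c)) x + (K x * B x) $$ (r, c)) x = 0"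
    proof (rule *[OF _ _ x])
      show "(\<lambda>x. deriv (\<lambda>y. K y $$ (r, c)) x + (K x * B x) $$ (r, c)) holomorphic_on eball 0 R"
        using rc by (intro holomorphic_intros mat_hol_entry[OF K] mat_hol_entry[OF mat_hol_mult[OF K B]]) auto
      fix y :: complex assume y: "y \<in> eball 0 R"
      then show "y * (deriv (\<lambda>y. K y $$ (r, c)) y + (K y * B y) $$ (r, c)) = 0"
        using arg_cong[OF dK[OF y], of "\<lambda>M. M $$ (r, c)"] rc B K
        by (simp add: mat_deriv_def algebra_simps del: index_mult_mat(1))
    qed
    then show "mat_deriv n n K x $$ (r, c) = (- (K x * B x)) $$ (r, c)"
      using rc B K by (simp add: mat_deriv_def eq_neg_iff_add_eq_0 del: index_mult_mat(1))
  qed (use B K in auto)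
  ultimately show thesis
    using FK F K inv by (intro that[of F K]) (auto simp: regular_pair_def frobenius_pair_def)
qed

text \<open>By the Riemann mapping theorem the case of a simply connected domain reduces to the case of
  the unit disc, in which the power series solves the equation.\<close>

theorem regular_pair_exists:
  assumes A: "open A" "simply_connected A" "A \<noteq> UNIV" and z0: "z0 \<in> A"
    and B: "mat_hol n n B A"
  obtains F K where "regular_pair n B A F K" "F z0 = 1\<^sub>m n" "K z0 = 1\<^sub>m n"
proof -
  obtain f g where f: "f holomorphic_on A" and g: "g holomorphic_on ball 0 1"
    and fg: "\<And>z. z \<in> A \<Longrightarrow> f z \<in> ball 0 1 \<and> g (f z) = z"
    and gf: "\<And>z. z \<in> ball 0 1 \<Longrightarrow> g z \<in> A \<and> f (g z) = z"
    using Riemann_mapping_theorem[of A] A z0 by blast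
  define B1 where "B1 = (\<lambda>w. deriv g w \<cdot>\<^sub>m B (g w))"
  have B1: "mat_hol n n B1 (eball 0 (ereal 1))"
    unfolding B1_def using gf g
    by (intro mat_hol_smult mat_hol_compose[OF B]) (auto intro!: holomorphic_intros)
  obtain F1 K1 where FK1: "regular_pair n B1 (ball 0 1) F1 K1"
    by (rule regular_pair_disc[OF B1]) (auto intro: that)
  then have F1: "mat_hol n n F1 (ball 0 1)" and K1: "mat_hol n n K1 (ball 0 1)"
    and inv: "\<And>x. x \<in> ball 0 1 \<Longrightarrow> K1 x * F1 x = 1\<^sub>m n" "\<And>x. x \<in> ball 0 1 \<Longrightarrow> F1 x * K1 x = 1\<^sub>m n"
    and dF: "\<And>x. x \<in> ball 0 1 \<Longrightarrow> mat_deriv n n F1 x = B1 x * F1 x"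
    and dK: "\<And>x. x \<in> ball 0 1 \<Longrightarrow> mat_deriv n n K1 x = - (K1 x * B1 x)"
    by (auto simp: regular_pair_def)
  define w0 where "w0 = f z0"
  have w0: "w0 \<in> ball 0 1" using fg[OF z0] by (simp add: w0_def)
  note cF = mat_hol_carrier[OF F1] and cK = mat_hol_carrier[OF K1] and cB = mat_hol_carrier[OF B]
  have fA: "f ` A \<subseteq> ball 0 1" using fg by blast
  have Ff: "mat_hol n n (\<lambda>z. F1 (f z)) A" and Kf: "mat_hol n n (\<lambda>z. K1 (f z)) A"
    using mat_hol_compose[OF F1 f fA] mat_hol_compose[OF K1 f fA] .
  define F where "F z = F1 (f z) * K1 w0" for z
  define K where "K z = F1 w0 * K1 (f z)" for z
  have F: "mat_hol n n F A" unfolding F_def[abs_def]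
    by (intro mat_hol_mult[OF Ff mat_hol_const] cK)
  have K: "mat_hol n n K A" unfolding K_def[abs_def]
    by (intro mat_hol_mult[OF mat_hol_const Kf] cF)
  have df: "deriv f z * deriv g (f z) = 1" if z: "z \<in> A" for z
  proof -
    have "((\<lambda>z. g (f z)) has_field_derivative deriv g (f z) * deriv f z) (at z)"
      using fg[OF z] z A f g by (intro DERIV_chain2 holomorphic_derivI[of g "ball 0 1"] holomorphic_derivI[of f A]) auto
    moreover have "((\<lambda>z. g (f z)) has_field_derivative 1) (at z)"
      by (rule has_field_derivative_transform_within_open[OF DERIV_ident A(1) z]) (use fg in auto)
    ultimately show ?thesis using DERIV_unique by (metis mult.commute)
  qed
  have f': "(f has_field_derivative deriv f z) (at z)" if "z \<in> A" for z
    using holomorphic_derivI[OF f A(1) that] .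
  have "K z * F z = 1\<^sub>m n \<and> F z * K z = 1\<^sub>m n \<and>
      mat_deriv n n F z = B z * F z \<and> mat_deriv n n K z = - (K z * B z)" if z: "z \<in> A" for z
  proof (intro conjI)
    have fz: "f z \<in> ball 0 1" using fg[OF z] by simp
    note c = cF[of "f z"] cK[of "f z"] cF[of w0] cK[of w0] cB[of z]
    have "K z * F z = F1 w0 * ((K1 (f z) * F1 (f z)) * K1 w0)"
      using c by (simp add: K_def F_def mat_assoc)
    then show "K z * F z = 1\<^sub>m n" using inv(1)[OF fz] inv(2)[OF w0] c by (simp add: mat_one_mult)
    have "F z * K z = F1 (f z) * ((K1 w0 * F1 w0) * K1 (f z))"
      using c by (simp add: K_def F_def mat_assoc)
    then show "F z * K z = 1\<^sub>m n" using inv(2)[OF fz] inv(1)[OF w0] c by (simp add: mat_one_mult)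
    have 1: "mat_deriv n n (\<lambda>z. F1 (f z)) z = deriv f z \<cdot>\<^sub>m (B1 (f z) * F1 (f z))"
      using mat_deriv_compose[OF F1 open_ball f'[OF z] fz] dF[OF fz] by simp
    have "mat_deriv n n F z = mat_deriv n n (\<lambda>z. F1 (f z)) z * K1 w0"
      unfolding F_def using mat_deriv_mult[OF Ff mat_hol_const[OF cK[of w0]] A(1) z] c
      by (simp add: mat_ring)
    also have "\<dots> = (deriv f z * deriv g (f z)) \<cdot>\<^sub>m (B z * F z)"
      unfolding 1 using c fg[OF z] by (simp add: B1_def F_def mat_ring)
    finally show "mat_deriv n n F z = B z * F z" unfolding df[OF z] by auto
    have 2: "mat_deriv n n (\<lambda>z. K1 (f z)) z = deriv f z \<cdot>\<^sub>m (- (K1 (f z) * B1 (f z)))"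
      using mat_deriv_compose[OF K1 open_ball f'[OF z] fz] dK[OF fz] by simp
    have "mat_deriv n n K z = F1 w0 * mat_deriv n n (\<lambda>z. K1 (f z)) z"
      unfolding K_def using mat_deriv_mult[OF mat_hol_const[OF cF[of w0]] Kf A(1) z] c
      by (simp add: mat_ring)
    also have "\<dots> = (deriv f z * deriv g (f z)) \<cdot>\<^sub>m (- (K z * B z))"
      unfolding 2 using c fg[OF z]
      by (intro eq_matI) (simp_all add: B1_def K_def mat_ring del: index_mult_mat(1))
    finally show "mat_deriv n n K z = - (K z * B z)" unfolding df[OF z] by auto
  qed
  moreover have "F z0 = 1\<^sub>m n" "K z0 = 1\<^sub>m n"
    using inv(2)[OF w0] by (auto simp: F_def K_def w0_def)
  ultimately show thesis using F K by (intro that[of F K]) (auto simp: regular_pair_def)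
qed

section \<open>Parallel transport along the Artin generators\<close>

lemma cscale_has_vector_derivative:
  assumes "(y has_vector_derivative y') (at t)"
  shows "((\<lambda>t. b + cscale (y t) a) has_vector_derivative cscale y' a) (at t)"
proof -
  have "((\<lambda>t. b + (y t * fst a, y t * snd a)) has_vector_derivative 0 + (y' * fst a, y' * snd a)) (at t)"
    by (intro has_vector_derivative_add has_vector_derivative_const has_vector_derivative_Pair
        has_vector_derivative_mult_left assms)
  then show ?thesis by (simp add: cscale_def case_prod_beta)
qed

text \<open>On a path that stays in one complex line the flat sections are restrictions of solutions of an
  ordinary differential equation in the coordinate of the line. The transport is unique because
  the product of \<open>K\<close> with any flat section is constant.\<close>

theorem parallel_transport_line:
  fixes y :: "real \<Rightarrow> complex"
  assumes A: "open A" and FK: "regular_pair n B A F K" and B: "\<And>x. B x \<in> carrier_mat n n"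
    and y: "continuous_on {0..1} y" "y ` {0..1} \<subseteq> A"
    and S: "finite S" "\<And>t. t \<in> {0<..<1} - S \<Longrightarrow> y differentiable at t"
    and \<Omega>: "\<And>x c. x \<in> A \<Longrightarrow> \<Omega> (b + cscale x a) (cscale c a) = c \<cdot>\<^sub>m B x"
  shows "parallel_transport n \<Omega> (\<lambda>t. b + cscale (y t) a) = F (y 1) * K (y 0)"
proof -
  define \<gamma> where "\<gamma> = (\<lambda>t. b + cscale (y t) a)"
  have F: "mat_hol n n F A" and K: "mat_hol n n K A"
    and inv: "\<And>x. x \<in> A \<Longrightarrow> K x * F x = 1\<^sub>m n" "\<And>x. x \<in> A \<Longrightarrow> F x * K x = 1\<^sub>m n"
    and dF: "\<And>x. x \<in> A \<Longrightarrow> mat_deriv n n F x = B x * F x"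
    and dK: "\<And>x. x \<in> A \<Longrightarrow> mat_deriv n n K x = - (K x * B x)"
    using FK by (auto simp: regular_pair_def)
  note cF = mat_hol_carrier[OF F] and cK = mat_hol_carrier[OF K]
  have yA: "y t \<in> A" if "t \<in> {0..1}" for t using y(2) that by auto
  define y' where "y' t = vector_derivative y (at t)" for t
  have y': "(y has_vector_derivative y' t) (at t)" if "t \<in> {0<..<1} - S" for t
    using S(2)[OF that] by (simp add: y'_def vector_derivative_works)
  have \<gamma>': "(\<gamma> has_vector_derivative cscale (y' t) a) (at t)" if "t \<in> {0<..<1} - S" for t
    unfolding \<gamma>_def using y'[OF that] by (rule cscale_has_vector_derivative)
  have \<Omega>_eq: "\<Omega> (\<gamma> t) (vector_derivative \<gamma> (at t)) = y' t \<cdot>\<^sub>m B (y t)" if "t \<in> {0<..<1} - S" for t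
    using \<Omega>[OF yA, of t "y' t"] vector_derivative_at[OF \<gamma>'[OF that]] that by (simp add: \<gamma>_def)
  have cont: "continuous_on {0..1} (\<lambda>t. G (y t) $$ (r, c))"
    if "mat_hol n n G A" "r < n" "c < n" for G r c
    using continuous_on_compose2[OF holomorphic_on_imp_continuous_on[OF mat_hol_entry[OF that]] y] .
  have deriv: "((\<lambda>t. G (y t) $$ (r, c)) has_vector_derivative y' t * mat_deriv n n G (y t) $$ (r, c)) (at t)"
    if "mat_hol n n G A" "r < n" "c < n" "t \<in> {0<..<1} - S" for G r c t
    using field_vector_diff_chain_at[OF y'[OF that(4)] mat_hol_has_deriv[OF that(1) A yA that(2,3)]]
      that by (simp add: o_def)
  have transports: "transports n \<Omega> \<gamma> (F (y 1) * K (y 0))"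
    unfolding transports_def
  proof (intro exI[of _ "\<lambda>t. F (y t) * K (y 0)"] exI[of _ S] conjI ballI allI impI)
    have G: "mat_hol n n (\<lambda>x. F x * K (y 0)) A"
      by (intro mat_hol_mult[OF F mat_hol_const] cK)
    show "F (y 0) * K (y 0) = 1\<^sub>m n" using inv(2) yA by simp
    show "continuous_on {0..1} (\<lambda>t. (F (y t) * K (y 0)) $$ (r, c))" if "r < n" "c < n" for r c
      using cont[OF G that] .
    fix t assume t: "t \<in> {0<..<1} - S"
    show "\<gamma> differentiable at t" using \<gamma>'[OF t] by (auto simp: differentiable_def has_vector_derivative_def)
    fix r c assume rc: "r < n" "c < n"
    have yt: "y t \<in> A" using yA t by auto
    have "mat_deriv n n (\<lambda>x. F x * K (y 0)) (y t) = B (y t) * F (y t) * K (y 0)"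
      using mat_deriv_mult[OF F mat_hol_const[OF cK[of "y 0"]] A yt] dF[OF yt] cF[of "y t"] cK[of "y 0"] B[of "y t"]
      by (simp add: mat_zero_mult)
    then have "y' t * mat_deriv n n (\<lambda>x. F x * K (y 0)) (y t) $$ (r, c) =
        (\<Omega> (\<gamma> t) (vector_derivative \<gamma> (at t)) * (F (y t) * K (y 0))) $$ (r, c)"
      unfolding \<Omega>_eq[OF t] using cF[of "y t"] cK[of "y 0"] B[of "y t"] rc
      by (simp add: mat_ring del: index_mult_mat(1))
    then show "((\<lambda>t. (F (y t) * K (y 0)) $$ (r, c)) has_vector_derivative
        (\<Omega> (\<gamma> t) (vector_derivative \<gamma> (at t)) * (F (y t) * K (y 0))) $$ (r, c)) (at t)"
      using deriv[OF G rc t] by simp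
  qed (use S cF cK in \<open>auto intro: mult_carrier_mat[of _ n n]\<close>)
  have unique: "M = F (y 1) * K (y 0)" if M: "transports n \<Omega> \<gamma> M" for M
  proof -
    obtain Y S' where S': "finite S'" and Y0: "\<forall>t\<in>{0..1}. Y t \<in> carrier_mat n n"
      "Y 0 = 1\<^sub>m n" "Y 1 = M"
      "\<forall>r<n. \<forall>c<n. continuous_on {0..1} (\<lambda>t. Y t $$ (r, c))"
      and dY0: "\<forall>t\<in>{0<..<1} - S'. \<gamma> differentiable at t \<and> (\<forall>r<n. \<forall>c<n.
        ((\<lambda>t. Y t $$ (r, c)) has_vector_derivative
            (\<Omega> (\<gamma> t) (vector_derivative \<gamma> (at t)) * Y t) $$ (r, c)) (at t))"
      using M unfolding transports_def by (elim exE conjE) (rule that)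
    have Y: "Y t \<in> carrier_mat n n" if "t \<in> {0..1}" for t using Y0(1) that by blast
    have contY: "continuous_on {0..1} (\<lambda>t. Y t $$ (r, c))" if "r < n" "c < n" for r c
      using Y0(4) that by blast
    have dY: "((\<lambda>t. Y t $$ (r, c)) has_vector_derivative
        (\<Omega> (\<gamma> t) (vector_derivative \<gamma> (at t)) * Y t) $$ (r, c)) (at t)"
      if "t \<in> {0<..<1} - S'" "r < n" "c < n" for t r c
      using dY0 that by blast
    have "K (y 1) * Y 1 = K (y 0)"
    proof (rule eq_matI)
      fix r c assume "r < dim_row (K (y 0))" "c < dim_col (K (y 0))"
      then have rc: "r < n" "c < n" using K by auto
      define Z where "Z t = (\<Sum>d<n. K (y t) $$ (r, d) * Y t $$ (d, c))" for t
      have Z: "Z t = (K (y t) * Y t) $$ (r, c)" if "t \<in> {0..1}" for t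
        unfolding Z_def using mult_entry[OF cK Y[OF that] rc] by simp
      have "Z 1 = Z 0"
      proof (rule has_derivative_zero_unique_strong_interval[of "S \<union> S' \<union> {0, 1}" 0 1 Z "Z 0" 1])
        show "continuous_on {0..1} Z"
          unfolding Z_def using rc by (intro continuous_intros cont K contY) auto
        fix t :: real assume "t \<in> {0..1} - (S \<union> S' \<union> {0, 1})"
        then have t: "t \<in> {0<..<1} - S" "t \<in> {0<..<1} - S'" "t \<in> {0..1}" by auto
        have yt: "y t \<in> A" using yA t by auto
        note c = cK[of "y t"] B[of "y t"] Y[OF t(3)]
        have "(Z has_vector_derivative (\<Sum>d<n. K (y t) $$ (r, d) *
            (\<Omega> (\<gamma> t) (vector_derivative \<gamma> (at t)) * Y t) $$ (d, c) +
            (y' t * mat_deriv n n K (y t) $$ (r, d)) * Y t $$ (d, c))) (at t)"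
          unfolding Z_def using rc t
          by (intro has_vector_derivative_sum has_vector_derivative_mult deriv[OF K] dY) auto
        also have "(\<Sum>d<n. K (y t) $$ (r, d) *
            (\<Omega> (\<gamma> t) (vector_derivative \<gamma> (at t)) * Y t) $$ (d, c) +
            (y' t * mat_deriv n n K (y t) $$ (r, d)) * Y t $$ (d, c)) =
          (K (y t) * ((y' t \<cdot>\<^sub>m B (y t)) * Y t)) $$ (r, c) + ((y' t \<cdot>\<^sub>m mat_deriv n n K (y t)) * Y t) $$ (r, c)"
        proof -
          have 1: "(y' t \<cdot>\<^sub>m B (y t)) * Y t \<in> carrier_mat n n" "y' t \<cdot>\<^sub>m mat_deriv n n K (y t) \<in> carrier_mat n n"
            using c by auto
          show ?thesis
            unfolding \<Omega>_eq[OF t(1)] mult_entry[OF c(1) 1(1) rc] mult_entry[OF 1(2) c(3) rc] sum.distrib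
            using rc by simp
        qed
        also have "\<dots> = 0"
          unfolding dK[OF yt] using c rc
          by (simp add: mat_ring del: index_mult_mat(1))
        finally show "(Z has_derivative (\<lambda>h. 0)) (at t within {0..1})"
          by (simp add: has_vector_derivative_def has_derivative_at_withinI)
      qed (use S S' in auto)
      then show "(K (y 1) * Y 1) $$ (r, c) = K (y 0) $$ (r, c)"
        using Z[of 0] Z[of 1] Y0(2) cK[of "y 0"] by (simp add: mat_one_mult)
    qed (use K Y[of 1] in auto)
    then have "F (y 1) * (K (y 1) * Y 1) = F (y 1) * K (y 0)" by simp
    moreover have "F (y 1) * (K (y 1) * Y 1) = Y 1"
      using mat_assoc[of "F (y 1)" "K (y 1)" "Y 1"] cF[of "y 1"] cK[of "y 1"] Y[of 1] inv(2)[OF yA, of 1]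
      by (simp add: mat_one_mult)
    ultimately show ?thesis using Y0(3) by simp
  qed
  show ?thesis
    unfolding parallel_transport_def \<gamma>_def[symmetric] using transports unique by (rule the_equality)
qed

text \<open>In the coordinate in which the segment from \<open>p\<close> to its mirror image is \<open>[-1/2, 1/2]\<close>, every
  generator follows the same path.\<close>

definition sigma_param :: "real \<Rightarrow> real \<Rightarrow> complex"
  where "sigma_param \<epsilon> = linepath (- 1 / 2) (- of_real \<epsilon> / 2) +++
    (part_circlepath 0 (\<epsilon> / 2) pi (2 * pi) +++ linepath (of_real \<epsilon> / 2) (1 / 2))"

lemma lower_half_circle:
  "part_circlepath 0 (\<epsilon> / 2) pi (2 * pi) t = - of_real (\<epsilon> / 2) * cis (pi * t)"
proof -
  have "part_circlepath 0 (\<epsilon> / 2) pi (2 * pi) t = of_real (\<epsilon> / 2) * cis (pi + pi * t)"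
    by (simp add: part_circlepath_def cis_conv_exp linepath_def algebra_simps)
  also have "cis (pi + pi * t) = - cis (pi * t)" by (simp add: complex_eq_iff)
  finally show ?thesis by simp
qed

lemma sigma_param_valid: "valid_path (sigma_param \<epsilon>)"
  unfolding sigma_param_def
  by (intro valid_path_join valid_path_linepath valid_path_part_circlepath)
    (simp_all add: pathstart_def pathfinish_def joinpaths_def lower_half_circle linepath_def)

lemma sigma_param_ends [simp]: "sigma_param \<epsilon> 0 = - 1 / 2" "sigma_param \<epsilon> 1 = 1 / 2"
  by (auto simp: sigma_param_def joinpaths_def linepath_def)

lemma sigma_param_image:
  assumes \<epsilon>: "0 < \<epsilon>" "\<epsilon> < 1" and t: "t \<in> {0..1}"
  shows "cmod (sigma_param \<epsilon> t) \<le> 1 / 2 \<and> Im (sigma_param \<epsilon> t) \<le> 0 \<and> sigma_param \<epsilon> t \<noteq> 0"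
proof -
  let ?P = "\<lambda>z. cmod z \<le> 1 / 2 \<and> Im z \<le> 0 \<and> z \<noteq> 0"
  have lin: "?P (linepath (of_real x) (of_real y) s)"
    if "s \<in> {0..1}" "(0 < x \<and> 0 < y) \<or> (x < 0 \<and> y < 0)" "\<bar>x\<bar> \<le> 1/2" "\<bar>y\<bar> \<le> 1/2" for x y s
  proof -
    have eq: "linepath (of_real x) (of_real y) s = complex_of_real ((1 - s) * x + s * y)"
      by (simp add: linepath_def scaleR_conv_of_real)
    have "\<bar>(1 - s) * x + s * y\<bar> \<le> (1 - s) * \<bar>x\<bar> + s * \<bar>y\<bar>"
      using that by (intro order_trans[OF abs_triangle_ineq]) (simp add: abs_mult)
    also have "\<dots> \<le> (1 - s) * (1/2) + s * (1/2)"
      using that by (intro add_mono mult_left_mono) auto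
    also have "\<dots> = 1/2" by (simp add: field_simps)
    finally have 1: "\<bar>(1 - s) * x + s * y\<bar> \<le> 1/2" .
    have pos: "0 < (1 - s) * u + s * v" if "0 < u" "0 < v" for u v
      using that \<open>s \<in> {0..1}\<close> by (cases "s = 1") (auto intro!: add_pos_nonneg)
    have "(1 - s) * x + s * y \<noteq> 0"
      using pos[of x y] pos[of "- x" "- y"] that(2) by (auto simp: algebra_simps)
    with 1 show ?thesis unfolding eq norm_of_real of_real_eq_0_iff Im_complex_of_real by simp
  qed
  have circ: "?P (part_circlepath 0 (\<epsilon> / 2) pi (2 * pi) s)" if "s \<in> {0..1}" for s
  proof -
    have "0 \<le> sin (pi * s)" using that by (intro sin_ge_zero) (auto simp: mult_left_le)
    then show ?thesis using \<epsilon> unfolding lower_half_circle by (auto simp: norm_mult)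
  qed
  have "- 1 / 2 = complex_of_real (- 1 / 2)" "- of_real \<epsilon> / 2 = complex_of_real (- \<epsilon> / 2)"
    "of_real \<epsilon> / 2 = complex_of_real (\<epsilon> / 2)" "1 / 2 = complex_of_real (1 / 2)" by auto
  note * = this
  show ?thesis
    unfolding sigma_param_def *
    using lin[of "2 * t" "- 1 / 2" "- \<epsilon> / 2"] circ[of "2 * (2 * t - 1)"]
      lin[of "2 * (2 * t - 1) - 1" "\<epsilon> / 2" "1 / 2"] \<epsilon> t
    by (auto simp: joinpaths_def)
qed

text \<open>In the coordinate \<open>y\<close> of \<^const>\<open>sigma_param\<close> the linear form \<open>f\<^sub>l\<close> is, up to a factor that is common
  to all \<open>l\<close>, the affine function with this constant term and slope.\<close>

definition weight_const :: "nat \<Rightarrow> nat \<Rightarrow> real \<Rightarrow> nat \<Rightarrow> real"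
  where "weight_const m i \<phi> l = cos \<phi> * sin (angle m i - angle m l)"

definition weight_slope :: "nat \<Rightarrow> nat \<Rightarrow> real \<Rightarrow> nat \<Rightarrow> real"
  where "weight_slope m i \<phi> l = - 2 * sin \<phi> * cos (angle m i - angle m l)"

text \<open>The form \<open>df\<^sub>l / f\<^sub>l\<close> in this coordinate; the base point makes the angle \<open>\<phi>\<close> with the line \<open>i\<close>.\<close>

definition weight :: "nat \<Rightarrow> nat \<Rightarrow> real \<Rightarrow> nat \<Rightarrow> complex \<Rightarrow> complex"
  where "weight m i \<phi> l y = of_real (weight_slope m i \<phi> l) /
    (of_real (weight_const m i \<phi> l) + y * of_real (weight_slope m i \<phi> l))"

definition polar :: "real \<Rightarrow> real \<Rightarrow> c2"
  where "polar r \<theta> = (of_real (r * cos \<theta>), of_real (r * sin \<theta>))"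

lemma reflection_polar: "reflection m i (polar r \<theta>) = polar r (2 * angle m i - \<theta>)"
  by (auto simp: reflection_def polar_def cos_diff sin_diff complex_eq_iff algebra_simps)

lemma lform_polar: "lform m l (polar r \<theta>) = of_real (r * sin (\<theta> - angle m l))"
  by (auto simp: lform_def polar_def sin_diff complex_eq_iff algebra_simps)

lemma lform_add: "lform m l (z + w) = lform m l z + lform m l w"
  by (cases z; cases w) (auto simp: lform_def algebra_simps)

lemma lform_cscale: "lform m l (cscale c z) = c * lform m l z"
  by (cases z) (auto simp: lform_def cscale_def algebra_simps)

lemma lform_scaleR: "lform m l (c *\<^sub>R z) = of_real c * lform m l z"
  by (cases z) (auto simp: lform_def algebra_simps scaleR_conv_of_real)

lemma lform_diff: "lform m l (z - w) = lform m l z - lform m l w"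
  by (cases z; cases w) (auto simp: lform_def algebra_simps)

lemma omega_weight:
  fixes r \<theta> :: real and m i :: nat
  defines "p \<equiv> polar r \<theta>" and "\<phi> \<equiv> \<theta> - angle m i"
  defines "a \<equiv> reflection m i p - p"
  assumes r: "0 < r"
  shows "omega m l (p + (1 / 2) *\<^sub>R a + cscale y a) (cscale c a) = c * weight m i \<phi> l y"
proof -
  define \<delta> where "\<delta> = angle m i - angle m l"
  have p: "lform m l p = of_real (r * sin (\<delta> + \<phi>))"
    by (simp add: p_def lform_polar \<delta>_def \<phi>_def)
  have a: "lform m l a = of_real (r * weight_slope m i \<phi> l)"
  proof -
    have "lform m l a = of_real (r * sin (\<delta> - \<phi>)) - of_real (r * sin (\<delta> + \<phi>))"
      unfolding a_def lform_diff p by (simp add: p_def reflection_polar lform_polar \<delta>_def \<phi>_def algebra_simps)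
    also have "\<dots> = of_real (r * sin (\<delta> - \<phi>) - r * sin (\<delta> + \<phi>))" by simp
    also have "r * sin (\<delta> - \<phi>) - r * sin (\<delta> + \<phi>) = r * weight_slope m i \<phi> l"
      by (simp add: weight_slope_def \<delta>_def[symmetric] sin_add sin_diff algebra_simps)
    finally show ?thesis .
  qed
  have "lform m l p + of_real (1 / 2) * lform m l a =
      of_real (r * sin (\<delta> + \<phi>) + (1 / 2) * (r * weight_slope m i \<phi> l))"
    unfolding p a by simp
  also have "r * sin (\<delta> + \<phi>) + (1 / 2) * (r * weight_slope m i \<phi> l) = r * weight_const m i \<phi> l"
    by (simp add: weight_slope_def weight_const_def \<delta>_def[symmetric] sin_add algebra_simps)
  finally have "lform m l (p + (1 / 2) *\<^sub>R a + cscale y a) =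
      of_real (r * weight_const m i \<phi> l) + y * of_real (r * weight_slope m i \<phi> l)"
    unfolding lform_add lform_cscale lform_scaleR a by simp
  also have "\<dots> = of_real r * (of_real (weight_const m i \<phi> l) + y * of_real (weight_slope m i \<phi> l))"
    by (simp add: algebra_simps)
  finally show ?thesis
    unfolding omega_def lform_cscale a using r by (simp add: weight_def)
qed

lemma sigma_path_eq:
  fixes r \<theta> :: real and m i :: nat
  defines "p \<equiv> polar r \<theta>"
  defines "a \<equiv> reflection m i p - p"
  assumes r: "0 < r" and \<phi>: "sin (\<theta> - angle m i) \<noteq> 0"
  shows "sigma_path m p \<epsilon> i = (\<lambda>t. p + (1 / 2) *\<^sub>R a + cscale (sigma_param \<epsilon> t) a)"
proof -
  define \<eta> where "\<eta> = angle m i"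
  define b where "b = p + ((1 - \<epsilon>) / 2) *\<^sub>R a"
  define s where "s = - 2 * r * sin (\<theta> - \<eta>)"
  have s: "s \<noteq> 0" using r \<phi> by (simp add: s_def \<eta>_def)
  have diffs: "cos (2 * \<eta> - \<theta>) - cos \<theta> = 2 * sin (\<theta> - \<eta>) * sin \<eta>"
    "sin (2 * \<eta> - \<theta>) - sin \<theta> = - 2 * sin (\<theta> - \<eta>) * cos \<eta>"
    "cos (2 * \<eta> - \<theta>) + cos \<theta> = 2 * cos (\<theta> - \<eta>) * cos \<eta>"
    "sin (2 * \<eta> - \<theta>) + sin \<theta> = 2 * cos (\<theta> - \<eta>) * sin \<eta>"
  proof -
    have "2 * \<eta> - \<theta> = \<eta> - (\<theta> - \<eta>)" "\<theta> = \<eta> + (\<theta> - \<eta>)" by auto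
    then have *: "cos (2 * \<eta> - \<theta>) = cos (\<eta> - (\<theta> - \<eta>))" "sin (2 * \<eta> - \<theta>) = sin (\<eta> - (\<theta> - \<eta>))"
      "cos \<theta> = cos (\<eta> + (\<theta> - \<eta>))" "sin \<theta> = sin (\<eta> + (\<theta> - \<eta>))" by simp_all
    show "cos (2 * \<eta> - \<theta>) - cos \<theta> = 2 * sin (\<theta> - \<eta>) * sin \<eta>"
      "sin (2 * \<eta> - \<theta>) - sin \<theta> = - 2 * sin (\<theta> - \<eta>) * cos \<eta>"
      "cos (2 * \<eta> - \<theta>) + cos \<theta> = 2 * cos (\<theta> - \<eta>) * cos \<eta>"
      "sin (2 * \<eta> - \<theta>) + sin \<theta> = 2 * cos (\<theta> - \<eta>) * sin \<eta>"
      unfolding * cos_add[of \<eta> "\<theta> - \<eta>"] sin_add[of \<eta> "\<theta> - \<eta>"] cos_diff[of \<eta> "\<theta> - \<eta>"] sin_diff[of \<eta> "\<theta> - \<eta>"]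
      by (simp_all add: algebra_simps)
  qed
  have a: "a = (of_real (- s * sin \<eta>), of_real (s * cos \<eta>))"
  proof -
    have "a = (of_real (r * (cos (2 * \<eta> - \<theta>) - cos \<theta>)), of_real (r * (sin (2 * \<eta> - \<theta>) - sin \<theta>)))"
      unfolding a_def p_def reflection_polar by (simp add: polar_def \<eta>_def algebra_simps)
    then show ?thesis unfolding diffs by (simp add: s_def algebra_simps)
  qed
  define d where "d = r * cos (\<theta> - \<eta>)"
  have mid: "p + (1 / 2) *\<^sub>R a = (of_real (d * cos \<eta>), of_real (d * sin \<eta>))"
  proof -
    have "p + (1 / 2) *\<^sub>R a = (of_real (r * (cos (2 * \<eta> - \<theta>) + cos \<theta>) / 2), of_real (r * (sin (2 * \<eta> - \<theta>) + sin \<theta>) / 2))"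
      unfolding a_def p_def reflection_polar by (simp add: polar_def \<eta>_def scaleR_conv_of_real field_simps)
    then show ?thesis unfolding diffs by (simp add: d_def algebra_simps)
  qed
  have b: "b = p + (1 / 2) *\<^sub>R a - (\<epsilon> / 2) *\<^sub>R a"
    by (simp add: b_def algebra_simps diff_divide_distrib)
  have inner_a: "inner a a = s\<^sup>2"
  proof -
    have "inner a a = (s * sin \<eta>)\<^sup>2 + (s * cos \<eta>)\<^sup>2"
      by (simp add: a inner_complex_def power2_eq_square)
    also have "\<dots> = s\<^sup>2 * ((sin \<eta>)\<^sup>2 + (cos \<eta>)\<^sup>2)"
      by (simp only: power_mult_distrib distrib_left)
    finally show ?thesis by simp
  qed
  have "inner (p + (1 / 2) *\<^sub>R a) a = 0"
    unfolding mid by (simp add: a inner_complex_def)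
  then have "inner b a = - (\<epsilon> / 2) * inner a a"
    unfolding b by (simp add: inner_diff_left)
  then have quot: "inner b a / inner a a = - \<epsilon> / 2"
    using s by (simp add: inner_a)
  have refl_p: "reflection m i p = p + a" by (simp add: a_def)
  have refl_b: "reflection m i b = p + (1 / 2) *\<^sub>R a + (\<epsilon> / 2) *\<^sub>R a"
  proof -
    have lin: "reflection m i (z + c *\<^sub>R w) = reflection m i z + c *\<^sub>R reflection m i w" for z w c
      by (cases z; cases w) (simp add: reflection_def scaleR_conv_of_real algebra_simps)
    have "reflection m i a = - a"
    proof -
      have "reflection m i (reflection m i p) = p" by (simp add: p_def reflection_polar)
      then show ?thesis using lin[of "reflection m i p" "-1" p] by (simp add: a_def)
    qed
    then have "reflection m i b = p + a - ((1 - \<epsilon>) / 2) *\<^sub>R a"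
      by (simp add: b_def lin refl_p)
    also have "\<dots> = p + (1 / 2) *\<^sub>R a + (\<epsilon> / 2) *\<^sub>R a"
      by (simp add: algebra_simps diff_divide_distrib) (simp flip: scaleR_add_left)
    finally show ?thesis .
  qed
  have cs: "cscale (of_real c) a = c *\<^sub>R a" for c
    by (cases a) (simp add: cscale_def scaleR_conv_of_real)
  have cs_lin: "cscale (x + y) a = cscale x a + cscale y a" "cscale (x - y) a = cscale x a - cscale y a"
    "cscale (- x) a = - cscale x a" for x y
    by (cases a; simp add: cscale_def algebra_simps)+
  have lin0: "q + cscale (linepath (of_real x) (of_real y) t) a =
      linepath (q + x *\<^sub>R a) (q + y *\<^sub>R a) t" for q x y t
    by (cases q; cases a) (simp add: cscale_def linepath_def scaleR_conv_of_real algebra_simps)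
  note lin1 = lin0[of "p + (1 / 2) *\<^sub>R a"]
  have seg1: "p + (1 / 2) *\<^sub>R a + cscale (linepath (- 1 / 2) (- of_real \<epsilon> / 2) t) a = linepath p b t" for t
    using lin1[of "- 1 / 2" "- \<epsilon> / 2" t] by (simp add: b)
  have mid2: "p + (1 / 2) *\<^sub>R a + (1 / 2) *\<^sub>R a = p + a"
    by (simp add: add.assoc flip: scaleR_add_left)
  have seg3: "p + (1 / 2) *\<^sub>R a + cscale (linepath (of_real \<epsilon> / 2) (1 / 2) t) a =
      linepath (reflection m i b) (reflection m i p) t" for t
    using lin1[of "\<epsilon> / 2" "1 / 2" t] mid2 unfolding refl_b refl_p by simp
  have seg2: "p + (1 / 2) *\<^sub>R a + cscale (part_circlepath 0 (\<epsilon> / 2) pi (2 * pi) t) a = half_circle a b t" for t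
  proof -
    have e: "part_circlepath 0 (\<epsilon> / 2) pi (2 * pi) t = - of_real (\<epsilon> / 2) * exp (of_real pi * \<i> * of_real t)"
    proof -
      have "cis (pi * t) = exp (of_real pi * \<i> * of_real t)" by (simp add: cis_conv_exp mult_ac)
      then show ?thesis by (simp add: lower_half_circle)
    qed
    have "half_circle a b t = p + (1 / 2) *\<^sub>R a - (\<epsilon> / 2) *\<^sub>R a -
        cscale ((1 - exp (of_real pi * \<i> * of_real t)) * of_real (- \<epsilon> / 2)) a"
      unfolding half_circle_def quot by (subst b) (rule refl)
    also have "\<dots> = p + (1 / 2) *\<^sub>R a + cscale (- of_real (\<epsilon> / 2) * exp (of_real pi * \<i> * of_real t)) a"
      by (cases p; cases a) (simp add: cscale_def scaleR_conv_of_real algebra_simps)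
    finally show ?thesis unfolding e by simp
  qed
  show ?thesis
    unfolding sigma_path_def Let_def a_def[symmetric] b_def[symmetric]
    by (rule ext) (simp add: joinpaths_def sigma_param_def seg1[symmetric] seg2[symmetric] seg3[symmetric])
qed

theorem sigma_transport:
  assumes r: "0 < r" and \<phi>: "\<phi> = \<theta> - angle m i" "sin \<phi> \<noteq> 0" and \<epsilon>: "0 < \<epsilon>" "\<epsilon> < 1"
    and A: "open A" "\<And>y. cmod y \<le> 1 / 2 \<Longrightarrow> Im y \<le> 0 \<Longrightarrow> y \<noteq> 0 \<Longrightarrow> y \<in> A"
    and FK: "regular_pair n (\<lambda>y. lin_comb n n {..<m} (\<lambda>l. \<kappa> * weight m i \<phi> l y) X) A F K"
  shows "parallel_transport n (connection m n \<kappa> X) (sigma_path m (polar r \<theta>) \<epsilon> i) =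
    F (1 / 2) * K (- 1 / 2)"
proof -
  have "sigma_param \<epsilon> piecewise_C1_differentiable_on {0..1}"
    using sigma_param_valid by (simp add: valid_path_def)
  then obtain S where S: "finite S" "sigma_param \<epsilon> C1_differentiable_on {0..1} - S"
    and cont: "continuous_on {0..1} (sigma_param \<epsilon>)"
    by (auto simp: piecewise_C1_differentiable_on_def)
  have "parallel_transport n (connection m n \<kappa> X) (\<lambda>t. polar r \<theta> +
      (1 / 2) *\<^sub>R (reflection m i (polar r \<theta>) - polar r \<theta>) +
      cscale (sigma_param \<epsilon> t) (reflection m i (polar r \<theta>) - polar r \<theta>)) =
    F (sigma_param \<epsilon> 1) * K (sigma_param \<epsilon> 0)"
  proof (rule parallel_transport_line[OF A(1) FK _ cont _ S(1)])
    show "sigma_param \<epsilon> ` {0..1} \<subseteq> A"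
      using sigma_param_image[OF \<epsilon>] A(2) by blast
    show "sigma_param \<epsilon> differentiable at t" if "t \<in> {0<..<1} - S" for t
      using S(2) that by (auto simp: C1_differentiable_on_eq)
  qed (auto simp: connection_lin_comb omega_weight[OF r] \<phi> lin_comb_smult mult_ac)
  then show ?thesis
    using sigma_path_eq[OF r, of \<theta> m i \<epsilon>] \<phi> by simp
qed

text \<open>The base point lies in a chamber that the line \<open>i\<close> bounds. Hence no line other than \<open>i\<close> meets the
  segment from the base point to its mirror image, and a zero of \<open>f\<^sub>l\<close>, which is real, lies outside of
  the closed disc of radius \<open>1 / 2\<close>.\<close>

lemma weight_slope_less_const:
  assumes m: "3 \<le> m" and \<theta>: "0 < \<theta>" "\<theta> < pi / real m" and i: "i < 2" and l: "l < m" "l \<noteq> i"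
  shows "\<bar>weight_slope m i (\<theta> - angle m i) l\<bar> / 2 < \<bar>weight_const m i (\<theta> - angle m i) l\<bar>"
proof -
  define \<phi> where "\<phi> = \<theta> - angle m i"
  define \<delta> where "\<delta> = angle m i - angle m l"
  have mpos: "0 < real m" using m by simp
  have "0 < sin (\<delta> + \<phi>) * sin (\<delta> - \<phi>)"
  proof -
    have eqs: "\<delta> + \<phi> = \<theta> - real l * (pi / real m)" "\<delta> - \<phi> = 2 * real i * (pi / real m) - \<theta> - real l * (pi / real m)"
      by (simp_all add: \<delta>_def \<phi>_def angle_def)
    define h where "h = pi / real m"
    have h: "0 < h" "real m * h = pi" "\<theta> < h" using mpos \<theta> by (auto simp: h_def)
    have lm: "real l * h \<le> (real m - 1) * h" using l h by (intro mult_right_mono) auto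
    have m3: "3 * h \<le> pi" using mult_right_mono[of 3 "real m" h] m h by simp
    define L where "L = real l * h"
    have Lm: "L \<le> pi - h" using lm h by (simp add: L_def algebra_simps)
    have neg: "sin x < 0" if "- pi < x" "x < 0" for x
      using sin_gt_zero[of "- x"] that by simp
    consider "i = 0" "1 \<le> l" | "i = 1" "l = 0" | "i = 1" "2 \<le> l" using i l by force
    then show ?thesis
    proof cases
      case 1
      then have "h \<le> L" using h by (simp add: L_def)
      moreover have "2 * real i * h = 0" using 1 by simp
      ultimately show ?thesis unfolding eqs h_def[symmetric] L_def[symmetric] using h Lm \<theta>(1)
        by (intro mult_neg_neg neg) linarith+
    next
      case 2
      then show ?thesis unfolding eqs h_def[symmetric] using h \<theta> m3
        by (intro mult_pos_pos sin_gt_zero) auto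
    next
      case 3
      then have "2 * h \<le> L" unfolding L_def using h by (intro mult_right_mono) auto
      moreover have "2 * real i * h = 2 * h" using 3 by simp
      ultimately show ?thesis unfolding eqs h_def[symmetric] L_def[symmetric] using h Lm \<theta>(1)
        by (intro mult_neg_neg neg) linarith+
    qed
  qed
  also have "sin (\<delta> + \<phi>) * sin (\<delta> - \<phi>) = (weight_const m i \<phi> l)\<^sup>2 - (weight_slope m i \<phi> l / 2)\<^sup>2"
    by (simp add: weight_const_def weight_slope_def \<delta>_def[symmetric] sin_add sin_diff power2_eq_square algebra_simps)
  finally have "\<bar>weight_slope m i \<phi> l / 2\<bar> < \<bar>weight_const m i \<phi> l\<bar>"
    using power_less_imp_less_base[of "\<bar>weight_slope m i \<phi> l / 2\<bar>" 2 "\<bar>weight_const m i \<phi> l\<bar>"]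
    by (simp only: power2_abs)
  then show ?thesis by (simp add: \<phi>_def)
qed

section \<open>Dihedral systems of matrices\<close>

text \<open>The index of the line into which the reflection in the line \<open>t\<close> takes the line \<open>u\<close>.\<close>

definition mirror :: "nat \<Rightarrow> nat \<Rightarrow> nat \<Rightarrow> nat"
  where "mirror m t u = (2 * t + (m - u)) mod m"

lemma mirror_less: "0 < m \<Longrightarrow> mirror m t u < m"
  by (simp add: mirror_def)

lemma mirror_int: "u < m \<Longrightarrow> int (mirror m t u) = (2 * int t - int u) mod int m"
proof -
  assume "u < m"
  then have "int (2 * t + (m - u)) = (2 * int t - int u) + int m" by simp
  then show ?thesis unfolding mirror_def zmod_int by (metis mod_add_self2)
qed

lemma mirror_mirror: "u < m \<Longrightarrow> mirror m t (mirror m t u) = u"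
proof -
  assume u: "u < m"
  then have "int (mirror m t (mirror m t u)) = (2 * int t - (2 * int t - int u) mod int m) mod int m"
    by (simp add: mirror_int mirror_less)
  also have "\<dots> = int u mod int m" by (simp add: mod_diff_right_eq)
  also have "\<dots> = int u" using u by simp
  finally show ?thesis by simp
qed

lemma mirror_self: "t < m \<Longrightarrow> mirror m t t = t"
  by (simp add: mirror_def)

lemma mirror_bij: "0 < m \<Longrightarrow> bij_betw (mirror m t) {..<m} {..<m}"
  by (rule bij_betw_byWitness[where f' = "mirror m t"]) (auto simp: mirror_mirror mirror_less)

lemma angle_mirror:
  assumes "l < m"
  shows "\<exists>j::int. angle m (mirror m i l) = 2 * angle m i - angle m l + of_int j * pi"
proof -
  define d where "d = (2 * int i - int l) div int m"
  have "int (mirror m i l) = 2 * int i - int l - int m * d"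
    using mirror_int[OF assms, of i] by (simp add: d_def minus_mult_div_eq_mod)
  then have eq: "real (mirror m i l) = 2 * real i - real l - real m * of_int d"
    by (metis of_int_diff of_int_mult of_int_numeral of_int_of_nat_eq)
  have "angle m (mirror m i l) = 2 * angle m i - angle m l + of_int (- d) * pi"
    unfolding angle_def eq using assms by (simp add: add_divide_distrib diff_divide_distrib algebra_simps)
  then show ?thesis by blast
qed

lemma weight_mirror:
  assumes "l < m"
  shows "weight m i \<phi> (mirror m i l) (- y) = - weight m i \<phi> l y"
proof -
  obtain j :: int where j: "angle m (mirror m i l) = 2 * angle m i - angle m l + of_int j * pi"
    using angle_mirror[OF assms] by blast
  define \<delta> where "\<delta> = angle m i - angle m l"
  define c where "c = cos (of_int j * pi)"
  have s0: "sin (of_int j * pi) = 0" by (metis mult.commute sin_npi_int)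
  then have c: "c\<^sup>2 = 1" unfolding c_def using sin_cos_squared_add[of "of_int j * pi"] by simp
  have "angle m i - angle m (mirror m i l) = - (\<delta> + of_int j * pi)" by (simp add: j \<delta>_def)
  then have "sin (angle m i - angle m (mirror m i l)) = - c * sin \<delta>"
    "cos (angle m i - angle m (mirror m i l)) = c * cos \<delta>"
    by (simp_all only: sin_minus cos_minus sin_add cos_add s0) (simp_all add: c_def)
  then have *: "weight_const m i \<phi> (mirror m i l) = - c * weight_const m i \<phi> l"
    "weight_slope m i \<phi> (mirror m i l) = c * weight_slope m i \<phi> l"
    by (simp_all add: weight_const_def weight_slope_def \<delta>_def)
  define D where "D = of_real (weight_const m i \<phi> l) + y * of_real (weight_slope m i \<phi> l)"
  have "of_real (- c * weight_const m i \<phi> l) + - y * of_real (c * weight_slope m i \<phi> l) = - (of_real c * D)"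
    by (simp add: D_def algebra_simps)
  moreover have "c \<noteq> 0" using c by auto
  ultimately show ?thesis unfolding weight_def * D_def[symmetric] by simp
qed

text \<open>The matrices by which the reflections and the elements \<open>e\<close> of the Brauer type algebra act;
  both the given representation and the Lawrence-Krammer one are of this kind.\<close>

locale brauer_matrices =
  fixes m n :: nat and k \<alpha> :: "nat \<Rightarrow> complex" and S e :: "nat \<Rightarrow> complex mat"
  assumes m: "3 \<le> m"
    and S_carrier: "t < m \<Longrightarrow> S t \<in> carrier_mat n n"
    and e_carrier: "t < m \<Longrightarrow> e t \<in> carrier_mat n n"
    and S_square: "t < m \<Longrightarrow> S t * S t = 1\<^sub>m n"
    and S_triple: "t < m \<Longrightarrow> u < m \<Longrightarrow> v < m \<Longrightarrow> S t * S u * S v = S ((t + (m - u) + v) mod m)"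
    and S_e: "t < m \<Longrightarrow> u < m \<Longrightarrow> S t * e u = e (mirror m t u) * S t"
    and S_fix: "t < m \<Longrightarrow> u < m \<Longrightarrow> mirror m t u = u \<Longrightarrow> S t * e u = e u"
    and e_square: "t < m \<Longrightarrow> e t * e t = \<alpha> t \<cdot>\<^sub>m e t"
    and e_mult: "t < m \<Longrightarrow> u < m \<Longrightarrow> t \<noteq> u \<Longrightarrow>
      e t * e u = lin_comb n n {v. v < m \<and> mirror m v u = t} k S * e u"
    and k_mirror: "t < m \<Longrightarrow> u < m \<Longrightarrow> k (mirror m t u) = k u"
    and \<alpha>_mirror: "t < m \<Longrightarrow> u < m \<Longrightarrow> \<alpha> (mirror m t u) = \<alpha> u"
begin

lemma dims [simp]:
  "t < m \<Longrightarrow> dim_row (S t) = n" "t < m \<Longrightarrow> dim_col (S t) = n"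
  "t < m \<Longrightarrow> dim_row (e t) = n" "t < m \<Longrightarrow> dim_col (e t) = n"
  using S_carrier[of t] e_carrier[of t] by auto

lemma m_pos [simp]: "0 < m" "0 < m \<or> P" "m \<noteq> 0" using m by auto

lemma mirror_m [simp]: "mirror m t u < m" by (simp add: mirror_less)

lemma S_conj: "t < m \<Longrightarrow> u < m \<Longrightarrow> S t * S u = S (mirror m t u) * S t"
proof -
  assume t: "t < m" and u: "u < m"
  have "S (mirror m t u) = S t * S u * S t"
    using S_triple[OF t u t] by (simp add: mirror_def mult_2 add.commute add.left_commute)
  then have "S (mirror m t u) * S t = S t * S u * (S t * S t)"
    using t u by (simp add: mat_assoc)
  then show ?thesis using t u by (simp add: S_square mat_one_mult)
qed

lemma e_S_fix: "t < m \<Longrightarrow> u < m \<Longrightarrow> mirror m t u = u \<Longrightarrow> e u * S t = e u"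
  using S_e[of t u] S_fix[of t u] by simp

definition res :: "nat \<Rightarrow> complex mat"
  where "res l = k l \<cdot>\<^sub>m S l - e l"

lemma res_carrier: "l < m \<Longrightarrow> res l \<in> carrier_mat n n"
  using S_carrier e_carrier by (auto simp: res_def)

lemma res_dim [simp]: "l < m \<Longrightarrow> dim_row (res l) = n" "l < m \<Longrightarrow> dim_col (res l) = n"
  by (auto simp: res_def)

lemma res_conj: "t < m \<Longrightarrow> u < m \<Longrightarrow> S t * res u = res (mirror m t u) * S t"
  by (simp add: res_def mat_ring S_conj[of t u] S_e[of t u] k_mirror)

lemma res_intertwine:
  assumes "brauer_matrices m n' k \<alpha> S' e'" "f \<in> carrier_mat n n'" "l < m"
    "S l * f = f * S' l" "e l * f = f * e' l"
  shows "res l * f = f * brauer_matrices.res k S' e' l"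
proof -
  interpret V': brauer_matrices m n' k \<alpha> S' e' by (rule assms(1))
  have f: "dim_row f = n" "dim_col f = n'" using assms(2) by auto
  show ?thesis using assms(3) f by (simp add: res_def V'.res_def mat_ring assms(4,5))
qed

definition total :: "complex mat"
  where "total = lin_comb n n {..<m} (\<lambda>_. 1) res"

lemma total_dim [simp]: "dim_row total = n" "dim_col total = n" "total \<in> carrier_mat n n"
  by (auto simp: total_def)

lemma lin_comb_res_conj:
  assumes t: "t < m" and c: "\<And>l. l < m \<Longrightarrow> c' (mirror m t l) = c l"
  shows "S t * lin_comb n n {..<m} c res = lin_comb n n {..<m} c' res * S t"
proof -
  have "S t * lin_comb n n {..<m} c res = lin_comb n n {..<m} c (\<lambda>l. S t * res l)"
    by (rule lin_comb_mult_left) (use res_carrier S_carrier t in auto)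
  also have "\<dots> = lin_comb n n {..<m} (\<lambda>l. c' (mirror m t l)) (\<lambda>l. res (mirror m t l) * S t)"
    using t c by (intro lin_comb_cong) (auto simp: res_conj[OF t])
  also have "\<dots> = lin_comb n n {..<m} c' (\<lambda>l. res l * S t)"
    by (rule lin_comb_reindex[symmetric]) (rule mirror_bij, simp)
  also have "\<dots> = lin_comb n n {..<m} c' res * S t"
    by (rule lin_comb_mult_right[symmetric]) (use res_carrier S_carrier t in auto)
  finally show ?thesis .
qed

lemma total_S: "t < m \<Longrightarrow> S t * total = total * S t"
  unfolding total_def by (rule lin_comb_res_conj) auto

lemma e_mult_right:
  assumes "t < m" "u < m" "t \<noteq> u"
  shows "e t * e u = e t * lin_comb n n {v. v < m \<and> mirror m v u = t} k S"
proof -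
  have "e t * e u = lin_comb n n {v. v < m \<and> mirror m v u = t} k (\<lambda>v. S v * e u)"
    unfolding e_mult[OF assms]
    by (rule lin_comb_mult_right) (use S_carrier e_carrier assms in auto)
  also have "\<dots> = lin_comb n n {v. v < m \<and> mirror m v u = t} k (\<lambda>v. e t * S v)"
    using assms by (intro lin_comb_cong refl) (auto simp: S_e[OF _ assms(2)])
  also have "\<dots> = e t * lin_comb n n {v. v < m \<and> mirror m v u = t} k S"
    by (rule lin_comb_mult_left[symmetric]) (use S_carrier e_carrier assms in auto)
  finally show ?thesis .
qed

text \<open>The product of \<open>e\<^sub>l\<close> and \<open>e\<^sub>i\<close> is the sum of \<open>k\<^sub>t S\<^sub>t e\<^sub>i\<close> over the reflections that take
  the line \<open>i\<close> to the line \<open>l\<close>. Summed over \<open>l\<close>, this exhausts all reflections, so only the terms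
  with \<open>l = i\<close> survive in the product of the total residue and \<open>e\<^sub>i\<close>.\<close>

lemma total_e:
  assumes i: "i < m"
  defines "c \<equiv> (\<Sum>t | t < m \<and> mirror m t i = i. k t) - \<alpha> i"
  shows "total * e i = c \<cdot>\<^sub>m e i" and "e i * total = c \<cdot>\<^sub>m e i"
proof -
  have *: "(\<Sum>l<m. k l * h l - g l) = c * x"
    if g: "\<And>l. l < m \<Longrightarrow> g l = (if l = i then \<alpha> i * x else (\<Sum>t | t < m \<and> mirror m t i = l. k t * h t))"
      and h: "\<And>t. t < m \<Longrightarrow> mirror m t i = i \<Longrightarrow> h t = x"
    for g h :: "nat \<Rightarrow> complex" and x
  proof -
    have "(\<Sum>l<m. k l * h l) = (\<Sum>l<m. \<Sum>t\<in>{t\<in>{..<m}. mirror m t i = l}. k t * h t)"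
      by (rule sum.group[symmetric]) auto
    also have "\<dots> - (\<Sum>l<m. g l) = (\<Sum>l<m. (\<Sum>t | t < m \<and> mirror m t i = l. k t * h t) - g l)"
      by (simp add: sum_subtractf)
    also have "\<dots> = (\<Sum>l<m. if l = i then c * x else 0)"
    proof (intro sum.cong refl)
      fix l assume l: "l \<in> {..<m}"
      have "(\<Sum>t | t < m \<and> mirror m t i = i. k t * h t) = (\<Sum>t | t < m \<and> mirror m t i = i. k t) * x"
        unfolding sum_distrib_right by (intro sum.cong refl) (auto simp: h)
      then show "(\<Sum>t | t < m \<and> mirror m t i = l. k t * h t) - g l = (if l = i then c * x else 0)"
        using l g[of l] by (auto simp: c_def algebra_simps)
    qed
    also have "\<dots> = c * x" using i by simp
    finally show ?thesis by (simp add: sum_subtractf)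
  qed
  show "total * e i = c \<cdot>\<^sub>m e i"
  proof (rule eq_matI)
    fix r s assume "r < dim_row (c \<cdot>\<^sub>m e i)" "s < dim_col (c \<cdot>\<^sub>m e i)"
    then have rs: "r < n" "s < n" using i by auto
    have "total * e i = lin_comb n n {..<m} (\<lambda>_. 1) (\<lambda>l. res l * e i)"
      unfolding total_def by (rule lin_comb_mult_right) (use res_carrier e_carrier i in auto)
    then have "(total * e i) $$ (r, s) = (\<Sum>l<m. (res l * e i) $$ (r, s))"
      using rs by simp
    also have "\<dots> = (\<Sum>l<m. k l * (S l * e i) $$ (r, s) - (e l * e i) $$ (r, s))"
      using rs i by (intro sum.cong) (auto simp: res_def mat_ring simp del: index_mult_mat(1))
    also have "\<dots> = c * e i $$ (r, s)"
    proof (rule *)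
      fix l assume l: "l < m"
      show "(e l * e i) $$ (r, s) = (if l = i then \<alpha> i * e i $$ (r, s) else
          (\<Sum>t | t < m \<and> mirror m t i = l. k t * (S t * e i) $$ (r, s)))"
      proof (cases "l = i")
        case False
        have "e l * e i = lin_comb n n {t. t < m \<and> mirror m t i = l} k (\<lambda>t. S t * e i)"
          unfolding e_mult[OF l i False] by (rule lin_comb_mult_right) (use S_carrier e_carrier i in auto)
        then show ?thesis using False rs by (simp del: index_mult_mat(1))
      qed (use i rs in \<open>simp add: e_square del: index_mult_mat(1)\<close>)
    qed (use i S_fix in auto)
    finally show "(total * e i) $$ (r, s) = (c \<cdot>\<^sub>m e i) $$ (r, s)" using rs i by simp
  qed (use i in auto)
  show "e i * total = c \<cdot>\<^sub>m e i"
  proof (rule eq_matI)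
    fix r s assume "r < dim_row (c \<cdot>\<^sub>m e i)" "s < dim_col (c \<cdot>\<^sub>m e i)"
    then have rs: "r < n" "s < n" using i by auto
    have "e i * total = lin_comb n n {..<m} (\<lambda>_. 1) (\<lambda>l. e i * res l)"
      unfolding total_def by (rule lin_comb_mult_left) (use res_carrier e_carrier i in auto)
    then have "(e i * total) $$ (r, s) = (\<Sum>l<m. (e i * res l) $$ (r, s))"
      using rs by simp
    also have "\<dots> = (\<Sum>l<m. k l * (e i * S l) $$ (r, s) - (e i * e l) $$ (r, s))"
      using rs i by (intro sum.cong) (auto simp: res_def mat_ring simp del: index_mult_mat(1))
    also have "\<dots> = c * e i $$ (r, s)"
    proof (rule *)
      fix l assume l: "l < m"
      show "(e i * e l) $$ (r, s) = (if l = i then \<alpha> i * e i $$ (r, s) else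
          (\<Sum>t | t < m \<and> mirror m t i = l. k t * (e i * S t) $$ (r, s)))"
      proof (cases "l = i")
        case False
        have "{t. t < m \<and> mirror m t l = i} = {t. t < m \<and> mirror m t i = l}"
          using i l mirror_mirror by fastforce
        then have "e i * e l = lin_comb n n {t. t < m \<and> mirror m t i = l} k (\<lambda>t. e i * S t)"
          using e_mult_right[OF i l] False
          by (subst lin_comb_mult_left[of _ _ n n _ n, symmetric]) (use S_carrier e_carrier i in auto)
        then show ?thesis using False rs by (simp del: index_mult_mat(1))
      qed (use i rs in \<open>simp add: e_square del: index_mult_mat(1)\<close>)
    qed (use i e_S_fix in auto)
    finally show "(e i * total) $$ (r, s) = (c \<cdot>\<^sub>m e i) $$ (r, s)" using rs i by simp
  qed (use i in auto)
qed

text \<open>This is the flatness of the connection.\<close>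

theorem total_res: "l < m \<Longrightarrow> total * res l = res l * total"
  by (simp add: res_def mat_ring total_S total_e)

definition tri :: "nat \<Rightarrow> complex \<Rightarrow> complex \<Rightarrow> complex \<Rightarrow> complex mat"
  where "tri i x y z = x \<cdot>\<^sub>m 1\<^sub>m n + y \<cdot>\<^sub>m S i + z \<cdot>\<^sub>m e i"

lemma tri_dim [simp]: "i < m \<Longrightarrow> dim_row (tri i x y z) = n" "i < m \<Longrightarrow> dim_col (tri i x y z) = n"
  by (auto simp: tri_def)

lemma tri_carrier: "i < m \<Longrightarrow> tri i x y z \<in> carrier_mat n n"
  using e_carrier by (auto simp: tri_def)

text \<open>The combinations of \<open>1\<close>, \<open>S\<^sub>i\<close> and \<open>e\<^sub>i\<close> form a commutative algebra, in which the local
  computations at the line \<open>i\<close> take place.\<close>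

lemma tri_mult:
  assumes i: "i < m"
  shows "tri i x y z * tri i x' y' z' =
    tri i (x * x' + y * y') (x * y' + y * x') ((x + y) * z' + z * (x' + y') + \<alpha> i * z * z')"
proof -
  have "S i * e i = e i" "e i * S i = e i"
    using i S_fix[of i i] e_S_fix[of i i] by (simp_all add: mirror_self)
  then show ?thesis
    using i by (intro eq_matI) (simp_all add: tri_def mat_ring S_square e_square algebra_simps del: index_mult_mat(1))
qed

lemma tri_one: "i < m \<Longrightarrow> tri i 1 0 0 = 1\<^sub>m n"
  by (intro eq_matI) (auto simp: tri_def)

lemma tri_zero: "i < m \<Longrightarrow> tri i 0 0 0 = 0\<^sub>m n n"
  by (intro eq_matI) (auto simp: tri_def)

lemma tri_res: "i < m \<Longrightarrow> \<kappa> \<cdot>\<^sub>m res i = tri i 0 (\<kappa> * k i) (- \<kappa>)"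
  by (intro eq_matI) (auto simp: tri_def res_def algebra_simps)

end

section \<open>Absence of resonance\<close>

lemma mult_cancel_inverse:
  fixes M Y J :: "complex mat"
  assumes "M \<in> carrier_mat n l" "Y \<in> carrier_mat l l" "J \<in> carrier_mat l l" "Y * J = 1\<^sub>m l"
    and "M * Y = 0\<^sub>m n l"
  shows "M = 0\<^sub>m n l"
proof -
  have "M = M * (Y * J)" using assms(1,4) by (simp add: mat_one_mult)
  also have "\<dots> = M * Y * J" using assms(1-3) by (simp add: mat_assoc)
  also have "\<dots> = 0\<^sub>m n l" using assms(3,5) by (simp add: mat_zero_mult)
  finally show ?thesis .
qed

text \<open>No two of the eigenvalues \<open>\<kappa> k\<close>, \<open>- \<kappa> k\<close> and \<open>\<kappa> (k - \<alpha>)\<close> of a residue differ by a non-zero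
  integer.\<close>

definition nonresonant_param :: "complex \<Rightarrow> complex \<Rightarrow> complex \<Rightarrow> bool"
  where "nonresonant_param \<kappa> k \<alpha> \<longleftrightarrow>
    (\<forall>\<mu>\<in>{2 * k, \<alpha>, 2 * k - \<alpha>}. \<forall>j::int. j \<noteq> 0 \<longrightarrow> \<kappa> * \<mu> \<noteq> of_int j)"

context brauer_matrices
begin

text \<open>A combination of \<open>1\<close>, \<open>S\<^sub>i\<close> and \<open>e\<^sub>i\<close> is invertible when its eigenvalues are non-zero, and these
  are \<open>r\<close> plus a difference of two eigenvalues of the residue.\<close>

lemma shifted_inverse:
  assumes i: "i < m" and gen: "nonresonant_param \<kappa> (k i) (\<alpha> i)" and r: "1 \<le> (r::nat)"
    and a: "a \<in> {\<kappa> * k i, - (\<kappa> * k i), \<kappa> * (k i - \<alpha> i)}"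
  obtains x y z where "tri i (of_nat r - a) (\<kappa> * k i) (- \<kappa>) * tri i x y z = 1\<^sub>m n"
proof -
  define D where "D = of_nat r - a"
  have ne: "\<kappa> * \<mu> \<noteq> of_nat r" "\<kappa> * \<mu> \<noteq> - of_nat r" if "\<mu> \<in> {2 * k i, \<alpha> i, 2 * k i - \<alpha> i}" for \<mu>
  proof -
    have *: "\<kappa> * \<mu> \<noteq> of_int j" if "j \<noteq> 0" for j :: int
      using gen \<open>\<mu> \<in> _\<close> that unfolding nonresonant_param_def by blast
    show "\<kappa> * \<mu> \<noteq> of_nat r" "\<kappa> * \<mu> \<noteq> - of_nat r"
      using *[of "int r"] *[of "- int r"] r by auto
  qed
  have r0: "of_nat r \<noteq> (0::complex)" using r by simp
  define K where "K = \<kappa> * k i"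
  define L where "L = \<kappa> * \<alpha> i"
  have facts: "of_nat r - 2 * K \<noteq> 0" "of_nat r + 2 * K \<noteq> 0" "of_nat r - L \<noteq> 0" "of_nat r + L \<noteq> 0"
    "of_nat r - 2 * K + L \<noteq> 0" "of_nat r + 2 * K - L \<noteq> 0"
    using ne[of "2 * k i"] ne[of "\<alpha> i"] ne[of "2 * k i - \<alpha> i"]
    by (auto simp: K_def L_def algebra_simps add_eq_0_iff diff_eq_eq)
  have 1: "D + \<kappa> * k i \<noteq> 0" "D - \<kappa> * k i \<noteq> 0" "D + \<kappa> * k i - \<kappa> * \<alpha> i \<noteq> 0"
  proof -
    consider "a = K" | "a = - K" | "a = K - L" using a by (auto simp: K_def L_def algebra_simps)
    then have "D + K \<noteq> 0 \<and> D - K \<noteq> 0 \<and> D + K - L \<noteq> 0"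
    proof cases
      case 1
      then have "D + K = of_nat r" "D - K = of_nat r - 2 * K" "D + K - L = of_nat r - L"
        by (simp_all add: D_def)
      then show ?thesis using facts r0 by metis
    next
      case 2
      then have "D + K = of_nat r + 2 * K" "D - K = of_nat r" "D + K - L = of_nat r + 2 * K - L"
        by (simp_all add: D_def)
      then show ?thesis using facts r0 by metis
    next
      case 3
      then have "D + K = of_nat r + L" "D - K = of_nat r - 2 * K + L" "D + K - L = of_nat r"
        by (simp_all add: D_def)
      then show ?thesis using facts r0 by metis
    qed
    then show "D + \<kappa> * k i \<noteq> 0" "D - \<kappa> * k i \<noteq> 0" "D + \<kappa> * k i - \<kappa> * \<alpha> i \<noteq> 0"
      by (simp_all add: K_def L_def)
  qed
  \<comment> \<open>The coefficients of \<open>1\<close> and \<open>S\<^sub>i\<close> determine \<open>x\<close> and \<open>y\<close>; then that of \<open>e\<^sub>i\<close> determines \<open>z\<close>.\<close>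
  define x where "x = D / ((D + \<kappa> * k i) * (D - \<kappa> * k i))"
  define y where "y = - (\<kappa> * k i) / ((D + \<kappa> * k i) * (D - \<kappa> * k i))"
  define z where "z = \<kappa> * (x + y) / (D + \<kappa> * k i - \<kappa> * \<alpha> i)"
  have "D * x + \<kappa> * k i * y = ((D + \<kappa> * k i) * (D - \<kappa> * k i)) / ((D + \<kappa> * k i) * (D - \<kappa> * k i))"
    unfolding x_def y_def times_divide_eq_right add_divide_distrib[symmetric] by (simp add: algebra_simps)
  also have "\<dots> = 1" using 1 by simp
  finally have e1: "D * x + \<kappa> * k i * y = 1" .
  have e2: "D * y + \<kappa> * k i * x = 0" by (simp add: x_def y_def)
  have e3: "(D + \<kappa> * k i) * z + - \<kappa> * (x + y) + \<alpha> i * - \<kappa> * z = 0"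
  proof -
    have "(D + \<kappa> * k i - \<kappa> * \<alpha> i) * z = \<kappa> * (x + y)" using 1 by (simp add: z_def)
    then show ?thesis by (simp add: algebra_simps)
  qed
  have "tri i D (\<kappa> * k i) (- \<kappa>) * tri i x y z = tri i 1 0 0"
    unfolding tri_mult[OF i] e1 e2 e3 ..
  then show thesis using that i unfolding D_def by (simp add: tri_one)
qed

lemma res_cubic:
  assumes i: "i < m"
  shows "tri i (- (\<kappa> * k i)) (\<kappa> * k i) (- \<kappa>) * (tri i (\<kappa> * k i) (\<kappa> * k i) (- \<kappa>) *
    tri i (- (\<kappa> * (k i - \<alpha> i))) (\<kappa> * k i) (- \<kappa>)) = 0\<^sub>m n n"
  unfolding tri_mult[OF i] tri_zero[OF i, symmetric]
  by (simp add: algebra_simps)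

end

context brauer_matrices
begin

lemma tri_commute: "i < m \<Longrightarrow> tri i x y z * tri i x' y' z' = tri i x' y' z' * tri i x y z"
  by (simp add: tri_mult algebra_simps)

lemma tri_shift: "i < m \<Longrightarrow> M \<in> carrier_mat n l \<Longrightarrow> tri i (x + c) y z * M = tri i x y z * M + c \<cdot>\<^sub>m M"
  "i < m \<Longrightarrow> M \<in> carrier_mat l n \<Longrightarrow> M * tri i (x + c) y z = M * tri i x y z + c \<cdot>\<^sub>m M"
proof -
  assume i: "i < m"
  have eq: "tri i (x + c) y z = tri i x y z + c \<cdot>\<^sub>m 1\<^sub>m n"
    using i by (intro eq_matI) (auto simp: tri_def algebra_simps)
  show "tri i (x + c) y z * M = tri i x y z * M + c \<cdot>\<^sub>m M" if "M \<in> carrier_mat n l"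
    unfolding eq using i that by (simp add: mat_ring)
  show "M * tri i (x + c) y z = M * tri i x y z + c \<cdot>\<^sub>m M" if "M \<in> carrier_mat l n"
    unfolding eq using i that by (simp add: mat_ring)
qed

text \<open>The residue is annihilated by a cubic polynomial with the known roots \<open>a\<^sub>1, a\<^sub>2, a\<^sub>3\<close>. If none of
  the differences of the roots is \<open>r\<close>, then the equation \<open>r M - [X, M] = N\<close> is solved explicitly by
  a telescoping sum.\<close>

lemma residue_nonresonant:
  assumes i: "i < m" and gen: "nonresonant_param \<kappa> (k i) (\<alpha> i)"
  shows "nonresonant n (\<kappa> \<cdot>\<^sub>m res i)"
  unfolding nonresonant_def
proof (intro allI impI ballI)
  fix r :: nat and N :: "complex mat" assume r: "1 \<le> r" and N: "N \<in> carrier_mat n n"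
  define a1 a2 a3 where "a1 = \<kappa> * k i" and "a2 = - (\<kappa> * k i)" and "a3 = \<kappa> * (k i - \<alpha> i)"
  define T where "T x = tri i x (\<kappa> * k i) (- \<kappa>)" for x
  define R where "R = (of_nat r :: complex)"
  note inv = shifted_inverse[OF i gen r, folded R_def T_def]
  have T: "T x \<in> carrier_mat n n" for x using i by (simp add: T_def tri_carrier)
  have Td [simp]: "dim_row (T x) = n" "dim_col (T x) = n" for x using i by (auto simp: T_def)
  obtain x1 y1 z1 where 1: "T (R - a1) * tri i x1 y1 z1 = 1\<^sub>m n" by (rule inv[of a1]) (auto simp: a1_def)
  obtain x2 y2 z2 where 2: "T (R - a2) * tri i x2 y2 z2 = 1\<^sub>m n" by (rule inv[of a2]) (auto simp: a2_def)
  obtain x3 y3 z3 where 3: "T (R - a3) * tri i x3 y3 z3 = 1\<^sub>m n" by (rule inv[of a3]) (auto simp: a3_def)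
  define J1 J2 J3 where J: "J1 = tri i x1 y1 z1" "J2 = tri i x2 y2 z2" "J3 = tri i x3 y3 z3"
  have Jd [simp]: "dim_row J1 = n" "dim_col J1 = n" "dim_row J2 = n" "dim_col J2 = n" "dim_row J3 = n" "dim_col J3 = n"
    using i by (auto simp: J)
  have Nd [simp]: "dim_row N = n" "dim_col N = n" using N by auto
  define Q where "Q = T (- a2) * (T (- a3) * N) + T (- a3) * (N * T (R - a1)) + N * (T (R - a1) * T (R - a2))"
  have Qd [simp]: "dim_row Q = n" "dim_col Q = n" by (auto simp: Q_def)
  define M where "M = Q * (J3 * (J2 * J1))"
  have M: "M \<in> carrier_mat n n" by (rule carrier_matI) (simp_all add: M_def)
  have Tl: "T (x + c) * Z = T x * Z + c \<cdot>\<^sub>m Z" and Tr: "Z * T (x + c) = Z * T x + c \<cdot>\<^sub>m Z"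
    if "Z \<in> carrier_mat n n" for Z x c
    using tri_shift[OF i that] by (auto simp: T_def)
  have comm: "T R * (J3 * (J2 * J1)) = (J3 * (J2 * J1)) * T R"
    unfolding J T_def tri_mult[OF i, of x2 y2 z2 x1 y1 z1] tri_mult[OF i, of x3 y3 z3]
    by (rule tri_commute[OF i])
  have step: "Z * T R - T 0 * Z = Z * T (R - a) - T (- a) * Z" if Z: "Z \<in> carrier_mat n n" for Z a
    using Tl[OF Z, of "- a" a] Tr[OF Z, of "R - a" a] Z by (intro eq_matI) (simp_all del: index_mult_mat(1))
  have cubic: "T (- a1) * (T (- a2) * T (- a3)) = 0\<^sub>m n n"
    using res_cubic[OF i, of \<kappa>] by (simp add: T_def a1_def a2_def a3_def)
  have "Q * T R - T 0 * Q =
      (T (- a2) * (T (- a3) * N) * T R - T 0 * (T (- a2) * (T (- a3) * N))) +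
      (T (- a3) * (N * T (R - a1)) * T R - T 0 * (T (- a3) * (N * T (R - a1)))) +
      (N * (T (R - a1) * T (R - a2)) * T R - T 0 * (N * (T (R - a1) * T (R - a2))))"
    by (intro eq_matI) (simp_all add: Q_def mat_ring del: index_mult_mat(1))
  also have "\<dots> = N * (T (R - a1) * (T (R - a2) * T (R - a3))) - (T (- a1) * (T (- a2) * T (- a3))) * N"
    using N step[of "T (- a2) * (T (- a3) * N)" a1] step[of "T (- a3) * (N * T (R - a1))" a2]
      step[of "N * (T (R - a1) * T (R - a2))" a3] T
    by (intro eq_matI) (simp_all add: mat_ring mult_carrier_mat[of _ n n] del: index_mult_mat(1))
  also have "\<dots> = N * (T (R - a1) * (T (R - a2) * T (R - a3)))"
    unfolding cubic using N by (intro eq_matI) (simp_all add: mat_zero_mult del: index_mult_mat(1))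
  finally have Q: "Q * T R - T 0 * Q = N * (T (R - a1) * (T (R - a2) * T (R - a3)))" .
  have "M * T R - T 0 * M = (Q * T R - T 0 * Q) * (J3 * (J2 * J1))"
    using comm by (simp add: M_def mat_ring)
  also have "\<dots> = N * (T (R - a1) * (T (R - a2) * ((T (R - a3) * J3) * (J2 * J1))))"
    unfolding Q by (simp add: mat_assoc)
  also have "T (R - a3) * J3 = 1\<^sub>m n" using 3 by (simp add: J)
  also have "T (R - a2) * (1\<^sub>m n * (J2 * J1)) = (T (R - a2) * J2) * J1" by (simp add: mat_ring)
  also have "T (R - a2) * J2 = 1\<^sub>m n" using 2 by (simp add: J)
  also have "T (R - a1) * (1\<^sub>m n * J1) = 1\<^sub>m n" using 1 by (simp add: J[symmetric] mat_one_mult)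
  finally have "M * T R - T 0 * M = N" by (simp add: mat_one_mult)
  moreover have "\<kappa> \<cdot>\<^sub>m res i = T 0" using i by (simp add: tri_res T_def)
  ultimately have "of_nat r \<cdot>\<^sub>m M - (\<kappa> \<cdot>\<^sub>m res i * M - M * (\<kappa> \<cdot>\<^sub>m res i)) = N"
    using Tr[OF M, of 0 R] M by (intro eq_matI) (auto simp: R_def simp del: index_mult_mat(1))
  then show "\<exists>M\<in>carrier_mat n n. of_nat r \<cdot>\<^sub>m M - (\<kappa> \<cdot>\<^sub>m res i * M - M * (\<kappa> \<cdot>\<^sub>m res i)) = N"
    using M by blast
qed

text \<open>If \<open>r M = X M - M X'\<close>, then \<open>M (r - a + X') = (X - a) M\<close>. The product of the right hand sides over
  the three roots is zero, and the factors on the left are invertible.\<close>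

lemma residue_no_resonance:
  assumes V': "brauer_matrices m n' k \<alpha> S' e'"
    and i: "i < m" and gen: "nonresonant_param \<kappa> (k i) (\<alpha> i)"
  shows "no_resonance n n' (\<kappa> \<cdot>\<^sub>m res i) (\<kappa> \<cdot>\<^sub>m brauer_matrices.res k S' e' i)"
  unfolding no_resonance_def
proof (intro allI impI ballI)
  interpret V': brauer_matrices m n' k \<alpha> S' e' by (rule V')
  fix r :: nat and M :: "complex mat" assume r: "1 \<le> r" and M: "M \<in> carrier_mat n n'"
    and eq: "of_nat r \<cdot>\<^sub>m M = (\<kappa> \<cdot>\<^sub>m res i) * M - M * (\<kappa> \<cdot>\<^sub>m V'.res i)"
  define a1 a2 a3 where "a1 = \<kappa> * k i" and "a2 = - (\<kappa> * k i)" and "a3 = \<kappa> * (k i - \<alpha> i)"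
  define T where "T x = tri i x (\<kappa> * k i) (- \<kappa>)" for x
  define T' where "T' x = V'.tri i x (\<kappa> * k i) (- \<kappa>)" for x
  define R where "R = (of_nat r :: complex)"
  note inv = V'.shifted_inverse[OF i gen r, folded R_def T'_def]
  have Td [simp]: "dim_row (T x) = n" "dim_col (T x) = n" "dim_row (T' x) = n'" "dim_col (T' x) = n'" for x
    using i by (auto simp: T_def T'_def)
  have T': "T' x \<in> carrier_mat n' n'" for x using i by (simp add: T'_def V'.tri_carrier)
  obtain x1 y1 z1 where 1: "T' (R - a1) * V'.tri i x1 y1 z1 = 1\<^sub>m n'" by (rule inv[of a1]) (auto simp: a1_def)
  obtain x2 y2 z2 where 2: "T' (R - a2) * V'.tri i x2 y2 z2 = 1\<^sub>m n'" by (rule inv[of a2]) (auto simp: a2_def)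
  obtain x3 y3 z3 where 3: "T' (R - a3) * V'.tri i x3 y3 z3 = 1\<^sub>m n'" by (rule inv[of a3]) (auto simp: a3_def)
  have Md [simp]: "dim_row M = n" "dim_col M = n'" using M by auto
  have "T 0 * M = M * T' R"
  proof -
    have "M * T' R = M * T' 0 + R \<cdot>\<^sub>m M"
      using V'.tri_shift(2)[OF i M, of 0 R] by (simp add: T'_def)
    moreover have "\<kappa> \<cdot>\<^sub>m res i = T 0" "\<kappa> \<cdot>\<^sub>m V'.res i = T' 0"
      using i by (simp_all add: tri_res V'.tri_res T_def T'_def)
    ultimately show ?thesis using eq by (auto simp: R_def mat_eq_iff simp del: index_mult_mat(1))
  qed
  then have step: "T (- a) * M = M * T' (R - a)" for a
    using tri_shift(1)[OF i M, of 0 "- a"] V'.tri_shift(2)[OF i M, of R "- a"]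
    by (simp add: T_def T'_def)
  have c1: "M * T' (R - a1) \<in> carrier_mat n n'" by (rule mult_carrier_mat[OF M T'])
  have c2: "M * T' (R - a1) * T' (R - a2) \<in> carrier_mat n n'" by (rule mult_carrier_mat[OF c1 T'])
  have s1: "M * T' (R - a1) * T' (R - a2) * T' (R - a3) = T (- a1) * (M * T' (R - a2) * T' (R - a3))"
    unfolding step[of a1, symmetric] by (simp add: mat_assoc)
  have s2: "M * T' (R - a2) * T' (R - a3) = T (- a2) * (M * T' (R - a3))"
    unfolding step[of a2, symmetric] by (simp add: mat_assoc)
  have "M * T' (R - a1) * T' (R - a2) * T' (R - a3) = T (- a1) * (T (- a2) * T (- a3)) * M"
    unfolding s1 s2 step[of a3, symmetric] by (simp add: mat_assoc)
  also have "\<dots> = 0\<^sub>m n n'"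
    using res_cubic[OF i, of \<kappa>] by (simp add: T_def a1_def a2_def a3_def mat_zero_mult)
  finally have "M * T' (R - a1) * T' (R - a2) * T' (R - a3) = 0\<^sub>m n n'" .
  then have "M * T' (R - a1) * T' (R - a2) = 0\<^sub>m n n'"
    by (rule mult_cancel_inverse[OF c2 T' V'.tri_carrier[OF i] 3])
  then have "M * T' (R - a1) = 0\<^sub>m n n'"
    by (rule mult_cancel_inverse[OF c1 T' V'.tri_carrier[OF i] 2])
  then show "M = 0\<^sub>m n n'"
    by (rule mult_cancel_inverse[OF M T' V'.tri_carrier[OF i] 1])
qed

end

section \<open>The local monodromy\<close>

text \<open>The coefficient of \<open>e\<^sub>i\<close> in the exponential of \<open>t \<kappa> (k\<^sub>i S\<^sub>i - e\<^sub>i)\<close>; its value for \<open>\<alpha> = 0\<close> is the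
  limit of the others.\<close>

definition local_chi :: "complex \<Rightarrow> complex \<Rightarrow> complex \<Rightarrow> complex \<Rightarrow> complex"
  where "local_chi \<kappa> k \<alpha> t = (if \<alpha> = 0 then - \<kappa> * t * exp (\<kappa> * k * t)
    else (exp (\<kappa> * (k - \<alpha>) * t) - exp (\<kappa> * k * t)) / \<alpha>)"

lemma local_chi_deriv:
  "(local_chi \<kappa> k \<alpha> has_field_derivative
    \<kappa> * ((k - \<alpha>) * local_chi \<kappa> k \<alpha> t - exp (\<kappa> * k * t))) (at t)"
proof (cases "\<alpha> = 0")
  case True
  have "((\<lambda>t. - \<kappa> * t * exp (\<kappa> * k * t)) has_field_derivative
      - \<kappa> * exp (\<kappa> * k * t) + - \<kappa> * t * (exp (\<kappa> * k * t) * (\<kappa> * k))) (at t)"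
    by (auto intro!: derivative_eq_intros simp: algebra_simps)
  moreover have "local_chi \<kappa> k \<alpha> = (\<lambda>t. - \<kappa> * t * exp (\<kappa> * k * t))"
    using True by (simp add: local_chi_def[abs_def])
  ultimately show ?thesis using True by (auto elim!: DERIV_cong simp: algebra_simps)
next
  case False
  have "((\<lambda>t. (exp (\<kappa> * (k - \<alpha>) * t) - exp (\<kappa> * k * t)) / \<alpha>) has_field_derivative
      (exp (\<kappa> * (k - \<alpha>) * t) * (\<kappa> * (k - \<alpha>)) - exp (\<kappa> * k * t) * (\<kappa> * k)) / \<alpha>) (at t)"
    by (intro DERIV_cdivide) (auto intro!: derivative_eq_intros simp: algebra_simps)
  moreover have "(exp (\<kappa> * (k - \<alpha>) * t) * (\<kappa> * (k - \<alpha>)) - exp (\<kappa> * k * t) * (\<kappa> * k)) / \<alpha> =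
      \<kappa> * ((k - \<alpha>) * ((exp (\<kappa> * (k - \<alpha>) * t) - exp (\<kappa> * k * t)) / \<alpha>) - exp (\<kappa> * k * t))"
  proof -
    have "(P * (\<kappa> * (k - \<alpha>)) - Q * (\<kappa> * k)) / \<alpha> = \<kappa> * ((k - \<alpha>) * ((P - Q) / \<alpha>) - Q)" for P Q
      using False by (simp add: field_simps)
    then show ?thesis .
  qed
  ultimately show ?thesis using False by (simp add: local_chi_def[abs_def])
qed

context brauer_matrices
begin

text \<open>The exponential of \<open>t \<kappa> (k\<^sub>i S\<^sub>i - e\<^sub>i)\<close>.\<close>

definition local_exp :: "complex \<Rightarrow> nat \<Rightarrow> complex \<Rightarrow> complex mat"
  where "local_exp \<kappa> i t = tri i ((exp (\<kappa> * k i * t) + exp (- (\<kappa> * k i * t))) / 2)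
    ((exp (\<kappa> * k i * t) - exp (- (\<kappa> * k i * t))) / 2) (local_chi \<kappa> (k i) (\<alpha> i) t)"

lemma local_exp_zero: "i < m \<Longrightarrow> local_exp \<kappa> i 0 = 1\<^sub>m n"
  by (simp add: local_exp_def local_chi_def tri_one)

lemma local_exp_carrier: "i < m \<Longrightarrow> local_exp \<kappa> i t \<in> carrier_mat n n"
  by (simp add: local_exp_def tri_carrier)

lemma local_exp_dim [simp]:
  "i < m \<Longrightarrow> dim_row (local_exp \<kappa> i t) = n" "i < m \<Longrightarrow> dim_col (local_exp \<kappa> i t) = n"
  by (simp_all add: local_exp_def)

lemma local_exp_add:
  assumes i: "i < m"
  shows "local_exp \<kappa> i s * local_exp \<kappa> i t = local_exp \<kappa> i (s + t)"
proof -
  define u v u' v' where u: "u = exp (\<kappa> * k i * s)" "v = exp (\<kappa> * k i * t)"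
    "u' = exp (- (\<kappa> * k i * s))" "v' = exp (- (\<kappa> * k i * t))"
  define c d where cd: "c = local_chi \<kappa> (k i) (\<alpha> i) s" "d = local_chi \<kappa> (k i) (\<alpha> i) t"
  have e: "exp (\<kappa> * k i * (s + t)) = u * v" "exp (- (\<kappa> * k i * (s + t))) = u' * v'"
    by (simp_all add: u distrib_left flip: exp_add)
  have chi: "u * d + c * v + \<alpha> i * c * d = local_chi \<kappa> (k i) (\<alpha> i) (s + t)"
  proof (cases "\<alpha> i = 0")
    case True
    show ?thesis
      unfolding cd local_chi_def if_P[OF True] e u[symmetric] by (simp add: True algebra_simps)
  next
    case False
    have e': "exp (\<kappa> * (k i - \<alpha> i) * (s + t)) = exp (\<kappa> * (k i - \<alpha> i) * s) * exp (\<kappa> * (k i - \<alpha> i) * t)"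
      by (simp add: distrib_left exp_add)
    have "u * ((q - v) / \<alpha> i) + (p - u) / \<alpha> i * v + \<alpha> i * ((p - u) / \<alpha> i) * ((q - v) / \<alpha> i) =
        (p * q - u * v) / \<alpha> i" for p q
      using False by (simp add: field_simps)
    then show ?thesis
      unfolding cd local_chi_def if_not_P[OF False] e e' u[symmetric] .
  qed
  have 1: "(u + u') / 2 * ((v + v') / 2) + (u - u') / 2 * ((v - v') / 2) = (u * v + u' * v') / 2"
    "(u + u') / 2 * ((v - v') / 2) + (u - u') / 2 * ((v + v') / 2) = (u * v - u' * v') / 2"
    by (simp_all add: field_simps)
  have 2: "((u + u') / 2 + (u - u') / 2) * d + c * ((v + v') / 2 + (v - v') / 2) + \<alpha> i * c * d =
      u * d + c * v + \<alpha> i * c * d"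
    by (simp add: field_simps)
  show ?thesis
    unfolding local_exp_def u[symmetric] cd[symmetric] tri_mult[OF i] 1 2 chi e ..
qed

lemma tri_has_deriv:
  assumes i: "i < m" and "(x has_field_derivative x') (at t)" "(y has_field_derivative y') (at t)"
    "(z has_field_derivative z') (at t)" and rc: "r < n" "c < n"
  shows "((\<lambda>t. tri i (x t) (y t) (z t) $$ (r, c)) has_field_derivative tri i x' y' z' $$ (r, c)) (at t)"
proof -
  have "tri i x y z $$ (r, c) = x * (1\<^sub>m n) $$ (r, c) + y * S i $$ (r, c) + z * e i $$ (r, c)" for x y z
    using i rc by (simp add: tri_def)
  then show ?thesis using assms by (auto intro!: derivative_eq_intros)
qed

lemma local_exp_has_deriv:
  assumes i: "i < m" and rc: "r < n" "c < n"
  shows "((\<lambda>t. local_exp \<kappa> i t $$ (r, c)) has_field_derivative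
    ((\<kappa> \<cdot>\<^sub>m res i) * local_exp \<kappa> i t) $$ (r, c)) (at t)"
proof -
  define u where "u = exp (\<kappa> * k i * t)"
  define u' where "u' = exp (- (\<kappa> * k i * t))"
  have "(\<kappa> \<cdot>\<^sub>m res i) * local_exp \<kappa> i t = tri i ((u * (\<kappa> * k i) - u' * (\<kappa> * k i)) / 2)
      ((u * (\<kappa> * k i) + u' * (\<kappa> * k i)) / 2)
      (\<kappa> * ((k i - \<alpha> i) * local_chi \<kappa> (k i) (\<alpha> i) t - u))"
    unfolding tri_res[OF i] local_exp_def tri_mult[OF i] u_def[symmetric] u'_def[symmetric]
    by (simp add: field_simps)
  moreover have "((\<lambda>t. local_exp \<kappa> i t $$ (r, c)) has_field_derivative
    tri i ((u * (\<kappa> * k i) - u' * (\<kappa> * k i)) / 2)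
      ((u * (\<kappa> * k i) + u' * (\<kappa> * k i)) / 2)
      (\<kappa> * ((k i - \<alpha> i) * local_chi \<kappa> (k i) (\<alpha> i) t - u)) $$ (r, c)) (at t)"
    unfolding local_exp_def
    by (rule tri_has_deriv[OF i _ _ _ rc])
      (auto intro!: derivative_eq_intros local_chi_deriv[THEN DERIV_cong] simp: u_def u'_def)
  ultimately show ?thesis by simp
qed

lemma local_exp_hol: "i < m \<Longrightarrow> mat_hol n n (local_exp \<kappa> i) UNIV"
  by (rule mat_holI[OF open_UNIV local_exp_carrier local_exp_has_deriv])

lemma local_exp_mat_deriv:
  "i < m \<Longrightarrow> mat_deriv n n (local_exp \<kappa> i) t = (\<kappa> \<cdot>\<^sub>m res i) * local_exp \<kappa> i t"
  by (rule mat_deriv_eqI[OF carrier_matI local_exp_has_deriv]) simp_all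

end

lemma regular_pair_of_inverse:
  assumes A: "open A" and F: "mat_hol n n F A" and K: "mat_hol n n K A"
    and inv: "\<And>x. x \<in> A \<Longrightarrow> K x * F x = 1\<^sub>m n" "\<And>x. x \<in> A \<Longrightarrow> F x * K x = 1\<^sub>m n"
    and B: "\<And>x. B x \<in> carrier_mat n n"
    and dF: "\<And>x. x \<in> A \<Longrightarrow> mat_deriv n n F x = B x * F x"
  shows "regular_pair n B A F K"
  unfolding regular_pair_def
proof (intro conjI ballI F K inv dF)
  fix x assume x: "x \<in> A"
  note c = mat_hol_carrier[OF F, of x] mat_hol_carrier[OF K, of x] B[of x]
  let ?D = "mat_deriv n n K x"
  have "mat_deriv n n (\<lambda>x. K x * F x) x = mat_deriv n n (\<lambda>_. 1\<^sub>m n) x"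
    by (rule mat_deriv_cong[OF inv(1) A x])
  then have "?D * F x + K x * (B x * F x) = 0\<^sub>m n n"
    using mat_deriv_mult[OF K F A x] dF[OF x] by simp
  then have "(?D * F x + K x * (B x * F x)) * K x = 0\<^sub>m n n * K x" by simp
  then have "?D * (F x * K x) + K x * (B x * (F x * K x)) = 0\<^sub>m n n"
    using c by (simp add: mat_ring)
  then have "?D + K x * B x = 0\<^sub>m n n"
    using c by (simp add: inv(2)[OF x] mat_one_mult)
  then show "?D = - (K x * B x)"
    using c by (auto simp: mat_eq_iff eq_neg_iff_add_eq_0 simp del: index_mult_mat(1))
qed

context brauer_matrices
begin

text \<open>The connection form in the coordinate of \<^const>\<open>sigma_param\<close> has a simple pole at \<open>0\<close>, which
  comes from the line \<open>i\<close>; this is the part that is regular there.\<close>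

definition regular_part :: "complex \<Rightarrow> nat \<Rightarrow> real \<Rightarrow> complex \<Rightarrow> complex mat"
  where "regular_part \<kappa> i \<phi> y = lin_comb n n ({..<m} - {i}) (\<lambda>l. \<kappa> * weight m i \<phi> l y) res"

lemma regular_part_dim [simp]:
  "dim_row (regular_part \<kappa> i \<phi> y) = n" "dim_col (regular_part \<kappa> i \<phi> y) = n"
  "regular_part \<kappa> i \<phi> y \<in> carrier_mat n n"
  by (auto simp: regular_part_def)

lemma regular_part_mirror:
  assumes i: "i < m"
  shows "regular_part \<kappa> i \<phi> y * S i = S i * ((-1) \<cdot>\<^sub>m regular_part \<kappa> i \<phi> (- y))"
proof -
  have bij: "bij_betw (mirror m i) ({..<m} - {i}) ({..<m} - {i})"
  proof (rule bij_betw_byWitness[where f' = "mirror m i"])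
    have "mirror m i l \<noteq> i" if "l < m" "l \<noteq> i" for l
      using that mirror_mirror[of l m i] i mirror_self by metis
    then show "mirror m i ` ({..<m} - {i}) \<subseteq> {..<m} - {i}" by auto
    then show "mirror m i ` ({..<m} - {i}) \<subseteq> {..<m} - {i}" .
  qed (auto simp: mirror_mirror)
  have "regular_part \<kappa> i \<phi> y * S i = lin_comb n n ({..<m} - {i}) (\<lambda>l. \<kappa> * weight m i \<phi> l y) (\<lambda>l. res l * S i)"
    unfolding regular_part_def by (rule lin_comb_mult_right) (use i res_carrier S_carrier in auto)
  also have "\<dots> = lin_comb n n ({..<m} - {i}) (\<lambda>l. \<kappa> * weight m i \<phi> (mirror m i l) y) (\<lambda>l. res (mirror m i l) * S i)"
    by (rule lin_comb_reindex[OF bij])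
  also have "\<dots> = lin_comb n n ({..<m} - {i}) (\<lambda>l. - (\<kappa> * weight m i \<phi> l (- y))) (\<lambda>l. S i * res l)"
    using weight_mirror[of _ m i \<phi> "- y"] by (intro lin_comb_cong) (auto simp: res_conj[OF i])
  also have "\<dots> = S i * lin_comb n n ({..<m} - {i}) (\<lambda>l. - (\<kappa> * weight m i \<phi> l (- y))) res"
    by (rule lin_comb_mult_left[symmetric]) (use i res_carrier S_carrier in auto)
  also have "lin_comb n n ({..<m} - {i}) (\<lambda>l. - (\<kappa> * weight m i \<phi> l (- y))) res = (-1) \<cdot>\<^sub>m regular_part \<kappa> i \<phi> (- y)"
    by (simp add: regular_part_def lin_comb_smult)
  finally show ?thesis .
qed

lemma regular_part_intertwine:
  assumes "brauer_matrices m n' k \<alpha> S' e'" and f: "f \<in> carrier_mat n n'"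
    and fr: "\<And>l. l < m \<Longrightarrow> res l * f = f * brauer_matrices.res k S' e' l"
  shows "regular_part \<kappa> i \<phi> y * f = f * brauer_matrices.regular_part m n' k S' e' \<kappa> i \<phi> y"
proof -
  interpret V': brauer_matrices m n' k \<alpha> S' e' by (rule assms(1))
  have "regular_part \<kappa> i \<phi> y * f = lin_comb n n' ({..<m} - {i}) (\<lambda>l. \<kappa> * weight m i \<phi> l y) (\<lambda>l. res l * f)"
    unfolding regular_part_def by (rule lin_comb_mult_right) (use res_carrier f in auto)
  also have "\<dots> = lin_comb n n' ({..<m} - {i}) (\<lambda>l. \<kappa> * weight m i \<phi> l y) (\<lambda>l. f * V'.res l)"
    using fr by (intro lin_comb_cong) auto
  also have "\<dots> = f * V'.regular_part \<kappa> i \<phi> y"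
    unfolding V'.regular_part_def by (rule lin_comb_mult_left[symmetric]) (use V'.res_carrier f in auto)
  finally show ?thesis .
qed

definition sigma_monodromy :: "complex \<Rightarrow> c2 \<Rightarrow> real \<Rightarrow> nat \<Rightarrow> complex mat"
  where "sigma_monodromy \<kappa> p \<epsilon> i =
    S i * parallel_transport n (connection m n \<kappa> res) (sigma_path m p \<epsilon> i)"

end

text \<open>A radius greater than \<open>1/2\<close> such that only the line \<open>i\<close> is met within it.\<close>

definition gap_radius :: "nat \<Rightarrow> nat \<Rightarrow> real \<Rightarrow> real \<Rightarrow> bool"
  where "gap_radius m i \<phi> R \<longleftrightarrow> 1 / 2 < R \<and>
    (\<forall>l<m. l \<noteq> i \<longrightarrow> weight_const m i \<phi> l \<noteq> 0 \<and>
      R * \<bar>weight_slope m i \<phi> l\<bar> \<le> \<bar>weight_const m i \<phi> l\<bar>)"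

lemma gap_radius_exists:
  assumes m: "3 \<le> m" and \<theta>: "0 < \<theta>" "\<theta> < pi / real m" and i: "i < 2"
  obtains R where "gap_radius m i (\<theta> - angle m i) R"
proof -
  define \<phi> where "\<phi> = \<theta> - angle m i"
  define f where "f l = (if weight_slope m i \<phi> l = 0 then 1 else \<bar>weight_const m i \<phi> l\<bar> / \<bar>weight_slope m i \<phi> l\<bar>)" for l
  define R where "R = Min (insert 1 (f ` ({..<m} - {i})))"
  have less: "\<bar>weight_slope m i \<phi> l\<bar> / 2 < \<bar>weight_const m i \<phi> l\<bar>" if "l < m" "l \<noteq> i" for l
    unfolding \<phi>_def by (rule weight_slope_less_const[OF m \<theta> i that])
  have "1 / 2 < R"
  proof -
    have "1 / 2 < f l" if "l < m" "l \<noteq> i" for l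
      using less[OF that] by (auto simp: f_def field_simps)
    then show ?thesis unfolding R_def by (subst Min_gr_iff) auto
  qed
  moreover have "weight_const m i \<phi> l \<noteq> 0 \<and> R * \<bar>weight_slope m i \<phi> l\<bar> \<le> \<bar>weight_const m i \<phi> l\<bar>"
    if l: "l < m" "l \<noteq> i" for l
  proof
    show "weight_const m i \<phi> l \<noteq> 0" using less[OF l] by auto
    have "R \<le> f l" unfolding R_def using l by (intro Min_le) auto
    then show "R * \<bar>weight_slope m i \<phi> l\<bar> \<le> \<bar>weight_const m i \<phi> l\<bar>"
      by (auto simp: f_def field_simps split: if_splits)
  qed
  ultimately show thesis using that unfolding gap_radius_def \<phi>_def by blast
qed

lemma gap_radius_nonzero:
  assumes "gap_radius m i \<phi> R" "l < m" "l \<noteq> i" "cmod y < R"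
  shows "of_real (weight_const m i \<phi> l) + y * of_real (weight_slope m i \<phi> l) \<noteq> 0"
proof
  assume "of_real (weight_const m i \<phi> l) + y * of_real (weight_slope m i \<phi> l) = 0"
  then have "\<bar>weight_const m i \<phi> l\<bar> = cmod y * \<bar>weight_slope m i \<phi> l\<bar>"
    by (metis add_eq_0_iff norm_minus_cancel norm_mult norm_of_real)
  moreover have g: "weight_const m i \<phi> l \<noteq> 0" "R * \<bar>weight_slope m i \<phi> l\<bar> \<le> \<bar>weight_const m i \<phi> l\<bar>"
    using assms by (auto simp: gap_radius_def)
  ultimately have "R * \<bar>weight_slope m i \<phi> l\<bar> \<le> cmod y * \<bar>weight_slope m i \<phi> l\<bar>"
    "weight_slope m i \<phi> l \<noteq> 0" by auto
  then show False using assms(4) by auto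
qed

lemma mat_smult_one: "1 \<cdot>\<^sub>m (A :: complex mat) = A"
  by (intro eq_matI) auto

text \<open>The slit is the half of the imaginary axis that the generators avoid; they pass below \<open>0\<close>.\<close>

definition slit_disc :: "real \<Rightarrow> complex set"
  where "slit_disc R = ball 0 R \<inter> {y. \<i> * y \<notin> \<real>\<^sub>\<le>\<^sub>0}"

lemma slit_disc_open: "open (slit_disc R)"
proof -
  have "closed ((\<lambda>y. \<i> * y) -` \<real>\<^sub>\<le>\<^sub>0)"
    by (intro closed_vimage closed_nonpos_Reals_complex continuous_intros)
  then have "open (- ((\<lambda>y. \<i> * y) -` \<real>\<^sub>\<le>\<^sub>0))" by (simp add: open_Compl)
  moreover have "- ((\<lambda>y. \<i> * y) -` \<real>\<^sub>\<le>\<^sub>0) = {y. \<i> * y \<notin> \<real>\<^sub>\<le>\<^sub>0}" by auto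
  ultimately show ?thesis unfolding slit_disc_def by (intro open_Int) auto
qed

lemma slit_disc_mem:
  "1 / 2 < R \<Longrightarrow> cmod y \<le> 1 / 2 \<Longrightarrow> Im y \<le> 0 \<Longrightarrow> y \<noteq> 0 \<Longrightarrow> y \<in> slit_disc R"
  by (auto simp: slit_disc_def complex_nonpos_Reals_iff complex_eq_iff)

lemma sin_angle_nonzero:
  assumes "0 < \<theta>" "\<theta> < pi / real m" "i < 2" "3 \<le> m"
  shows "sin (\<theta> - angle m i) \<noteq> 0"
proof -
  have m: "pi / real m < pi" using assms(4) by (simp add: field_simps)
  consider "i = 0" | "i = 1" using assms(3) by linarith
  then show ?thesis
  proof cases
    case 1
    then have "0 < sin (\<theta> - angle m i)" using assms m by (intro sin_gt_zero) (auto simp: angle_def)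
    then show ?thesis by simp
  next
    case 2
    then have "0 < sin (angle m i - \<theta>)" using assms m by (intro sin_gt_zero) (auto simp: angle_def)
    then show ?thesis using sin_minus[of "angle m i - \<theta>"] by simp
  qed
qed

context brauer_matrices
begin

lemma regular_part_hol:
  assumes "gap_radius m i \<phi> R"
  shows "mat_hol n n (regular_part \<kappa> i \<phi>) (ball 0 R)"
  unfolding regular_part_def[abs_def] weight_def
  using gap_radius_nonzero[OF assms]
  by (intro mat_hol_lin_comb holomorphic_intros) auto

lemma connection_split:
  assumes i: "i < m" and \<phi>: "sin \<phi> \<noteq> 0"
  shows "lin_comb n n {..<m} (\<lambda>l. \<kappa> * weight m i \<phi> l y) res =
    (1 / y) \<cdot>\<^sub>m (\<kappa> \<cdot>\<^sub>m res i) + regular_part \<kappa> i \<phi> y"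
proof -
  have "weight m i \<phi> i y = 1 / y" using \<phi> by (simp add: weight_def weight_const_def weight_slope_def)
  then show ?thesis
    using i by (intro eq_matI) (auto simp: regular_part_def sum.remove[of "{..<m}" i])
qed

text \<open>On the normal form the continuation of \<open>exp (X log y)\<close> from \<open>-1/2\<close> to \<open>1/2\<close> through the lower
  half plane is multiplication by \<open>exp (\<pi> \<i> X)\<close>. The reflection \<open>S\<^sub>i\<close> exchanges \<open>y\<close> and \<open>-y\<close>, so
  that by uniqueness it also exchanges the two values of the gauge transformation.\<close>

theorem local_solution:
  assumes \<theta>: "0 < \<theta>" "\<theta> < pi / real m" and r: "0 < r" and i: "i < 2" and \<epsilon>: "0 < \<epsilon>" "\<epsilon> < 1"
    and gen: "nonresonant_param \<kappa> (k i) (\<alpha> i)" and R: "gap_radius m i (\<theta> - angle m i) R"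
  obtains H K where
    "frobenius_pair n (\<kappa> \<cdot>\<^sub>m res i) (regular_part \<kappa> i (\<theta> - angle m i)) (ereal R) H K"
    "sigma_monodromy \<kappa> (polar r \<theta>) \<epsilon> i =
      H (- 1 / 2) * (S i * local_exp \<kappa> i (\<i> * of_real pi)) * K (- 1 / 2)"
proof -
  define \<phi> where "\<phi> = \<theta> - angle m i"
  have im: "i < m" using i m by simp
  have \<phi>: "sin \<phi> \<noteq> 0" unfolding \<phi>_def by (rule sin_angle_nonzero[OF \<theta> i m])
  note R' = R[folded \<phi>_def]
  have R2: "1 / 2 < R" "0 < R" using R by (auto simp: gap_radius_def)
  define X where "X = \<kappa> \<cdot>\<^sub>m res i"
  define B where "B = regular_part \<kappa> i \<phi>"
  define E where "E = local_exp \<kappa> i"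
  have X: "X \<in> carrier_mat n n" using res_carrier[OF im] by (simp add: X_def)
  have Xd [simp]: "dim_row X = n" "dim_col X = n" using X by auto
  have Sd [simp]: "dim_row (S i) = n" "dim_col (S i) = n" using im by auto
  have B: "mat_hol n n B (eball 0 (ereal R))"
    unfolding B_def using regular_part_hol[OF R'] by simp
  have self: "brauer_matrices m n k \<alpha> S e" by unfold_locales
  have nr: "no_resonance n n X X" using residue_no_resonance[OF self im gen] by (simp add: X_def)
  obtain H K where HK: "frobenius_pair n X B (ereal R) H K"
    by (rule frobenius_pair_exists[OF X _ nr _ B])
      (use residue_nonresonant[OF im gen] R2 in \<open>auto simp: X_def\<close>)
  then have H: "mat_hol n n H (ball 0 R)" "H 0 = 1\<^sub>m n" and K: "mat_hol n n K (ball 0 R)"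
    and inv: "\<And>y. y \<in> ball 0 R \<Longrightarrow> K y * H y = 1\<^sub>m n" "\<And>y. y \<in> ball 0 R \<Longrightarrow> H y * K y = 1\<^sub>m n"
    and dH: "\<And>y. y \<in> ball 0 R \<Longrightarrow> y \<cdot>\<^sub>m mat_deriv n n H y = X * H y - H y * X + y \<cdot>\<^sub>m (B y * H y)"
    by (auto simp: frobenius_pair_def)
  note Hc = mat_hol_carrier[OF H(1)] and Kc = mat_hol_carrier[OF K]
  have Hd [simp]: "dim_row (H y) = n" "dim_col (H y) = n" "dim_row (K y) = n" "dim_col (K y) = n" for y
    using Hc[of y] Kc[of y] by auto
  have Bd [simp]: "dim_row (B y) = n" "dim_col (B y) = n" for y by (auto simp: B_def)
  have Ed [simp]: "dim_row (E t) = n" "dim_col (E t) = n" for t using im by (auto simp: E_def)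
  have mirror: "H y * S i = S i * H (- y)" if y: "y \<in> ball 0 R" for y
  proof (rule frobenius_intertwine[OF X X _ nr HK B, where B' = "\<lambda>y. (-1) \<cdot>\<^sub>m B (- y)" and H' = "\<lambda>y. H (- y)"])
    have neg: "uminus ` eball 0 (ereal R) \<subseteq> (eball 0 (ereal R) :: complex set)" by (auto simp: dist_norm)
    have hol_neg: "uminus holomorphic_on eball 0 (ereal R)"
      using holomorphic_on_minus[OF holomorphic_on_ident] by (simp add: id_def)
    show "mat_hol n n (\<lambda>y. (-1) \<cdot>\<^sub>m B (- y)) (eball 0 (ereal R))"
      by (intro mat_hol_smult mat_hol_compose[OF B hol_neg neg] holomorphic_on_const)
    show "mat_hol n n (\<lambda>y. H (- y)) (eball 0 (ereal R))"
      using H(1) by (intro mat_hol_compose[OF _ hol_neg neg]) auto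
    show "X * S i = S i * X"
      using im res_conj[OF im im] by (simp add: X_def mat_ring mirror_self)
    fix x :: complex assume "x \<in> eball 0 (ereal R)"
    then have x: "- x \<in> ball 0 R" "x \<in> ball 0 R" by (auto simp: dist_norm)
    have "mat_deriv n n (\<lambda>y. H (- y)) x = (-1) \<cdot>\<^sub>m mat_deriv n n H (- x)"
      by (rule mat_deriv_compose[where g = uminus, OF H(1) open_ball _ x(1)]) (auto intro!: derivative_eq_intros)
    then have "x \<cdot>\<^sub>m mat_deriv n n (\<lambda>y. H (- y)) x = (- x) \<cdot>\<^sub>m mat_deriv n n H (- x)"
      by (simp add: mat_smult_smult)
    also have "\<dots> = X * H (- x) - H (- x) * X + x \<cdot>\<^sub>m ((-1) \<cdot>\<^sub>m B (- x) * H (- x))"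
      unfolding dH[OF x(1)] by (simp add: mat_ring)
    finally show "x \<cdot>\<^sub>m mat_deriv n n (\<lambda>y. H (- y)) x =
      X * H (- x) - H (- x) * X + x \<cdot>\<^sub>m ((-1) \<cdot>\<^sub>m B (- x) * H (- x))" .
    show "B x * S i = S i * ((-1) \<cdot>\<^sub>m B (- x))"
      unfolding B_def by (rule regular_part_mirror[OF im])
  qed (use H S_carrier[OF im] R2 y in auto)
  define A where "A = slit_disc R"
  have A: "open A" by (simp add: A_def slit_disc_open)
  have A_ball: "A \<subseteq> ball 0 R" by (auto simp: A_def slit_disc_def)
  have A_slit: "\<i> * y \<notin> \<real>\<^sub>\<le>\<^sub>0" "y \<noteq> 0" if "y \<in> A" for y
    using that by (auto simp: A_def slit_disc_def)
  have Ln_hol: "(\<lambda>y. Ln (\<i> * y)) holomorphic_on A"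
    using A_slit by (intro holomorphic_intros) auto
  have EL: "mat_hol n n (\<lambda>y. E (Ln (\<i> * y))) A"
    unfolding E_def by (rule mat_hol_compose[OF local_exp_hol[OF im] Ln_hol]) simp
  have EL': "mat_hol n n (\<lambda>y. E (- Ln (\<i> * y))) A"
    unfolding E_def by (rule mat_hol_compose[OF local_exp_hol[OF im]]) (auto intro!: holomorphic_intros Ln_hol)
  define F where "F y = H y * E (Ln (\<i> * y))" for y
  define G where "G y = E (- Ln (\<i> * y)) * K y" for y
  note HA = mat_hol_subset[OF H(1) A_ball] and KA = mat_hol_subset[OF K A_ball]
  have E_inv: "E t * E (- t) = 1\<^sub>m n" "E (- t) * E t = 1\<^sub>m n" for t
    using local_exp_add[OF im, of \<kappa> t "- t"] local_exp_add[OF im, of \<kappa> "- t" t] local_exp_zero[OF im]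
    by (simp_all add: E_def)
  have "regular_pair n (\<lambda>y. lin_comb n n {..<m} (\<lambda>l. \<kappa> * weight m i \<phi> l y) res) A F G"
  proof (rule regular_pair_of_inverse[OF A])
    show "mat_hol n n F A" unfolding F_def[abs_def] by (rule mat_hol_mult[OF HA EL])
    show "mat_hol n n G A" unfolding G_def[abs_def] by (rule mat_hol_mult[OF EL' KA])
    fix y assume y: "y \<in> A"
    then have yb: "y \<in> ball 0 R" using A_ball by auto
    have "G y * F y = E (- Ln (\<i> * y)) * ((K y * H y) * E (Ln (\<i> * y)))"
      by (simp add: F_def G_def mat_assoc)
    then show "G y * F y = 1\<^sub>m n" by (simp add: inv(1)[OF yb] mat_one_mult E_inv)
    have "F y * G y = H y * ((E (Ln (\<i> * y)) * E (- Ln (\<i> * y))) * K y)"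
      by (simp add: F_def G_def mat_assoc)
    then show "F y * G y = 1\<^sub>m n" by (simp add: inv(2)[OF yb] mat_one_mult E_inv)
    have dE: "mat_deriv n n (\<lambda>y. E (Ln (\<i> * y))) y = (1 / y) \<cdot>\<^sub>m (X * E (Ln (\<i> * y)))"
    proof -
      have "((\<lambda>y. Ln (\<i> * y)) has_field_derivative 1 / y) (at y)"
        using A_slit[OF y] by (auto intro!: derivative_eq_intros simp: field_simps)
      then have "mat_deriv n n (\<lambda>y. E (Ln (\<i> * y))) y = (1 / y) \<cdot>\<^sub>m mat_deriv n n E (Ln (\<i> * y))"
        unfolding E_def by (intro mat_deriv_compose[OF local_exp_hol[OF im] open_UNIV]) auto
      then show ?thesis using local_exp_mat_deriv[OF im, of \<kappa> "Ln (\<i> * y)"] by (simp add: E_def X_def)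
    qed
    have "mat_deriv n n F y = ((1 / y) \<cdot>\<^sub>m (y \<cdot>\<^sub>m mat_deriv n n H y)) * E (Ln (\<i> * y)) +
        H y * ((1 / y) \<cdot>\<^sub>m (X * E (Ln (\<i> * y))))"
      unfolding F_def mat_deriv_mult[OF HA EL A y] dE using A_slit(2)[OF y]
      by (simp add: mat_smult_smult mat_smult_one)
    also have "\<dots> = ((1 / y) \<cdot>\<^sub>m X + B y) * F y"
      unfolding dH[OF yb] F_def using A_slit(2)[OF y]
      by (intro eq_matI) (simp_all add: mat_ring field_simps del: index_mult_mat(1))
    finally show "mat_deriv n n F y = lin_comb n n {..<m} (\<lambda>l. \<kappa> * weight m i \<phi> l y) res * F y"
      unfolding connection_split[OF im \<phi>] X_def B_def .
  qed auto
  then have transport: "parallel_transport n (connection m n \<kappa> res) (sigma_path m (polar r \<theta>) \<epsilon> i) =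
      F (1 / 2) * G (- 1 / 2)"
    using slit_disc_mem[OF R2(1)] A
    by (intro sigma_transport[OF r \<phi>_def \<phi> \<epsilon>, where A = A]) (auto simp: A_def)
  have Ln: "Ln (\<i> * (1 / 2)) + - Ln (\<i> * (- 1 / 2)) = \<i> * of_real pi"
    using Ln_times_of_real[of "1 / 2" \<i>] Ln_times_of_real[of "1 / 2" "- \<i>"] by simp
  have half: "(1 / 2 :: complex) \<in> ball 0 R" using R2 by simp
  have "S i * (F (1 / 2) * G (- 1 / 2)) =
      (S i * H (1 / 2)) * ((E (Ln (\<i> * (1 / 2))) * E (- Ln (\<i> * (- 1 / 2)))) * K (- 1 / 2))"
    by (simp add: F_def G_def mat_assoc)
  also have "S i * H (1 / 2) = H (- 1 / 2) * S i"
    using mirror[of "- 1 / 2"] half by simp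
  also have "E (Ln (\<i> * (1 / 2))) * E (- Ln (\<i> * (- 1 / 2))) = E (\<i> * of_real pi)"
    unfolding E_def local_exp_add[OF im] Ln ..
  finally have "sigma_monodromy \<kappa> (polar r \<theta>) \<epsilon> i =
      H (- 1 / 2) * (S i * E (\<i> * of_real pi)) * K (- 1 / 2)"
    unfolding sigma_monodromy_def transport by (simp add: mat_assoc)
  then show thesis
    using that[of H K] HK by (simp add: X_def B_def E_def \<phi>_def)
qed

lemma local_exp_intertwine:
  assumes "brauer_matrices m n' k \<alpha> S' e'" "f \<in> carrier_mat n n'" "i < m"
    "S i * f = f * S' i" "e i * f = f * e' i"
  shows "local_exp \<kappa> i t * f = f * brauer_matrices.local_exp n' k \<alpha> S' e' \<kappa> i t"
proof -
  interpret V': brauer_matrices m n' k \<alpha> S' e' by (rule assms(1))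
  have f: "dim_row f = n" "dim_col f = n'" using assms(2) by auto
  show ?thesis
    using assms(3) f unfolding local_exp_def V'.local_exp_def
    by (simp add: tri_def V'.tri_def mat_ring assms(4,5))
qed

text \<open>Hence the monodromy is natural with respect to intertwining matrices.\<close>

theorem sigma_monodromy_intertwine:
  assumes V': "brauer_matrices m n' k \<alpha> S' e'" and f: "f \<in> carrier_mat n n'"
    and Sf: "\<And>l. l < m \<Longrightarrow> S l * f = f * S' l" and ef: "\<And>l. l < m \<Longrightarrow> e l * f = f * e' l"
    and \<theta>: "0 < \<theta>" "\<theta> < pi / real m" and r: "0 < r" and i: "i < 2" and \<epsilon>: "0 < \<epsilon>" "\<epsilon> < 1"
    and gen: "nonresonant_param \<kappa> (k i) (\<alpha> i)"
  shows "sigma_monodromy \<kappa> (polar r \<theta>) \<epsilon> i * f =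
    f * brauer_matrices.sigma_monodromy m n' k S' e' \<kappa> (polar r \<theta>) \<epsilon> i"
proof -
  interpret V': brauer_matrices m n' k \<alpha> S' e' by (rule V')
  have im: "i < m" using i m by simp
  obtain R where R: "gap_radius m i (\<theta> - angle m i) R" by (rule gap_radius_exists[OF m \<theta> i])
  have R2: "1 / 2 < R" "0 < R" using R by (auto simp: gap_radius_def)
  obtain H K where HK: "frobenius_pair n (\<kappa> \<cdot>\<^sub>m res i) (regular_part \<kappa> i (\<theta> - angle m i)) (ereal R) H K"
    and T: "sigma_monodromy \<kappa> (polar r \<theta>) \<epsilon> i =
      H (- 1 / 2) * (S i * local_exp \<kappa> i (\<i> * of_real pi)) * K (- 1 / 2)"
    by (rule local_solution[OF \<theta> r i \<epsilon> gen R])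
  obtain H' K' where HK': "frobenius_pair n' (\<kappa> \<cdot>\<^sub>m V'.res i) (V'.regular_part \<kappa> i (\<theta> - angle m i)) (ereal R) H' K'"
    and T': "V'.sigma_monodromy \<kappa> (polar r \<theta>) \<epsilon> i =
      H' (- 1 / 2) * (S' i * V'.local_exp \<kappa> i (\<i> * of_real pi)) * K' (- 1 / 2)"
    by (rule V'.local_solution[OF \<theta> r i \<epsilon> gen R])
  define w where "w = (- 1 / 2 :: complex)"
  have half: "w \<in> eball 0 (ereal R)" using R2 by (simp add: w_def)
  note T = T[folded w_def] and T' = T'[folded w_def]
  have rf: "res l * f = f * V'.res l" if "l < m" for l
    by (rule res_intertwine[OF V' f that Sf[OF that] ef[OF that]])
  have fd [simp]: "dim_row f = n" "dim_col f = n'" using f by auto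
  have Hf: "H w * f = f * H' w"
  proof (rule frobenius_intertwine[OF _ _ _ residue_no_resonance[OF V' im gen] HK])
    show "mat_hol n n (regular_part \<kappa> i (\<theta> - angle m i)) (eball 0 (ereal R))"
      using regular_part_hol[OF R] by simp
    show "mat_hol n' n' (V'.regular_part \<kappa> i (\<theta> - angle m i)) (eball 0 (ereal R))"
      using V'.regular_part_hol[OF R] by simp
    show "\<kappa> \<cdot>\<^sub>m res i * f = f * (\<kappa> \<cdot>\<^sub>m V'.res i)"
      using im rf[OF im] by (simp add: mat_ring)
    show "regular_part \<kappa> i (\<theta> - angle m i) x * f = f * V'.regular_part \<kappa> i (\<theta> - angle m i) x" for x
      by (rule regular_part_intertwine[OF V' f rf])
  qed (use HK' f half R2 res_carrier[OF im] V'.res_carrier[OF im] in \<open>auto simp: frobenius_pair_def\<close>)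
  have Hd: "H w \<in> carrier_mat n n" "K w \<in> carrier_mat n n"
    "H' w \<in> carrier_mat n' n'" "K' w \<in> carrier_mat n' n'"
    and inv: "K w * H w = 1\<^sub>m n" "H' w * K' w = 1\<^sub>m n'"
    using HK HK' half unfolding frobenius_pair_def by (auto simp del: in_eball_iff dest: mat_hol_carrier)
  note Hd' = Hd[THEN carrier_matD(1)] Hd[THEN carrier_matD(2)]
  have Kf: "K w * f = f * K' w"
  proof -
    have "K w * f = K w * (f * (H' w * K' w))"
      unfolding inv(2) by (simp add: mat_one_mult)
    also have "\<dots> = K w * ((f * H' w) * K' w)" by (simp add: mat_assoc Hd')
    also have "\<dots> = (K w * H w) * (f * K' w)"
      unfolding Hf[symmetric] by (simp add: mat_assoc Hd')
    finally have "K w * f = (K w * H w) * (f * K' w)" .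
    then show ?thesis unfolding inv(1) by (simp add: mat_one_mult Hd')
  qed
  let ?t = "\<i> * of_real pi"
  note Ef = local_exp_intertwine[OF V' f im Sf[OF im] ef[OF im], of \<kappa> ?t]
  have "sigma_monodromy \<kappa> (polar r \<theta>) \<epsilon> i * f = H w * (S i * (local_exp \<kappa> i ?t * (K w * f)))"
    unfolding T using im by (simp add: mat_assoc Hd')
  also have "\<dots> = H w * (S i * ((local_exp \<kappa> i ?t * f) * K' w))"
    unfolding Kf using im by (simp add: mat_assoc Hd')
  also have "\<dots> = H w * ((S i * f) * (V'.local_exp \<kappa> i ?t * K' w))"
    unfolding Ef using im by (simp add: mat_assoc Hd')
  also have "\<dots> = (H w * f) * (S' i * (V'.local_exp \<kappa> i ?t * K' w))"
    unfolding Sf[OF im] using im by (simp add: mat_assoc Hd')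
  also have "\<dots> = f * V'.sigma_monodromy \<kappa> (polar r \<theta>) \<epsilon> i"
    unfolding Hf T' using im by (simp add: mat_assoc Hd')
  finally show ?thesis .
qed

text \<open>The conjugating matrix is a value of the normalising gauge transformation, which by uniqueness
  commutes with every matrix that commutes with the connection.\<close>

theorem sigma_monodromy_normal_form:
  assumes \<theta>: "0 < \<theta>" "\<theta> < pi / real m" and r: "0 < r" and i: "i < 2" and \<epsilon>: "0 < \<epsilon>" "\<epsilon> < 1"
    and gen: "nonresonant_param \<kappa> (k i) (\<alpha> i)"
  obtains P Q where "P \<in> carrier_mat n n" "Q \<in> carrier_mat n n" "P * Q = 1\<^sub>m n" "Q * P = 1\<^sub>m n"
    "sigma_monodromy \<kappa> (polar r \<theta>) \<epsilon> i = P * (S i * local_exp \<kappa> i (\<i> * of_real pi)) * Q"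
    "\<And>g. g \<in> carrier_mat n n \<Longrightarrow> (\<And>l. l < m \<Longrightarrow> res l * g = g * res l) \<Longrightarrow> P * g = g * P"
proof -
  have im: "i < m" using i m by simp
  have self: "brauer_matrices m n k \<alpha> S e" by unfold_locales
  obtain R where R: "gap_radius m i (\<theta> - angle m i) R" by (rule gap_radius_exists[OF m \<theta> i])
  have R2: "1 / 2 < R" "0 < R" using R by (auto simp: gap_radius_def)
  obtain H K where HK: "frobenius_pair n (\<kappa> \<cdot>\<^sub>m res i) (regular_part \<kappa> i (\<theta> - angle m i)) (ereal R) H K"
    and T: "sigma_monodromy \<kappa> (polar r \<theta>) \<epsilon> i =
      H (- 1 / 2) * (S i * local_exp \<kappa> i (\<i> * of_real pi)) * K (- 1 / 2)"
    by (rule local_solution[OF \<theta> r i \<epsilon> gen R])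
  define w where "w = (- 1 / 2 :: complex)"
  have half: "w \<in> eball 0 (ereal R)" using R2 by (simp add: w_def)
  note T = T[folded w_def]
  have Hd: "H w \<in> carrier_mat n n" "K w \<in> carrier_mat n n"
    and inv: "K w * H w = 1\<^sub>m n" "H w * K w = 1\<^sub>m n"
    using HK half unfolding frobenius_pair_def by (auto simp del: in_eball_iff dest: mat_hol_carrier)
  have "H w * g = g * H w"
    if g: "g \<in> carrier_mat n n" and rg: "\<And>l. l < m \<Longrightarrow> res l * g = g * res l" for g
  proof (rule frobenius_intertwine[OF _ _ _ residue_no_resonance[OF self im gen] HK])
    show "mat_hol n n (regular_part \<kappa> i (\<theta> - angle m i)) (eball 0 (ereal R))"
      using regular_part_hol[OF R] by simp
    then show "mat_hol n n (regular_part \<kappa> i (\<theta> - angle m i)) (eball 0 (ereal R))" .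
    show "\<kappa> \<cdot>\<^sub>m res i * g = g * (\<kappa> \<cdot>\<^sub>m res i)"
      using im rg[OF im] g by (simp add: mat_smult_mult)
    show "regular_part \<kappa> i (\<theta> - angle m i) x * g = g * regular_part \<kappa> i (\<theta> - angle m i) x" for x
      by (rule regular_part_intertwine[OF self g rg])
  qed (use HK g half R2 res_carrier[OF im] in \<open>auto simp: frobenius_pair_def\<close>)
  then show thesis using that Hd inv T by blast
qed

end

section \<open>The braid relation\<close>

text \<open>In the coordinate \<open>\<tau> = (x - \<i> y) / (x + \<i> y)\<close> the line \<open>l\<close> is the point \<open>cis (- 2 angle m l)\<close> of the
  unit circle. The rays from these points to infinity are removed.\<close>

definition cut_plane :: "nat \<Rightarrow> complex set"
  where "cut_plane m = {\<tau>. \<forall>l<m. 1 - cis (2 * angle m l) * \<tau> \<notin> \<real>\<^sub>\<le>\<^sub>0}"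

lemma cut_plane_open: "open (cut_plane m)"
proof -
  have "closed (\<Union>l<m. (\<lambda>\<tau>. 1 - cis (2 * angle m l) * \<tau>) -` \<real>\<^sub>\<le>\<^sub>0)"
    by (intro closed_UN ballI closed_vimage closed_nonpos_Reals_complex continuous_intros) auto
  then have "open (- (\<Union>l<m. (\<lambda>\<tau>. 1 - cis (2 * angle m l) * \<tau>) -` \<real>\<^sub>\<le>\<^sub>0))" by (rule open_Compl)
  moreover have "- (\<Union>l<m. (\<lambda>\<tau>. 1 - cis (2 * angle m l) * \<tau>) -` \<real>\<^sub>\<le>\<^sub>0) = cut_plane m"
    by (auto simp: cut_plane_def)
  ultimately show ?thesis by simp
qed

lemma zero_in_cut_plane: "0 \<in> cut_plane m"
  by (simp add: cut_plane_def complex_nonpos_Reals_iff)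

lemma cut_plane_nonzero: "\<tau> \<in> cut_plane m \<Longrightarrow> l < m \<Longrightarrow> cis (2 * angle m l) * \<tau> \<noteq> 1"
  by (auto simp: cut_plane_def)

lemma cut_plane_starlike: "starlike (cut_plane m)"
  unfolding starlike_def
proof (intro bexI[of _ 0] ballI zero_in_cut_plane)
  fix \<tau> assume \<tau>: "\<tau> \<in> cut_plane m"
  show "closed_segment 0 \<tau> \<subseteq> cut_plane m"
  proof
    fix z assume "z \<in> closed_segment 0 \<tau>"
    then obtain t where t: "0 \<le> t" "t \<le> 1" "z = t *\<^sub>R \<tau>" by (auto simp: in_segment)
    show "z \<in> cut_plane m"
      unfolding cut_plane_def
    proof safe
      fix l assume l: "l < m" and neg: "1 - cis (2 * angle m l) * z \<in> \<real>\<^sub>\<le>\<^sub>0"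
      define v where "v = cis (2 * angle m l) * \<tau>"
      have eq: "cis (2 * angle m l) * z = t *\<^sub>R v" by (simp add: v_def t(3))
      have v: "1 \<le> t * Re v" "t * Im v = 0" using neg unfolding eq by (auto simp: complex_nonpos_Reals_iff)
      then have "t \<noteq> 0" by auto
      then have "0 < Re v" using v(1) t(1) by (metis less_eq_real_def mult_nonneg_nonpos not_le zero_less_one_class.zero_less_one order_trans less_le_not_le)
      then have "t * Re v \<le> 1 * Re v" using t(2) by (intro mult_right_mono) auto
      then have "1 - v \<in> \<real>\<^sub>\<le>\<^sub>0" using v \<open>t \<noteq> 0\<close> by (auto simp: complex_nonpos_Reals_iff)
      then show False using \<tau> l by (auto simp: cut_plane_def v_def)
    qed
  qed
qed

lemma cut_plane_not_UNIV: "0 < m \<Longrightarrow> cut_plane m \<noteq> UNIV"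
proof -
  assume "0 < m"
  then have "1 \<notin> cut_plane m" by (auto simp: cut_plane_def angle_def)
  then show ?thesis by auto
qed

lemma cut_plane_disc:
  assumes "cmod \<tau> \<le> 1" "\<And>l. l < m \<Longrightarrow> cis (2 * angle m l) * \<tau> \<noteq> 1"
  shows "\<tau> \<in> cut_plane m"
  unfolding cut_plane_def
proof safe
  fix l assume l: "l < m" and neg: "1 - cis (2 * angle m l) * \<tau> \<in> \<real>\<^sub>\<le>\<^sub>0"
  define v where "v = cis (2 * angle m l) * \<tau>"
  have "cmod v \<le> 1" using assms(1) by (simp add: v_def norm_mult)
  then have "Re v \<le> 1" using complex_Re_le_cmod[of v] by linarith
  moreover have "1 \<le> Re v" "Im v = 0" using neg by (auto simp: complex_nonpos_Reals_iff v_def)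
  ultimately have "v = 1" by (simp add: complex_eq_iff)
  then show False using assms(2)[OF l] by (simp add: v_def)
qed

lemma cis_2_angle_mirror:
  assumes "l < m"
  shows "cis (2 * angle m (mirror m i l)) = cis (4 * angle m i) * inverse (cis (2 * angle m l))"
proof -
  obtain j :: int where j: "angle m (mirror m i l) = 2 * angle m i - angle m l + of_int j * pi"
    using angle_mirror[OF assms] by blast
  have "cis (2 * angle m (mirror m i l)) = cis (4 * angle m i) * cis (- (2 * angle m l)) * cis (2 * pi * of_int j)"
    unfolding cis_mult j by (simp add: algebra_simps)
  then show ?thesis by (simp add: cis_multiple_2pi flip: cis_inverse)
qed

context brauer_matrices
begin

lemma total_eq_lin_comb: "c \<cdot>\<^sub>m total = lin_comb n n {..<m} (\<lambda>_. c) res"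
  by (simp add: total_def lin_comb_smult)

lemma lin_comb_add: "lin_comb n n I c X + lin_comb n n I d X = lin_comb n n I (\<lambda>i. c i + d i) X"
  by (auto intro!: eq_matI simp: distrib_right sum.distrib)

lemma lin_comb_commute:
  assumes "g \<in> carrier_mat n n" "\<And>l. l < m \<Longrightarrow> res l * g = g * res l"
  shows "lin_comb n n {..<m} c res * g = g * lin_comb n n {..<m} c res"
proof -
  have "lin_comb n n {..<m} c res * g = lin_comb n n {..<m} c (\<lambda>l. res l * g)"
    by (rule lin_comb_mult_right) (use res_carrier assms in auto)
  also have "\<dots> = lin_comb n n {..<m} c (\<lambda>l. g * res l)"
    using assms by (intro lin_comb_cong) auto
  also have "\<dots> = g * lin_comb n n {..<m} c res"
    by (rule lin_comb_mult_left[symmetric]) (use res_carrier assms in auto)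
  finally show ?thesis .
qed

definition circle_form :: "complex \<Rightarrow> complex \<Rightarrow> complex mat"
  where "circle_form \<kappa> \<tau> = lin_comb n n {..<m}
    (\<lambda>l. - (\<kappa> * cis (2 * angle m l) / (1 - cis (2 * angle m l) * \<tau>))) res"

text \<open>In the coordinates \<open>a = x + \<i> y\<close> and \<open>\<tau> = (x - \<i> y) / a\<close> the connection form is
  \<open>\<kappa> total da / a\<close> plus a form in \<open>\<tau>\<close> alone. The flat sections are \<open>E (log a) G \<tau>\<close>.\<close>

definition global_solution ::
    "complex \<Rightarrow> (complex \<Rightarrow> complex mat) \<Rightarrow> (complex \<Rightarrow> complex mat) \<Rightarrow>
      (complex \<Rightarrow> complex mat) \<Rightarrow> (complex \<Rightarrow> complex mat) \<Rightarrow> bool"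
  where "global_solution \<kappa> E E' G G' \<longleftrightarrow>
    regular_pair n (\<lambda>_. \<kappa> \<cdot>\<^sub>m total) UNIV E E' \<and> E 0 = 1\<^sub>m n \<and> E' 0 = 1\<^sub>m n \<and>
    regular_pair n (circle_form \<kappa>) (cut_plane m) G G' \<and> G 0 = 1\<^sub>m n \<and> G' 0 = 1\<^sub>m n"

lemma global_solution_exists: obtains E E' G G' where "global_solution \<kappa> E E' G G'"
proof -
  have "mat_hol n n (\<lambda>_. \<kappa> \<cdot>\<^sub>m total) (eball 0 \<infinity>)" by (intro mat_hol_const) simp
  then obtain E E' where E: "regular_pair n (\<lambda>_. \<kappa> \<cdot>\<^sub>m total) UNIV E E'" "E 0 = 1\<^sub>m n" "E' 0 = 1\<^sub>m n"
    by (rule regular_pair_disc) auto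
  have circle: "mat_hol n n (circle_form \<kappa>) (cut_plane m)"
    unfolding circle_form_def[abs_def]
    by (intro mat_hol_lin_comb holomorphic_intros) (auto dest: cut_plane_nonzero)
  obtain G G' where "regular_pair n (circle_form \<kappa>) (cut_plane m) G G'" "G 0 = 1\<^sub>m n" "G' 0 = 1\<^sub>m n"
    by (rule regular_pair_exists[OF cut_plane_open _ _ zero_in_cut_plane circle])
      (auto simp: starlike_imp_simply_connected cut_plane_starlike cut_plane_not_UNIV)
  with E show thesis using that by (auto simp: global_solution_def)
qed

end

locale braid_setting = brauer_matrices +
  fixes \<kappa> :: complex and E E' G G' :: "complex \<Rightarrow> complex mat"
  assumes sol: "global_solution \<kappa> E E' G G'"
begin

lemma E: "mat_hol n n E UNIV" and E': "mat_hol n n E' UNIV" and E0: "E 0 = 1\<^sub>m n" "E' 0 = 1\<^sub>m n"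
  and E_inv: "E' s * E s = 1\<^sub>m n" "E s * E' s = 1\<^sub>m n"
  and dE: "mat_deriv n n E s = (\<kappa> \<cdot>\<^sub>m total) * E s"
  and E_pair: "regular_pair n (\<lambda>_. \<kappa> \<cdot>\<^sub>m total) UNIV E E'"
  using sol by (auto simp: global_solution_def regular_pair_def)

lemma G: "mat_hol n n G (cut_plane m)" and G': "mat_hol n n G' (cut_plane m)"
  and G0: "G 0 = 1\<^sub>m n" "G' 0 = 1\<^sub>m n"
  and G_inv: "\<tau> \<in> cut_plane m \<Longrightarrow> G' \<tau> * G \<tau> = 1\<^sub>m n" "\<tau> \<in> cut_plane m \<Longrightarrow> G \<tau> * G' \<tau> = 1\<^sub>m n"
  and dG: "\<tau> \<in> cut_plane m \<Longrightarrow> mat_deriv n n G \<tau> = circle_form \<kappa> \<tau> * G \<tau>"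
  and G_pair: "regular_pair n (circle_form \<kappa>) (cut_plane m) G G'"
  using sol by (auto simp: global_solution_def regular_pair_def)

lemma EG_dim [simp]:
  "dim_row (E s) = n" "dim_col (E s) = n" "dim_row (E' s) = n" "dim_col (E' s) = n"
  "dim_row (G s) = n" "dim_col (G s) = n" "dim_row (G' s) = n" "dim_col (G' s) = n"
  "dim_row (circle_form \<kappa> s) = n" "dim_col (circle_form \<kappa> s) = n"
  using E E' G G' by (auto simp: circle_form_def)

lemma cut_plane_connected: "connected (cut_plane m)"
  by (simp add: starlike_imp_connected cut_plane_starlike)

lemma E_commute:
  assumes g: "g \<in> carrier_mat n n" "total * g = g * total"
  shows "E s * g = g * E s"
proof -
  have gd: "dim_row g = n" "dim_col g = n" using g by auto
  have "E' s * g * E s = E' 0 * g * E 0"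
    by (rule regular_intertwine[OF open_UNIV connected_UNIV E_pair, of "\<lambda>_. \<kappa> \<cdot>\<^sub>m total"])
      (use g E dE gd in \<open>auto simp: mat_ring\<close>)
  then have "E s * (E' s * g * E s) = E s * g" using gd E0 by (simp add: mat_one_mult)
  moreover have "E s * (E' s * g * E s) = (E s * E' s) * (g * E s)" using gd by (simp add: mat_assoc)
  ultimately show ?thesis using gd by (simp add: E_inv mat_one_mult)
qed

lemma E_add: "E s * E t = E (s + t)"
proof -
  have "E' s * 1\<^sub>m n * E (s + t) = E' 0 * 1\<^sub>m n * E (0 + t)"
  proof (rule regular_intertwine[OF open_UNIV connected_UNIV E_pair,
        where F' = "\<lambda>s. E (s + t)" and B' = "\<lambda>_. \<kappa> \<cdot>\<^sub>m total"])
    show "mat_hol n n (\<lambda>s. E (s + t)) UNIV"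
      by (rule mat_hol_compose[OF E]) (auto intro!: holomorphic_intros)
    fix x
    have "mat_deriv n n (\<lambda>s. E (s + t)) x = 1 \<cdot>\<^sub>m mat_deriv n n E (x + t)"
      by (rule mat_deriv_compose[OF E open_UNIV]) (auto intro!: derivative_eq_intros)
    then show "mat_deriv n n (\<lambda>s. E (s + t)) x = (\<kappa> \<cdot>\<^sub>m total) * E (x + t)"
      by (simp add: dE mat_smult_one)
  qed (auto simp: mat_one_mult)
  then have "E s * (E' s * E (s + t)) = E s * E t" by (simp add: mat_one_mult E0)
  moreover have "E s * (E' s * E (s + t)) = (E s * E' s) * E (s + t)" by (simp add: mat_assoc)
  ultimately show ?thesis by (simp add: E_inv mat_one_mult)
qed

lemma E_S: "t < m \<Longrightarrow> E s * S t = S t * E s"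
  by (rule E_commute) (auto simp: S_carrier total_S)

lemma E_res: "l < m \<Longrightarrow> E s * res l = res l * E s"
  by (rule E_commute) (auto simp: res_carrier total_res)

lemma E_G: "\<tau> \<in> cut_plane m \<Longrightarrow> E s * G \<tau> = G \<tau> * E s"
proof -
  assume \<tau>: "\<tau> \<in> cut_plane m"
  have "G' \<tau> * E s * G \<tau> = G' 0 * E s * G 0"
    by (rule regular_intertwine[OF cut_plane_open cut_plane_connected G_pair, of "circle_form \<kappa>"])
      (use mat_hol_carrier[OF E] G dG \<tau> zero_in_cut_plane E_res in
        \<open>auto simp: circle_form_def intro!: lin_comb_commute\<close>)
  then have "G \<tau> * (G' \<tau> * E s * G \<tau>) = G \<tau> * E s" by (simp add: mat_one_mult G0)
  moreover have "G \<tau> * (G' \<tau> * E s * G \<tau>) = (G \<tau> * G' \<tau>) * (E s * G \<tau>)" by (simp add: mat_assoc)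
  ultimately show ?thesis by (simp add: G_inv[OF \<tau>] mat_one_mult)
qed

lemma EG_pair:
  assumes A: "open A" and lam: "\<And>y. y \<in> A \<Longrightarrow> (lam has_field_derivative lam' y) (at y)"
    and tau: "\<And>y. y \<in> A \<Longrightarrow> (tau has_field_derivative tau' y) (at y)" "tau ` A \<subseteq> cut_plane m"
  shows "regular_pair n (\<lambda>y. lin_comb n n {..<m} (\<lambda>l. \<kappa> * (lam' y -
      tau' y * (cis (2 * angle m l) / (1 - cis (2 * angle m l) * tau y)))) res) A
    (\<lambda>y. E (lam y) * G (tau y)) (\<lambda>y. G' (tau y) * E' (lam y))"
proof (rule regular_pair_of_inverse[OF A])
  have hol: "lam holomorphic_on A" "tau holomorphic_on A"
    using lam tau(1) A by (auto simp: holomorphic_on_open)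
  have El: "mat_hol n n (\<lambda>y. E (lam y)) A" and El': "mat_hol n n (\<lambda>y. E' (lam y)) A"
    by (auto intro!: mat_hol_compose[OF E hol(1)] mat_hol_compose[OF E' hol(1)])
  have Gt: "mat_hol n n (\<lambda>y. G (tau y)) A" and Gt': "mat_hol n n (\<lambda>y. G' (tau y)) A"
    by (auto intro!: mat_hol_compose[OF G hol(2) tau(2)] mat_hol_compose[OF G' hol(2) tau(2)])
  show "mat_hol n n (\<lambda>y. E (lam y) * G (tau y)) A" by (rule mat_hol_mult[OF El Gt])
  show "mat_hol n n (\<lambda>y. G' (tau y) * E' (lam y)) A" by (rule mat_hol_mult[OF Gt' El'])
  fix y assume y: "y \<in> A"
  then have ty: "tau y \<in> cut_plane m" using tau(2) by auto
  have "G' (tau y) * E' (lam y) * (E (lam y) * G (tau y)) = G' (tau y) * ((E' (lam y) * E (lam y)) * G (tau y))"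
    by (simp add: mat_assoc)
  then show "G' (tau y) * E' (lam y) * (E (lam y) * G (tau y)) = 1\<^sub>m n"
    by (simp add: E_inv G_inv[OF ty] mat_one_mult)
  have "E (lam y) * G (tau y) * (G' (tau y) * E' (lam y)) = E (lam y) * ((G (tau y) * G' (tau y)) * E' (lam y))"
    by (simp add: mat_assoc)
  then show "E (lam y) * G (tau y) * (G' (tau y) * E' (lam y)) = 1\<^sub>m n"
    by (simp add: E_inv G_inv[OF ty] mat_one_mult)
  have 1: "mat_deriv n n (\<lambda>y. E (lam y)) y = lam' y \<cdot>\<^sub>m ((\<kappa> \<cdot>\<^sub>m total) * E (lam y))"
    using mat_deriv_compose[OF E open_UNIV lam[OF y]] by (simp add: dE)
  have 2: "mat_deriv n n (\<lambda>y. G (tau y)) y = tau' y \<cdot>\<^sub>m (circle_form \<kappa> (tau y) * G (tau y))"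
    using mat_deriv_compose[OF G cut_plane_open tau(1)[OF y] ty] by (simp add: dG[OF ty])
  have comm: "E (lam y) * circle_form \<kappa> (tau y) = circle_form \<kappa> (tau y) * E (lam y)"
    unfolding circle_form_def
    by (rule lin_comb_commute[symmetric]) (auto simp: E_res mat_hol_carrier[OF E])
  have "mat_deriv n n (\<lambda>y. E (lam y) * G (tau y)) y =
      lam' y \<cdot>\<^sub>m ((\<kappa> \<cdot>\<^sub>m total) * E (lam y)) * G (tau y) + tau' y \<cdot>\<^sub>m ((E (lam y) * circle_form \<kappa> (tau y)) * G (tau y))"
    unfolding mat_deriv_mult[OF El Gt A y] 1 2 by (simp add: mat_ring)
  also have "\<dots> = (lam' y \<cdot>\<^sub>m (\<kappa> \<cdot>\<^sub>m total) + tau' y \<cdot>\<^sub>m circle_form \<kappa> (tau y)) * (E (lam y) * G (tau y))"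
    unfolding comm by (simp add: mat_ring)
  also have "lam' y \<cdot>\<^sub>m (\<kappa> \<cdot>\<^sub>m total) + tau' y \<cdot>\<^sub>m circle_form \<kappa> (tau y) =
      lin_comb n n {..<m} (\<lambda>l. \<kappa> * (lam' y -
      tau' y * (cis (2 * angle m l) / (1 - cis (2 * angle m l) * tau y)))) res"
    unfolding mat_smult_smult total_eq_lin_comb circle_form_def lin_comb_smult lin_comb_add
    by (intro lin_comb_cong) (auto simp: algebra_simps)
  finally show "mat_deriv n n (\<lambda>y. E (lam y) * G (tau y)) y =
      lin_comb n n {..<m} (\<lambda>l. \<kappa> * (lam' y -
      tau' y * (cis (2 * angle m l) / (1 - cis (2 * angle m l) * tau y)))) res * (E (lam y) * G (tau y))" .
qed auto

definition rot :: "complex mat"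
  where "rot = S 1 * S 0"

lemma one_m [simp]: "1 < m" "Suc 0 < m" using m by auto

lemma rot_dim [simp]: "dim_row rot = n" "dim_col rot = n" "rot \<in> carrier_mat n n"
  using S_carrier[of 1] S_carrier[of 0] by (auto simp: rot_def)

lemma rot_res: "l < m \<Longrightarrow> rot * res l = res (mirror m 1 (mirror m 0 l)) * rot"
proof -
  assume l: "l < m"
  have "rot * res l = S 1 * (S 0 * res l)" using l by (simp add: rot_def mat_assoc)
  also have "\<dots> = (S 1 * res (mirror m 0 l)) * S 0"
    unfolding res_conj[OF m_pos(1) l] by (simp add: mat_assoc)
  also have "\<dots> = res (mirror m 1 (mirror m 0 l)) * rot"
    unfolding res_conj[OF one_m(1) mirror_m] rot_def by (simp add: mat_assoc)
  finally show ?thesis .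
qed

definition root :: complex
  where "root = cis (4 * pi / real m)"

lemma cis_rot: "l < m \<Longrightarrow> cis (2 * angle m (mirror m 1 (mirror m 0 l))) = root * cis (2 * angle m l)"
  unfolding cis_2_angle_mirror[OF mirror_m] cis_2_angle_mirror[of l m 0] by (simp add: angle_def root_def)

lemma root_mult_cut_plane: "\<tau> \<in> cut_plane m \<Longrightarrow> root * \<tau> \<in> cut_plane m"
  unfolding cut_plane_def
proof safe
  fix l assume \<tau>: "\<forall>l<m. 1 - cis (2 * angle m l) * \<tau> \<notin> \<real>\<^sub>\<le>\<^sub>0" and l: "l < m"
    and neg: "1 - cis (2 * angle m l) * (root * \<tau>) \<in> \<real>\<^sub>\<le>\<^sub>0"
  have "cis (2 * angle m (mirror m 1 (mirror m 0 l))) * \<tau> = cis (2 * angle m l) * (root * \<tau>)"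
    unfolding cis_rot[OF l] by (simp add: mult_ac)
  then show False using \<tau> neg by (metis mirror_m)
qed

text \<open>Rotation by \<open>2 \<pi> / m\<close> permutes the poles, so that \<open>G\<close> is equivariant by uniqueness.\<close>

lemma rot_G: "\<tau> \<in> cut_plane m \<Longrightarrow> G \<tau> * rot = rot * G (root * \<tau>)"
proof -
  assume \<tau>: "\<tau> \<in> cut_plane m"
  have "G' \<tau> * rot * G (root * \<tau>) = G' 0 * rot * G (root * 0)"
  proof (rule regular_intertwine[OF cut_plane_open cut_plane_connected G_pair,
        where F' = "\<lambda>\<tau>. G (root * \<tau>)" and B' = "\<lambda>\<tau>. root \<cdot>\<^sub>m circle_form \<kappa> (root * \<tau>)"])
    show "mat_hol n n (\<lambda>\<tau>. G (root * \<tau>)) (cut_plane m)"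
      by (rule mat_hol_compose[OF G]) (auto intro!: holomorphic_intros root_mult_cut_plane)
    fix x assume x: "x \<in> cut_plane m"
    have "mat_deriv n n (\<lambda>\<tau>. G (root * \<tau>)) x = root \<cdot>\<^sub>m mat_deriv n n G (root * x)"
      by (rule mat_deriv_compose[where g = "(*) root", OF G cut_plane_open _ root_mult_cut_plane[OF x]])
        (auto intro!: derivative_eq_intros)
    then show "mat_deriv n n (\<lambda>\<tau>. G (root * \<tau>)) x = root \<cdot>\<^sub>m circle_form \<kappa> (root * x) * G (root * x)"
      by (simp add: dG[OF root_mult_cut_plane[OF x]] mat_smult_mult)
    define \<pi> where "\<pi> l = mirror m 1 (mirror m 0 l)" for l
    have bij: "bij_betw \<pi> {..<m} {..<m}"
      using bij_betw_trans[OF mirror_bij mirror_bij, of m 1 0] by (simp add: \<pi>_def[abs_def] o_def)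
    define c where "c l = - (\<kappa> * cis (2 * angle m l) / (1 - cis (2 * angle m l) * x))" for l
    have "circle_form \<kappa> x * rot = lin_comb n n {..<m} c (\<lambda>l. res l * rot)"
      unfolding circle_form_def c_def[symmetric, abs_def]
      by (rule lin_comb_mult_right) (auto simp: res_carrier)
    also have "\<dots> = lin_comb n n {..<m} (\<lambda>l. c (\<pi> l)) (\<lambda>l. res (\<pi> l) * rot)"
      by (rule lin_comb_reindex[OF bij])
    also have "\<dots> = lin_comb n n {..<m} (\<lambda>l. root * - (\<kappa> * cis (2 * angle m l) / (1 - cis (2 * angle m l) * (root * x)))) (\<lambda>l. rot * res l)"
    proof (rule lin_comb_cong)
      fix l assume "l \<in> {..<m}"
      then have l: "l < m" by simp
      show "c (\<pi> l) = root * - (\<kappa> * cis (2 * angle m l) / (1 - cis (2 * angle m l) * (root * x)))"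
        unfolding c_def \<pi>_def cis_rot[OF l] by (simp add: mult_ac)
      show "res (\<pi> l) * rot = rot * res l" unfolding \<pi>_def rot_res[OF l] ..
    qed
    also have "\<dots> = rot * lin_comb n n {..<m} (\<lambda>l. root * - (\<kappa> * cis (2 * angle m l) / (1 - cis (2 * angle m l) * (root * x)))) res"
      by (rule lin_comb_mult_left[symmetric]) (auto simp: res_carrier)
    also have "\<dots> = rot * (root \<cdot>\<^sub>m circle_form \<kappa> (root * x))"
      by (simp add: circle_form_def lin_comb_smult)
    finally show "circle_form \<kappa> x * rot = rot * (root \<cdot>\<^sub>m circle_form \<kappa> (root * x))" .
  qed (use \<tau> zero_in_cut_plane in \<open>auto simp: circle_form_def\<close>)
  then have "G \<tau> * (G' \<tau> * rot * G (root * \<tau>)) = G \<tau> * rot" by (simp add: mat_one_mult G0)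
  moreover have "G \<tau> * (G' \<tau> * rot * G (root * \<tau>)) = (G \<tau> * G' \<tau>) * (rot * G (root * \<tau>))"
    by (simp add: mat_assoc)
  ultimately show ?thesis by (simp add: G_inv[OF \<tau>] mat_one_mult)
qed

text \<open>The fundamental solution at the point \<open>(cos x, sin x)\<close>, where \<open>a = exp (\<i> x)\<close> and
  \<open>\<tau> = exp (- 2 \<i> x)\<close>.\<close>

definition Psi :: "complex \<Rightarrow> complex mat"
  where "Psi x = E (\<i> * x) * G (exp (- 2 * \<i> * x))"

definition Psi' :: "complex \<Rightarrow> complex mat"
  where "Psi' x = G' (exp (- 2 * \<i> * x)) * E' (\<i> * x)"

definition off_lines :: "complex \<Rightarrow> bool"
  where "off_lines x \<longleftrightarrow> exp (- 2 * \<i> * x) \<in> cut_plane m"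

lemma Psi_dim [simp]:
  "dim_row (Psi x) = n" "dim_col (Psi x) = n" "dim_row (Psi' x) = n" "dim_col (Psi' x) = n"
  by (auto simp: Psi_def Psi'_def)

lemma Psi_inv: "off_lines x \<Longrightarrow> Psi x * Psi' x = 1\<^sub>m n" "off_lines x \<Longrightarrow> Psi' x * Psi x = 1\<^sub>m n"
proof -
  assume x: "off_lines x"
  let ?t = "exp (- 2 * \<i> * x)"
  have "Psi x * Psi' x = E (\<i> * x) * ((G ?t * G' ?t) * E' (\<i> * x))"
    by (simp add: Psi_def Psi'_def mat_assoc)
  then show "Psi x * Psi' x = 1\<^sub>m n" using x by (simp add: off_lines_def G_inv E_inv mat_one_mult)
  have "Psi' x * Psi x = G' ?t * ((E' (\<i> * x) * E (\<i> * x)) * G ?t)"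
    by (simp add: Psi_def Psi'_def mat_assoc)
  then show "Psi' x * Psi x = 1\<^sub>m n" using x by (simp add: off_lines_def G_inv E_inv mat_one_mult)
qed

lemma E_Psi: "off_lines x \<Longrightarrow> E s * Psi x = Psi x * E s"
proof -
  assume x: "off_lines x"
  define t where "t = exp (- 2 * \<i> * x)"
  have t: "t \<in> cut_plane m" using x by (simp add: off_lines_def t_def)
  have "E s * Psi x = (E s * E (\<i> * x)) * G t" by (simp add: Psi_def t_def mat_assoc)
  also have "E s * E (\<i> * x) = E (\<i> * x) * E s" by (simp add: E_add add.commute)
  also have "E (\<i> * x) * E s * G t = E (\<i> * x) * (E s * G t)" by (simp add: mat_assoc)
  also have "\<dots> = Psi x * E s"
    unfolding E_G[OF t] by (simp add: Psi_def t_def mat_assoc)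
  finally show ?thesis .
qed

lemma Psi_pi: "Psi (x + of_real pi) = E (\<i> * of_real pi) * Psi x" "off_lines (x + of_real pi) = off_lines x"
proof -
  have e: "exp (- 2 * \<i> * (x + of_real pi)) = exp (- 2 * \<i> * x)"
  proof -
    have "- 2 * \<i> * (x + of_real pi) = - 2 * \<i> * x + - (2 * of_real pi * \<i>)"
      by (simp add: algebra_simps)
    then show ?thesis by (simp only: exp_add exp_minus exp_two_pi_i) simp
  qed
  show "Psi (x + of_real pi) = E (\<i> * of_real pi) * Psi x"
    unfolding Psi_def e by (simp add: mat_assoc[symmetric] E_add algebra_simps)
  show "off_lines (x + of_real pi) = off_lines x" unfolding off_lines_def e ..
qed

lemma Psi_rot:
  assumes "off_lines x"
  defines "h \<equiv> of_real (2 * pi / real m) :: complex"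
  shows "Psi (x + h) * rot = E (\<i> * h) * (rot * Psi x)" and "off_lines (x + h)"
proof -
  let ?t = "exp (- 2 * \<i> * x)"
  have root: "root = exp (2 * \<i> * h)"
    by (simp add: root_def h_def cis_conv_exp algebra_simps)
  have e: "root * exp (- 2 * \<i> * (x + h)) = ?t"
    unfolding root exp_add[symmetric] by (simp add: algebra_simps)
  have t: "?t \<in> cut_plane m" using assms by (simp add: off_lines_def)
  show off: "off_lines (x + h)"
    unfolding off_lines_def
  proof -
    have "root ^ (m - 1) * ?t \<in> cut_plane m"
    proof -
      have "root ^ j * ?t \<in> cut_plane m" for j
        using t root_mult_cut_plane by (induction j) (auto simp: mult.assoc)
      then show ?thesis .
    qed
    moreover have "root ^ m = 1"
    proof -
      have "root ^ m = cis (real m * (4 * pi / real m))" unfolding root_def by (rule Complex.DeMoivre)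
      also have "real m * (4 * pi / real m) = 2 * pi * 2" using m by simp
      also have "cis (2 * pi * 2) = 1" using cis_multiple_2pi[of 2] by simp
      finally show ?thesis .
    qed
    then have "root ^ (m - 1) * root = 1" using m by (metis m_pos(1) mult.commute power_eq_if m_pos(3))
    then have "root ^ (m - 1) * ?t = exp (- 2 * \<i> * (x + h))"
      unfolding e[symmetric] by (simp add: mult.assoc[symmetric])
    ultimately show "exp (- 2 * \<i> * (x + h)) \<in> cut_plane m" by simp
  qed
  have "Psi (x + h) * rot = E (\<i> * (x + h)) * (G (exp (- 2 * \<i> * (x + h))) * rot)"
    by (simp add: Psi_def mat_assoc)
  also have "G (exp (- 2 * \<i> * (x + h))) * rot = rot * G ?t"
    using rot_G[of "exp (- 2 * \<i> * (x + h))"] off unfolding off_lines_def e by simp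
  also have "E (\<i> * (x + h)) * (rot * G ?t) = E (\<i> * h) * (E (\<i> * x) * rot) * G ?t"
    by (simp add: mat_assoc[symmetric] E_add algebra_simps)
  also have "E (\<i> * x) * rot = rot * E (\<i> * x)"
  proof -
    have "E (\<i> * x) * rot = (E (\<i> * x) * S 1) * S 0" by (simp add: rot_def mat_assoc)
    also have "\<dots> = S 1 * (E (\<i> * x) * S 0)" by (simp add: E_S mat_assoc)
    also have "\<dots> = rot * E (\<i> * x)" by (simp add: E_S rot_def mat_assoc)
    finally show ?thesis .
  qed
  finally show "Psi (x + h) * rot = E (\<i> * h) * (rot * Psi x)"
    by (simp add: Psi_def mat_assoc)
qed

end

lemma regular_pair_cong:
  assumes "regular_pair n B A F K" "\<And>y. y \<in> A \<Longrightarrow> B y = B' y"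
  shows "regular_pair n B' A F K"
  using assms by (simp add: regular_pair_def)

lemma regular_pair_conj:
  assumes FK: "regular_pair n B A F K" and A: "open A" and S: "S \<in> carrier_mat n n" "S * S = 1\<^sub>m n"
    and B: "\<And>y. B y \<in> carrier_mat n n" "\<And>y. B' y \<in> carrier_mat n n"
    and comm: "\<And>y. y \<in> A \<Longrightarrow> S * B y = B' y * S"
  shows "regular_pair n B' A (\<lambda>y. S * F y * S) (\<lambda>y. S * K y * S)"
proof (rule regular_pair_of_inverse[OF A])
  have F: "mat_hol n n F A" and K: "mat_hol n n K A" and dF: "\<And>y. y \<in> A \<Longrightarrow> mat_deriv n n F y = B y * F y"
    and inv: "\<And>y. y \<in> A \<Longrightarrow> K y * F y = 1\<^sub>m n" "\<And>y. y \<in> A \<Longrightarrow> F y * K y = 1\<^sub>m n"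
    using FK by (auto simp: regular_pair_def)
  have Sd [simp]: "dim_row S = n" "dim_col S = n" using S by auto
  have d [simp]: "dim_row (F y) = n" "dim_col (F y) = n" "dim_row (K y) = n" "dim_col (K y) = n" 
    "dim_row (B y) = n" "dim_col (B y) = n" "dim_row (B' y) = n" "dim_col (B' y) = n" for y
    using F K B[of y] by auto
  have SF: "mat_hol n n (\<lambda>y. S * F y) A" using S by (intro mat_hol_mult[OF mat_hol_const F])
  show "mat_hol n n (\<lambda>y. S * F y * S) A" using S by (intro mat_hol_mult[OF SF mat_hol_const])
  show "mat_hol n n (\<lambda>y. S * K y * S) A"
    using S by (intro mat_hol_mult[OF mat_hol_mult[OF mat_hol_const K] mat_hol_const])
  have *: "(S * M * S) * (S * N * S) = S * (M * N) * S" if "M \<in> carrier_mat n n" "N \<in> carrier_mat n n" for M N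
  proof -
    have "(S * M * S) * (S * N * S) = S * (M * ((S * S) * (N * S)))" using that by (simp add: mat_assoc)
    then show ?thesis unfolding S(2) using that by (simp add: mat_assoc mat_one_mult)
  qed
  fix y assume y: "y \<in> A"
  have SS: "S * 1\<^sub>m n * S = 1\<^sub>m n" using S by (simp add: mat_one_mult)
  show "S * K y * S * (S * F y * S) = 1\<^sub>m n" "S * F y * S * (S * K y * S) = 1\<^sub>m n"
    unfolding *[OF mat_hol_carrier[OF K] mat_hol_carrier[OF F]] *[OF mat_hol_carrier[OF F] mat_hol_carrier[OF K]]
      inv[OF y] SS by (rule refl)+
  have "mat_deriv n n (\<lambda>y. S * F y) y = S * mat_deriv n n F y"
    using mat_deriv_mult[OF mat_hol_const[OF S(1)] F A y] by (simp add: mat_zero_mult)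
  then have "mat_deriv n n (\<lambda>y. S * F y * S) y = S * (B y * F y) * S"
    using mat_deriv_mult[OF SF mat_hol_const[OF S(1)] A y] by (simp add: mat_zero_mult dF[OF y])
  also have "\<dots> = (S * B y) * (F y * S)" by (simp add: mat_assoc)
  also have "\<dots> = B' y * (S * F y * S)" unfolding comm[OF y] by (simp add: mat_assoc)
  finally show "mat_deriv n n (\<lambda>y. S * F y * S) y = B' y * (S * F y * S)" .
qed (use B in auto)

text \<open>A line \<open>\<mu> + \<i> \<nu> y\<close> that crosses the mirror \<open>j\<close> at \<open>y = 0\<close>, in the coordinates \<open>a\<close> and \<open>\<tau>\<close>
  after rotation of the mirror to the first coordinate axis.\<close>

definition cross_tau :: "nat \<Rightarrow> nat \<Rightarrow> real \<Rightarrow> real \<Rightarrow> complex \<Rightarrow> complex"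
  where "cross_tau m j \<mu> \<nu> y = cis (- 2 * angle m j) *
    ((of_real \<mu> - \<i> * of_real \<nu> * y) / (of_real \<mu> + \<i> * of_real \<nu> * y))"

definition cross_log :: "nat \<Rightarrow> nat \<Rightarrow> real \<Rightarrow> real \<Rightarrow> complex \<Rightarrow> complex"
  where "cross_log m j \<mu> \<nu> y = Ln (of_real \<mu> + \<i> * of_real \<nu> * y) + \<i> * of_real (angle m j)"

definition cross_weight :: "nat \<Rightarrow> nat \<Rightarrow> real \<Rightarrow> real \<Rightarrow> nat \<Rightarrow> complex \<Rightarrow> complex"
  where "cross_weight m j \<mu> \<nu> l y = of_real (\<nu> * cos (angle m j - angle m l)) /
    (of_real (\<mu> * sin (angle m j - angle m l)) + y * of_real (\<nu> * cos (angle m j - angle m l)))"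

definition cross_dom :: "nat \<Rightarrow> nat \<Rightarrow> real \<Rightarrow> real \<Rightarrow> complex set"
  where "cross_dom m j \<mu> \<nu> = {y. 0 < Re (of_real \<mu> + \<i> * of_real \<nu> * y) \<and> cross_tau m j \<mu> \<nu> y \<in> cut_plane m}"

lemma cross_dom_open: "open (cross_dom m j \<mu> \<nu>)"
proof -
  define O1 where "O1 = {y. 0 < Re (of_real \<mu> + \<i> * of_real \<nu> * y)}"
  have O1: "open O1" unfolding O1_def by (intro open_Collect_less continuous_intros)
  have "continuous_on O1 (cross_tau m j \<mu> \<nu>)"
    unfolding cross_tau_def[abs_def] by (intro continuous_intros) (auto simp: O1_def complex_eq_iff)
  then have "open (O1 \<inter> cross_tau m j \<mu> \<nu> -` cut_plane m)"
    using O1 cut_plane_open by (rule continuous_open_preimage)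
  moreover have "O1 \<inter> cross_tau m j \<mu> \<nu> -` cut_plane m = cross_dom m j \<mu> \<nu>"
    by (auto simp: O1_def cross_dom_def)
  ultimately show ?thesis by simp
qed

lemma cross_identity:
  fixes \<mu> \<nu> :: real and m j l :: nat
  assumes a: "a = of_real \<mu> + \<i> * of_real \<nu> * y" "b = of_real \<mu> - \<i> * of_real \<nu> * y"
  defines "\<delta> \<equiv> angle m j - angle m l"
  defines "v \<equiv> cis (- 2 * \<delta>)"
  defines "D \<equiv> of_real (\<mu> * sin \<delta>) + y * of_real (\<nu> * cos \<delta>)"
  shows "a - v * b = cis (- \<delta>) * (2 * \<i> * D)"
    and "1 + v = cis (- \<delta>) * of_real (2 * cos \<delta>)"
proof -
  define w where "w = cis (- \<delta>)"
  define s where "s = complex_of_real (sin \<delta>)"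
  define c where "c = complex_of_real (cos \<delta>)"
  have w: "w = c - \<i> * s" by (simp add: w_def s_def c_def complex_eq_iff)
  have v: "v = w * w" by (simp add: v_def w_def cis_mult)
  have sc: "c * c + s * s = 1"
    using sin_cos_squared_add[of \<delta>] by (simp add: s_def c_def power2_eq_square add.commute flip: of_real_mult of_real_add)
  have w1: "w * (c + \<i> * s) = 1" using sc by (simp add: w algebra_simps)
  have "a - v * b = w * ((c + \<i> * s) * a - w * b)"
    using w1 by (simp add: v right_diff_distrib mult.assoc[symmetric])
  also have "(c + \<i> * s) * a - w * b = 2 * \<i> * D"
    by (simp add: w a D_def s_def c_def algebra_simps)
  finally show "a - v * b = cis (- \<delta>) * (2 * \<i> * D)" by (simp add: w_def)
  have "1 + v = w * ((c + \<i> * s) + w)" using w1 by (simp add: v distrib_left)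
  also have "(c + \<i> * s) + w = of_real (2 * cos \<delta>)" by (simp add: w c_def)
  finally show "1 + v = cis (- \<delta>) * of_real (2 * cos \<delta>)" by (simp add: w_def)
qed

text \<open>In the lower half plane \<open>\<bar>\<tau>\<bar> \<le> 1\<close>, so that the cuts, which lie outside of the unit circle, can only
  be met in their end points.\<close>

lemma cross_dom_mem:
  assumes "0 < \<mu>" "0 < \<nu>" "Im y \<le> 0"
    and ne: "\<And>l. l < m \<Longrightarrow> of_real (\<mu> * sin (angle m j - angle m l)) + y * of_real (\<nu> * cos (angle m j - angle m l)) \<noteq> 0"
  shows "y \<in> cross_dom m j \<mu> \<nu>"
proof -
  define a where "a = of_real \<mu> + \<i> * of_real \<nu> * y"
  define b where "b = of_real \<mu> - \<i> * of_real \<nu> * y"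
  have neg: "\<nu> * Im y \<le> 0" using assms by (simp add: mult_nonneg_nonpos)
  have Re_a: "0 < Re a" using neg assms(1) by (simp add: a_def)
  then have a0: "a \<noteq> 0" by auto
  have "(cmod b)\<^sup>2 \<le> (cmod a)\<^sup>2"
  proof -
    have "(cmod a)\<^sup>2 - (cmod b)\<^sup>2 = - 4 * (\<mu> * (\<nu> * Im y))"
      unfolding cmod_power2 by (simp add: a_def b_def power2_eq_square algebra_simps)
    moreover have "\<mu> * (\<nu> * Im y) \<le> 0" using neg assms(1) by (simp add: mult_nonneg_nonpos)
    ultimately show ?thesis by linarith
  qed
  then have ba: "cmod b \<le> cmod a" by (rule power2_le_imp_le) simp
  have "cross_tau m j \<mu> \<nu> y \<in> cut_plane m"
  proof (rule cut_plane_disc)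
    show "cmod (cross_tau m j \<mu> \<nu> y) \<le> 1"
      using ba a0 by (simp add: cross_tau_def norm_mult norm_divide flip: a_def b_def)
    fix l assume l: "l < m"
    define v where "v = cis (- 2 * (angle m j - angle m l))"
    note id = cross_identity[OF a_def b_def, of m j l, folded v_def]
    have id3: "cis (2 * angle m l) * cis (- 2 * angle m j) = v"
      by (simp add: v_def cis_mult algebra_simps)
    have "a - v * b \<noteq> 0" unfolding id(1) using ne[OF l] by simp
    then have "v * (b / a) \<noteq> 1" using a0 by (auto simp: field_simps)
    moreover have "cis (2 * angle m l) * cross_tau m j \<mu> \<nu> y = v * (b / a)"
      unfolding cross_tau_def a_def[symmetric] b_def[symmetric] mult.assoc[symmetric] id3 ..
    ultimately show "cis (2 * angle m l) * cross_tau m j \<mu> \<nu> y \<noteq> 1" by metis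
  qed
  with Re_a show ?thesis by (simp add: cross_dom_def a_def)
qed

context braid_setting
begin

lemma cross_pair:
  "regular_pair n (\<lambda>y. lin_comb n n {..<m} (\<lambda>l. \<kappa> * cross_weight m j \<mu> \<nu> l y) res) (cross_dom m j \<mu> \<nu>)
    (\<lambda>y. E (cross_log m j \<mu> \<nu> y) * G (cross_tau m j \<mu> \<nu> y))
    (\<lambda>y. G' (cross_tau m j \<mu> \<nu> y) * E' (cross_log m j \<mu> \<nu> y))"
proof (rule regular_pair_cong[OF EG_pair[OF cross_dom_open]])
  define a where "a y = of_real \<mu> + \<i> * of_real \<nu> * y" for y :: complex
  define b where "b y = of_real \<mu> - \<i> * of_real \<nu> * y" for y :: complex
  fix y assume y: "y \<in> cross_dom m j \<mu> \<nu>"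
  then have a1: "0 < Re (a y)" and a3: "cross_tau m j \<mu> \<nu> y \<in> cut_plane m"
    by (simp_all add: cross_dom_def a_def)
  have a2: "a y \<noteq> 0" using a1 by (metis less_irrefl zero_complex.sel(1))
  note a = a1 a2 a3
  show "(cross_log m j \<mu> \<nu> has_field_derivative \<i> * of_real \<nu> / a y) (at y)"
    unfolding cross_log_def[abs_def] using a
    by (auto intro!: derivative_eq_intros simp: a_def complex_nonpos_Reals_iff divide_inverse mult.commute)
  show "(cross_tau m j \<mu> \<nu> has_field_derivative
      cis (- 2 * angle m j) * (- 2 * \<i> * of_real \<nu> * of_real \<mu> / (a y)\<^sup>2)) (at y)"
    unfolding cross_tau_def[abs_def] using a(2)
    by (auto intro!: derivative_eq_intros simp: a_def power2_eq_square divide_simps) (simp_all add: algebra_simps)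
  show "lin_comb n n {..<m} (\<lambda>l. \<kappa> * (\<i> * of_real \<nu> / a y - cis (- 2 * angle m j) * (- 2 * \<i> * of_real \<nu> * of_real \<mu> / (a y)\<^sup>2) *
      (cis (2 * angle m l) / (1 - cis (2 * angle m l) * cross_tau m j \<mu> \<nu> y)))) res =
    lin_comb n n {..<m} (\<lambda>l. \<kappa> * cross_weight m j \<mu> \<nu> l y) res"
  proof (rule lin_comb_cong)
    fix l assume "l \<in> {..<m}"
    then have l: "l < m" by simp
    define v where "v = cis (- 2 * (angle m j - angle m l))"
    define w where "w = cis (- (angle m j - angle m l))"
    define D where "D = of_real (\<mu> * sin (angle m j - angle m l)) + y * of_real (\<nu> * cos (angle m j - angle m l))"
    note id = cross_identity[OF a_def[of y] b_def[of y], of m j l, folded v_def w_def D_def]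
    have id3: "cis (2 * angle m l) * cis (- 2 * angle m j) = v"
      by (simp add: v_def cis_mult algebra_simps)
    have tau: "cis (2 * angle m l) * cross_tau m j \<mu> \<nu> y = v * (b y / a y)"
      unfolding cross_tau_def a_def[symmetric] b_def[symmetric] mult.assoc[symmetric] id3 ..
    have "v * (b y / a y) \<noteq> 1" using cut_plane_nonzero[OF a(3) l] unfolding tau .
    then have ne: "a y - v * b y \<noteq> 0" using a(2) by (auto simp: field_simps)
    have w0: "w \<noteq> 0" by (simp add: w_def)
    have "\<i> * of_real \<nu> / a y - cis (- 2 * angle m j) * (- 2 * \<i> * of_real \<nu> * of_real \<mu> / (a y)\<^sup>2) *
      (cis (2 * angle m l) / (1 - cis (2 * angle m l) * cross_tau m j \<mu> \<nu> y)) =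
      \<i> * of_real \<nu> / a y + v * (2 * \<i> * of_real \<nu> * of_real \<mu> / (a y)\<^sup>2) / (1 - v * (b y / a y))"
      unfolding tau id3[symmetric] by simp
    also have "1 - v * (b y / a y) = (a y - v * b y) / a y" using a(2) by (simp add: field_simps)
    also have "\<i> * of_real \<nu> / a y + v * (2 * \<i> * of_real \<nu> * of_real \<mu> / (a y)\<^sup>2) / ((a y - v * b y) / a y) =
      \<i> * of_real \<nu> * ((a y - v * b y) + v * (2 * of_real \<mu>)) / (a y * (a y - v * b y))"
      using a(2) ne by (simp add: divide_simps power2_eq_square) (simp add: algebra_simps)
    also have "2 * of_real \<mu> = a y + b y" by (simp add: a_def b_def)
    also have "(a y - v * b y) + v * (a y + b y) = a y * (1 + v)" by (simp add: algebra_simps)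
    also have "\<i> * of_real \<nu> * (a y * (1 + v)) / (a y * (a y - v * b y)) = \<i> * of_real \<nu> * (1 + v) / (a y - v * b y)"
      using a(2) by simp
    also have "\<dots> = cross_weight m j \<mu> \<nu> l y"
      unfolding id(1,2) cross_weight_def D_def[symmetric] using w0 by simp
    finally show "\<kappa> * (\<i> * of_real \<nu> / a y - cis (- 2 * angle m j) * (- 2 * \<i> * of_real \<nu> * of_real \<mu> / (a y)\<^sup>2) *
      (cis (2 * angle m l) / (1 - cis (2 * angle m l) * cross_tau m j \<mu> \<nu> y))) = \<kappa> * cross_weight m j \<mu> \<nu> l y"
      by simp
  qed simp
qed (auto simp: cross_dom_def)

lemma cross_ends:
  fixes s \<psi> :: real and j :: nat
  assumes "0 < \<psi>" "\<psi> < pi / 2" and s: "s = 1 \<or> s = - 1"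
  defines "x \<equiv> of_real (angle m j + s * \<psi>) :: complex"
  shows "E (cross_log m j (cos \<psi>) (2 * sin \<psi>) (of_real s / 2)) *
      G (cross_tau m j (cos \<psi>) (2 * sin \<psi>) (of_real s / 2)) = Psi x"
    and "G' (cross_tau m j (cos \<psi>) (2 * sin \<psi>) (of_real s / 2)) *
      E' (cross_log m j (cos \<psi>) (2 * sin \<psi>) (of_real s / 2)) = Psi' x"
proof -
  have a: "of_real (cos \<psi>) + \<i> * of_real (2 * sin \<psi>) * (of_real s / 2) = cis (s * \<psi>)"
    "of_real (cos \<psi>) - \<i> * of_real (2 * sin \<psi>) * (of_real s / 2) = cis (- (s * \<psi>))"
    using s by (auto simp: complex_eq_iff)
  have "Ln (cis (s * \<psi>)) = \<i> * of_real (s * \<psi>)"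
  proof -
    have "Ln (exp (\<i> * of_real (s * \<psi>))) = \<i> * of_real (s * \<psi>)"
      using assms(1,2) s by (intro Ln_exp) auto
    then show ?thesis by (simp add: cis_conv_exp)
  qed
  then have lg: "cross_log m j (cos \<psi>) (2 * sin \<psi>) (of_real s / 2) = \<i> * x"
    unfolding cross_log_def a by (simp add: x_def algebra_simps)
  have tau: "cross_tau m j (cos \<psi>) (2 * sin \<psi>) (of_real s / 2) = exp (- 2 * \<i> * x)"
  proof -
    have "cross_tau m j (cos \<psi>) (2 * sin \<psi>) (of_real s / 2) = cis (- 2 * angle m j + (- (s * \<psi>) - s * \<psi>))"
      unfolding cross_tau_def a cis_divide cis_mult ..
    also have "- 2 * angle m j + (- (s * \<psi>) - s * \<psi>) = - 2 * (angle m j + s * \<psi>)" by simp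
    finally have "cross_tau m j (cos \<psi>) (2 * sin \<psi>) (of_real s / 2) = cis (- 2 * (angle m j + s * \<psi>))" .
    moreover have "cis (- 2 * t) = exp (- 2 * \<i> * of_real t)" for t
      by (simp add: cis_conv_exp mult_ac)
    ultimately show ?thesis unfolding x_def by (simp only:)
  qed
  show "E (cross_log m j (cos \<psi>) (2 * sin \<psi>) (of_real s / 2)) *
      G (cross_tau m j (cos \<psi>) (2 * sin \<psi>) (of_real s / 2)) = Psi x"
    "G' (cross_tau m j (cos \<psi>) (2 * sin \<psi>) (of_real s / 2)) *
      E' (cross_log m j (cos \<psi>) (2 * sin \<psi>) (of_real s / 2)) = Psi' x"
    unfolding lg tau Psi_def Psi'_def by (rule refl)+
qed

text \<open>The generator \<open>\<sigma>\<^sub>1\<close> crosses the line \<open>1\<close> anticlockwise and \<open>S\<^sub>0 \<sigma>\<^sub>0\<close> crosses the line \<open>0\<close>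
  anticlockwise; on both paths \<open>\<tau>\<close> stays in the closed unit disc and avoids the cuts.\<close>

lemma sigma_monodromy_Psi:
  assumes \<theta>: "0 < \<theta>" "\<theta> < pi / real m" and r: "0 < r" and \<epsilon>: "0 < \<epsilon>" "\<epsilon> < 1"
  shows "sigma_monodromy \<kappa> (polar r \<theta>) \<epsilon> 1 =
      S 1 * (Psi (of_real (2 * pi / real m - \<theta>)) * Psi' (of_real \<theta>))"
    and "sigma_monodromy \<kappa> (polar r \<theta>) \<epsilon> 0 =
      Psi (of_real \<theta>) * (Psi' (of_real (- \<theta>)) * S 0)"
proof -
  have pm: "pi / real m < pi / 2" using m by (simp add: field_simps)
  have ang: "angle m 1 = pi / real m" "angle m (Suc 0) = pi / real m" "angle m 0 = 0"
    by (auto simp: angle_def)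
  have half: "- 1 / 2 = (of_real (- 1) / 2 :: complex)" "1 / 2 = (of_real 1 / 2 :: complex)" by auto
  show "sigma_monodromy \<kappa> (polar r \<theta>) \<epsilon> 1 =
      S 1 * (Psi (of_real (2 * pi / real m - \<theta>)) * Psi' (of_real \<theta>))"
  proof -
    define \<psi> where "\<psi> = pi / real m - \<theta>"
    have \<psi>: "0 < \<psi>" "\<psi> < pi / 2" using \<theta> pm by (auto simp: \<psi>_def)
    have pos: "0 < cos \<psi>" "0 < 2 * sin \<psi>" using \<psi> by (auto intro!: cos_gt_zero_pi sin_gt_zero2)
    define \<phi> where "\<phi> = \<theta> - angle m 1"
    have \<phi>: "\<phi> = - \<psi>" by (simp add: \<phi>_def \<psi>_def ang)
    have w: "weight m 1 \<phi> l y = cross_weight m 1 (cos \<psi>) (2 * sin \<psi>) l y" for l y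
      by (simp add: weight_def cross_weight_def weight_const_def weight_slope_def \<phi>)
    obtain R where R: "gap_radius m 1 \<phi> R"
      using gap_radius_exists[OF m \<theta>, of 1] unfolding \<phi>_def by auto
    have "parallel_transport n (connection m n \<kappa> res) (sigma_path m (polar r \<theta>) \<epsilon> 1) =
      E (cross_log m 1 (cos \<psi>) (2 * sin \<psi>) (1 / 2)) * G (cross_tau m 1 (cos \<psi>) (2 * sin \<psi>) (1 / 2)) *
      (G' (cross_tau m 1 (cos \<psi>) (2 * sin \<psi>) (- 1 / 2)) * E' (cross_log m 1 (cos \<psi>) (2 * sin \<psi>) (- 1 / 2)))"
    proof (rule sigma_transport[OF r \<phi>_def _ \<epsilon> cross_dom_open])
      show "sin \<phi> \<noteq> 0" using pos by (simp add: \<phi>)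
      fix y :: complex assume y: "cmod y \<le> 1 / 2" "Im y \<le> 0" "y \<noteq> 0"
      show "y \<in> cross_dom m 1 (cos \<psi>) (2 * sin \<psi>)"
      proof (rule cross_dom_mem[OF pos y(2)])
        fix l assume l: "l < m"
        show "of_real (cos \<psi> * sin (angle m 1 - angle m l)) + y * of_real (2 * sin \<psi> * cos (angle m 1 - angle m l)) \<noteq> 0"
        proof (cases "l = 1")
          case True
          then show ?thesis using y(3) pos by simp
        next
          case False
          then show ?thesis
            using gap_radius_nonzero[OF R l False, of y] y(1) R
            by (simp add: gap_radius_def weight_const_def weight_slope_def \<phi>)
        qed
      qed
    next
      show "regular_pair n (\<lambda>y. lin_comb n n {..<m} (\<lambda>l. \<kappa> * weight m 1 \<phi> l y) res) (cross_dom m 1 (cos \<psi>) (2 * sin \<psi>))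
        (\<lambda>y. E (cross_log m 1 (cos \<psi>) (2 * sin \<psi>) y) * G (cross_tau m 1 (cos \<psi>) (2 * sin \<psi>) y))
        (\<lambda>y. G' (cross_tau m 1 (cos \<psi>) (2 * sin \<psi>) y) * E' (cross_log m 1 (cos \<psi>) (2 * sin \<psi>) y))"
        unfolding w by (rule cross_pair)
    qed
    also have "\<dots> = Psi (of_real (angle m 1 + 1 * \<psi>)) * Psi' (of_real (angle m 1 + (- 1) * \<psi>))"
      unfolding half by (subst cross_ends[OF \<psi>], simp, subst cross_ends[OF \<psi>], simp, rule refl)
    also have "angle m 1 + 1 * \<psi> = 2 * pi / real m - \<theta>" by (simp add: ang \<psi>_def)
    also have "angle m 1 + (- 1) * \<psi> = \<theta>" by (simp add: ang \<psi>_def)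
    finally show ?thesis by (simp add: sigma_monodromy_def)
  qed
  show "sigma_monodromy \<kappa> (polar r \<theta>) \<epsilon> 0 =
      Psi (of_real \<theta>) * (Psi' (of_real (- \<theta>)) * S 0)"
  proof -
    have \<psi>: "0 < \<theta>" "\<theta> < pi / 2" using \<theta> pm by linarith+
    have pos: "0 < cos \<theta>" "0 < 2 * sin \<theta>" using \<psi> by (auto intro!: cos_gt_zero_pi sin_gt_zero2)
    have \<phi>: "\<theta> = \<theta> - angle m 0" by (simp add: ang)
    have w: "weight m 0 \<theta> (mirror m 0 l) y = cross_weight m 0 (cos \<theta>) (2 * sin \<theta>) l y" if "l < m" for l y
      using weight_mirror[OF that, of 0 \<theta> "- y"]
      by (simp add: weight_def cross_weight_def weight_const_def weight_slope_def)
    obtain R where R: "gap_radius m 0 \<theta> R"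
      using gap_radius_exists[OF m \<theta>, of 0] by (auto simp: ang)
    define F where "F y = E (cross_log m 0 (cos \<theta>) (2 * sin \<theta>) y) * G (cross_tau m 0 (cos \<theta>) (2 * sin \<theta>) y)" for y
    define K where "K y = G' (cross_tau m 0 (cos \<theta>) (2 * sin \<theta>) y) * E' (cross_log m 0 (cos \<theta>) (2 * sin \<theta>) y)" for y
    have FK: "regular_pair n (\<lambda>y. lin_comb n n {..<m} (\<lambda>l. \<kappa> * cross_weight m 0 (cos \<theta>) (2 * sin \<theta>) l y) res)
      (cross_dom m 0 (cos \<theta>) (2 * sin \<theta>)) F K"
      unfolding F_def[abs_def] K_def[abs_def] by (rule cross_pair)
    have S0 [simp]: "dim_row (S 0) = n" "dim_col (S 0) = n" by auto
    have "parallel_transport n (connection m n \<kappa> res) (sigma_path m (polar r \<theta>) \<epsilon> 0) =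
      (S 0 * F (1 / 2) * S 0) * (S 0 * K (- 1 / 2) * S 0)"
    proof (rule sigma_transport[OF r \<phi> _ \<epsilon> cross_dom_open])
      show "sin \<theta> \<noteq> 0" using pos by simp
      show "regular_pair n (\<lambda>y. lin_comb n n {..<m} (\<lambda>l. \<kappa> * weight m 0 \<theta> l y) res) (cross_dom m 0 (cos \<theta>) (2 * sin \<theta>))
        (\<lambda>y. S 0 * F y * S 0) (\<lambda>y. S 0 * K y * S 0)"
        by (rule regular_pair_conj[OF FK cross_dom_open])
          (auto simp: S_carrier S_square w intro!: lin_comb_res_conj)
      fix y :: complex assume y: "cmod y \<le> 1 / 2" "Im y \<le> 0" "y \<noteq> 0"
      show "y \<in> cross_dom m 0 (cos \<theta>) (2 * sin \<theta>)"
      proof (rule cross_dom_mem[OF pos y(2)])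
        fix l assume l: "l < m"
        show "of_real (cos \<theta> * sin (angle m 0 - angle m l)) + y * of_real (2 * sin \<theta> * cos (angle m 0 - angle m l)) \<noteq> 0"
        proof (cases "l = 0")
          case True
          then show ?thesis using y(3) pos by simp
        next
          case False
          then show ?thesis
            using gap_radius_nonzero[OF R l False, of "- y"] y(1) R
            by (simp add: gap_radius_def weight_const_def weight_slope_def)
        qed
      qed
    qed
    also have "F (1 / 2) = Psi (of_real (angle m 0 + 1 * \<theta>))"
      unfolding half F_def by (rule cross_ends(1)[OF \<psi>]) simp
    also have "K (- 1 / 2) = Psi' (of_real (angle m 0 + (- 1) * \<theta>))"
      unfolding half K_def by (rule cross_ends(2)[OF \<psi>]) simp
    finally have t: "parallel_transport n (connection m n \<kappa> res) (sigma_path m (polar r \<theta>) \<epsilon> 0) =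
      (S 0 * Psi (of_real \<theta>) * S 0) * (S 0 * Psi' (of_real (- \<theta>)) * S 0)" by (simp add: ang)
    have "sigma_monodromy \<kappa> (polar r \<theta>) \<epsilon> 0 =
      (S 0 * S 0) * (Psi (of_real \<theta>) * ((S 0 * S 0) * (Psi' (of_real (- \<theta>)) * S 0)))"
      unfolding sigma_monodromy_def t by (simp add: mat_assoc)
    then show ?thesis by (simp add: S_square mat_one_mult)
  qed
qed

end

lemma off_lines_aux:
  assumes "sin (x - y) \<noteq> 0"
  shows "1 - cis (2 * x) * exp (- 2 * \<i> * Complex y z) \<notin> \<real>\<^sub>\<le>\<^sub>0"
proof
  assume neg: "1 - cis (2 * x) * exp (- 2 * \<i> * Complex y z) \<in> \<real>\<^sub>\<le>\<^sub>0"
  have "exp (- 2 * \<i> * Complex y z) = of_real (exp (2 * z)) * cis (- 2 * y)"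
    by (simp add: exp_eq_polar)
  then have eq: "cis (2 * x) * exp (- 2 * \<i> * Complex y z) = of_real (exp (2 * z)) * cis (2 * (x - y))"
    by (simp add: mult.left_commute cis_mult algebra_simps)
  have "sin (2 * (x - y)) = 0" "1 \<le> exp (2 * z) * cos (2 * (x - y))"
    using neg unfolding eq by (auto simp: complex_nonpos_Reals_iff)
  then have "sin (2 * (x - y)) = 0" "0 < exp (2 * z) * cos (2 * (x - y))" by auto
  then have "cos (x - y) = 0" "0 < cos (2 * (x - y))"
    using assms unfolding sin_double by (auto simp: zero_less_mult_iff)
  then show False unfolding cos_double by (simp add: not_less)
qed

context braid_setting
begin

lemma off_lines_sector:
  assumes x: "0 < Re x" "Re x < pi / real m"
  shows "off_lines x" "off_lines (- x)"
proof -
  define h where "h = pi / real m"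
  have h: "0 < h" "real m * h = pi" "Re x < h" using m x by (auto simp: h_def)
  have ang: "angle m l = real l * h" for l by (simp add: angle_def h_def)
  have lm: "real l * h \<le> pi - h" if "l < m" for l
  proof -
    have "real l * h \<le> (real m - 1) * h" using that h by (intro mult_right_mono) auto
    then show ?thesis using h by (simp add: algebra_simps)
  qed
  show "off_lines x"
    unfolding off_lines_def cut_plane_def
  proof safe
    fix l assume l: "l < m" and neg: "1 - cis (2 * angle m l) * exp (- 2 * \<i> * x) \<in> \<real>\<^sub>\<le>\<^sub>0"
    have "sin (angle m l - Re x) \<noteq> 0"
    proof (cases "l = 0")
      case True
      have "0 < sin (Re x)" using x h lm[OF l] True by (intro sin_gt_zero) (auto simp: h_def)
      then show ?thesis using True by (simp add: angle_def)
    next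
      case False
      then have "1 * h \<le> real l * h" using h by (intro mult_right_mono) auto
      then have "0 < sin (angle m l - Re x)"
        unfolding ang using x h lm[OF l] by (intro sin_gt_zero) linarith+
      then show ?thesis by simp
    qed
    from off_lines_aux[OF this, of "Im x"] show False using neg by simp
  qed
  show "off_lines (- x)"
    unfolding off_lines_def cut_plane_def
  proof safe
    fix l assume l: "l < m" and neg: "1 - cis (2 * angle m l) * exp (- 2 * \<i> * - x) \<in> \<real>\<^sub>\<le>\<^sub>0"
    have "0 \<le> real l * h" using h by simp
    moreover have "Re (- x) = - Re x" by simp
    ultimately have "0 < sin (angle m l - Re (- x))"
      unfolding ang using x h lm[OF l] by (intro sin_gt_zero) linarith+
    then have "sin (angle m l - Re (- x)) \<noteq> 0" by simp
    from off_lines_aux[OF this, of "Im (- x)", unfolded complex_surj] show False using neg by simp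
  qed
qed

text \<open>The reflection \<open>S\<^sub>0\<close> turns the solution inside the unit circle into the one outside of it. The
  two are compared along the arc between the lines \<open>0\<close> and \<open>1\<close>, where both are flat.\<close>

lemma Psi_reflect:
  assumes x: "0 < Re x" "Re x < pi / real m" and y: "0 < Re y" "Re y < pi / real m"
  shows "Psi' (- x) * S 0 * Psi x = Psi' (- y) * S 0 * Psi y"
proof -
  define U where "U = {x. 0 < Re x \<and> Re x < pi / real m}"
  have "U = {x. Re x > 0} \<inter> {x. Re x < pi / real m}" by (auto simp: U_def)
  then have U: "open U" "connected U"
    by (auto intro!: convex_connected convex_Int convex_halfspace_Re_gt convex_halfspace_Re_lt
        open_halfspace_Re_gt open_halfspace_Re_lt)
  define B where "B x = lin_comb n n {..<m} (\<lambda>l. \<kappa> * (- \<i> - (2 * \<i> * exp (- 2 * \<i> * - x)) *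
      (cis (2 * angle m l) / (1 - cis (2 * angle m l) * exp (- 2 * \<i> * - x))))) res" for x
  define B' where "B' x = lin_comb n n {..<m} (\<lambda>l. \<kappa> * (\<i> - (- 2 * \<i> * exp (- 2 * \<i> * x)) *
      (cis (2 * angle m l) / (1 - cis (2 * angle m l) * exp (- 2 * \<i> * x))))) res" for x
  have "regular_pair n B U (\<lambda>x. E (\<i> * - x) * G (exp (- 2 * \<i> * - x)))
      (\<lambda>x. G' (exp (- 2 * \<i> * - x)) * E' (\<i> * - x))"
    unfolding B_def[abs_def]
    by (rule EG_pair[OF U(1)])
      (use off_lines_sector(2) in \<open>auto intro!: derivative_eq_intros simp: U_def off_lines_def\<close>)
  then have P1: "regular_pair n B U (\<lambda>x. Psi (- x)) (\<lambda>x. Psi' (- x))"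
    by (simp only: Psi_def Psi'_def)
  have "regular_pair n B' U (\<lambda>x. E (\<i> * x) * G (exp (- 2 * \<i> * x)))
      (\<lambda>x. G' (exp (- 2 * \<i> * x)) * E' (\<i> * x))"
    unfolding B'_def[abs_def]
    by (rule EG_pair[OF U(1)])
      (use off_lines_sector(1) in \<open>auto intro!: derivative_eq_intros simp: U_def off_lines_def\<close>)
  then have P2: "regular_pair n B' U Psi Psi'"
    by (simp only: Psi_def[abs_def] Psi'_def[abs_def])
  have comm: "B x * S 0 = S 0 * B' x" if "x \<in> U" for x
    unfolding B_def B'_def
  proof (rule lin_comb_res_conj[symmetric])
    fix l assume l: "l < m"
    define u where "u = cis (2 * angle m l)"
    define t where "t = exp (- 2 * \<i> * x)"
    have u0: "u \<noteq> 0" "t \<noteq> 0" by (auto simp: u_def t_def)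
    have "t \<in> cut_plane m"
      using off_lines_sector(1)[of x] that by (simp add: U_def off_lines_def t_def)
    then have ne: "u * t \<noteq> 1" using cut_plane_nonzero[OF _ l] by (simp add: u_def)
    have u': "cis (2 * angle m (mirror m 0 l)) = inverse u"
      unfolding cis_2_angle_mirror[OF l] by (simp add: u_def angle_def)
    have t': "exp (- 2 * \<i> * - x) = inverse t" by (simp add: t_def exp_minus[symmetric])
    have ne': "1 - inverse u * inverse t = (u * t - 1) / (u * t)" using u0 by (simp add: field_simps)
    have "- \<i> - (2 * \<i> * inverse t) * (inverse u / (1 - inverse u * inverse t)) = - \<i> - 2 * \<i> / (u * t - 1)"
      unfolding ne' using u0 ne by (simp add: field_simps)
    also have "\<dots> = \<i> - (- 2 * \<i> * t) * (u / (1 - u * t))"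
    proof -
      define d where "d = u * t - 1"
      have d: "d \<noteq> 0" "1 - u * t = - d" using ne by (auto simp: d_def)
      have "(- 2 * \<i> * t) * (u / (1 - u * t)) = 2 * \<i> * (u * t) / d"
        unfolding d(2) by (simp add: mult_ac)
      also have "2 * \<i> * (u * t) / d = 2 * \<i> * (d + 1) / d" by (simp add: d_def)
      also have "2 * \<i> * (d + 1) / d = 2 * \<i> + 2 * \<i> / d" using d(1) by (simp add: field_simps)
      finally have *: "(- 2 * \<i> * t) * (u / (1 - u * t)) = 2 * \<i> + 2 * \<i> / d" .
      show ?thesis unfolding * d_def[symmetric] by simp
    qed
    finally show "\<kappa> * (- \<i> - (2 * \<i> * exp (- 2 * \<i> * - x)) * (cis (2 * angle m (mirror m 0 l)) /
        (1 - cis (2 * angle m (mirror m 0 l)) * exp (- 2 * \<i> * - x)))) =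
      \<kappa> * (\<i> - (- 2 * \<i> * exp (- 2 * \<i> * x)) * (cis (2 * angle m l) / (1 - cis (2 * angle m l) * exp (- 2 * \<i> * x))))"
      unfolding u' t' u_def[symmetric] t_def[symmetric] by simp
  qed simp
  show ?thesis
  proof (rule regular_intertwine[OF U P1, where F' = Psi and B' = B' and l = n])
    show "mat_hol n n Psi U" "\<And>x. x \<in> U \<Longrightarrow> mat_deriv n n Psi x = B' x * Psi x"
      using P2 by (auto simp: regular_pair_def)
  qed (use x y comm in \<open>auto simp: B_def B'_def U_def S_carrier\<close>)
qed

end

section \<open>Powers of conjugates\<close>

lemma pow_mat_dims [simp]:
  "dim_row M = n \<Longrightarrow> dim_col M = n \<Longrightarrow> dim_row (M ^\<^sub>m h) = n"
  "dim_row M = n \<Longrightarrow> dim_col M = n \<Longrightarrow> dim_col (M ^\<^sub>m h) = n"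
  by (auto simp: pow_mat_dim)

lemma pow_mat_commute:
  fixes A M :: "complex mat"
  assumes "A \<in> carrier_mat n n" "M \<in> carrier_mat n n" "A * M = M * A"
  shows "A * M ^\<^sub>m h = M ^\<^sub>m h * A"
proof (induction h)
  case (Suc h)
  have d: "dim_row A = n" "dim_col A = n" "dim_row M = n" "dim_col M = n" using assms by auto
  have "A * M ^\<^sub>m Suc h = (A * M ^\<^sub>m h) * M" using d by (simp add: mat_assoc)
  also have "\<dots> = M ^\<^sub>m h * (A * M)" unfolding Suc using d by (simp add: mat_assoc)
  also have "\<dots> = M ^\<^sub>m Suc h * A" unfolding assms(3) using d by (simp add: mat_assoc)
  finally show ?case .
qed (use assms in \<open>auto simp: mat_one_mult\<close>)

lemma pow_mat_inverse:
  fixes M M' :: "complex mat"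
  assumes "M \<in> carrier_mat n n" "M' \<in> carrier_mat n n" "M * M' = 1\<^sub>m n" "M' * M = 1\<^sub>m n"
  shows "M ^\<^sub>m h * M' ^\<^sub>m h = 1\<^sub>m n"
proof (induction h)
  case (Suc h)
  have d: "dim_row M = n" "dim_col M = n" "dim_row M' = n" "dim_col M' = n" using assms by auto
  have "M' * M' ^\<^sub>m h = M' ^\<^sub>m h * M'" by (rule pow_mat_commute) (use assms in auto)
  then have "M ^\<^sub>m Suc h * M' ^\<^sub>m Suc h = M ^\<^sub>m h * (M * (M' * M' ^\<^sub>m h))"
    using d by (simp add: mat_assoc)
  also have "M * (M' * M' ^\<^sub>m h) = (M * M') * M' ^\<^sub>m h" using d by (simp add: mat_assoc)
  finally show ?case using assms(3) Suc d by (simp add: mat_one_mult)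
qed (use assms in \<open>auto simp: mat_one_mult\<close>)

context braid_setting
begin

lemma E_central_pow:
  assumes "M \<in> carrier_mat n n" "\<And>s. E s * M = M * E s"
  shows "E s * M ^\<^sub>m h = M ^\<^sub>m h * E s"
  by (rule pow_mat_commute) (use assms mat_hol_carrier[OF E] in auto)

lemma conj_pow:
  assumes P: "P \<in> carrier_mat n n" "P' \<in> carrier_mat n n" "M \<in> carrier_mat n n" "P' * P = 1\<^sub>m n" "P * P' = 1\<^sub>m n"
    and comm: "\<And>s. E s * P = P * E s" "\<And>s. E s * P' = P' * E s" "\<And>s. E s * M = M * E s"
  shows "(E s * (P * (M * P'))) ^\<^sub>m h = E (of_nat h * s) * (P * (M ^\<^sub>m h * P'))"
proof (induction h)
  case 0
  have "dim_row P = n" "dim_col P' = n" "dim_row P' = n" "dim_col P = n" using P by auto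
  then show ?case using P(3,5) E0 by (simp add: mat_one_mult)
next
  case (Suc h)
  have d: "dim_row P = n" "dim_col P = n" "dim_row P' = n" "dim_col P' = n" "dim_row M = n" "dim_col M = n"
    using P by auto
  note d' = d pow_mat_dims[OF d(5,6)]
  have "(E s * (P * (M * P'))) ^\<^sub>m Suc h =
      E (of_nat h * s) * (P * (M ^\<^sub>m h * ((P' * E s) * (P * (M * P')))))"
    using d' by (simp add: Suc mat_assoc)
  also have "P' * E s = E s * P'" using comm(2) by simp
  also have "E s * P' * (P * (M * P')) = E s * ((P' * P) * (M * P'))" using d' by (simp add: mat_assoc)
  also have "\<dots> = E s * (M * P')" unfolding P(4) using d' by (simp add: mat_one_mult)
  also have "M ^\<^sub>m h * (E s * (M * P')) = (M ^\<^sub>m h * E s) * (M * P')" using d' by (simp add: mat_assoc)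
  also have "M ^\<^sub>m h * E s = E s * M ^\<^sub>m h" using E_central_pow[OF P(3) comm(3)] by simp
  also have "P * (E s * M ^\<^sub>m h * (M * P')) = (P * E s) * (M ^\<^sub>m h * (M * P'))" using d' by (simp add: mat_assoc)
  also have "P * E s = E s * P" using comm(1) by simp
  also have "E (of_nat h * s) * (E s * P * (M ^\<^sub>m h * (M * P'))) = (E (of_nat h * s) * E s) * (P * (M ^\<^sub>m Suc h * P'))"
    using d' by (simp add: mat_assoc)
  also have "E (of_nat h * s) * E s = E (of_nat (Suc h) * s)" by (simp add: E_add algebra_simps)
  finally show ?case .
qed

definition rot' :: "complex mat"
  where "rot' = S 0 * S 1"

lemma rot'_dim [simp]: "dim_row rot' = n" "dim_col rot' = n" "rot' \<in> carrier_mat n n"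
  using S_carrier[of 1] S_carrier[of 0] by (auto simp: rot'_def)

lemma rot_inverse: "rot * rot' = 1\<^sub>m n" "rot' * rot = 1\<^sub>m n"
proof -
  have d: "dim_row (S 0) = n" "dim_col (S 0) = n" "dim_row (S 1) = n" "dim_col (S 1) = n" by auto
  have "rot * rot' = S 1 * ((S 0 * S 0) * S 1)" using d by (simp add: rot_def rot'_def mat_assoc)
  then show "rot * rot' = 1\<^sub>m n" using d by (simp add: S_square mat_one_mult)
  have "rot' * rot = S 0 * ((S 1 * S 1) * S 0)" using d by (simp add: rot_def rot'_def mat_assoc)
  then show "rot' * rot = 1\<^sub>m n" using d by (simp add: S_square mat_one_mult)
qed

lemma S0_rot: "S 0 * rot = rot' * S 0"
  by (simp add: rot_def rot'_def mat_assoc)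

lemma S0_rot_pow: "S 0 * rot ^\<^sub>m h = rot' ^\<^sub>m h * S 0"
proof (induction h)
  case (Suc h)
  have "S 0 * rot ^\<^sub>m Suc h = (S 0 * rot ^\<^sub>m h) * rot" by (simp add: mat_assoc)
  also have "\<dots> = rot' ^\<^sub>m h * (S 0 * rot)" unfolding Suc by (simp add: mat_assoc)
  also have "\<dots> = rot' ^\<^sub>m Suc h * S 0" unfolding S0_rot by (simp add: mat_assoc)
  finally show ?case .
qed (auto simp: mat_one_mult)

lemma rot_S: "j < m \<Longrightarrow> rot * S j = S ((j + 1) mod m)"
proof -
  assume j: "j < m"
  have "(1 + (m - 0) + j) mod m = ((j + 1) + m) mod m" by (simp add: ac_simps)
  then have "(1 + (m - 0) + j) mod m = (j + 1) mod m" by (simp only: mod_add_self2)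
  then show ?thesis using S_triple[OF one_m(1) m_pos(1) j] by (simp only: rot_def)
qed

lemma rot_pow_m: "rot ^\<^sub>m m = 1\<^sub>m n"
proof -
  have "rot ^\<^sub>m j * S 0 = S (j mod m)" for j
  proof (induction j)
    case (Suc j)
    have "rot * rot ^\<^sub>m j = rot ^\<^sub>m j * rot" by (rule pow_mat_commute) auto
    then have "rot ^\<^sub>m Suc j * S 0 = rot * (rot ^\<^sub>m j * S 0)"
      by (simp add: mat_assoc[symmetric])
    also have "\<dots> = S (Suc j mod m)" unfolding Suc by (subst rot_S) (auto simp: mod_Suc_eq)
    finally show ?case .
  qed (auto simp: mat_one_mult)
  from this[of m] have "rot ^\<^sub>m m * S 0 = S 0" by simp
  then have "rot ^\<^sub>m m * S 0 * S 0 = S 0 * S 0" by simp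
  then show ?thesis by (simp add: mat_assoc S_square mat_one_mult)
qed

lemma E_rot: "E s * rot = rot * E s" and E_rot': "E s * rot' = rot' * E s"
proof -
  have "E s * rot = (E s * S 1) * S 0" by (simp add: rot_def mat_assoc)
  also have "\<dots> = S 1 * (E s * S 0)" by (simp add: E_S mat_assoc)
  also have "\<dots> = rot * E s" by (simp add: E_S rot_def mat_assoc)
  finally show "E s * rot = rot * E s" .
  have "E s * rot' = (E s * S 0) * S 1" by (simp add: rot'_def mat_assoc)
  also have "\<dots> = S 0 * (E s * S 1)" by (simp add: E_S mat_assoc)
  also have "\<dots> = rot' * E s" by (simp add: E_S rot'_def mat_assoc)
  finally show "E s * rot' = rot' * E s" .
qed

lemma Psi_rot_pow:
  assumes "off_lines x"
  defines "h \<equiv> of_real (2 * pi / real m) :: complex"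
  shows "off_lines (x + of_nat j * h) \<and>
    Psi (x + of_nat j * h) * rot ^\<^sub>m j = E (\<i> * (of_nat j * h)) * (rot ^\<^sub>m j * Psi x)"
proof (induction j)
  case 0
  then show ?case using assms(1) by (simp add: E0 mat_one_mult)
next
  case (Suc j)
  then have off: "off_lines (x + of_nat j * h)" by simp
  have eq: "x + of_nat (Suc j) * h = (x + of_nat j * h) + h" by (simp add: algebra_simps)
  note R = Psi_rot[OF off, folded h_def]
  have cm: "rot * rot ^\<^sub>m j = rot ^\<^sub>m j * rot" by (rule pow_mat_commute) auto
  have "Psi (x + of_nat (Suc j) * h) * rot ^\<^sub>m Suc j = (Psi (x + of_nat j * h + h) * rot) * rot ^\<^sub>m j"
    unfolding eq by (simp add: mat_assoc cm)
  also have "\<dots> = E (\<i> * h) * (rot * (Psi (x + of_nat j * h) * rot ^\<^sub>m j))"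
    unfolding R(1) by (simp add: mat_assoc)
  also have "Psi (x + of_nat j * h) * rot ^\<^sub>m j = E (\<i> * (of_nat j * h)) * (rot ^\<^sub>m j * Psi x)"
    using Suc by simp
  also have "E (\<i> * h) * (rot * (E (\<i> * (of_nat j * h)) * (rot ^\<^sub>m j * Psi x))) =
      E (\<i> * h) * ((rot * E (\<i> * (of_nat j * h))) * (rot ^\<^sub>m j * Psi x))" by (simp add: mat_assoc)
  also have "rot * E (\<i> * (of_nat j * h)) = E (\<i> * (of_nat j * h)) * rot" by (simp add: E_rot)
  also have "E (\<i> * h) * (E (\<i> * (of_nat j * h)) * rot * (rot ^\<^sub>m j * Psi x)) =
      (E (\<i> * h) * E (\<i> * (of_nat j * h))) * ((rot * rot ^\<^sub>m j) * Psi x)" by (simp add: mat_assoc)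
  also have "\<dots> = E (\<i> * (of_nat (Suc j) * h)) * (rot ^\<^sub>m Suc j * Psi x)"
    unfolding cm by (simp add: E_add algebra_simps)
  finally have "Psi (x + of_nat (Suc j) * h) * rot ^\<^sub>m Suc j = E (\<i> * (of_nat (Suc j) * h)) * (rot ^\<^sub>m Suc j * Psi x)" .
  then show ?case using R(2)[folded eq] by blast
qed

end

lemma pow_mat_add_dims:
  assumes "A \<in> carrier_mat n n"
  shows "A ^\<^sub>m (i + j) = A ^\<^sub>m i * A ^\<^sub>m j"
proof (induction j)
  case 0
  show ?case using pow_carrier_mat[OF assms, of i] carrier_matD[OF assms] by simp
next
  case (Suc j)
  show ?case
    using Suc assoc_mult_mat[OF pow_carrier_mat[OF assms] pow_carrier_mat[OF assms] assms] by simp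
qed

context braid_setting
begin

text \<open>With \<open>Q = S\<^sub>0 \<Psi>(-\<theta>)\<close> and \<open>C = S\<^sub>1 S\<^sub>0\<close> the two generators are \<open>T\<^sub>0 = \<Psi>(\<theta>) Q\<^sup>-\<^sup>1\<close> and
  \<open>T\<^sub>1 = \<zeta> Q C\<^sup>-\<^sup>1 \<Psi>(\<theta>)\<^sup>-\<^sup>1\<close> with a central \<open>\<zeta>\<close>, so that both products of the generators are
  conjugates of \<open>\<zeta> C\<^sup>-\<^sup>1\<close>. For \<open>m = 2 h\<close> the power \<open>C\<^sup>h\<close> is the rotation by \<open>\<pi>\<close>, which commutes
  with everything. For \<open>m = 2 h + 1\<close> the relation amounts to \<open>Z C\<^sup>-\<^sup>h Z = \<zeta> C\<^sup>h\<close> for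
  \<open>Z = Q\<^sup>-\<^sup>1 \<Psi>(\<theta>)\<close>, which expresses that \<open>Z\<close> does not change when \<open>\<theta>\<close> is replaced by
  \<open>\<pi> / m - \<theta>\<close>.\<close>

theorem braid_relation:
  assumes \<theta>: "0 < \<theta>" "\<theta> < pi / real m" and r: "0 < r" and \<epsilon>: "0 < \<epsilon>" "\<epsilon> < 1"
  defines "T \<equiv> sigma_monodromy \<kappa> (polar r \<theta>) \<epsilon>"
  shows "m = 2 * h \<Longrightarrow> (T 0 * T 1) ^\<^sub>m h = (T 1 * T 0) ^\<^sub>m h"
    and "m = 2 * h + 1 \<Longrightarrow> (T 0 * T 1) ^\<^sub>m h * T 0 = (T 1 * T 0) ^\<^sub>m h * T 1"
    and "\<exists>M \<in> carrier_mat n n. T 0 * M = 1\<^sub>m n \<and> M * T 0 = 1\<^sub>m n"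
    and "\<exists>M \<in> carrier_mat n n. T 1 * M = 1\<^sub>m n \<and> M * T 1 = 1\<^sub>m n"
proof -
  define x where "x = complex_of_real \<theta>"
  define \<eta> where "\<eta> = complex_of_real (2 * pi / real m)"
  have off: "off_lines x" "off_lines (- x)"
    using off_lines_sector[of x] \<theta> by (auto simp: x_def)
  define P P' N N' where "P = Psi x" and "P' = Psi' x" and "N = Psi (- x)" and "N' = Psi' (- x)"
  have Pd [simp]: "dim_row P = n" "dim_col P = n" "dim_row P' = n" "dim_col P' = n"
    "dim_row N = n" "dim_col N = n" "dim_row N' = n" "dim_col N' = n"
    by (auto simp: P_def P'_def N_def N'_def)
  have S0d [simp]: "dim_row (S 0) = n" "dim_col (S 0) = n" "dim_row (S 1) = n" "dim_col (S 1) = n" by auto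
  have Pinv: "P * P' = 1\<^sub>m n" "P' * P = 1\<^sub>m n" "N * N' = 1\<^sub>m n" "N' * N = 1\<^sub>m n"
    using Psi_inv[OF off(1)] Psi_inv[OF off(2)] by (auto simp: P_def P'_def N_def N'_def)
  define Q Q' where "Q = S 0 * N" and "Q' = N' * S 0"
  have Qd [simp]: "dim_row Q = n" "dim_col Q = n" "dim_row Q' = n" "dim_col Q' = n"
    by (auto simp: Q_def Q'_def)
  have Qinv: "Q * Q' = 1\<^sub>m n" "Q' * Q = 1\<^sub>m n"
  proof -
    have "Q * Q' = S 0 * ((N * N') * S 0)" by (simp add: Q_def Q'_def mat_assoc)
    then show "Q * Q' = 1\<^sub>m n" by (simp add: Pinv mat_one_mult S_square)
    have "Q' * Q = N' * ((S 0 * S 0) * N)" by (simp add: Q_def Q'_def mat_assoc)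
    then show "Q' * Q = 1\<^sub>m n" by (simp add: Pinv mat_one_mult S_square)
  qed
  have cm: "M' * E s = E s * M'" if "M \<in> carrier_mat n n" "M' \<in> carrier_mat n n" "M * M' = 1\<^sub>m n" "M' * M = 1\<^sub>m n"
    "E s * M = M * E s" for M M' s
  proof -
    have "M' * E s = M' * (E s * (M * M'))" using that(1,2) by (simp add: that(3) mat_one_mult)
    also have "\<dots> = M' * ((E s * M) * M')" using that(1,2) by (simp add: mat_assoc)
    also have "\<dots> = (M' * M) * (E s * M')" unfolding that(5) using that(1,2) by (simp add: mat_assoc)
    finally show ?thesis using that(1,2) by (simp add: that(4) mat_one_mult)
  qed
  have car: "P \<in> carrier_mat n n" "P' \<in> carrier_mat n n" "Q \<in> carrier_mat n n" "Q' \<in> carrier_mat n n"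
    by (auto intro!: carrier_matI)
  have EP: "E s * P = P * E s" for s using E_Psi[OF off(1)] by (simp add: P_def)
  have EP': "E s * P' = P' * E s" for s using cm[OF car(1,2) Pinv(1,2) EP] by simp
  have EQ: "E s * Q = Q * E s" for s
  proof -
    have "E s * Q = (E s * S 0) * N" by (simp add: Q_def mat_assoc)
    also have "\<dots> = S 0 * (E s * N)" by (simp add: E_S mat_assoc)
    also have "\<dots> = Q * E s" using E_Psi[OF off(2)] by (simp add: N_def[symmetric] Q_def mat_assoc)
    finally show ?thesis .
  qed
  have EQ': "E s * Q' = Q' * E s" for s using cm[OF car(3,4) Qinv EQ] by simp
  define z where "z = \<i> * \<eta>"
  have T0: "T 0 = P * Q'"
    unfolding T_def sigma_monodromy_Psi(2)[OF \<theta> r \<epsilon>] by (simp add: P_def Q'_def N'_def x_def)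
  have T1: "T 1 = E z * (Q * (rot' * P'))"
  proof -
    have "Psi (of_real (2 * pi / real m - \<theta>)) = Psi (- x + \<eta>)" by (simp add: x_def \<eta>_def)
    also have "\<dots> = Psi (- x + \<eta>) * (rot * rot')" by (simp add: rot_inverse mat_one_mult)
    also have "\<dots> = (Psi (- x + \<eta>) * rot) * rot'" by (simp add: mat_assoc)
    also have "Psi (- x + \<eta>) * rot = E z * (rot * N)"
      using Psi_rot(1)[OF off(2)] by (simp add: \<eta>_def z_def N_def)
    finally have "T 1 = (S 1 * E z) * (rot * (N * (rot' * P')))"
      unfolding T_def sigma_monodromy_Psi(1)[OF \<theta> r \<epsilon>] by (simp add: P'_def x_def mat_assoc)
    also have "\<dots> = (E z * S 1) * (rot * (N * (rot' * P')))" by (simp add: E_S)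
    also have "\<dots> = E z * (((S 1 * S 1) * S 0) * (N * (rot' * P')))" by (simp add: rot_def mat_assoc)
    finally show ?thesis by (simp add: S_square mat_one_mult Q_def mat_assoc)
  qed
  have T01: "T 0 * T 1 = E z * (P * (rot' * P'))"
  proof -
    have "T 0 * T 1 = P * ((Q' * E z) * (Q * (rot' * P')))" unfolding T0 T1 by (simp add: mat_assoc)
    also have "\<dots> = (P * E z) * ((Q' * Q) * (rot' * P'))" by (simp add: EQ'[symmetric] mat_assoc)
    finally show ?thesis by (simp add: Qinv mat_one_mult EP[symmetric] mat_assoc)
  qed
  have T10: "T 1 * T 0 = E z * (Q * (rot' * Q'))"
  proof -
    have "T 1 * T 0 = E z * (Q * (rot' * ((P' * P) * Q')))" unfolding T0 T1 by (simp add: mat_assoc)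
    then show ?thesis by (simp add: Pinv mat_one_mult)
  qed
  have pow01: "(T 0 * T 1) ^\<^sub>m h = E (of_nat h * z) * (P * (rot' ^\<^sub>m h * P'))" for h
    unfolding T01 by (rule conj_pow) (use car Pinv EP EP' E_rot' in auto)
  have pow10: "(T 1 * T 0) ^\<^sub>m h = E (of_nat h * z) * (Q * (rot' ^\<^sub>m h * Q'))" for h
    unfolding T10 by (rule conj_pow) (use car Qinv EQ EQ' E_rot' in auto)
  have rpow: "rot ^\<^sub>m j * rot' ^\<^sub>m j = 1\<^sub>m n" "rot' ^\<^sub>m j * rot ^\<^sub>m j = 1\<^sub>m n" for j
    by (rule pow_mat_inverse; simp add: rot_inverse)+
  have rd [simp]: "dim_row (rot ^\<^sub>m j) = n" "dim_col (rot ^\<^sub>m j) = n" "dim_row (rot' ^\<^sub>m j) = n" "dim_col (rot' ^\<^sub>m j) = n" for j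
    by auto
  have E_cancel: "A = B" if "E s * A = E s * B" "dim_row A = n" "dim_row B = n" for s A B
  proof -
    have "E (- s) * (E s * A) = E (- s) * (E s * B)" using that by simp
    then have "(E (- s) * E s) * A = (E (- s) * E s) * B" using that by (simp add: mat_assoc)
    then show ?thesis using that by (simp add: E_add E0 mat_one_mult)
  qed
  have m0: "complex_of_nat m \<noteq> 0" by simp
  have m\<eta>: "of_nat m * \<eta> = 2 * of_real pi" by (simp add: \<eta>_def)
  show "(T 0 * T 1) ^\<^sub>m h = (T 1 * T 0) ^\<^sub>m h" if mh: "m = 2 * h"
  proof -
    have h\<eta>: "of_nat h * \<eta> = of_real pi" using m\<eta> by (simp add: mh)
    have comm: "Psi w * rot ^\<^sub>m h = rot ^\<^sub>m h * Psi w" if w: "off_lines w" for w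
    proof (rule E_cancel[of "\<i> * of_real pi"])
      have "Psi (w + of_real pi) * rot ^\<^sub>m h = E (\<i> * of_real pi) * (rot ^\<^sub>m h * Psi w)"
        using Psi_rot_pow[OF w, of h] unfolding \<eta>_def[symmetric] h\<eta> by simp
      then show "E (\<i> * of_real pi) * (Psi w * rot ^\<^sub>m h) = E (\<i> * of_real pi) * (rot ^\<^sub>m h * Psi w)"
        unfolding Psi_pi by (simp add: mat_assoc)
    qed auto
    have rr: "rot' ^\<^sub>m h = rot ^\<^sub>m h"
    proof -
      have "rot ^\<^sub>m h * rot ^\<^sub>m h = 1\<^sub>m n"
        using rot_pow_m pow_mat_add_dims[of rot n h h] by (simp add: mh mult_2)
      then have "rot' ^\<^sub>m h * (rot ^\<^sub>m h * rot ^\<^sub>m h) = rot' ^\<^sub>m h" by (simp add: mat_one_mult)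
      moreover have "rot' ^\<^sub>m h * (rot ^\<^sub>m h * rot ^\<^sub>m h) = (rot' ^\<^sub>m h * rot ^\<^sub>m h) * rot ^\<^sub>m h"
        by (simp add: mat_assoc)
      ultimately show ?thesis by (simp add: rpow mat_one_mult)
    qed
    have "P * (rot' ^\<^sub>m h * P') = (P * rot ^\<^sub>m h) * P'" unfolding rr by (simp add: mat_assoc)
    also have "\<dots> = rot ^\<^sub>m h * (P * P')" using comm[OF off(1)] by (simp add: P_def[symmetric] mat_assoc)
    finally have 1: "P * (rot' ^\<^sub>m h * P') = rot ^\<^sub>m h" by (simp add: Pinv mat_one_mult)
    have "Q * (rot' ^\<^sub>m h * Q') = S 0 * ((N * rot ^\<^sub>m h) * Q')" unfolding rr by (simp add: Q_def mat_assoc)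
    also have "\<dots> = (S 0 * rot ^\<^sub>m h) * (N * Q')" using comm[OF off(2)] by (simp add: N_def[symmetric] mat_assoc)
    also have "\<dots> = rot ^\<^sub>m h * (Q * Q')" unfolding S0_rot_pow rr by (simp add: Q_def mat_assoc)
    finally have 2: "Q * (rot' ^\<^sub>m h * Q') = rot ^\<^sub>m h" by (simp add: Qinv mat_one_mult)
    show ?thesis unfolding pow01 pow10 1 2 ..
  qed
  show "(T 0 * T 1) ^\<^sub>m h * T 0 = (T 1 * T 0) ^\<^sub>m h * T 1" if mh: "m = 2 * h + 1"
  proof -
    define x' where "x' = of_real (pi / real m) - x"
    define R where "R = rot ^\<^sub>m h"
    define R' where "R' = rot' ^\<^sub>m h"
    have RRd [simp]: "dim_row R = n" "dim_col R = n" "dim_row R' = n" "dim_col R' = n" by (auto simp: R_def R'_def)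
    have RR: "R * R' = 1\<^sub>m n" "R' * R = 1\<^sub>m n" by (simp_all add: R_def R'_def rpow)
    have h\<eta>: "of_nat h * \<eta> = of_real pi - of_real (pi / real m)"
    proof -
      have "2 * (of_nat h * \<eta>) + \<eta> = 2 * of_real pi" using m\<eta> by (simp add: mh algebra_simps)
      moreover have "\<eta> = 2 * of_real (pi / real m)" by (simp add: \<eta>_def)
      ultimately have "2 * (of_nat h * \<eta>) = 2 * (of_real pi - of_real (pi / real m))" by (simp add: algebra_simps)
      then show ?thesis by (subst (asm) mult_cancel_left) simp
    qed
    define s where "s = \<i> * (of_nat h * \<eta>)"
    have Es: "of_nat h * z = s" by (simp add: s_def z_def)
    define Px Nx where "Px = Psi x'" and "Nx = Psi (- x')"
    have Pxd [simp]: "dim_row Px = n" "dim_col Px = n" "dim_row Nx = n" "dim_col Nx = n" by (auto simp: Px_def Nx_def)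
    have x'_range: "0 < Re x'" "Re x' < pi / real m" using \<theta> by (auto simp: x'_def x_def)
    have x_range: "0 < Re x" "Re x < pi / real m" using \<theta> by (auto simp: x_def)
    \<comment> \<open>As \<open>h\<close> rotations make up \<open>\<pi> - \<pi> / m\<close>, they take \<open>x\<close> to \<open>\<pi> - x'\<close> and \<open>x'\<close> to \<open>\<pi> - x\<close>.\<close>
    have I: "E (\<i> * of_real pi) * (Nx * R) = E s * (R * P)"
    proof -
      have "x + of_nat h * \<eta> = - x' + of_real pi" by (simp add: h\<eta> x'_def)
      then show ?thesis
        using Psi_rot_pow[OF off(1), of h, folded \<eta>_def] Psi_pi(1)[of "- x'"]
        by (simp add: Nx_def P_def R_def s_def mat_assoc)
    qed
    have II: "E (\<i> * of_real pi) * (N * R) = E s * (R * Px)"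
    proof -
      have "x' + of_nat h * \<eta> = - x + of_real pi" by (simp add: h\<eta> x'_def)
      then show ?thesis
        using Psi_rot_pow[OF off_lines_sector(1)[OF x'_range], of h, folded \<eta>_def] Psi_pi(1)[of "- x"]
        by (simp add: N_def Px_def R_def s_def mat_assoc)
    qed
    define Z where "Z = Q' * P"
    have Zd [simp]: "dim_row Z = n" "dim_col Z = n" by (auto simp: Z_def)
    have Z: "S 0 * Px = Nx * Z"
    proof -
      have "Psi' (- x') * S 0 * Px = Z"
        using Psi_reflect[OF x'_range x_range]
        by (simp add: Px_def Z_def Q'_def N'_def P_def)
      then have "Nx * (Psi' (- x') * S 0 * Px) = Nx * Z" by simp
      moreover have "Nx * (Psi' (- x') * S 0 * Px) = (Nx * Psi' (- x')) * (S 0 * Px)" by (simp add: mat_assoc)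
      moreover have "Nx * Psi' (- x') = 1\<^sub>m n" unfolding Nx_def by (rule Psi_inv[OF off_lines_sector(2)[OF x'_range]])
      ultimately show ?thesis by (simp add: mat_one_mult)
    qed
    have ER: "E t * R = R * E t" "E t * R' = R' * E t" for t
      unfolding R_def R'_def by (rule E_central_pow; simp add: E_rot E_rot')+
    let ?e = "\<i> * of_real pi"
    have ES0: "E t * S 0 = S 0 * E t" for t by (rule E_S) simp
    have II': "E s * Px = E ?e * (R' * (N * R))"
    proof -
      have "R' * (E ?e * (N * R)) = R' * (E s * (R * Px))" unfolding II ..
      moreover have "R' * (E ?e * (N * R)) = (R' * E ?e) * (N * R)" by (simp add: mat_assoc)
      moreover have "R' * (E s * (R * Px)) = (R' * E s) * (R * Px)" by (simp add: mat_assoc)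
      ultimately have "(E ?e * R') * (N * R) = (E s * R') * (R * Px)" unfolding ER(2) by simp
      then have "E ?e * (R' * (N * R)) = E s * ((R' * R) * Px)" by (simp add: mat_assoc)
      then show ?thesis by (simp add: RR mat_one_mult)
    qed
    have I': "E ?e * Nx = E s * (R * (P * R'))"
    proof -
      have "(E ?e * (Nx * R)) * R' = (E s * (R * P)) * R'" unfolding I ..
      moreover have "(E ?e * (Nx * R)) * R' = E ?e * (Nx * (R * R'))" by (simp add: mat_assoc)
      ultimately show ?thesis by (simp add: RR mat_one_mult mat_assoc)
    qed
    have L: "E (?e + ?e) * (R * (Q * R)) = E (s + s) * (R * (P * (R' * Z)))"
    proof -
      have "E ?e * (S 0 * (E s * Px)) = (E ?e * S 0) * (E ?e * (R' * (N * R)))"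
        unfolding II' by (simp add: mat_assoc)
      also have "\<dots> = S 0 * ((E ?e * E ?e) * (R' * (N * R)))" unfolding ES0 by (simp add: mat_assoc)
      also have "\<dots> = (S 0 * E (?e + ?e)) * (R' * (N * R))" by (simp add: E_add mat_assoc)
      also have "\<dots> = E (?e + ?e) * ((S 0 * R') * (N * R))" unfolding ES0[symmetric] by (simp add: mat_assoc)
      also have "S 0 * R' = R * S 0"
      proof -
        have "S 0 * R' = S 0 * R' * (S 0 * S 0)" by (simp add: S_square mat_one_mult)
        also have "\<dots> = S 0 * (R' * S 0) * S 0" by (simp add: mat_assoc)
        also have "R' * S 0 = S 0 * R" using S0_rot_pow[of h] by (simp add: R_def R'_def)
        also have "S 0 * (S 0 * R) * S 0 = (S 0 * S 0) * (R * S 0)" by (simp add: mat_assoc)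
        finally show ?thesis by (simp add: S_square mat_one_mult)
      qed
      also have "R * S 0 * (N * R) = R * (Q * R)" by (simp add: Q_def mat_assoc)
      finally have a: "E ?e * (S 0 * (E s * Px)) = E (?e + ?e) * (R * (Q * R))" .
      have "E ?e * (S 0 * (E s * Px)) = E ?e * ((S 0 * E s) * Px)" by (simp add: mat_assoc)
      also have "\<dots> = (E ?e * E s) * (S 0 * Px)" unfolding ES0[symmetric] by (simp add: mat_assoc)
      also have "\<dots> = (E s * E ?e) * (Nx * Z)" unfolding Z by (simp add: E_add add.commute)
      also have "\<dots> = E s * ((E ?e * Nx) * Z)" by (simp add: mat_assoc)
      also have "\<dots> = (E s * E s) * (R * (P * (R' * Z)))" unfolding I' by (simp add: mat_assoc)
      finally show ?thesis using a by (simp add: E_add)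
    qed
    have main: "P * (R' * Z) = E z * (Q * R)"
    proof -
      have eq: "?e + ?e = (s + s) + z"
      proof -
        have "2 * of_real pi = 2 * (of_nat h * \<eta>) + \<eta>" using m\<eta> by (simp add: mh algebra_simps)
        then have "\<i> * (2 * of_real pi) = \<i> * (2 * (of_nat h * \<eta>) + \<eta>)" by (rule arg_cong)
        then show ?thesis by (simp add: s_def z_def algebra_simps)
      qed
      have "E (s + s) * (E z * (R * (Q * R))) = E (s + s) * (R * (P * (R' * Z)))"
        using L unfolding eq E_add[symmetric] by (simp add: mat_assoc)
      then have "E z * (R * (Q * R)) = R * (P * (R' * Z))" by (rule E_cancel) auto
      then have "R' * (E z * (R * (Q * R))) = R' * (R * (P * (R' * Z)))" by simp
      moreover have "R' * (E z * (R * (Q * R))) = (R' * E z) * (R * (Q * R))" by (simp add: mat_assoc)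
      moreover have "R' * E z = E z * R'" by (simp add: ER)
      moreover have "E z * R' * (R * (Q * R)) = E z * ((R' * R) * (Q * R))" by (simp add: mat_assoc)
      moreover have "R' * (R * (P * (R' * Z))) = (R' * R) * (P * (R' * Z))" by (simp add: mat_assoc)
      ultimately show ?thesis by (simp add: RR mat_one_mult)
    qed
    have "P * (R' * Q') = P * (R' * (Q' * (P * P')))" by (simp add: Pinv mat_one_mult)
    also have "\<dots> = (P * (R' * Z)) * P'" by (simp add: Z_def mat_assoc)
    also have "\<dots> = E z * (Q * (R * P'))" unfolding main by (simp add: mat_assoc)
    finally have main': "P * (R' * Q') = E z * (Q * (R * P'))" .
    have R_eq: "R' * rot' = R"
    proof -
      have "rot ^\<^sub>m m = R * (R * rot)"
        using pow_mat_add_dims[of rot n h "Suc h"] by (simp add: mh R_def mult_2)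
      then have "R * (R * rot) = 1\<^sub>m n" by (simp add: rot_pow_m)
      then have "(R' * R) * (R * (rot * rot')) = R' * rot'"
        by (metis (no_types, lifting) RRd mat_assoc mat_one_mult(1) rot'_dim(1,2) rot_dim(1,2) index_mult_mat(2,3))
      then show ?thesis by (simp add: RR rot_inverse mat_one_mult)
    qed
    have "(T 0 * T 1) ^\<^sub>m h * T 0 = E s * (P * (R' * ((P' * P) * Q')))"
      unfolding pow01 unfolding Es T0 R'_def[symmetric] by (simp add: mat_assoc)
    also have "\<dots> = E s * (E z * (Q * (R * P')))" by (simp add: Pinv mat_one_mult main')
    finally have a: "(T 0 * T 1) ^\<^sub>m h * T 0 = E s * (E z * (Q * (R * P')))" .
    have "(T 1 * T 0) ^\<^sub>m h * T 1 = E s * (Q * (R' * ((Q' * E z) * (Q * (rot' * P')))))"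
      unfolding pow10 unfolding Es T1 R'_def[symmetric] by (simp add: mat_assoc)
    also have "\<dots> = E s * (Q * ((R' * E z) * ((Q' * Q) * (rot' * P'))))"
      unfolding EQ'[symmetric] by (simp add: mat_assoc)
    also have "\<dots> = E s * ((Q * E z) * (R' * (rot' * P')))"
      unfolding ER(2)[symmetric] by (simp add: Qinv mat_one_mult mat_assoc)
    also have "\<dots> = E s * (E z * (Q * ((R' * rot') * P')))"
      unfolding EQ[symmetric] by (simp add: mat_assoc)
    finally show ?thesis unfolding a R_eq ..
  qed
  show "\<exists>M \<in> carrier_mat n n. T 0 * M = 1\<^sub>m n \<and> M * T 0 = 1\<^sub>m n"
  proof (intro bexI conjI)
    have "T 0 * (Q * P') = P * ((Q' * Q) * P')" by (simp add: T0 mat_assoc)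
    then show "T 0 * (Q * P') = 1\<^sub>m n" by (simp add: Qinv Pinv mat_one_mult)
    have "(Q * P') * T 0 = Q * ((P' * P) * Q')" by (simp add: T0 mat_assoc)
    then show "(Q * P') * T 0 = 1\<^sub>m n" by (simp add: Qinv Pinv mat_one_mult)
  qed (auto intro!: carrier_matI)
  show "\<exists>M \<in> carrier_mat n n. T 1 * M = 1\<^sub>m n \<and> M * T 1 = 1\<^sub>m n"
  proof (intro bexI conjI)
    let ?M = "P * (rot * (Q' * E' z))"
    have "T 1 * ?M = E z * (Q * (rot' * ((P' * P) * (rot * (Q' * E' z)))))" unfolding T1 by (simp add: mat_assoc)
    also have "\<dots> = E z * (Q * ((rot' * rot) * (Q' * E' z)))" by (simp add: Pinv mat_one_mult mat_assoc)
    also have "\<dots> = E z * ((Q * Q') * E' z)" by (simp add: rot_inverse mat_one_mult mat_assoc)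
    finally show "T 1 * ?M = 1\<^sub>m n" by (simp add: Qinv mat_one_mult E_inv)
    have "?M * T 1 = P * (rot * (Q' * ((E' z * E z) * (Q * (rot' * P')))))" unfolding T1 by (simp add: mat_assoc)
    also have "\<dots> = P * (rot * ((Q' * Q) * (rot' * P')))" by (simp add: E_inv mat_one_mult mat_assoc)
    also have "\<dots> = P * ((rot * rot') * P')" by (simp add: Qinv mat_one_mult mat_assoc)
    finally show "?M * T 1 = 1\<^sub>m n" by (simp add: rot_inverse mat_one_mult Pinv)
  qed (auto intro!: carrier_matI)
qed

end

section \<open>The skein elements\<close>

text \<open>The matrix of \<open>E\<^sub>i\<close>, which the quadratic relation determines from the matrix \<open>T\<close> of \<open>X\<^sub>i\<close>.\<close>

definition skein :: "nat \<Rightarrow> complex \<Rightarrow> complex \<Rightarrow> complex mat \<Rightarrow> complex mat"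
  where "skein n q l T = (l / (inverse q - q)) \<cdot>\<^sub>m ((T - q \<cdot>\<^sub>m 1\<^sub>m n) * (T + inverse q \<cdot>\<^sub>m 1\<^sub>m n))"

fun letter_mat :: "(nat \<Rightarrow> complex mat) \<Rightarrow> (nat \<Rightarrow> complex mat) \<Rightarrow> letter \<Rightarrow> complex mat"
  where
    "letter_mat T E (GenX i) = T i"
  | "letter_mat T E (GenE i) = E i"

definition word_mat :: "nat \<Rightarrow> (nat \<Rightarrow> complex mat) \<Rightarrow> (nat \<Rightarrow> complex mat) \<Rightarrow> letter list \<Rightarrow> complex mat"
  where "word_mat n T E u = foldr (\<lambda>g A. letter_mat T E g * A) u (1\<^sub>m n)"

locale generic_monodromy = brauer_matrices +
  fixes \<kappa> :: complex and r \<theta> \<epsilon> :: real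
  assumes \<theta>: "0 < \<theta>" "\<theta> < pi / real m" and r: "0 < r" and \<epsilon>: "0 < \<epsilon>" "\<epsilon> < 1"
    and nonresonant: "i < 2 \<Longrightarrow> nonresonant_param \<kappa> (k i) (\<alpha> i)"
    and q_square: "i < 2 \<Longrightarrow> (q_par k \<kappa> i)\<^sup>2 \<noteq> 1"
begin

definition T :: "nat \<Rightarrow> complex mat"
  where "T = sigma_monodromy \<kappa> (polar r \<theta>) \<epsilon>"

definition E :: "nat \<Rightarrow> complex mat"
  where "E i = skein n (q_par k \<kappa> i) (l_par k \<alpha> \<kappa> i) (T i)"

definition W :: "letter list \<Rightarrow> complex mat"
  where "W = word_mat n T E"

text \<open>At the line \<open>i\<close> the monodromy is conjugate to \<open>S\<^sub>i exp(\<pi> \<i> \<kappa> (k\<^sub>i S\<^sub>i - e\<^sub>i))\<close>, a combination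
  of \<open>1\<close>, \<open>S\<^sub>i\<close> and \<open>e\<^sub>i\<close>, and the skein element is conjugate to a multiple of \<open>e\<^sub>i\<close>. The
  conjugating matrix commutes with all symmetries of the connection.\<close>

lemma T_normal_form:
  assumes i: "i < 2"
  obtains c P Q where "P \<in> carrier_mat n n" "Q \<in> carrier_mat n n" "P * Q = 1\<^sub>m n" "Q * P = 1\<^sub>m n"
    "T i \<in> carrier_mat n n" "E i = c \<cdot>\<^sub>m (P * (e i * Q))"
    "T i * E i = inverse (l_par k \<alpha> \<kappa> i) \<cdot>\<^sub>m E i" "E i * T i = inverse (l_par k \<alpha> \<kappa> i) \<cdot>\<^sub>m E i"
    "\<And>g. g \<in> carrier_mat n n \<Longrightarrow> (\<And>l. l < m \<Longrightarrow> res l * g = g * res l) \<Longrightarrow> Q * g = g * Q"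
    "\<And>g. g \<in> carrier_mat n n \<Longrightarrow> (\<And>l. l < m \<Longrightarrow> res l * g = g * res l) \<Longrightarrow> P * g = g * P"
proof -
  have im: "i < m" using i m by simp
  obtain P Q where PQ: "P \<in> carrier_mat n n" "Q \<in> carrier_mat n n" "P * Q = 1\<^sub>m n" "Q * P = 1\<^sub>m n"
    and T0: "sigma_monodromy \<kappa> (polar r \<theta>) \<epsilon> i = P * (S i * local_exp \<kappa> i (\<i> * of_real pi)) * Q"
    and comm: "\<And>g. g \<in> carrier_mat n n \<Longrightarrow> (\<And>l. l < m \<Longrightarrow> res l * g = g * res l) \<Longrightarrow> P * g = g * P"
    using sigma_monodromy_normal_form[OF \<theta> r i \<epsilon> nonresonant[OF i]] by metis
  have d [simp]: "dim_row P = n" "dim_col P = n" "dim_row Q = n" "dim_col Q = n" using PQ by auto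
  define q where "q = q_par k \<kappa> i"
  define l where "l = l_par k \<alpha> \<kappa> i"
  define ch where "ch = local_chi \<kappa> (k i) (\<alpha> i) (\<i> * of_real pi)"
  have q: "exp (\<kappa> * k i * (\<i> * of_real pi)) = q" by (simp add: q_def q_par_def mult_ac)
  have q0: "q \<noteq> 0" by (simp add: q_def q_par_def)
  define s c where "s = (q - inverse q) / 2" and "c = (q + inverse q) / 2"
  have le: "S i * local_exp \<kappa> i (\<i> * of_real pi) = tri i s c ch"
  proof -
    have "S i = tri i 0 1 0" using im by (intro eq_matI) (auto simp: tri_def)
    then show ?thesis
      by (simp add: local_exp_def exp_minus q tri_mult[OF im] s_def c_def ch_def)
  qed
  define X where "X = tri i s c ch"
  have Xd [simp]: "dim_row X = n" "dim_col X = n" using im by (auto simp: X_def)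
  have T: "T i = P * (X * Q)" unfolding T_def T0 le X_def using im by (simp add: mat_assoc)
  have Td: "T i \<in> carrier_mat n n" unfolding T using PQ by (auto intro!: carrier_matI)
  have ed [simp]: "dim_row (e i) = n" "dim_col (e i) = n" using im by auto
  have shift: "T i + a \<cdot>\<^sub>m 1\<^sub>m n = P * (tri i (s + a) c ch * Q)" for a
  proof -
    have "tri i (s + a) c ch = X + a \<cdot>\<^sub>m 1\<^sub>m n"
      using im by (intro eq_matI) (auto simp: X_def tri_def algebra_simps)
    then have "P * (tri i (s + a) c ch * Q) = P * (X * Q) + a \<cdot>\<^sub>m (P * Q)"
      by (simp add: mat_ring)
    then show ?thesis by (simp add: T PQ)
  qed
  have minus: "T i - q \<cdot>\<^sub>m 1\<^sub>m n = T i + (- q) \<cdot>\<^sub>m 1\<^sub>m n"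
    using Td by (intro eq_matI) auto
  have "(T i - q \<cdot>\<^sub>m 1\<^sub>m n) * (T i + inverse q \<cdot>\<^sub>m 1\<^sub>m n) =
      P * (tri i (s + - q) c ch * ((Q * P) * (tri i (s + inverse q) c ch * Q)))"
    unfolding minus shift using im by (simp add: mat_assoc)
  also have "\<dots> = P * ((tri i (s + - q) c ch * tri i (s + inverse q) c ch) * Q)"
    using im by (simp add: PQ mat_ring)
  also have "tri i (s + - q) c ch * tri i (s + inverse q) c ch = tri i 0 0 (ch * (2 * c + \<alpha> i * ch))"
  proof -
    have sq: "s + - q = - c" "s + inverse q = c" by (simp_all add: s_def c_def field_simps)
    show ?thesis unfolding sq by (simp add: tri_mult[OF im] algebra_simps)
  qed
  also have "\<dots> = (ch * (2 * c + \<alpha> i * ch)) \<cdot>\<^sub>m e i"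
    using im by (intro eq_matI) (auto simp: tri_def)
  finally have E: "E i = (l / (inverse q - q) * (ch * (2 * c + \<alpha> i * ch))) \<cdot>\<^sub>m (P * (e i * Q))"
    unfolding E_def skein_def q_def[symmetric] l_def[symmetric] by (simp add: mat_smult_mult mat_smult_smult)
  have eig: "s + c + \<alpha> i * ch = inverse l"
  proof -
    have sc: "s + c = q" by (simp add: s_def c_def field_simps)
    show ?thesis
    proof (cases "\<alpha> i = 0")
      case True
      then show ?thesis by (simp add: sc l_def l_par_def q_def)
    next
      case False
      have "exp (\<kappa> * (k i - \<alpha> i) * (\<i> * of_real pi)) = q * exp (- (\<kappa> * \<alpha> i * of_real pi * \<i>))"
        unfolding q[symmetric] exp_add[symmetric] by (simp add: algebra_simps)
      also have "\<dots> = inverse l"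
        by (simp add: l_def l_par_def q_def[symmetric] exp_minus divide_inverse)
      finally have "ch = (inverse l - q) / \<alpha> i" using False by (simp add: ch_def local_chi_def q)
      then show ?thesis using False by (simp add: sc)
    qed
  qed
  have e_tri: "e i = tri i 0 0 1" using im by (intro eq_matI) (auto simp: tri_def)
  have Xe: "X * e i = inverse l \<cdot>\<^sub>m e i" "e i * X = inverse l \<cdot>\<^sub>m e i"
  proof -
    have *: "tri i 0 0 (inverse l) = inverse l \<cdot>\<^sub>m e i"
      using im by (intro eq_matI) (auto simp: tri_def)
    have "X * e i = tri i 0 0 (s + c + \<alpha> i * ch)" "e i * X = tri i 0 0 (s + c + \<alpha> i * ch)"
      unfolding X_def e_tri tri_mult[OF im] by simp_all
    then show "X * e i = inverse l \<cdot>\<^sub>m e i" "e i * X = inverse l \<cdot>\<^sub>m e i"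
      unfolding eig * by auto
  qed
  have "T i * (P * (e i * Q)) = P * (X * ((Q * P) * (e i * Q)))" by (simp add: T mat_assoc)
  also have "\<dots> = P * ((X * e i) * Q)" by (simp add: PQ mat_ring)
  finally have TE: "T i * (P * (e i * Q)) = inverse l \<cdot>\<^sub>m (P * (e i * Q))" by (simp add: Xe mat_ring)
  have "(P * (e i * Q)) * T i = P * (e i * ((Q * P) * (X * Q)))" by (simp add: T mat_assoc)
  also have "\<dots> = P * ((e i * X) * Q)" by (simp add: PQ mat_ring)
  finally have ET: "(P * (e i * Q)) * T i = inverse l \<cdot>\<^sub>m (P * (e i * Q))" by (simp add: Xe mat_ring)
  have commQ: "Q * g = g * Q" if g: "g \<in> carrier_mat n n" "\<And>l. l < m \<Longrightarrow> res l * g = g * res l" for g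
  proof -
    have gd [simp]: "dim_row g = n" "dim_col g = n" using g by auto
    have "Q * g = Q * (g * (P * Q))" by (simp add: PQ mat_one_mult)
    also have "\<dots> = Q * ((P * g) * Q)" using comm[OF g] by (simp add: mat_assoc)
    also have "\<dots> = (Q * P) * (g * Q)" by (simp add: mat_assoc)
    finally show ?thesis by (simp add: PQ mat_one_mult)
  qed
  have dim: "dim_row (T i) = n" "dim_col (T i) = n" using Td by auto
  show thesis
  proof (rule that[OF PQ Td E])
    show "T i * E i = inverse (l_par k \<alpha> \<kappa> i) \<cdot>\<^sub>m E i" "E i * T i = inverse (l_par k \<alpha> \<kappa> i) \<cdot>\<^sub>m E i"
      unfolding l_def[symmetric] E using dim
      by (simp_all add: mat_smult_mult TE ET mat_smult_smult mult.commute)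
  qed (use comm commQ in auto)
qed

lemma T_carrier: "i < 2 \<Longrightarrow> T i \<in> carrier_mat n n"
  by (elim T_normal_form)

lemma T_dim [simp]: "i < 2 \<Longrightarrow> dim_row (T i) = n" "i < 2 \<Longrightarrow> dim_col (T i) = n"
  using T_carrier by auto

lemma E_carrier: "i < 2 \<Longrightarrow> E i \<in> carrier_mat n n"
  using T_carrier by (auto simp: E_def skein_def)

lemma E_dim [simp]: "i < 2 \<Longrightarrow> dim_row (E i) = n" "i < 2 \<Longrightarrow> dim_col (E i) = n"
  using E_carrier by auto

lemma T_E: "i < 2 \<Longrightarrow> T i * E i = inverse (l_par k \<alpha> \<kappa> i) \<cdot>\<^sub>m E i"
  by (elim T_normal_form)

lemma E_T: "i < 2 \<Longrightarrow> E i * T i = inverse (l_par k \<alpha> \<kappa> i) \<cdot>\<^sub>m E i"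
  by (elim T_normal_form)

lemma skein_relation:
  assumes i: "i < 2"
  shows "(inverse (q_par k \<kappa> i) - q_par k \<kappa> i) \<cdot>\<^sub>m E i = l_par k \<alpha> \<kappa> i \<cdot>\<^sub>m
    ((T i - q_par k \<kappa> i \<cdot>\<^sub>m 1\<^sub>m n) * (T i + inverse (q_par k \<kappa> i) \<cdot>\<^sub>m 1\<^sub>m n))"
proof -
  have "inverse (q_par k \<kappa> i) - q_par k \<kappa> i \<noteq> 0"
    using q_square[OF i] by (auto simp: q_par_def field_simps power2_eq_square)
  then show ?thesis by (simp add: E_def skein_def mat_smult_smult)
qed

lemma braid_words:
  shows "m = 2 * h \<Longrightarrow> (T 0 * T 1) ^\<^sub>m h = (T 1 * T 0) ^\<^sub>m h"
    and "m = 2 * h + 1 \<Longrightarrow> (T 0 * T 1) ^\<^sub>m h * T 0 = (T 1 * T 0) ^\<^sub>m h * T 1"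
    and "i < 2 \<Longrightarrow> \<exists>M \<in> carrier_mat n n. T i * M = 1\<^sub>m n \<and> M * T i = 1\<^sub>m n"
proof -
  obtain E E' G G' where "global_solution \<kappa> E E' G G'" by (rule global_solution_exists)
  then interpret B: braid_setting m n k \<alpha> S e \<kappa> E E' G G' by unfold_locales
  note B.braid_relation[OF \<theta> r \<epsilon>, folded T_def]
  note * = this
  show "m = 2 * h \<Longrightarrow> (T 0 * T 1) ^\<^sub>m h = (T 1 * T 0) ^\<^sub>m h"
    and "m = 2 * h + 1 \<Longrightarrow> (T 0 * T 1) ^\<^sub>m h * T 0 = (T 1 * T 0) ^\<^sub>m h * T 1"
    by (fact *)+
  show "\<exists>M \<in> carrier_mat n n. T i * M = 1\<^sub>m n \<and> M * T i = 1\<^sub>m n" if "i < 2"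
  proof -
    have "i = 0 \<or> i = 1" using that by auto
    then show ?thesis using *(3,4) by auto
  qed
qed

lemma W_Cons: "W (x # u) = letter_mat T E x * W u" and W_Nil: "W [] = 1\<^sub>m n"
  by (simp_all add: W_def word_mat_def)

lemma letter_mat_carrier: "x \<in> {GenX 0, GenX 1, GenE 0, GenE 1} \<Longrightarrow> letter_mat T E x \<in> carrier_mat n n"
  using T_carrier E_carrier by auto

lemma W_carrier: "u \<in> Lambda \<Longrightarrow> W u \<in> carrier_mat n n"
proof (induction u)
  case (Cons x u)
  then have "x \<in> {GenX 0, GenX 1, GenE 0, GenE 1}" "u \<in> Lambda" by (auto simp: Lambda_def)
  then show ?case unfolding W_Cons using Cons.IH letter_mat_carrier by (intro mult_carrier_mat) auto
qed (simp add: W_Nil)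

lemma W_dim [simp]: "u \<in> Lambda \<Longrightarrow> dim_row (W u) = n" "u \<in> Lambda \<Longrightarrow> dim_col (W u) = n"
  using W_carrier by auto

text \<open>The conjugating matrices of the normal form commute with a symmetry \<open>g\<close> of the connection, so
  that the skein element absorbs \<open>g\<close> with the same scalar as \<open>e\<^sub>i\<close> does.\<close>

lemma E_absorb:
  assumes i: "i < 2" and g: "g \<in> carrier_mat n n"
    "\<And>l. l < m \<Longrightarrow> S l * g = g * S l" "\<And>l. l < m \<Longrightarrow> e l * g = g * e l"
    and z: "e i * g = z \<cdot>\<^sub>m e i"
  shows "E i * g = z \<cdot>\<^sub>m E i" and "g * E i = z \<cdot>\<^sub>m E i"
proof -
  have im: "i < m" using i m by simp
  have d [simp]: "dim_row g = n" "dim_col g = n" using g(1) by auto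
  have res: "res l * g = g * res l" if "l < m" for l
    using that g by (simp add: res_def mat_ring)
  obtain c P Q where PQ: "P \<in> carrier_mat n n" "Q \<in> carrier_mat n n"
    and E: "E i = c \<cdot>\<^sub>m (P * (e i * Q))" and comm: "Q * g = g * Q" "P * g = g * P"
    using T_normal_form[OF i] g(1) res by metis
  have PQd [simp]: "dim_row P = n" "dim_col P = n" "dim_row Q = n" "dim_col Q = n" using PQ by auto
  have ed [simp]: "dim_row (e i) = n" "dim_col (e i) = n" using im by auto
  have "P * (e i * Q) * g = P * ((e i * g) * Q)" by (simp add: mat_assoc comm)
  then have 1: "P * (e i * Q) * g = z \<cdot>\<^sub>m (P * (e i * Q))" by (simp add: z mat_ring)
  have "g * (P * (e i * Q)) = (g * P) * (e i * Q)" by (simp add: mat_assoc)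
  also have "\<dots> = P * ((g * e i) * Q)" by (simp add: comm(2)[symmetric] mat_assoc)
  finally have 2: "g * (P * (e i * Q)) = z \<cdot>\<^sub>m (P * (e i * Q))"
    by (simp add: g(3)[OF im, symmetric] z mat_ring)
  show "E i * g = z \<cdot>\<^sub>m E i" "g * E i = z \<cdot>\<^sub>m E i"
    unfolding E using 1 2 by (simp_all add: mat_smult_mult mat_smult_smult mult.commute)
qed

text \<open>Intertwiners of the \<open>S\<^sub>l\<close> and \<open>e\<^sub>l\<close> are intertwiners of the connections, hence of the monodromies
  and of everything that is built from them.\<close>

lemma W_intertwine:
  assumes V': "generic_monodromy m n' k \<alpha> S' e' \<kappa> r \<theta> \<epsilon>" and f: "f \<in> carrier_mat n n'"
    and Sf: "\<And>l. l < m \<Longrightarrow> S l * f = f * S' l" and ef: "\<And>l. l < m \<Longrightarrow> e l * f = f * e' l"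
  shows "i < 2 \<Longrightarrow> T i * f = f * generic_monodromy.T m n' k S' e' \<kappa> r \<theta> \<epsilon> i"
    and "i < 2 \<Longrightarrow> E i * f = f * generic_monodromy.E m n' k \<alpha> S' e' \<kappa> r \<theta> \<epsilon> i"
    and "u \<in> Lambda \<Longrightarrow> W u * f = f * generic_monodromy.W m n' k \<alpha> S' e' \<kappa> r \<theta> \<epsilon> u"
proof -
  interpret V': generic_monodromy m n' k \<alpha> S' e' \<kappa> r \<theta> \<epsilon> by (rule V')
  have d [simp]: "dim_row f = n" "dim_col f = n'" using f by auto
  show T: "T i * f = f * V'.T i" if "i < 2" for i
    unfolding T_def V'.T_def
    by (rule sigma_monodromy_intertwine[OF V'.brauer_matrices_axioms f Sf ef \<theta> r that \<epsilon> nonresonant[OF that]])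
  show E: "E i * f = f * V'.E i" if i: "i < 2" for i
  proof -
    have *: "(T i + a \<cdot>\<^sub>m 1\<^sub>m n) * f = f * (V'.T i + a \<cdot>\<^sub>m 1\<^sub>m n')"
      "(T i - a \<cdot>\<^sub>m 1\<^sub>m n) * f = f * (V'.T i - a \<cdot>\<^sub>m 1\<^sub>m n')" for a
      using i by (simp_all add: mat_ring T)
    have "((T i - a \<cdot>\<^sub>m 1\<^sub>m n) * (T i + b \<cdot>\<^sub>m 1\<^sub>m n)) * f =
      f * ((V'.T i - a \<cdot>\<^sub>m 1\<^sub>m n') * (V'.T i + b \<cdot>\<^sub>m 1\<^sub>m n'))" for a b
    proof -
      have "((T i - a \<cdot>\<^sub>m 1\<^sub>m n) * (T i + b \<cdot>\<^sub>m 1\<^sub>m n)) * f =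
          ((T i - a \<cdot>\<^sub>m 1\<^sub>m n) * f) * (V'.T i + b \<cdot>\<^sub>m 1\<^sub>m n')"
        using i mat_assoc[of "T i - a \<cdot>\<^sub>m 1\<^sub>m n" "T i + b \<cdot>\<^sub>m 1\<^sub>m n" f]
          mat_assoc[of "T i - a \<cdot>\<^sub>m 1\<^sub>m n" f "V'.T i + b \<cdot>\<^sub>m 1\<^sub>m n'"] by (simp add: *(1))
      then show ?thesis
        using i mat_assoc[of f "V'.T i - a \<cdot>\<^sub>m 1\<^sub>m n'" "V'.T i + b \<cdot>\<^sub>m 1\<^sub>m n'"] by (simp add: *(2))
    qed
    then show ?thesis
      using i by (simp add: E_def V'.E_def skein_def mat_smult_mult)
  qed
  show "W u * f = f * V'.W u" if "u \<in> Lambda"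
    using that
  proof (induction u)
    case Nil
    show ?case by (simp add: W_Nil V'.W_Nil mat_one_mult)
  next
    case (Cons x u)
    then have x: "x \<in> {GenX 0, GenX 1, GenE 0, GenE 1}" and u: "u \<in> Lambda" by (auto simp: Lambda_def)
    have x': "letter_mat T E x * f = f * letter_mat V'.T V'.E x" using x T E by auto
    have xd: "dim_row (letter_mat T E x) = n" "dim_col (letter_mat T E x) = n"
      "dim_row (letter_mat V'.T V'.E x) = n'" "dim_col (letter_mat V'.T V'.E x) = n'"
      using letter_mat_carrier[OF x] V'.letter_mat_carrier[OF x] by auto
    have "W (x # u) * f = letter_mat T E x * (f * V'.W u)"
      unfolding W_Cons using u xd Cons.IH[OF u] by (simp add: mat_assoc)
    also have "\<dots> = (letter_mat T E x * f) * V'.W u" using u xd by (simp add: mat_assoc)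
    also have "\<dots> = f * V'.W (x # u)" unfolding V'.W_Cons x' using u xd by (simp add: mat_assoc)
    finally show ?case .
  qed
qed

end

section \<open>The dihedral group and its lines\<close>

lemma line_shift:
  assumes "a = angle m j + of_int z * pi"
  shows "line m j = {(c * of_real (cos a), c * of_real (sin a)) | c. True}"
proof -
  define s where "s = (complex_of_real (cos (of_int z * pi)))"
  have sin: "sin (of_int z * pi) = 0" by (simp add: sin_zero_iff_int2)
  then have "cos (of_int z * pi) * cos (of_int z * pi) = (1::real)"
    using sin_cos_squared_add2[of "of_int z * pi"] by (simp add: power2_eq_square)
  then have ss: "s * s = 1" unfolding s_def of_real_mult[symmetric] by simp
  have cs: "complex_of_real (cos a) = of_real (cos (angle m j)) * s"
    "complex_of_real (sin a) = of_real (sin (angle m j)) * s"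
    by (simp_all add: assms cos_add sin_add sin s_def)
  have "(c * of_real (cos (angle m j)), c * of_real (sin (angle m j))) =
      ((c * s) * of_real (cos a), (c * s) * of_real (sin a))" for c
  proof -
    have "(c * s) * (x * s) = c * x" for x
    proof -
      have "(c * s) * (x * s) = (c * x) * (s * s)" by (simp add: mult_ac)
      then show ?thesis by (simp add: ss)
    qed
    note * = this
    show ?thesis by (simp add: cs *)
  qed
  moreover have "(c * of_real (cos a), c * of_real (sin a)) =
      ((c * s) * of_real (cos (angle m j)), (c * s) * of_real (sin (angle m j)))" for c
    by (simp add: cs mult_ac)
  ultimately show ?thesis unfolding line_def by - (rule Collect_cong, metis)
qed

lemma angle_of_sum: "0 < m \<Longrightarrow> angle m (i + j) = angle m i + angle m j"
  by (simp add: angle_def add_divide_distrib distrib_right)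

lemma angle_multiple: "0 < m \<Longrightarrow> angle m (m * i) = real i * pi"
  by (simp add: angle_def)

lemma reflection_line:
  assumes "j < m"
  shows "reflection m t ` line m j = line m (mirror m t j)"
proof -
  obtain z :: int where "angle m (mirror m t j) = 2 * angle m t - angle m j + of_int z * pi"
    using angle_mirror[OF assms] by blast
  then have "line m (mirror m t j) = {(c * of_real (cos (2 * angle m t - angle m j)),
      c * of_real (sin (2 * angle m t - angle m j))) | c. True}"
    by (intro line_shift[where z = "- z"]) (simp add: algebra_simps)
  moreover have "reflection m t (c * of_real (cos (angle m j)), c * of_real (sin (angle m j))) =
      (c * of_real (cos (2 * angle m t - angle m j)), c * of_real (sin (2 * angle m t - angle m j)))" for c
    by (simp add: reflection_def cos_diff sin_diff algebra_simps)
  ultimately show ?thesis unfolding line_def[of m j] by (auto simp: image_def) metis+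
qed

lemma rotation_line:
  assumes "j < m" 
  shows "rotation m t ` line m j = line m ((2 * t + j) mod m)"
proof -
  have m: "0 < m" using assms by simp
  have "2 * angle m t + angle m j = angle m (2 * t + j)"
    by (simp add: angle_def add_divide_distrib distrib_right)
  also have "\<dots> = angle m (m * ((2 * t + j) div m) + (2 * t + j) mod m)" by simp
  also have "\<dots> = angle m ((2 * t + j) mod m) + of_int (int ((2 * t + j) div m)) * pi"
    unfolding angle_of_sum[OF m] angle_multiple[OF m] by simp
  finally have "2 * angle m t + angle m j =
      angle m ((2 * t + j) mod m) + of_int (int ((2 * t + j) div m)) * pi" .
  then have "line m ((2 * t + j) mod m) = {(c * of_real (cos (2 * angle m t + angle m j)),
      c * of_real (sin (2 * angle m t + angle m j))) | c. True}"
    by (rule line_shift)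
  moreover have "rotation m t (c * of_real (cos (angle m j)), c * of_real (sin (angle m j))) =
      (c * of_real (cos (2 * angle m t + angle m j)), c * of_real (sin (2 * angle m t + angle m j)))" for c
    by (simp add: rotation_def cos_add sin_add algebra_simps)
  ultimately show ?thesis unfolding line_def[of m j] by (auto simp: image_def) metis+
qed

lemma line_inj:
  assumes ij: "i < m" "j < m" and eq: "line m i = line m j"
  shows "i = j"
proof -
  have m: "0 < real m" using ij by simp
  have "(of_real (cos (angle m i)), of_real (sin (angle m i))) \<in> line m i"
    unfolding line_def by (auto intro!: exI[of _ 1])
  then obtain c where "complex_of_real (cos (angle m i)) = c * of_real (cos (angle m j))"
    "complex_of_real (sin (angle m i)) = c * of_real (sin (angle m j))"
    unfolding eq by (auto simp: line_def)
  then have "complex_of_real (sin (angle m i - angle m j)) = 0"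
    by (simp add: sin_diff)
  then have "sin (angle m i - angle m j) = 0" by (simp only: of_real_eq_0_iff)
  then obtain z :: int where "angle m i - angle m j = of_int z * pi"
    by (auto simp: sin_zero_iff_int2)
  then have "real i - real j = of_int z * real m"
  proof -
    assume "angle m i - angle m j = of_int z * pi"
    then have "(real i - real j) * (pi / real m) = (of_int z * real m) * (pi / real m)"
      using m by (simp add: angle_def left_diff_distrib diff_divide_distrib)
    then show ?thesis using m by (subst (asm) mult_cancel_right) auto
  qed
  then have "int i - int j = z * int m"
    by (metis (mono_tags, lifting) of_int_diff of_int_eq_iff of_int_mult of_int_of_nat_eq)
  moreover have "\<bar>int i - int j\<bar> < int m" using ij by linarith
  ultimately have "\<bar>z\<bar> * int m < 1 * int m" by (simp add: abs_mult)
  then have "z = 0" by (simp only: mult_less_cancel_right) auto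
  then show ?thesis using \<open>int i - int j = z * int m\<close> by simp
qed

lemma refls_between_mirror:
  assumes "i < m" "j < m"
  shows "refls_between m i j = {t. t < m \<and> mirror m t j = i}"
  using line_inj[of "mirror m _ j" m i] assms mirror_less[of m]
  by (auto simp: refls_between_def reflection_line)

lemma line_act_reflection:
  assumes "j < m"
  shows "line_act m (reflection m t) j = mirror m t j"
  unfolding line_act_def reflection_line[OF assms]
  by (rule the_equality) (use assms line_inj mirror_less[of m t j] in auto)

lemma angle_mod:
  assumes "0 < m"
  shows "cos (2 * angle m (x mod m)) = cos (2 * angle m x)" "sin (2 * angle m (x mod m)) = sin (2 * angle m x)"
proof -
  have "x = m * (x div m) + x mod m" by simp
  then have "real x = real m * real (x div m) + real (x mod m)" by (metis of_nat_add of_nat_mult)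
  then have *: "2 * angle m x = 2 * angle m (x mod m) + 2 * of_nat (x div m) * pi"
    using assms by (simp add: angle_def field_simps)
  have "sin (2 * of_nat (x div m) * pi) = 0" "cos (2 * of_nat (x div m) * pi) = (1::real)"
    using sin_npi2[of "2 * (x div m)"] cos_npi[of "2 * (x div m)"] by (simp_all add: mult_ac)
  then show "cos (2 * angle m (x mod m)) = cos (2 * angle m x)" "sin (2 * angle m (x mod m)) = sin (2 * angle m x)"
    unfolding * by (simp_all add: cos_add sin_add)
qed

lemma reflection_reflection:
  assumes "0 < m" "u < m"
  shows "reflection m t \<circ> reflection m u = rotation m ((t + (m - u)) mod m)"
proof -
  have "real (t + (m - u)) = real t - real u + real m" using assms by (simp add: of_nat_diff)
  then have "2 * angle m (t + (m - u)) = 2 * angle m t - 2 * angle m u + 2 * pi"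
    using assms unfolding angle_def by (simp add: field_simps)
  then have *: "cos (2 * angle m (t + (m - u))) = cos (2 * angle m t - 2 * angle m u)"
    "sin (2 * angle m (t + (m - u))) = sin (2 * angle m t - 2 * angle m u)" by simp_all
  show ?thesis
    unfolding fun_eq_iff reflection_def rotation_def angle_mod[OF assms(1)] * cos_diff sin_diff
    by (auto simp: algebra_simps)
qed

lemma rotation_reflection:
  assumes "0 < m"
  shows "rotation m s \<circ> reflection m v = reflection m ((s + v) mod m)"
proof -
  have "2 * angle m (s + v) = 2 * angle m s + 2 * angle m v"
    by (simp add: angle_of_sum[OF assms])
  then show ?thesis
    by (auto simp: fun_eq_iff reflection_def rotation_def angle_mod[OF assms] cos_add sin_add algebra_simps)
qed

lemma rotation_0: "rotation m 0 = id"
  by (auto simp: rotation_def angle_def fun_eq_iff)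

lemma reflection_involution: "reflection m t \<circ> reflection m t = id"
proof -
  have "complex_of_real (cos x) * of_real (cos x) + of_real (sin x) * of_real (sin x) = 1" for x
    unfolding of_real_mult[symmetric] of_real_add[symmetric]
    using sin_cos_squared_add3[of x] by simp
  note * = this[of "2 * angle m t"]
  have "z = complex_of_real (cos (2 * angle m t)) * (of_real (cos (2 * angle m t)) * z) +
      of_real (sin (2 * angle m t)) * (of_real (sin (2 * angle m t)) * z)" for z
    using arg_cong[OF *, of "\<lambda>x. x * z"] by (simp add: algebra_simps)
  note ** = this[symmetric]
  show ?thesis
    using ** by (auto simp: fun_eq_iff reflection_def algebra_simps)
qed

lemma inv_reflection: "inv_into UNIV (reflection m t) = reflection m t"
  by (rule inv_unique_comp) (rule reflection_involution)+

section \<open>The Lawrence-Krammer representation\<close>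

lemma mirror_triple:
  assumes "0 < m" "t < m" "u < m" "v < m" "c < m"
  shows "mirror m ((t + (m - u) + v) mod m) c = mirror m t (mirror m u (mirror m v c))"
proof -
  have "line m (mirror m ((t + (m - u) + v) mod m) c) = reflection m ((t + (m - u) + v) mod m) ` line m c"
    using assms by (simp add: reflection_line)
  also have "reflection m ((t + (m - u) + v) mod m) = reflection m t \<circ> reflection m u \<circ> reflection m v"
    using assms by (simp add: reflection_reflection rotation_reflection mod_add_left_eq)
  also have "\<dots> ` line m c = line m (mirror m t (mirror m u (mirror m v c)))"
    using assms by (simp only: image_comp[symmetric] reflection_line mirror_less)
  finally show ?thesis using assms by (intro line_inj[of _ m]) (auto intro!: mirror_less)
qed

lemma LK_iota_entry:
  "r < m \<Longrightarrow> c < m \<Longrightarrow> LK_iota m (reflection m t) $$ (r, c) = (if r = mirror m t c then 1 else 0)"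
  by (simp add: LK_iota_def line_act_reflection)

lemma LK_dim [simp]:
  "dim_row (LK_iota m w) = m" "dim_col (LK_iota m w) = m"
  "dim_row (LK_p m k \<alpha> i) = m" "dim_col (LK_p m k \<alpha> i) = m"
  by (simp_all add: LK_iota_def LK_p_def)

lemma LK_carrier: "LK_iota m w \<in> carrier_mat m m" "LK_p m k \<alpha> i \<in> carrier_mat m m"
  by (auto intro!: carrier_matI)

lemma LK_iota_mult:
  assumes "M \<in> carrier_mat m l" "r < m" "c < l"
  shows "(LK_iota m (reflection m t) * M) $$ (r, c) = M $$ (mirror m t r, c)"
proof -
  have "(LK_iota m (reflection m t) * M) $$ (r, c) =
      (\<Sum>d<m. (if r = mirror m t d then 1 else 0) * M $$ (d, c))"
    using assms by (subst mult_entry[OF LK_carrier(1)]) (auto intro!: sum.cong simp: LK_iota_entry)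
  also have "\<dots> = (\<Sum>d<m. if d = mirror m t r then M $$ (d, c) else 0)"
    using assms(2) mirror_mirror[of _ m t] by (intro sum.cong) auto
  finally show ?thesis using assms(2) mirror_less[of m t r] by simp
qed

lemma mult_LK_iota:
  assumes "M \<in> carrier_mat l m" "r < l" "c < m"
  shows "(M * LK_iota m (reflection m t)) $$ (r, c) = M $$ (r, mirror m t c)"
proof -
  have "(M * LK_iota m (reflection m t)) $$ (r, c) =
      (\<Sum>d<m. M $$ (r, d) * (if d = mirror m t c then 1 else 0))"
    using assms by (subst mult_entry[OF assms(1) LK_carrier(1)]) (auto intro!: sum.cong simp: LK_iota_entry)
  also have "\<dots> = (\<Sum>d<m. if d = mirror m t c then M $$ (r, d) else 0)"
    by (intro sum.cong) auto
  finally show ?thesis using assms(3) mirror_less[of m t c] by simp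
qed

definition LK_coeff :: "nat \<Rightarrow> (nat \<Rightarrow> complex) \<Rightarrow> (nat \<Rightarrow> complex) \<Rightarrow> nat \<Rightarrow> nat \<Rightarrow> complex"
  where "LK_coeff m k \<alpha> i j = (if j = i then \<alpha> i else (\<Sum>t | t < m \<and> mirror m t j = i. k t))"

lemma LK_p_entry:
  "i < m \<Longrightarrow> r < m \<Longrightarrow> c < m \<Longrightarrow> LK_p m k \<alpha> i $$ (r, c) = (if r = i then LK_coeff m k \<alpha> i c else 0)"
  by (simp add: LK_p_def LK_coeff_def refls_between_mirror)

lemma LK_p_mult:
  assumes "M \<in> carrier_mat m l" "i < m" "r < m" "c < l"
  shows "(LK_p m k \<alpha> i * M) $$ (r, c) = (if r = i then \<Sum>d<m. LK_coeff m k \<alpha> i d * M $$ (d, c) else 0)"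
  using assms by (subst mult_entry[OF LK_carrier(2)]) (auto simp: LK_p_entry)

lemma mult_LK_p:
  assumes "M \<in> carrier_mat l m" "i < m" "r < l" "c < m"
  shows "(M * LK_p m k \<alpha> i) $$ (r, c) = M $$ (r, i) * LK_coeff m k \<alpha> i c"
proof -
  have "(M * LK_p m k \<alpha> i) $$ (r, c) = (\<Sum>d<m. if d = i then M $$ (r, d) * LK_coeff m k \<alpha> i c else 0)"
    unfolding mult_entry[OF assms(1) LK_carrier(2) assms(3,4)] using assms
    by (intro sum.cong) (auto simp: LK_p_entry)
  then show ?thesis using assms(2) by simp
qed

text \<open>The matrix \<open>p\<^sub>i\<close> has rank one.\<close>

lemma LK_p_sandwich:
  assumes "M \<in> carrier_mat m m" "i < m"
  shows "LK_p m k \<alpha> i * (M * LK_p m k \<alpha> i) = (\<Sum>d<m. LK_coeff m k \<alpha> i d * M $$ (d, i)) \<cdot>\<^sub>m LK_p m k \<alpha> i"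
proof (rule eq_matI)
  fix r c assume rc: "r < dim_row ((\<Sum>d<m. LK_coeff m k \<alpha> i d * M $$ (d, i)) \<cdot>\<^sub>m LK_p m k \<alpha> i)"
    "c < dim_col ((\<Sum>d<m. LK_coeff m k \<alpha> i d * M $$ (d, i)) \<cdot>\<^sub>m LK_p m k \<alpha> i)"
  then have rc: "r < m" "c < m" by simp_all
  have MP: "M * LK_p m k \<alpha> i \<in> carrier_mat m m" using assms(1) LK_carrier(2) by (rule mult_carrier_mat)
  show "(LK_p m k \<alpha> i * (M * LK_p m k \<alpha> i)) $$ (r, c) =
      ((\<Sum>d<m. LK_coeff m k \<alpha> i d * M $$ (d, i)) \<cdot>\<^sub>m LK_p m k \<alpha> i) $$ (r, c)"
    unfolding LK_p_mult[OF MP assms(2) rc] using rc assms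
    by (simp add: mult_LK_p[OF assms(1,2)] LK_p_entry sum_distrib_right sum_distrib_left mult_ac del: index_mult_mat(1))
qed auto

text \<open>The group permutes the basis vectors and \<open>p\<^sub>i\<close> maps to the line of \<open>v\<^sub>i\<close>, so that the relations
  come down to the invariance of the coefficients of the \<open>p\<^sub>i\<close> under the group.\<close>

lemma LK_brauer:
  assumes m: "3 \<le> m"
    and k: "\<And>t u. t < m \<Longrightarrow> u < m \<Longrightarrow> k (mirror m t u) = k u"
    and \<alpha>: "\<And>t u. t < m \<Longrightarrow> u < m \<Longrightarrow> \<alpha> (mirror m t u) = \<alpha> u"
  shows "brauer_matrices m m k \<alpha> (\<lambda>t. LK_iota m (reflection m t)) (LK_p m k \<alpha>)"
proof -
  have m0: "0 < m" using m by simp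
  let ?S = "\<lambda>t. LK_iota m (reflection m t)"
  let ?e = "LK_p m k \<alpha>"
  have mir [simp]: "mirror m t u < m" for t u using m0 by (rule mirror_less)
  have mir_eq: "mirror m t u = v \<longleftrightarrow> u = mirror m t v" if "u < m" "v < m" for t u v
    using that mirror_mirror[of _ m t] by auto
  have coeff: "LK_coeff m k \<alpha> (mirror m t u) (mirror m t c) = LK_coeff m k \<alpha> u c"
    if t: "t < m" and u: "u < m" and c: "c < m" for t u c
  proof -
    have *: "mirror m (mirror m t s) (mirror m t c) = mirror m t (mirror m s c)" if "s < m" for s
      using mirror_triple[OF m0 t that t, of "mirror m t c"] t c
      by (simp add: mirror_mirror) (simp add: mirror_def mult_2 add_ac)
    have "(\<Sum>s | s < m \<and> mirror m s c = u. k s) =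
        (\<Sum>s | s < m \<and> mirror m s (mirror m t c) = mirror m t u. k s)"
    proof (rule sum.reindex_bij_witness[of _ "mirror m t" "mirror m t"])
      fix s assume s: "s \<in> {s. s < m \<and> mirror m s (mirror m t c) = mirror m t u}"
      then have "mirror m (mirror m t (mirror m t s)) (mirror m t c) = mirror m t u"
        by (simp add: mirror_mirror)
      then have "mirror m t (mirror m (mirror m t s) c) = mirror m t u" by (subst (asm) *) simp_all
      then show "mirror m t s \<in> {s. s < m \<and> mirror m s c = u}" using u by (simp add: mir_eq mirror_mirror)
    qed (use u t * k in \<open>auto simp: mirror_mirror\<close>)
    then show ?thesis using u c \<alpha>[OF t u] by (auto simp: LK_coeff_def mir_eq mirror_mirror)
  qed
  have Smul: "(?S t * M) $$ (r, c) = M $$ (mirror m t r, c)" "(M * ?S t) $$ (r, c) = M $$ (r, mirror m t c)"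
    if "M \<in> carrier_mat m m" "r < m" "c < m" for M t r c
    using LK_iota_mult[OF that] mult_LK_iota[OF that] by auto
  note car = LK_carrier mult_carrier_mat[OF LK_carrier(1) LK_carrier(1)]
  show ?thesis
  proof (unfold_locales)
    show "3 \<le> m" by fact
    fix t u v
    show "?S t \<in> carrier_mat m m" "?e t \<in> carrier_mat m m" by (rule LK_carrier)+
    show "k (mirror m t u) = k u" "\<alpha> (mirror m t u) = \<alpha> u" if "t < m" "u < m" using that k \<alpha> by auto
    show "?S t * ?S t = 1\<^sub>m m" if t: "t < m"
    proof (rule eq_matI)
      fix r c assume "r < dim_row (1\<^sub>m m :: complex mat)" "c < dim_col (1\<^sub>m m :: complex mat)"
      then have rc: "r < m" "c < m" by auto
      show "(?S t * ?S t) $$ (r, c) = 1\<^sub>m m $$ (r, c)"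
        unfolding Smul(1)[OF LK_carrier(1) rc]
        using rc mir_eq[of r "mirror m t c" t] by (simp add: LK_iota_entry mirror_mirror)
    qed auto
    show "?S t * ?S u * ?S v = ?S ((t + (m - u) + v) mod m)" if tuv: "t < m" "u < m" "v < m"
    proof (rule eq_matI)
      fix r c assume "r < dim_row (?S ((t + (m - u) + v) mod m))" "c < dim_col (?S ((t + (m - u) + v) mod m))"
      then have rc: "r < m" "c < m" by auto
      show "(?S t * ?S u * ?S v) $$ (r, c) = ?S ((t + (m - u) + v) mod m) $$ (r, c)"
        unfolding Smul(2)[OF car(3) rc] Smul(2)[OF LK_carrier(1) rc(1) mir]
        using rc mirror_triple[OF m0 tuv rc(2)] by (simp add: LK_iota_entry)
    qed auto
    show "?S t * ?e u = ?e (mirror m t u) * ?S t" if tu: "t < m" "u < m"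
    proof (rule eq_matI)
      fix r c assume "r < dim_row (?e (mirror m t u) * ?S t)" "c < dim_col (?e (mirror m t u) * ?S t)"
      then have rc: "r < m" "c < m" by auto
      show "(?S t * ?e u) $$ (r, c) = (?e (mirror m t u) * ?S t) $$ (r, c)"
        unfolding Smul(1)[OF LK_carrier(2) rc] Smul(2)[OF LK_carrier(2) rc]
        using rc tu coeff[OF tu rc(2)] by (auto simp: LK_p_entry mir_eq mirror_mirror)
    qed auto
    show "?S t * ?e u = ?e u" if tu: "t < m" "u < m" "mirror m t u = u"
    proof (rule eq_matI)
      fix r c assume "r < dim_row (?e u)" "c < dim_col (?e u)"
      then have rc: "r < m" "c < m" by auto
      show "(?S t * ?e u) $$ (r, c) = ?e u $$ (r, c)"
        unfolding Smul(1)[OF LK_carrier(2) rc] using rc tu by (auto simp: LK_p_entry mir_eq)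
    qed auto
    have ee: "(?e t * ?e u) $$ (r, c) = (if r = t then LK_coeff m k \<alpha> t u * LK_coeff m k \<alpha> u c else 0)"
      if "t < m" "u < m" "r < m" "c < m" for r c
      using mult_LK_p[OF LK_carrier(2) that(2-4)] that by (simp add: LK_p_entry)
    show "?e t * ?e t = \<alpha> t \<cdot>\<^sub>m ?e t" if t: "t < m"
    proof (rule eq_matI)
      fix r c assume "r < dim_row (\<alpha> t \<cdot>\<^sub>m ?e t)" "c < dim_col (\<alpha> t \<cdot>\<^sub>m ?e t)"
      then have rc: "r < m" "c < m" by auto
      show "(?e t * ?e t) $$ (r, c) = (\<alpha> t \<cdot>\<^sub>m ?e t) $$ (r, c)"
        using rc t mult_LK_p[OF LK_carrier(2) t rc] by (simp add: LK_p_entry LK_coeff_def del: index_mult_mat(1))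
    qed auto
    show "?e t * ?e u = lin_comb m m {v. v < m \<and> mirror m v u = t} k ?S * ?e u"
      if tu: "t < m" "u < m" "t \<noteq> u"
    proof (rule eq_matI)
      have *: "lin_comb m m {v. v < m \<and> mirror m v u = t} k ?S * ?e u =
          lin_comb m m {v. v < m \<and> mirror m v u = t} k (\<lambda>v. ?S v * ?e u)"
        by (rule lin_comb_mult_right) (use LK_carrier in auto)
      fix r c assume "r < dim_row (lin_comb m m {v. v < m \<and> mirror m v u = t} k ?S * ?e u)"
        "c < dim_col (lin_comb m m {v. v < m \<and> mirror m v u = t} k ?S * ?e u)"
      then have rc: "r < m" "c < m" by (auto simp: lin_comb_def)
      have "(\<Sum>v | v < m \<and> mirror m v u = t. k v * (?S v * ?e u) $$ (r, c)) =
          (\<Sum>v | v < m \<and> mirror m v u = t. if r = t then k v * LK_coeff m k \<alpha> u c else 0)"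
        unfolding Smul(1)[OF LK_carrier(2) rc] using rc tu
        by (intro sum.cong refl) (auto simp: LK_p_entry mir_eq mirror_mirror)
      also have "\<dots> = (if r = t then LK_coeff m k \<alpha> t u * LK_coeff m k \<alpha> u c else 0)"
        using tu by (simp add: LK_coeff_def sum_distrib_right)
      finally show "(?e t * ?e u) $$ (r, c) =
          (lin_comb m m {v. v < m \<and> mirror m v u = t} k ?S * ?e u) $$ (r, c)"
        unfolding * using rc tu mult_LK_p[OF LK_carrier(2) tu(2) rc]
        by (simp add: lin_comb_def LK_p_entry del: index_mult_mat(1))
    qed (auto simp: lin_comb_def)
  qed
qed

section \<open>Matrix representations of presented algebras\<close>

lemma free_algebra_simps [simp]:
  "monoid.mult (free_algebra G) = (*)" "one (free_algebra G) = 1"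
  "zero (free_algebra G) = 0" "add (free_algebra G) = (+)"
  by (simp_all add: free_algebra_def)

lemma free_algebra_carrier:
  "x \<in> carrier (free_algebra G) \<longleftrightarrow> (\<forall>u \<in> Poly_Mapping.keys x. set (letters u) \<subseteq> G)"
  by (simp add: free_algebra_def)

lemma word_eq: "word [] = 1" "word (g # u) = gen g * word u" "const c * word u = Poly_Mapping.single (Word u) c"
  subgoal by (simp add: word_def zero_fmon_def[symmetric])
  by (simp_all add: word_def gen_def const_def mult_single plus_fmon_def)

lemma free_algebra_closed:
  "0 \<in> carrier (free_algebra G)"
  "1 \<in> carrier (free_algebra G)"
  "const c \<in> carrier (free_algebra G)"
  "set u \<subseteq> G \<Longrightarrow> word u \<in> carrier (free_algebra G)"
  "g \<in> G \<Longrightarrow> gen g \<in> carrier (free_algebra G)"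
  "x \<in> carrier (free_algebra G) \<Longrightarrow> y \<in> carrier (free_algebra G) \<Longrightarrow> x + y \<in> carrier (free_algebra G)"
  "x \<in> carrier (free_algebra G) \<Longrightarrow> - x \<in> carrier (free_algebra G)"
  "x \<in> carrier (free_algebra G) \<Longrightarrow> y \<in> carrier (free_algebra G) \<Longrightarrow> x - y \<in> carrier (free_algebra G)"
  "x \<in> carrier (free_algebra G) \<Longrightarrow> y \<in> carrier (free_algebra G) \<Longrightarrow> x * y \<in> carrier (free_algebra G)"
proof -
  show plus: "x + y \<in> carrier (free_algebra G)"
    if "x \<in> carrier (free_algebra G)" "y \<in> carrier (free_algebra G)" for x y
    using that keys_add[of x y] by (auto simp: free_algebra_carrier)
  show uminus: "- x \<in> carrier (free_algebra G)" if "x \<in> carrier (free_algebra G)" for x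
  proof -
    have "Poly_Mapping.keys (- x) = Poly_Mapping.keys x" by (auto simp: in_keys_iff)
    then show ?thesis using that by (simp add: free_algebra_carrier)
  qed
  show "x - y \<in> carrier (free_algebra G)"
    if "x \<in> carrier (free_algebra G)" "y \<in> carrier (free_algebra G)"
    using plus[OF that(1) uminus[OF that(2)]] by simp
  show "x * y \<in> carrier (free_algebra G)"
    if "x \<in> carrier (free_algebra G)" "y \<in> carrier (free_algebra G)"
    using that keys_mult[of x y] by (fastforce simp: free_algebra_carrier plus_fmon_def)
  show w: "word u \<in> carrier (free_algebra G)" if "set u \<subseteq> G" for u
    using that by (simp add: free_algebra_carrier word_def)
  show "gen g \<in> carrier (free_algebra G)" if "g \<in> G" unfolding gen_def using that by (intro w) auto
  show "1 \<in> carrier (free_algebra G)" using w[of "[]"] by (simp add: word_eq)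
qed (auto simp: free_algebra_carrier const_def)

lemma free_algebra_induct [consumes 1, case_names zero add]:
  assumes "x \<in> carrier (free_algebra G)"
    and "P 0"
    and step: "\<And>u c y. set u \<subseteq> G \<Longrightarrow> y \<in> carrier (free_algebra G) \<Longrightarrow> P y \<Longrightarrow> P (const c * word u + y)"
  shows "P x"
  using assms(1)
proof (induction "card (Poly_Mapping.keys x)" arbitrary: x)
  case 0
  then show ?case using assms(2) by simp
next
  case (Suc h)
  then have "Poly_Mapping.keys x \<noteq> {}" by (metis card.empty nat.distinct(1))
  then obtain w where w: "w \<in> Poly_Mapping.keys x" by blast
  define c where "c = Poly_Mapping.lookup x w"
  define y where "y = x - Poly_Mapping.single w c"
  have keys: "Poly_Mapping.keys y = Poly_Mapping.keys x - {w}"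
    by (auto simp: y_def c_def in_keys_iff lookup_minus lookup_single when_def split: if_splits)
  then have "h = card (Poly_Mapping.keys y)" using w Suc.hyps(2) by simp
  moreover have y: "y \<in> carrier (free_algebra G)" using Suc.prems keys by (auto simp: free_algebra_carrier)
  ultimately have "P y" by (rule Suc.hyps(1))
  moreover have "set (letters w) \<subseteq> G" using w Suc.prems by (auto simp: free_algebra_carrier)
  ultimately have "P (const c * word (letters w) + y)" using y by (intro step)
  moreover have "const c * word (letters w) + y = x" by (simp add: word_eq y_def)
  ultimately show ?case by simp
qed

lemma free_algebra_ring: "ring (free_algebra G)"
proof (rule ringI)
  show "abelian_group (free_algebra G)"
  proof (rule abelian_groupI)
    fix x assume "x \<in> carrier (free_algebra G)"
    then show "\<exists>y\<in>carrier (free_algebra G). y \<oplus>\<^bsub>free_algebra G\<^esub> x = \<zero>\<^bsub>free_algebra G\<^esub>"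
      using free_algebra_closed(7) by (intro bexI[of _ "- x"]) auto
  qed (auto simp: free_algebra_closed add_ac)
  show "Group.monoid (free_algebra G)"
    by (rule monoidI) (auto simp: free_algebra_closed mult.assoc)
qed (auto simp: distrib_left distrib_right)

locale presented_rep =
  fixes G :: "'g set" and S :: "'g ncpoly set" and n :: nat and \<rho> :: "'g ncpoly set \<Rightarrow> complex mat"
  assumes rep: "matrix_rep G S n \<rho>" and S: "S \<subseteq> carrier (free_algebra G)"
begin

definition R :: "'g ncpoly \<Rightarrow> complex mat" where "R x = \<rho> (cls G S x)"

lemma ideal: "ideal (genideal (free_algebra G) S) (free_algebra G)"
  using S by (rule ring.genideal_ideal[OF free_algebra_ring])

lemma cls_hom: "cls G S \<in> Ring.ring_hom (free_algebra G) (presented_algebra G S)"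
  using ideal.rcos_ring_hom[OF ideal] unfolding presented_algebra_def cls_def[abs_def] .

lemma ring: "ring (presented_algebra G S)"
  unfolding presented_algebra_def by (rule ideal.quotient_is_ring[OF ideal])

lemma carrier_cls: "carrier (presented_algebra G S) = cls G S ` carrier (free_algebra G)"
  by (auto simp: presented_algebra_def FactRing_def A_RCOSETS_def' cls_def)

lemma rho_hom: "\<rho> \<in> Ring.ring_hom (presented_algebra G S) (ring_mat TYPE(complex) n ())"
  using rep by (simp add: matrix_rep_def)

lemma cls_closed: "x \<in> carrier (free_algebra G) \<Longrightarrow> cls G S x \<in> carrier (presented_algebra G S)"
  using ring_hom_closed[OF cls_hom] by simp

lemma R_carrier: "x \<in> carrier (free_algebra G) \<Longrightarrow> R x \<in> carrier_mat n n"
  using ring_hom_closed[OF rho_hom] cls_closed by (simp add: R_def ring_mat_simps)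

lemma R_dim [simp]: "x \<in> carrier (free_algebra G) \<Longrightarrow> dim_row (R x) = n"
  "x \<in> carrier (free_algebra G) \<Longrightarrow> dim_col (R x) = n"
  using R_carrier by auto

lemma R_add: "x \<in> carrier (free_algebra G) \<Longrightarrow> y \<in> carrier (free_algebra G) \<Longrightarrow> R (x + y) = R x + R y"
  using ring_hom_add[OF cls_hom, of x y] ring_hom_add[OF rho_hom, of "cls G S x" "cls G S y"] cls_closed
  by (simp add: R_def ring_mat_simps)

lemma R_mult: "x \<in> carrier (free_algebra G) \<Longrightarrow> y \<in> carrier (free_algebra G) \<Longrightarrow> R (x * y) = R x * R y"
  using ring_hom_mult[OF cls_hom, of x y] ring_hom_mult[OF rho_hom, of "cls G S x" "cls G S y"] cls_closed
  by (simp add: R_def ring_mat_simps)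

lemma R_one: "R 1 = 1\<^sub>m n"
  using ring_hom_one[OF cls_hom] ring_hom_one[OF rho_hom] by (simp add: R_def ring_mat_simps)

lemma R_const: "R (const c) = c \<cdot>\<^sub>m 1\<^sub>m n"
  using rep by (simp add: matrix_rep_def R_def)

lemma R_const_mult: "x \<in> carrier (free_algebra G) \<Longrightarrow> R (const c * x) = c \<cdot>\<^sub>m R x"
  by (simp add: R_mult free_algebra_closed R_const mat_smult_mult mat_one_mult)

lemma cls_zero: "x \<in> S \<Longrightarrow> cls G S x = \<zero>\<^bsub>presented_algebra G S\<^esub>"
proof -
  assume "x \<in> S"
  then have "x \<in> genideal (free_algebra G) S"
    using ring.genideal_self[OF free_algebra_ring S] by blast
  moreover have "abelian_subgroup (genideal (free_algebra G) S) (free_algebra G)"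
    by (rule abelian_subgroupI3[OF ideal.axioms(1)[OF ideal] ring.is_abelian_group[OF free_algebra_ring]])
  ultimately show ?thesis
    by (simp add: cls_def presented_algebra_def FactRing_def abelian_subgroup.a_rcos_const)
qed

lemma rho_zero: "\<rho> \<zero>\<^bsub>presented_algebra G S\<^esub> = 0\<^sub>m n n"
  using ring_hom_zero[OF rho_hom ring ring_mat] by (simp add: ring_mat_simps)

lemma R_rel: "x \<in> S \<Longrightarrow> R x = 0\<^sub>m n n"
  by (simp add: R_def cls_zero rho_zero)

lemma R_zero: "R 0 = 0\<^sub>m n n"
  using ring_hom_zero[OF cls_hom free_algebra_ring ring] by (simp add: R_def rho_zero)

lemma R_rel_eq:
  assumes "x - y \<in> S" "x \<in> carrier (free_algebra G)" "y \<in> carrier (free_algebra G)"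
  shows "R x = R y"
proof -
  have "R x = R ((x - y) + y)" by simp
  also have "\<dots> = R (x - y) + R y" using assms S by (intro R_add) auto
  finally show ?thesis using R_carrier[OF assms(3)] by (simp add: R_rel[OF assms(1)])
qed

lemma R_sum:
  assumes "finite I" "\<And>i. i \<in> I \<Longrightarrow> x i \<in> carrier (free_algebra G)"
  shows "(\<Sum>i\<in>I. const (c i) * x i) \<in> carrier (free_algebra G)"
    "R (\<Sum>i\<in>I. const (c i) * x i) = lin_comb n n I c (\<lambda>i. R (x i))"
proof -
  have "(\<Sum>i\<in>I. const (c i) * x i) \<in> carrier (free_algebra G) \<and>
      R (\<Sum>i\<in>I. const (c i) * x i) = lin_comb n n I c (\<lambda>i. R (x i))"
    using assms
  proof (induction I rule: finite_induct)
    case empty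
    show ?case by (auto intro!: eq_matI simp: free_algebra_closed R_zero lin_comb_def)
  next
    case (insert i I)
    have x: "const (c i) * x i \<in> carrier (free_algebra G)" using insert by (intro free_algebra_closed) auto
    show ?case using insert x R_carrier[of "x i"]
      by (auto intro!: eq_matI simp: free_algebra_closed R_add R_const_mult lin_comb_def)
  qed
  then show "(\<Sum>i\<in>I. const (c i) * x i) \<in> carrier (free_algebra G)"
    "R (\<Sum>i\<in>I. const (c i) * x i) = lin_comb n n I c (\<lambda>i. R (x i))" by auto
qed

end

text \<open>Conversely, matrices that satisfy the relations define a representation.\<close>

definition eval_poly :: "nat \<Rightarrow> ('g \<Rightarrow> complex mat) \<Rightarrow> 'g ncpoly \<Rightarrow> complex mat"
  where "eval_poly n \<phi> x = mat n n (\<lambda>(r, s).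
    \<Sum>u\<in>Poly_Mapping.keys x. Poly_Mapping.lookup x u * foldr (\<lambda>g A. \<phi> g * A) (letters u) (1\<^sub>m n) $$ (r, s))"

context
  fixes G :: "'g set" and n :: nat and \<phi> :: "'g \<Rightarrow> complex mat"
  assumes \<phi>: "\<And>g. g \<in> G \<Longrightarrow> \<phi> g \<in> carrier_mat n n"
begin

lemma word_carrier: "set u \<subseteq> G \<Longrightarrow> foldr (\<lambda>g A. \<phi> g * A) u (1\<^sub>m n) \<in> carrier_mat n n"
  by (induction u) (auto intro!: mult_carrier_mat[of _ n n] \<phi>)

lemma word_append: "set u \<subseteq> G \<Longrightarrow> set v \<subseteq> G \<Longrightarrow> foldr (\<lambda>g A. \<phi> g * A) (u @ v) (1\<^sub>m n) =
    foldr (\<lambda>g A. \<phi> g * A) u (1\<^sub>m n) * foldr (\<lambda>g A. \<phi> g * A) v (1\<^sub>m n)"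
proof (induction u)
  case Nil
  then show ?case using word_carrier[of v] by simp
next
  case (Cons g u)
  then show ?case
    using assoc_mult_mat[OF \<phi>[of g] word_carrier[of u] word_carrier[of v]] by simp
qed

lemma eval_poly_carrier: "eval_poly n \<phi> x \<in> carrier_mat n n"
  by (simp add: eval_poly_def)

lemma eval_poly_dim [simp]: "dim_row (eval_poly n \<phi> x) = n" "dim_col (eval_poly n \<phi> x) = n"
  using eval_poly_carrier[of x] by auto

lemma eval_poly_superset:
  assumes "finite A" "Poly_Mapping.keys x \<subseteq> A"
  shows "eval_poly n \<phi> x = mat n n (\<lambda>(r, s).
    \<Sum>u\<in>A. Poly_Mapping.lookup x u * foldr (\<lambda>g A. \<phi> g * A) (letters u) (1\<^sub>m n) $$ (r, s))"
  unfolding eval_poly_def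
  by (intro eq_matI) (use assms in \<open>auto intro!: sum.mono_neutral_left simp: in_keys_iff\<close>)

lemma eval_poly_add: "eval_poly n \<phi> (x + y) = eval_poly n \<phi> x + eval_poly n \<phi> y"
proof -
  let ?A = "Poly_Mapping.keys x \<union> Poly_Mapping.keys y"
  have *: "eval_poly n \<phi> z = mat n n (\<lambda>(r, s).
    \<Sum>u\<in>?A. Poly_Mapping.lookup z u * foldr (\<lambda>g A. \<phi> g * A) (letters u) (1\<^sub>m n) $$ (r, s))" if "Poly_Mapping.keys z \<subseteq> ?A" for z
    using that by (intro eval_poly_superset) auto
  show ?thesis
    unfolding *[OF keys_add] *[OF Un_upper1] *[OF Un_upper2]
    by (intro eq_matI) (auto simp: lookup_add distrib_right sum.distrib)
qed

lemma eval_poly_const_word: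
  assumes "set u \<subseteq> G"
  shows "eval_poly n \<phi> (const c * word u) = c \<cdot>\<^sub>m foldr (\<lambda>g A. \<phi> g * A) u (1\<^sub>m n)"
proof -
  have *: "eval_poly n \<phi> (const c * word u) = mat n n (\<lambda>(r, s).
    \<Sum>v\<in>{Word u}. Poly_Mapping.lookup (const c * word u) v * foldr (\<lambda>g A. \<phi> g * A) (letters v) (1\<^sub>m n) $$ (r, s))"
    by (intro eval_poly_superset) (auto simp: word_eq)
  show ?thesis
    unfolding * using word_carrier[OF assms] by (intro eq_matI) (auto simp: word_eq)
qed

lemma eval_poly_word: "set u \<subseteq> G \<Longrightarrow> eval_poly n \<phi> (word u) = foldr (\<lambda>g A. \<phi> g * A) u (1\<^sub>m n)"
proof -
  assume u: "set u \<subseteq> G"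
  have "const 1 * word u = word u" unfolding word_eq(3) by (simp add: word_def)
  then show ?thesis using eval_poly_const_word[OF u, of 1] word_carrier[OF u] by (auto intro!: eq_matI)
qed

lemma eval_poly_const: "eval_poly n \<phi> (const c) = c \<cdot>\<^sub>m 1\<^sub>m n"
  using eval_poly_const_word[of "[]" c] by (simp add: word_eq)

lemma eval_poly_one: "eval_poly n \<phi> 1 = 1\<^sub>m n"
  using eval_poly_word[of "[]"] by (simp add: word_eq)

lemma eval_poly_gen: "g \<in> G \<Longrightarrow> eval_poly n \<phi> (gen g) = \<phi> g"
  using eval_poly_word[of "[g]"] \<phi>[of g] by (simp add: gen_def)

lemma eval_poly_zero: "eval_poly n \<phi> 0 = 0\<^sub>m n n"
  by (intro eq_matI) (auto simp: eval_poly_def)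

lemma eval_poly_mult:
  assumes "x \<in> carrier (free_algebra G)" "y \<in> carrier (free_algebra G)"
  shows "eval_poly n \<phi> (x * y) = eval_poly n \<phi> x * eval_poly n \<phi> y"
  using assms(1)
proof (induction x rule: free_algebra_induct)
  case zero
  show ?case by (simp add: eval_poly_zero mat_zero_mult)
next
  case (add u c x)
  have "eval_poly n \<phi> (const c * word u * y) = eval_poly n \<phi> (const c * word u) * eval_poly n \<phi> y"
    using assms(2)
  proof (induction y rule: free_algebra_induct)
    case zero
    show ?case by (simp add: eval_poly_zero mat_zero_mult)
  next
    case (add v d y)
    have "const c * word u * (const d * word v) = const (c * d) * word (u @ v)"
      by (simp add: word_eq mult_single plus_fmon_def)
    then have "eval_poly n \<phi> (const c * word u * (const d * word v)) =
        eval_poly n \<phi> (const c * word u) * eval_poly n \<phi> (const d * word v)"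
      using add.hyps(1) \<open>set u \<subseteq> G\<close> word_carrier[of u] word_carrier[of v]
      by (simp add: eval_poly_const_word word_append mat_smult_mult mat_smult_smult mult.commute del: foldr_append)
    then show ?case by (simp add: distrib_left eval_poly_add add.IH mat_add_distrib)
  qed
  then show ?case by (simp add: distrib_right eval_poly_add add.IH mat_add_distrib)
qed

lemma eval_poly_uminus: "eval_poly n \<phi> (- x) = - eval_poly n \<phi> x"
proof -
  have "eval_poly n \<phi> (- x) + eval_poly n \<phi> x = 0\<^sub>m n n"
    using eval_poly_add[of "- x" x] by (simp add: eval_poly_zero)
  then have "eval_poly n \<phi> (- x) $$ (r, c) + eval_poly n \<phi> x $$ (r, c) = 0" if "r < n" "c < n" for r c
    using that by (metis eval_poly_dim index_add_mat(1) index_zero_mat(1))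
  then show ?thesis by (intro eq_matI) (auto simp: eq_neg_iff_add_eq_0)
qed

lemma eval_poly_diff: "eval_poly n \<phi> (x - y) = eval_poly n \<phi> x - eval_poly n \<phi> y"
proof -
  have "eval_poly n \<phi> (x - y) = eval_poly n \<phi> x + - eval_poly n \<phi> y"
    using eval_poly_add[of x "- y"] by (simp add: eval_poly_uminus)
  then show ?thesis by (intro eq_matI) auto
qed

lemma matrix_rep_exists:
  assumes S: "S \<subseteq> carrier (free_algebra G)" and rel: "\<And>x. x \<in> S \<Longrightarrow> eval_poly n \<phi> x = 0\<^sub>m n n"
  obtains h where "matrix_rep G S n h" "\<And>g. g \<in> G \<Longrightarrow> h (cls G S (gen g)) = \<phi> g"
proof -
  let ?F = "free_algebra G" and ?I = "genideal (free_algebra G) S" and ?ev = "eval_poly n \<phi>"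
  interpret F: ring ?F by (rule free_algebra_ring)
  have ideal: "ideal ?I ?F" using S by (rule F.genideal_ideal)
  interpret I: ideal ?I ?F by (rule ideal)
  have hom: "?ev \<in> Ring.ring_hom ?F (ring_mat TYPE(complex) n ())"
    by (rule ring_hom_memI)
      (auto simp: ring_mat_simps eval_poly_carrier eval_poly_mult eval_poly_add eval_poly_one)
  have hr: "ring_hom_ring ?F (ring_mat TYPE(complex) n ()) ?ev"
    by (rule ring_hom_ringI2[OF free_algebra_ring ring_mat hom])
  have "ideal (a_kernel ?F (ring_mat TYPE(complex) n ()) ?ev) ?F"
    by (rule ring_hom_ring.kernel_is_ideal[OF hr])
  then have "?I \<subseteq> a_kernel ?F (ring_mat TYPE(complex) n ()) ?ev"
    by (rule F.genideal_minimal) (use S rel in \<open>auto simp: a_kernel_def' ring_mat_simps\<close>)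
  then have ev0: "?ev x = 0\<^sub>m n n" if "x \<in> ?I" for x
    using that by (auto simp: a_kernel_def' ring_mat_simps)
  define h where "h = (\<lambda>X. the_elem (?ev ` X))"
  have h: "h (cls G S x) = ?ev x" for x
  proof -
    have "?ev ` cls G S x = {?ev x}"
    proof -
      have "?ev y = ?ev x" if "y \<in> cls G S x" for y
        using that ev0 eval_poly_carrier[of x]
        by (auto simp: cls_def a_r_coset_def' eval_poly_add)
      moreover have "x \<in> cls G S x"
        using I.zero_closed by (auto simp: cls_def a_r_coset_def' intro!: bexI[of _ 0])
      ultimately show ?thesis by blast
    qed
    then show ?thesis by (simp add: h_def)
  qed
  have cls_hom: "cls G S \<in> Ring.ring_hom ?F (presented_algebra G S)"
    using I.rcos_ring_hom unfolding presented_algebra_def cls_def[abs_def] .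
  have carrier_cls: "carrier (presented_algebra G S) = cls G S ` carrier ?F"
    by (auto simp: presented_algebra_def FactRing_def A_RCOSETS_def' cls_def)
  have "h \<in> Ring.ring_hom (presented_algebra G S) (ring_mat TYPE(complex) n ())"
  proof (rule ring_hom_memI)
    fix X Y assume "X \<in> carrier (presented_algebra G S)" "Y \<in> carrier (presented_algebra G S)"
    then obtain x y where xy: "x \<in> carrier ?F" "y \<in> carrier ?F" "X = cls G S x" "Y = cls G S y"
      by (auto simp: carrier_cls)
    show "h (X \<otimes>\<^bsub>presented_algebra G S\<^esub> Y) = h X \<otimes>\<^bsub>ring_mat TYPE(complex) n ()\<^esub> h Y"
      unfolding xy(3,4) ring_hom_mult[OF cls_hom xy(1,2), symmetric] h
      using xy by (simp add: eval_poly_mult ring_mat_simps)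
    show "h (X \<oplus>\<^bsub>presented_algebra G S\<^esub> Y) = h X \<oplus>\<^bsub>ring_mat TYPE(complex) n ()\<^esub> h Y"
      unfolding xy(3,4) ring_hom_add[OF cls_hom xy(1,2), symmetric] h
      by (simp add: eval_poly_add ring_mat_simps)
  next
    fix X assume "X \<in> carrier (presented_algebra G S)"
    then show "h X \<in> carrier (ring_mat TYPE(complex) n ())"
      by (auto simp: carrier_cls h eval_poly_carrier ring_mat_simps)
  next
    show "h \<one>\<^bsub>presented_algebra G S\<^esub> = \<one>\<^bsub>ring_mat TYPE(complex) n ()\<^esub>"
      unfolding ring_hom_one[OF cls_hom, symmetric] h by (simp add: eval_poly_one ring_mat_simps)
  qed
  then have "matrix_rep G S n h" by (simp add: matrix_rep_def h eval_poly_const)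
  then show thesis by (rule that) (simp add: h eval_poly_gen)
qed

end

section \<open>Representations of the Brauer type algebra\<close>

lemma reflection_dihedral: "t < m \<Longrightarrow> reflection m t \<in> dihedral m"
  and rotation_dihedral: "t < m \<Longrightarrow> rotation m t \<in> dihedral m"
  by (auto simp: dihedral_def)

lemma dihedral_comp:
  assumes w: "w1 \<in> dihedral m" "w2 \<in> dihedral m" and m: "0 < m"
  shows "w1 \<circ> w2 \<in> dihedral m"
proof -
  have refl: "reflection m t \<circ> reflection m u \<in> dihedral m" if "u < m" for t u
    unfolding reflection_reflection[OF m that] using m by (auto simp: dihedral_def)
  have rot: "rotation m t \<circ> reflection m u \<in> dihedral m" for t u
    unfolding rotation_reflection[OF m] using m by (auto simp: dihedral_def)
  have refl_rot: "reflection m t \<circ> rotation m u \<in> dihedral m" if "u < m" for t u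
  proof -
    have "reflection m t \<circ> rotation m u = (reflection m t \<circ> reflection m u) \<circ> reflection m 0"
      using reflection_reflection[of m 0 u] m that by (simp add: comp_assoc)
    then show ?thesis unfolding reflection_reflection[OF m that] using rot by simp
  qed
  have rot_rot: "rotation m t \<circ> rotation m u \<in> dihedral m" if "u < m" for t u
  proof -
    have "rotation m t \<circ> rotation m u = (rotation m t \<circ> reflection m u) \<circ> reflection m 0"
      using reflection_reflection[of m 0 u] m that by (simp add: comp_assoc)
    then show ?thesis unfolding rotation_reflection[OF m] using refl m by simp
  qed
  have "w1 \<in> reflection m ` {..<m} \<union> rotation m ` {..<m}" "w2 \<in> reflection m ` {..<m} \<union> rotation m ` {..<m}"
    using w by (simp_all add: dihedral_def)
  then show ?thesis by (elim UnE imageE) (simp_all add: refl rot refl_rot rot_rot)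
qed

lemma dihedral_id: "0 < m \<Longrightarrow> id \<in> dihedral m"
  using rotation_dihedral[of 0 m] by (simp add: rotation_0)

lemma dihedral_line:
  assumes "w \<in> dihedral m" "j < m"
  obtains i where "i < m" "w ` line m j = line m i"
proof -
  have m: "0 < m" using assms by simp
  consider t where "w = reflection m t" | t where "w = rotation m t"
    using assms(1) by (auto simp: dihedral_def)
  then show thesis
  proof cases
    case 1
    show thesis by (rule that[OF mirror_less[OF m]]) (simp add: 1 reflection_line[OF assms(2)])
  next
    case 2
    show thesis by (rule that[OF mod_less_divisor[OF m]]) (simp add: 2 rotation_line[OF assms(2)])
  qed
qed

text \<open>A vector that the reflection fixes lies on the line \<open>t\<close>, since it is the mean of itself and its
  image.\<close>

lemma line_fixed:
  assumes tu: "t < m" "u < m" "t \<noteq> u"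
  shows "line m u \<inter> {v. reflection m t v = v} = {(0, 0)}"
proof -
  let ?c = "complex_of_real (cos (angle m t))" and ?s = "complex_of_real (sin (angle m t))"
  have "?c * ?c + ?s * ?s = 1"
    unfolding of_real_mult[symmetric] of_real_add[symmetric] sin_cos_squared_add3 by simp
  then have one: "2 * (?c * ?c) + 2 * (?s * ?s) = 2" by (simp flip: distrib_left)
  have double: "complex_of_real (cos (2 * angle m t)) = 2 * ?c * ?c - 1"
    "complex_of_real (cos (2 * angle m t)) = 1 - 2 * ?s * ?s"
    "complex_of_real (sin (2 * angle m t)) = 2 * ?s * ?c"
    unfolding cos_double_cos[of "angle m t"] sin_double[of "angle m t"]
    using one by (simp_all add: power2_eq_square algebra_simps)
  have "v = (0, 0)" if v: "v \<in> line m u" "reflection m t v = v" for v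
  proof -
    obtain c where c: "v = (c * of_real (cos (angle m u)), c * of_real (sin (angle m u)))"
      using v(1) by (auto simp: line_def)
    obtain x y where xy: "v = (x, y)" by (cases v)
    define d where "d = ?c * x + ?s * y"
    have "(2 * ?c * ?c - 1) * x + 2 * ?s * ?c * y = x" "2 * ?s * ?c * x - (1 - 2 * ?s * ?s) * y = y"
      using v(2) unfolding xy reflection_def double(3)
      by (auto simp: double(1)[symmetric] double(2)[symmetric])
    then have "2 * x = 2 * (d * ?c)" "2 * y = 2 * (d * ?s)" by (simp_all add: d_def algebra_simps)
    then have "x = d * ?c" "y = d * ?s" by (simp_all only: mult_cancel_left) simp_all
    then have "x * ?s = y * ?c" by simp
    then have "c * of_real (sin (angle m t - angle m u)) = 0"
      using c xy by (simp add: sin_diff algebra_simps)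
    moreover have "sin (angle m t - angle m u) \<noteq> 0"
    proof
      assume "sin (angle m t - angle m u) = 0"
      then obtain z :: int where "angle m t - angle m u = of_int z * pi" by (auto simp: sin_zero_iff_int2)
      then have "angle m t = angle m u + of_int z * pi" by simp
      then have "line m u = line m t" unfolding line_def[of m t] by (rule line_shift)
      then show False using line_inj tu by metis
    qed
    ultimately have "c = 0" by simp
    then show ?thesis by (simp add: c)
  qed
  moreover have "(0, 0) \<in> line m u" by (auto simp: line_def intro!: exI[of _ 0])
  moreover have "reflection m t (0, 0) = (0, 0)" by (simp add: reflection_def)
  ultimately show ?thesis by blast
qed

lemma free_algebra_sum:
  "(\<And>i. i \<in> I \<Longrightarrow> x i \<in> carrier (free_algebra G)) \<Longrightarrow> sum x I \<in> carrier (free_algebra G)"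
  by (induction I rule: infinite_finite_induct) (auto simp: free_algebra_closed)

lemma br_rels_carrier:
  assumes "0 < m"
  shows "br_rels m k \<alpha> \<subseteq> carrier (free_algebra (br_gens m))"
proof -
  have T: "gen_T w \<in> carrier (free_algebra (br_gens m))" if "w \<in> dihedral m" for w
    using that by (intro free_algebra_closed) (auto simp: br_gens_def)
  have e: "gen_e i \<in> carrier (free_algebra (br_gens m))" if "i < m" for i
    using that by (intro free_algebra_closed) (auto simp: br_gens_def)
  have s: "(\<Sum>t\<in>refls_between m i j. const (k t) * gen_T (reflection m t)) \<in> carrier (free_algebra (br_gens m))" for i j
    by (intro free_algebra_sum free_algebra_closed T reflection_dihedral) (auto simp: refls_between_def)
  show ?thesis unfolding br_rels_def
    by (auto intro!: free_algebra_closed(1-3,6-9) T e s dihedral_comp dihedral_id reflection_dihedral assms)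
qed

lemma br_relsI:
  "w1 \<in> dihedral m \<Longrightarrow> w2 \<in> dihedral m \<Longrightarrow> gen_T w1 * gen_T w2 - gen_T (w1 \<circ> w2) \<in> br_rels m k \<alpha>"
  "gen_T id - 1 \<in> br_rels m k \<alpha>"
  "i < m \<Longrightarrow> gen_T (reflection m i) * gen_e i - gen_e i \<in> br_rels m k \<alpha>"
  "w \<in> dihedral m \<Longrightarrow> i < m \<Longrightarrow> w ` line m i = line m i \<Longrightarrow> line m i \<inter> {v. w v = v} = {(0, 0)} \<Longrightarrow>
    gen_T w * gen_e i - gen_e i \<in> br_rels m k \<alpha>"
  "i < m \<Longrightarrow> gen_e i * gen_e i - const (\<alpha> i) * gen_e i \<in> br_rels m k \<alpha>"
  "w \<in> dihedral m \<Longrightarrow> i < m \<Longrightarrow> j < m \<Longrightarrow> w ` line m j = line m i \<Longrightarrow>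
    gen_T w * gen_e j - gen_e i * gen_T w \<in> br_rels m k \<alpha>"
  "i < m \<Longrightarrow> j < m \<Longrightarrow> i \<noteq> j \<Longrightarrow> refls_between m i j \<noteq> {} \<Longrightarrow>
    gen_e i * gen_e j - (\<Sum>t\<in>refls_between m i j. const (k t) * gen_T (reflection m t)) * gen_e j
      \<in> br_rels m k \<alpha>"
  "i < m \<Longrightarrow> j < m \<Longrightarrow> i \<noteq> j \<Longrightarrow> refls_between m i j = {} \<Longrightarrow> gen_e i * gen_e j \<in> br_rels m k \<alpha>"
  unfolding br_rels_def
  subgoal by (rule UnI1, rule UnI1, rule UnI1, rule UnI1, rule UnI1, rule UnI1, rule UnI1, rule UnI1, rule UnI1, rule UnI1, rule CollectI, (rule exI)+, rule conjI, rule refl, (intro conjI)?, assumption+)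
  subgoal by (rule UnI1, rule UnI1, rule UnI1, rule UnI1, rule UnI1, rule UnI1, rule UnI1, rule UnI1, rule UnI1, rule UnI2, rule singletonI)
  subgoal by (rule UnI1, rule UnI1, rule UnI1, rule UnI1, rule UnI1, rule UnI1, rule UnI1, rule UnI1, rule UnI2, rule CollectI, (rule exI)+, rule conjI, rule refl, (intro conjI)?, assumption+)
  subgoal by (rule UnI1, rule UnI1, rule UnI1, rule UnI1, rule UnI1, rule UnI1, rule UnI2, rule CollectI, (rule exI)+, rule conjI, rule refl, (intro conjI)?, assumption+)
  subgoal by (rule UnI1, rule UnI1, rule UnI1, rule UnI1, rule UnI2, rule CollectI, (rule exI)+, rule conjI, rule refl, (intro conjI)?, assumption+)
  subgoal by (rule UnI1, rule UnI1, rule UnI1, rule UnI2, rule CollectI, (rule exI)+, rule conjI, rule refl, (intro conjI)?, assumption+)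
  subgoal by (rule UnI1, rule UnI1, rule UnI2, rule CollectI, (rule exI)+, rule conjI, rule refl, (intro conjI)?, assumption+)
  subgoal by (rule UnI2, rule CollectI, (rule exI)+, rule conjI, rule refl, (intro conjI)?, assumption+)
  done

locale brauer_rep =
  fixes m :: nat and k \<alpha> :: "nat \<Rightarrow> complex" and n :: nat and \<rho> :: "br_gen ncpoly set \<Rightarrow> complex mat"
  assumes m: "3 \<le> m" and Br_rep: "Br_rep m k \<alpha> n \<rho>"
    and k_mirror: "\<And>t u. t < m \<Longrightarrow> u < m \<Longrightarrow> k (mirror m t u) = k u"
    and \<alpha>_mirror: "\<And>t u. t < m \<Longrightarrow> u < m \<Longrightarrow> \<alpha> (mirror m t u) = \<alpha> u"
begin

lemma m_pos: "0 < m" using m by simp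

sublocale presented_rep "br_gens m" "br_rels m k \<alpha>" n \<rho>
  using Br_rep br_rels_carrier[OF m_pos] by unfold_locales (simp_all add: Br_rep_def)

abbreviation T where "T \<equiv> rep_T m k \<alpha> \<rho>"
abbreviation e where "e \<equiv> rep_e m k \<alpha> \<rho>"

lemma T_R: "T w = R (gen_T w)" and e_R: "e i = R (gen_e i)"
  by (simp_all add: rep_T_def rep_e_def R_def)

lemma gen_closed:
  "w \<in> dihedral m \<Longrightarrow> gen_T w \<in> carrier (free_algebra (br_gens m))"
  "i < m \<Longrightarrow> gen_e i \<in> carrier (free_algebra (br_gens m))"
  by (auto intro!: free_algebra_closed simp: br_gens_def)

lemma T_carrier: "w \<in> dihedral m \<Longrightarrow> T w \<in> carrier_mat n n"
  and e_carrier: "i < m \<Longrightarrow> e i \<in> carrier_mat n n"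
  by (simp_all add: T_R e_R R_carrier gen_closed)

lemma T_mult:
  assumes "w1 \<in> dihedral m" "w2 \<in> dihedral m"
  shows "T w1 * T w2 = T (w1 \<circ> w2)"
proof -
  have "gen_T w1 * gen_T w2 - gen_T (w1 \<circ> w2) \<in> br_rels m k \<alpha>"
    using assms by (rule br_relsI)
  then have "R (gen_T w1 * gen_T w2) = R (gen_T (w1 \<circ> w2))"
    by (rule R_rel_eq) (use assms in \<open>auto intro!: free_algebra_closed(9) gen_closed dihedral_comp m_pos\<close>)
  then show ?thesis using assms by (simp add: T_R R_mult gen_closed)
qed

lemma T_id: "T id = 1\<^sub>m n"
proof -
  have "gen_T id - 1 \<in> br_rels m k \<alpha>" by (rule br_relsI)
  then have "R (gen_T id) = R 1"
    by (rule R_rel_eq) (auto intro!: free_algebra_closed(2) gen_closed dihedral_id m_pos)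
  then show ?thesis by (simp add: T_R R_one)
qed

lemma T_e:
  assumes "w \<in> dihedral m" "i < m" "j < m" "w ` line m j = line m i"
  shows "T w * e j = e i * T w"
proof -
  have "gen_T w * gen_e j - gen_e i * gen_T w \<in> br_rels m k \<alpha>"
 using assms by (rule br_relsI)
  then have "R (gen_T w * gen_e j) = R (gen_e i * gen_T w)"
    by (rule R_rel_eq) (use assms in \<open>auto intro!: free_algebra_closed(9) gen_closed\<close>)
  then show ?thesis using assms by (simp add: T_R e_R R_mult gen_closed)
qed

lemma T_fix:
  assumes t: "t < m" and u: "u < m" and fixed: "mirror m t u = u"
  shows "T (reflection m t) * e u = e u"
proof -
  have "gen_T (reflection m t) * gen_e u - gen_e u \<in> br_rels m k \<alpha>"
  proof (cases "t = u")
    case True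
    then show ?thesis using br_relsI(3)[OF u] by simp
  next
    case False
    have "reflection m t \<in> dihedral m" "reflection m t ` line m u = line m u"
      "line m u \<inter> {v. reflection m t v = v} = {(0, 0)}"
      using reflection_dihedral[OF t] reflection_line[OF u, of t] line_fixed[OF t u False] fixed by auto
    then show ?thesis using u by (intro br_relsI(4))
  qed
  then have "R (gen_T (reflection m t) * gen_e u) = R (gen_e u)"
    by (rule R_rel_eq) (use t u in \<open>auto intro!: free_algebra_closed(9) gen_closed reflection_dihedral\<close>)
  then show ?thesis using t u by (simp add: T_R e_R R_mult gen_closed reflection_dihedral)
qed

lemma e_square:
  assumes i: "i < m"
  shows "e i * e i = \<alpha> i \<cdot>\<^sub>m e i"
proof -
  have "gen_e i * gen_e i - const (\<alpha> i) * gen_e i \<in> br_rels m k \<alpha>"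
    using i by (rule br_relsI)
  then have "R (gen_e i * gen_e i) = R (const (\<alpha> i) * gen_e i)"
    by (rule R_rel_eq) (use i in \<open>auto intro!: free_algebra_closed(3,9) gen_closed\<close>)
  then show ?thesis using i by (simp add: e_R R_mult R_const_mult gen_closed)
qed

lemma e_mult:
  assumes ij: "i < m" "j < m" "i \<noteq> j"
  shows "e i * e j = lin_comb n n {t. t < m \<and> mirror m t j = i} k (\<lambda>t. T (reflection m t)) * e j"
proof (cases "refls_between m i j = {}")
  case True
  then have "gen_e i * gen_e j \<in> br_rels m k \<alpha>" using ij by (intro br_relsI(8)) auto
  then have "R (gen_e i * gen_e j) = 0\<^sub>m n n" by (rule R_rel)
  then have *: "e i * e j = 0\<^sub>m n n" using ij by (simp add: e_R R_mult gen_closed)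
  have "lin_comb n n {} k (\<lambda>t. T (reflection m t)) = 0\<^sub>m n n" by (intro eq_matI) auto
  moreover have "{t. t < m \<and> mirror m t j = i} = {}"
    using True unfolding refls_between_mirror[OF ij(1,2)] .
  ultimately show ?thesis
    using * left_mult_zero_mat[OF e_carrier[OF ij(2)], of n] by (simp only:)
next
  case False
  define s where "s = (\<Sum>t\<in>refls_between m i j. const (k t) * gen_T (reflection m t))"
  have fin: "finite (refls_between m i j)" unfolding refls_between_mirror[OF ij(1,2)] by simp
  have s: "s \<in> carrier (free_algebra (br_gens m))"
    "R s = lin_comb n n (refls_between m i j) k (\<lambda>t. R (gen_T (reflection m t)))"
    unfolding s_def
    by (rule R_sum[OF fin]; auto intro!: gen_closed reflection_dihedral simp: refls_between_def)+
  have "gen_e i * gen_e j - s * gen_e j \<in> br_rels m k \<alpha>"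
    unfolding s_def using ij False by (rule br_relsI)
  then have "R (gen_e i * gen_e j) = R (s * gen_e j)"
    by (rule R_rel_eq) (use ij s in \<open>auto intro!: free_algebra_closed(9) gen_closed\<close>)
  then have "e i * e j = lin_comb n n (refls_between m i j) k (\<lambda>t. R (gen_T (reflection m t))) * e j"
    using ij s by (simp add: e_R R_mult gen_closed)
  then show ?thesis unfolding refls_between_mirror[OF ij(1,2)] T_R .
qed

lemma brauer_matrices: "brauer_matrices m n k \<alpha> (\<lambda>t. T (reflection m t)) e"
proof unfold_locales
  fix t u v
  show "T (reflection m t) * T (reflection m t) = 1\<^sub>m n" if "t < m"
    using that by (simp add: T_mult reflection_dihedral reflection_involution T_id)
  show "T (reflection m t) * T (reflection m u) * T (reflection m v) =
      T (reflection m ((t + (m - u) + v) mod m))" if "t < m" "u < m" "v < m"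
    using that m_pos
    by (simp add: T_mult reflection_dihedral dihedral_comp)
      (simp add: reflection_reflection rotation_reflection mod_add_left_eq)
  show "T (reflection m t) * e u = e (mirror m t u) * T (reflection m t)" if "t < m" "u < m"
    using that m_pos by (intro T_e) (auto simp: reflection_dihedral mirror_less reflection_line)
qed (use m T_carrier reflection_dihedral e_carrier T_fix e_square e_mult k_mirror \<alpha>_mirror in auto)

text \<open>The matrices that are killed by everything that kills all \<open>e\<^sub>a\<close> form a left ideal, since
  multiplication by a generator on the right preserves the condition \<open>D e\<^sub>a = 0\<close>: the group
  permutes the \<open>e\<^sub>a\<close>.\<close>

lemma kills_right_mult:
  assumes D: "D \<in> carrier_mat n n" "\<And>a. a < m \<Longrightarrow> D * e a = 0\<^sub>m n n"
    and y: "y \<in> carrier (free_algebra (br_gens m))" and a: "a < m"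
  shows "D * R y * e a = 0\<^sub>m n n"
proof -
  define good where "good = {D \<in> carrier_mat n n. \<forall>a<m. D * e a = 0\<^sub>m n n}"
  have gen: "D * R (gen g) \<in> good" if D: "D \<in> good" and g: "g \<in> br_gens m" for D g
  proof -
    have Dc: "D \<in> carrier_mat n n" using D by (simp add: good_def)
    have gc: "R (gen g) \<in> carrier_mat n n" using g by (intro R_carrier free_algebra_closed)
    have "D * R (gen g) * e a = 0\<^sub>m n n" if a: "a < m" for a
    proof (cases g)
      case (GenT w)
      then have w: "w \<in> dihedral m" using g by (auto simp: br_gens_def)
      obtain b where b: "b < m" "w ` line m a = line m b" using dihedral_line[OF w a] .
      have "D * R (gen g) * e a = D * (T w * e a)"
        using GenT Dc gc e_carrier[OF a] by (simp add: T_R)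
      also have "\<dots> = (D * e b) * T w"
        unfolding T_e[OF w b(1) a b(2)] using Dc e_carrier[OF b(1)] T_carrier[OF w] by simp
      finally show ?thesis using D b T_carrier[OF w] by (simp add: good_def)
    next
      case (Gene i)
      then have i: "i < m" using g by (auto simp: br_gens_def)
      then show ?thesis using D e_carrier[OF a] Gene by (simp add: good_def e_R)
    qed
    then show ?thesis using Dc gc by (simp add: good_def)
  qed
  have word: "D * R (word u) \<in> good" if "D \<in> good" "set u \<subseteq> br_gens m" for D u
    using that
  proof (induction u arbitrary: D)
    case Nil
    then show ?case by (auto simp: word_eq R_one good_def)
  next
    case (Cons g u)
    have g: "R (gen g) \<in> carrier_mat n n" "R (word u) \<in> carrier_mat n n" "D \<in> carrier_mat n n"
      using Cons.prems by (auto intro!: R_carrier free_algebra_closed simp: good_def)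
    have "D * R (word (g # u)) = (D * R (gen g)) * R (word u)"
      using g Cons.prems by (simp add: word_eq(2) R_mult free_algebra_closed)
    then show ?case using Cons gen by auto
  qed
  have "D \<in> good" using D by (simp add: good_def)
  have "D * R y \<in> good"
    using y
  proof (induction y rule: free_algebra_induct)
    case zero
    show ?case using D e_carrier by (auto simp: R_zero good_def intro!: left_mult_zero_mat)
  next
    case (add u c y)
    note u = free_algebra_closed(4)[OF add.hyps(1)]
    have c: "R (word u) \<in> carrier_mat n n" "R y \<in> carrier_mat n n" using add.hyps u by (auto intro: R_carrier)
    have "R (const c * word u + y) = c \<cdot>\<^sub>m R (word u) + R y"
      using u add.hyps by (simp add: R_add R_const_mult free_algebra_closed)
    then have *: "D * R (const c * word u + y) = c \<cdot>\<^sub>m (D * R (word u)) + D * R y"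
      using c D by (simp add: mat_add_distrib mat_smult_mult)
    have "D * R (const c * word u + y) * e a = 0\<^sub>m n n" if a: "a < m" for a
    proof -
      have "D * R (const c * word u + y) * e a = c \<cdot>\<^sub>m (D * R (word u) * e a) + D * R y * e a"
        unfolding * using c D e_carrier[OF a]
          mat_add_distrib(2)[of "c \<cdot>\<^sub>m (D * R (word u))" "e a" "D * R y"] mat_smult_mult(1)[of "D * R (word u)" "e a" c]
        by simp
      moreover have "D * R (word u) * e a = 0\<^sub>m n n" "D * R y * e a = 0\<^sub>m n n"
        using word[OF \<open>D \<in> good\<close> add.hyps(1)] add.IH a by (auto simp: good_def)
      ultimately show ?thesis by simp
    qed
    then show ?case using c D * by (auto simp: good_def)
  qed
  then show ?thesis using a by (simp add: good_def)
qed

text \<open>The elements \<open>X\<close> with this property for all such \<open>D\<close> form a two-sided ideal.\<close>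

lemma kills_ideal:
  assumes D: "D \<in> carrier_mat n n" "\<And>a. a < m \<Longrightarrow> D * e a = 0\<^sub>m n n"
    and X: "X \<in> genideal (Br m k \<alpha>) ((\<lambda>a. cls (br_gens m) (br_rels m k \<alpha>) (gen_e a)) ` {..<m})"
  shows "D * \<rho> X = 0\<^sub>m n n"
proof -
  let ?A = "presented_algebra (br_gens m) (br_rels m k \<alpha>)"
  interpret A: ring ?A by (rule ring)
  define good where "good = {D \<in> carrier_mat n n. \<forall>a<m. D * e a = 0\<^sub>m n n}"
  define K where "K = {X \<in> carrier ?A. \<forall>D\<in>good. D * \<rho> X = 0\<^sub>m n n}"
  have car: "\<rho> X \<in> carrier_mat n n" if "X \<in> carrier ?A" for X
    using ring_hom_closed[OF rho_hom that] by (simp add: ring_mat_simps)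
  have add: "\<rho> (X \<oplus>\<^bsub>?A\<^esub> Y) = \<rho> X + \<rho> Y" and mult: "\<rho> (X \<otimes>\<^bsub>?A\<^esub> Y) = \<rho> X * \<rho> Y"
    if "X \<in> carrier ?A" "Y \<in> carrier ?A" for X Y
    using ring_hom_add[OF rho_hom that] ring_hom_mult[OF rho_hom that] by (simp_all add: ring_mat_simps)
  have "ideal K ?A"
  proof (rule idealI)
    show "ring ?A" by (rule ring)
    show "subgroup K (add_monoid ?A)"
    proof
      show "K \<subseteq> carrier (add_monoid ?A)" by (auto simp: K_def)
      show "\<one>\<^bsub>add_monoid ?A\<^esub> \<in> K" by (auto simp: K_def rho_zero good_def)
      fix X assume X: "X \<in> K"
      show "X \<otimes>\<^bsub>add_monoid ?A\<^esub> Y \<in> K" if "Y \<in> K" for Y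
      proof -
        have "D * (\<rho> X + \<rho> Y) = 0\<^sub>m n n" if "D \<in> good" for D
          using mult_add_distrib_mat[of D n n "\<rho> X" n "\<rho> Y"] that X \<open>Y \<in> K\<close> car[of X] car[of Y]
          by (simp add: K_def good_def)
        then show ?thesis using X that by (simp add: K_def add)
      qed
      have X': "X \<in> carrier ?A" using X by (simp add: K_def)
      have "D * \<rho> (\<ominus>\<^bsub>?A\<^esub> X) = 0\<^sub>m n n" if D: "D \<in> good" for D
      proof -
        have Dc: "D \<in> carrier_mat n n" using D by (simp add: good_def)
        have c: "\<rho> (\<ominus>\<^bsub>?A\<^esub> X) \<in> carrier_mat n n" using X' by (simp add: car)
        have "\<rho> (\<ominus>\<^bsub>?A\<^esub> X) + \<rho> X = 0\<^sub>m n n"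
          unfolding add[OF A.a_inv_closed[OF X'] X', symmetric] A.l_neg[OF X'] by (rule rho_zero)
        then have "D * (\<rho> (\<ominus>\<^bsub>?A\<^esub> X) + \<rho> X) = 0\<^sub>m n n" using Dc by simp
        then have "D * \<rho> (\<ominus>\<^bsub>?A\<^esub> X) + D * \<rho> X = 0\<^sub>m n n"
          using mult_add_distrib_mat[OF Dc c car[OF X']] by simp
        then show ?thesis using D X Dc c by (simp add: K_def)
      qed
      then show "inv\<^bsub>add_monoid ?A\<^esub> X \<in> K"
        unfolding a_inv_def[symmetric] using X' by (simp add: K_def)
    qed
    fix X Y assume X: "X \<in> K" and Y: "Y \<in> carrier ?A"
    have X': "X \<in> carrier ?A" using X by (simp add: K_def)
    obtain y where y: "y \<in> carrier (free_algebra (br_gens m))" "\<rho> Y = R y"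
      using Y unfolding carrier_cls by (auto simp: R_def)
    have "D * (\<rho> Y * \<rho> X) = 0\<^sub>m n n" if D: "D \<in> good" for D
    proof -
      have Dc: "D \<in> carrier_mat n n" using D by (simp add: good_def)
      have "D * R y \<in> good" using D Dc R_carrier[OF y(1)] kills_right_mult[of D y] y by (auto simp: good_def)
      then show ?thesis using X Dc R_carrier[OF y(1)] car[OF X'] by (simp add: K_def y(2) flip: assoc_mult_mat)
    qed
    then show "Y \<otimes>\<^bsub>?A\<^esub> X \<in> K" using X' Y by (simp add: K_def mult)
    have "D * (\<rho> X * \<rho> Y) = 0\<^sub>m n n" if D: "D \<in> good" for D
    proof -
      have "D * (\<rho> X * \<rho> Y) = (D * \<rho> X) * \<rho> Y"
        using D assoc_mult_mat[OF _ car[OF X'] car[OF Y], of D n] by (simp add: good_def)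
      then show ?thesis using D X car[OF Y] by (simp add: K_def)
    qed
    then show "X \<otimes>\<^bsub>?A\<^esub> Y \<in> K" using X' Y by (simp add: K_def mult)
  qed
  then have "genideal ?A ((\<lambda>a. cls (br_gens m) (br_rels m k \<alpha>) (gen_e a)) ` {..<m}) \<subseteq> K"
    by (rule A.genideal_minimal)
      (auto simp: K_def good_def cls_closed gen_closed rep_e_def[symmetric])
  then show ?thesis using X D unfolding Br_def by (auto simp: K_def good_def)
qed

end

section \<open>Transfer from the Lawrence-Krammer representation\<close>

context brauer_matrices
begin

text \<open>For fixed \<open>a\<close> these matrices behave under the \<open>S\<^sub>l\<close> and \<open>e\<^sub>l\<close> like the basis vectors \<open>v\<^sub>j\<close> of the
  Lawrence-Krammer representation.\<close>

definition orbit_sum :: "nat \<Rightarrow> nat \<Rightarrow> complex mat"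
  where "orbit_sum a j = lin_comb n n {t. t < m \<and> mirror m t a = j} (\<lambda>_. 1) (\<lambda>t. S t * e a)"

lemma orbit_sum_dim [simp]: "dim_row (orbit_sum a j) = n" "dim_col (orbit_sum a j) = n"
  by (simp_all add: orbit_sum_def)

lemma orbit_sum_carrier: "orbit_sum a j \<in> carrier_mat n n"
  by (simp add: orbit_sum_def)

text \<open>Since \<open>S\<^sub>a e\<^sub>a = e\<^sub>a\<close>, the product \<open>S\<^sub>u S\<^sub>t e\<^sub>a\<close> equals \<open>S\<^sub>u S\<^sub>t S\<^sub>a e\<^sub>a\<close>, and \<open>S\<^sub>u S\<^sub>t S\<^sub>a\<close> belongs to a
  reflection.\<close>

lemma S_orbit_sum:
  assumes u: "u < m" and a: "a < m" and j: "j < m"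
  shows "S u * orbit_sum a j = orbit_sum a (mirror m u j)"
proof -
  define \<pi> where "\<pi> t = (u + (m - t) + a) mod m" for t
  have \<pi>_less: "\<pi> t < m" for t by (simp add: \<pi>_def)
  have \<pi>_inv: "\<pi> (\<pi> t) = t" if "t < m" for t
  proof -
    have *: "int (\<pi> t) = (int u + int m - int t + int a) mod int m" if "t < m" for t
      using that by (simp add: \<pi>_def zmod_int of_nat_diff algebra_simps)
    have "int (\<pi> (\<pi> t)) = (int u + int m - (int u + int m - int t + int a) mod int m + int a) mod int m"
      unfolding *[OF \<pi>_less] *[OF that] ..
    also have "\<dots> = (int u + int m - (int u + int m - int t + int a) + int a) mod int m"
      by (metis mod_add_left_eq mod_diff_right_eq)
    also have "\<dots> = int t" using that by simp
    finally show ?thesis by simp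
  qed
  have mirror_pi: "mirror m (\<pi> t) a = mirror m u (mirror m t a)" if "t < m" for t
    using mirror_triple[OF m_pos(1) u that a a] a by (simp add: \<pi>_def mirror_self)
  have bij: "bij_betw \<pi> {t. t < m \<and> mirror m t a = j} {t. t < m \<and> mirror m t a = mirror m u j}"
  proof (rule bij_betw_byWitness[of _ \<pi>])
    show "\<pi> ` {t. t < m \<and> mirror m t a = mirror m u j} \<subseteq> {t. t < m \<and> mirror m t a = j}"
    proof clarify
      fix t assume t: "t < m" "mirror m t a = mirror m u j"
      then have "mirror m (\<pi> t) a = j" using j by (simp add: mirror_pi mirror_mirror)
      then show "\<pi> t < m \<and> mirror m (\<pi> t) a = j" by (simp add: \<pi>_less)
    qed
  qed (auto simp: \<pi>_inv \<pi>_less mirror_pi)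
  have "S u * orbit_sum a j = lin_comb n n {t. t < m \<and> mirror m t a = j} (\<lambda>_. 1) (\<lambda>t. S u * (S t * e a))"
    unfolding orbit_sum_def by (rule lin_comb_mult_left) (use S_carrier e_carrier u a in auto)
  also have "\<dots> = lin_comb n n {t. t < m \<and> mirror m t a = j} (\<lambda>_. 1) (\<lambda>t. S (\<pi> t) * e a)"
  proof (rule lin_comb_cong)
    fix t assume "t \<in> {t. t < m \<and> mirror m t a = j}"
    then have t: "t < m" by simp
    have "S a * e a = e a" using S_fix[OF a a] a by (simp add: mirror_self)
    then have "S u * (S t * e a) = S u * S t * S a * e a" using t u a by (simp add: mat_assoc)
    then show "S u * (S t * e a) = S (\<pi> t) * e a" unfolding S_triple[OF u t a] \<pi>_def .
  qed simp
  also have "\<dots> = orbit_sum a (mirror m u j)"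
    unfolding orbit_sum_def by (rule lin_comb_reindex[OF bij, symmetric])
  finally show ?thesis .
qed

text \<open>As \<open>S\<^sub>t e\<^sub>a = e\<^sub>j S\<^sub>t\<close> if \<open>t\<close> takes the line \<open>a\<close> to the line \<open>j\<close>, the orbit sum is a product with
  left factor \<open>e\<^sub>j\<close>, and the product \<open>e\<^sub>i e\<^sub>j\<close> is known.\<close>

lemma e_orbit_sum:
  assumes i: "i < m" and a: "a < m" and j: "j < m"
  shows "e i * orbit_sum a j = LK_coeff m k \<alpha> i j \<cdot>\<^sub>m orbit_sum a i"
proof -
  define G where "G = lin_comb n n {t. t < m \<and> mirror m t a = j} (\<lambda>_. 1) S"
  have G [simp]: "dim_row G = n" "dim_col G = n" by (simp_all add: G_def)
  have F: "orbit_sum a j = e j * G"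
  proof -
    have "orbit_sum a j = lin_comb n n {t. t < m \<and> mirror m t a = j} (\<lambda>_. 1) (\<lambda>t. e j * S t)"
      unfolding orbit_sum_def using a by (intro lin_comb_cong) (auto simp: S_e[OF _ a])
    also have "\<dots> = e j * G"
      unfolding G_def by (rule lin_comb_mult_left[symmetric]) (use S_carrier e_carrier j in auto)
    finally show ?thesis .
  qed
  show ?thesis
  proof (cases "j = i")
    case True
    have "e i * (e i * G) = (e i * e i) * G" using i by (simp add: mat_assoc)
    then show ?thesis using i F True by (simp add: e_square mat_smult_mult LK_coeff_def)
  next
    case False
    have "e i * orbit_sum a j = (e i * e j) * G" unfolding F using i j by (simp add: mat_assoc)
    also have "\<dots> = lin_comb n n {v. v < m \<and> mirror m v j = i} k S * orbit_sum a j"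
      unfolding e_mult[OF i j False[symmetric]] F using j by (simp add: mat_assoc)
    also have "\<dots> = lin_comb n n {v. v < m \<and> mirror m v j = i} k (\<lambda>v. S v * orbit_sum a j)"
      by (rule lin_comb_mult_right) (use S_carrier orbit_sum_carrier in auto)
    also have "\<dots> = lin_comb n n {v. v < m \<and> mirror m v j = i} k (\<lambda>_. orbit_sum a i)"
      by (rule lin_comb_cong) (auto simp: S_orbit_sum a j)
    also have "\<dots> = LK_coeff m k \<alpha> i j \<cdot>\<^sub>m orbit_sum a i"
      using False by (intro eq_matI) (auto simp: LK_coeff_def sum_distrib_right)
    finally show ?thesis .
  qed
qed

text \<open>Each column of the orbit sums of \<open>e\<^sub>a\<close> gives a map from the Lawrence-Krammer representation,
  and these maps together have the columns of a multiple of \<open>e\<^sub>a\<close> in their images. A matrix that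
  kills all images of the Lawrence-Krammer representation therefore kills all \<open>e\<^sub>a\<close>.\<close>

lemma kills_e:
  assumes D: "D \<in> carrier_mat n n"
    and f: "\<And>f. f \<in> carrier_mat n m \<Longrightarrow>
      (\<And>l. l < m \<Longrightarrow> S l * f = f * LK_iota m (reflection m l)) \<Longrightarrow>
      (\<And>l. l < m \<Longrightarrow> e l * f = f * LK_p m k \<alpha> l) \<Longrightarrow> D * f = 0\<^sub>m n m"
    and a: "a < m"
  shows "D * e a = 0\<^sub>m n n"
proof -
  have "D * orbit_sum a a = 0\<^sub>m n n"
  proof (rule eq_matI)
    fix r q assume "r < dim_row (0\<^sub>m n n :: complex mat)" "q < dim_col (0\<^sub>m n n :: complex mat)"
    then have rq: "r < n" "q < n" by auto
    define f where "f = mat n m (\<lambda>(r, j). orbit_sum a j $$ (r, q))"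
    have fc: "f \<in> carrier_mat n m" by (simp add: f_def)
    have Mf: "(M * f) $$ (r, j) = (M * orbit_sum a j) $$ (r, q)"
      if "M \<in> carrier_mat n n" "r < n" "j < m" for M r j
      using that rq by (subst mult_entry[OF that(1) fc that(2,3)], subst mult_entry[OF that(1) orbit_sum_carrier that(2) rq(2)])
        (auto intro!: sum.cong simp: f_def)
    have "D * f = 0\<^sub>m n m"
    proof (rule f[OF fc])
      fix l assume l: "l < m"
      show "S l * f = f * LK_iota m (reflection m l)"
      proof (rule eq_matI)
        fix r j assume "r < dim_row (f * LK_iota m (reflection m l))" "j < dim_col (f * LK_iota m (reflection m l))"
        then have rj: "r < n" "j < m" using fc by auto
        show "(S l * f) $$ (r, j) = (f * LK_iota m (reflection m l)) $$ (r, j)"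
          unfolding Mf[OF S_carrier[OF l] rj] mult_LK_iota[OF fc rj] S_orbit_sum[OF l a rj(2)]
          using rj by (simp add: f_def)
      qed (use fc l in auto)
      show "e l * f = f * LK_p m k \<alpha> l"
      proof (rule eq_matI)
        fix r j assume "r < dim_row (f * LK_p m k \<alpha> l)" "j < dim_col (f * LK_p m k \<alpha> l)"
        then have rj: "r < n" "j < m" using fc by auto
        show "(e l * f) $$ (r, j) = (f * LK_p m k \<alpha> l) $$ (r, j)"
          unfolding Mf[OF e_carrier[OF l] rj] mult_LK_p[OF fc l rj] e_orbit_sum[OF l a rj(2)]
          using rj rq l by (simp add: f_def)
      qed (use fc l in auto)
    qed
    then show "(D * orbit_sum a a) $$ (r, q) = 0\<^sub>m n n $$ (r, q)"
      using Mf[OF D rq(1) a] rq a by simp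
  qed (use D in auto)
  \<comment> \<open>Each reflection that fixes the line \<open>a\<close> contributes \<open>e\<^sub>a\<close>, and the reflection \<open>a\<close> is one of them.\<close>
  moreover define c where "c = (of_nat (card {t. t < m \<and> mirror m t a = a}) :: complex)"
  have "orbit_sum a a = c \<cdot>\<^sub>m e a"
  proof -
    have "orbit_sum a a = lin_comb n n {t. t < m \<and> mirror m t a = a} (\<lambda>_. 1) (\<lambda>_. e a)"
      unfolding orbit_sum_def by (rule lin_comb_cong) (auto simp: S_fix a)
    also have "\<dots> = c \<cdot>\<^sub>m e a" using a by (intro eq_matI) (auto simp: c_def)
    finally show ?thesis .
  qed
  ultimately have "c \<cdot>\<^sub>m (D * e a) = 0\<^sub>m n n" using a D by (simp add: mat_smult_mult)
  moreover have "c \<noteq> 0"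
  proof -
    have "a \<in> {t. t < m \<and> mirror m t a = a}" using a by (simp add: mirror_self)
    then have "card {t. t < m \<and> mirror m t a = a} \<noteq> 0" by (subst card_0_eq) auto
    then show ?thesis by (simp add: c_def)
  qed
  ultimately have "inverse c \<cdot>\<^sub>m (c \<cdot>\<^sub>m (D * e a)) = inverse c \<cdot>\<^sub>m 0\<^sub>m n n" "inverse c * c = 1" by simp_all
  then have "1 \<cdot>\<^sub>m (D * e a) = 0\<^sub>m n n" by (simp add: mat_smult_smult)
  moreover have "1 \<cdot>\<^sub>m (D * e a) = D * e a" by (intro eq_matI) auto
  ultimately show ?thesis by simp
qed

end

section \<open>Ideals of semisimple algebras\<close>

text \<open>The right unit of the left ideal is the component of \<open>1\<close> in it.\<close>

lemma semisimple_complement: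
  assumes "semisimple A" "left_ideal I A" and ring: "ring A"
  obtains \<epsilon> where "\<epsilon> \<in> I" "\<And>x. x \<in> I \<Longrightarrow> x \<otimes>\<^bsub>A\<^esub> \<epsilon> = x"
proof -
  interpret ring A by (rule ring)
  obtain J where J: "left_ideal J A" "I \<inter> J = {\<zero>\<^bsub>A\<^esub>}" "I <+>\<^bsub>A\<^esub> J = carrier A"
    using assms(1,2) by (auto simp: semisimple_def)
  interpret I: additive_subgroup I A using assms(2) by (simp add: left_ideal_def)
  interpret J: additive_subgroup J A using J(1) by (simp add: left_ideal_def)
  obtain \<epsilon> \<delta> where \<epsilon>: "\<epsilon> \<in> I" "\<delta> \<in> J" "\<one>\<^bsub>A\<^esub> = \<epsilon> \<oplus>\<^bsub>A\<^esub> \<delta>"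
    using one_closed unfolding J(3)[symmetric] set_add_def' by auto
  note c = I.a_Hcarr[OF \<epsilon>(1)] J.a_Hcarr[OF \<epsilon>(2)]
  have "x \<otimes>\<^bsub>A\<^esub> \<epsilon> = x" if x: "x \<in> I" for x
  proof -
    have xc: "x \<in> carrier A" using x by (rule I.a_Hcarr)
    have xe: "x \<otimes>\<^bsub>A\<^esub> \<epsilon> \<in> I" and xd: "x \<otimes>\<^bsub>A\<^esub> \<delta> \<in> J"
      using assms(2) J(1) xc \<epsilon> by (auto simp: left_ideal_def)
    have sum: "x = x \<otimes>\<^bsub>A\<^esub> \<epsilon> \<oplus>\<^bsub>A\<^esub> x \<otimes>\<^bsub>A\<^esub> \<delta>"
      unfolding r_distr[OF c xc, symmetric] \<epsilon>(3)[symmetric] using xc by simp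
    have "x \<otimes>\<^bsub>A\<^esub> \<delta> = \<ominus>\<^bsub>A\<^esub> (x \<otimes>\<^bsub>A\<^esub> \<epsilon>) \<oplus>\<^bsub>A\<^esub> x"
      by (subst (2) sum) (use xc c in \<open>simp add: r_neg2 r_neg1\<close>)
    then have "x \<otimes>\<^bsub>A\<^esub> \<delta> \<in> I" using x xe by simp
    then have "x \<otimes>\<^bsub>A\<^esub> \<delta> = \<zero>\<^bsub>A\<^esub>" using xd J(2) by blast
    then show ?thesis using sum xc c by simp
  qed
  then show thesis using that \<epsilon>(1) by blast
qed

text \<open>Semisimplicity on the left splits the unit along a two-sided ideal, which gives a right unit of
  the ideal. It is a left unit as well since the elements of the ideal that the ideal annihilates
  from the left form a left ideal with a right unit, which annihilates this left ideal.\<close>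

lemma semisimple_ideal_unit:
  assumes ss: "semisimple A" and I: "ideal I A"
  obtains \<epsilon> where "\<epsilon> \<in> I" "\<And>x. x \<in> I \<Longrightarrow> x \<otimes>\<^bsub>A\<^esub> \<epsilon> = x"
    "\<And>y. y \<in> carrier A \<Longrightarrow> y \<otimes>\<^bsub>A\<^esub> \<epsilon> = \<epsilon> \<otimes>\<^bsub>A\<^esub> y"
proof -
  interpret I: ideal I A by (rule I)
  have ring: "ring A" by (rule I.ring_axioms)
  have left: "left_ideal I A"
    unfolding left_ideal_def using I.additive_subgroup_axioms I.I_l_closed by auto
  obtain \<epsilon> where \<epsilon>: "\<epsilon> \<in> I" "\<And>x. x \<in> I \<Longrightarrow> x \<otimes>\<^bsub>A\<^esub> \<epsilon> = x"
    by (rule semisimple_complement[OF ss left ring]) (rule that)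
  have c: "\<epsilon> \<in> carrier A" using \<epsilon>(1) by (rule I.Icarr)
  \<comment> \<open>The left ideal that measures the failure of \<open>\<epsilon>\<close> to be a left unit.\<close>
  define N where "N = {x \<in> I. \<forall>y\<in>I. y \<otimes>\<^bsub>A\<^esub> x = \<zero>\<^bsub>A\<^esub>}"
  have Nc: "x \<in> carrier A" if "x \<in> N" for x using that by (auto simp: N_def intro: I.Icarr)
  have leftN: "left_ideal N A"
    unfolding left_ideal_def
  proof (intro conjI ballI)
    show "additive_subgroup N A"
    proof (rule additive_subgroup.intro, rule subgroup.intro)
      show "N \<subseteq> carrier (add_monoid A)" using Nc by auto
      show "x \<otimes>\<^bsub>add_monoid A\<^esub> y \<in> N" if "x \<in> N" "y \<in> N" for x y
        using that Nc by (auto simp: N_def I.r_distr I.Icarr)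
      show "\<one>\<^bsub>add_monoid A\<^esub> \<in> N" by (auto simp: N_def I.Icarr)
      show "inv\<^bsub>add_monoid A\<^esub> x \<in> N" if "x \<in> N" for x
        unfolding a_inv_def[symmetric] using that Nc by (auto simp: N_def I.r_minus I.Icarr)
    qed
  next
    fix a x assume a: "a \<in> carrier A" and x: "x \<in> N"
    have "y \<otimes>\<^bsub>A\<^esub> (a \<otimes>\<^bsub>A\<^esub> x) = \<zero>\<^bsub>A\<^esub>" if "y \<in> I" for y
    proof -
      have "y \<otimes>\<^bsub>A\<^esub> (a \<otimes>\<^bsub>A\<^esub> x) = (y \<otimes>\<^bsub>A\<^esub> a) \<otimes>\<^bsub>A\<^esub> x"
        using that a Nc[OF x] by (simp add: I.m_assoc I.Icarr)
      then show ?thesis using x I.I_r_closed[OF that a] by (simp add: N_def)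
    qed
    then show "a \<otimes>\<^bsub>A\<^esub> x \<in> N" using x a by (auto simp: N_def I.I_l_closed)
  qed
  obtain \<eta> where \<eta>: "\<eta> \<in> N" "\<And>x. x \<in> N \<Longrightarrow> x \<otimes>\<^bsub>A\<^esub> \<eta> = x"
    by (rule semisimple_complement[OF ss leftN ring]) (rule that)
  have N0: "x = \<zero>\<^bsub>A\<^esub>" if "x \<in> N" for x
    using \<eta>(2)[OF that] \<eta>(1) that by (simp add: N_def)
  have left_unit: "\<epsilon> \<otimes>\<^bsub>A\<^esub> x = x" if x: "x \<in> I" for x
  proof -
    have xc: "x \<in> carrier A" using x by (rule I.Icarr)
    have "\<epsilon> \<otimes>\<^bsub>A\<^esub> x \<ominus>\<^bsub>A\<^esub> x \<in> N"
      unfolding N_def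
    proof (intro CollectI conjI ballI)
      show "\<epsilon> \<otimes>\<^bsub>A\<^esub> x \<ominus>\<^bsub>A\<^esub> x \<in> I"
        unfolding a_minus_def using I.I_r_closed[OF \<epsilon>(1) xc] x by simp
      fix y assume y: "y \<in> I"
      have yc: "y \<in> carrier A" using y by (rule I.Icarr)
      have "y \<otimes>\<^bsub>A\<^esub> (\<epsilon> \<otimes>\<^bsub>A\<^esub> x \<ominus>\<^bsub>A\<^esub> x) = (y \<otimes>\<^bsub>A\<^esub> \<epsilon>) \<otimes>\<^bsub>A\<^esub> x \<ominus>\<^bsub>A\<^esub> y \<otimes>\<^bsub>A\<^esub> x"
        using yc xc c by (simp add: a_minus_def I.r_distr I.r_minus I.m_assoc)
      then show "y \<otimes>\<^bsub>A\<^esub> (\<epsilon> \<otimes>\<^bsub>A\<^esub> x \<ominus>\<^bsub>A\<^esub> x) = \<zero>\<^bsub>A\<^esub>"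
        using \<epsilon>(2)[OF y] yc xc by (simp add: a_minus_def I.r_neg)
    qed
    then have "\<epsilon> \<otimes>\<^bsub>A\<^esub> x \<ominus>\<^bsub>A\<^esub> x = \<zero>\<^bsub>A\<^esub>" by (rule N0)
    moreover have "\<epsilon> \<otimes>\<^bsub>A\<^esub> x = (\<epsilon> \<otimes>\<^bsub>A\<^esub> x \<ominus>\<^bsub>A\<^esub> x) \<oplus>\<^bsub>A\<^esub> x"
      using xc c by (simp add: a_minus_def I.a_assoc I.l_neg)
    ultimately show ?thesis using xc by simp
  qed
  show thesis
  proof (rule that[OF \<epsilon>])
    fix y assume y: "y \<in> carrier A"
    have "y \<otimes>\<^bsub>A\<^esub> \<epsilon> = \<epsilon> \<otimes>\<^bsub>A\<^esub> (y \<otimes>\<^bsub>A\<^esub> \<epsilon>)" using left_unit[OF I.I_l_closed[OF \<epsilon>(1) y]] by simp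
    also have "\<dots> = (\<epsilon> \<otimes>\<^bsub>A\<^esub> y) \<otimes>\<^bsub>A\<^esub> \<epsilon>" using y c by (simp add: I.m_assoc)
    also have "\<dots> = \<epsilon> \<otimes>\<^bsub>A\<^esub> y" by (rule \<epsilon>(2)[OF I.I_r_closed[OF \<epsilon>(1) y]])
    finally show "y \<otimes>\<^bsub>A\<^esub> \<epsilon> = \<epsilon> \<otimes>\<^bsub>A\<^esub> y" .
  qed auto
qed

section \<open>The relations of the deformed algebra\<close>

lemma even_mirror:
  assumes "even m" "u < m"
  shows "even (mirror m t u) \<longleftrightarrow> even u"
proof -
  have "even (mirror m t u) \<longleftrightarrow> even (2 * t + (m - u))"
    using assms(1) unfolding mirror_def by (rule dvd_mod_iff)
  then show ?thesis using assms by (simp add: even_diff_nat)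
qed

lemma LK_coeff_parity:
  assumes "even m" "c < m" "i < m" "even c \<noteq> even i"
  shows "LK_coeff m k \<alpha> i c = 0"
proof -
  have *: "{t. t < m \<and> mirror m t c = i} = {}" using even_mirror[OF assms(1,2)] assms(4) by auto
  show ?thesis unfolding LK_coeff_def * using assms(4) by auto
qed

definition parity_mat :: "nat \<Rightarrow> complex mat"
  where "parity_mat m = mat m m (\<lambda>(r, c). if r = c \<and> even r then 1 else 0)"

lemma parity_mat_carrier: "parity_mat m \<in> carrier_mat m m"
  by (simp add: parity_mat_def)

lemma parity_mat_mult:
  assumes "M \<in> carrier_mat m m" "r < m" "c < m"
  shows "(parity_mat m * M) $$ (r, c) = (if even r then M $$ (r, c) else 0)"
    and "(M * parity_mat m) $$ (r, c) = (if even c then M $$ (r, c) else 0)"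
proof -
  have "(parity_mat m * M) $$ (r, c) = (\<Sum>d<m. if d = r then (if even r then M $$ (r, c) else 0) else 0)"
    unfolding mult_entry[OF parity_mat_carrier assms] using assms
    by (intro sum.cong) (auto simp: parity_mat_def)
  then show "(parity_mat m * M) $$ (r, c) = (if even r then M $$ (r, c) else 0)" using assms by simp
  have "(M * parity_mat m) $$ (r, c) = (\<Sum>d<m. if d = c then (if even c then M $$ (r, c) else 0) else 0)"
    unfolding mult_entry[OF assms(1) parity_mat_carrier assms(2,3)] using assms
    by (intro sum.cong) (auto simp: parity_mat_def)
  then show "(M * parity_mat m) $$ (r, c) = (if even c then M $$ (r, c) else 0)" using assms by simp
qed

locale LK_monodromy = generic_monodromy m m k \<alpha> "\<lambda>t. LK_iota m (reflection m t)" "LK_p m k \<alpha>" \<kappa> r \<theta> \<epsilon>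
  for m k \<alpha> \<kappa> r \<theta> \<epsilon>
begin

lemma T_LK_eq: "T_LK m k \<alpha> \<kappa> (polar r \<theta>) \<epsilon> = T"
  by (simp add: fun_eq_iff T_LK_def artin_monodromy_def quotient_monodromy_def inv_reflection
      T_def sigma_monodromy_def res_def[abs_def])

lemma LK_e_eq: "LK_e m k \<alpha> \<kappa> (polar r \<theta>) \<epsilon> = E"
  by (simp add: fun_eq_iff LK_e_def T_LK_eq E_def skein_def)

lemma LK_word_eq: "LK_word m k \<alpha> \<kappa> (polar r \<theta>) \<epsilon> = W"
proof -
  have "LK_letter m k \<alpha> \<kappa> (polar r \<theta>) \<epsilon> x = letter_mat T E x" for x
    by (cases x) (simp_all add: T_LK_eq LK_e_eq)
  then show ?thesis by (simp add: fun_eq_iff LK_word_def W_def word_mat_def)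
qed

text \<open>The skein element is conjugate to a multiple of a matrix of rank one.\<close>

lemma Phi:
  assumes i: "i < 2" and u: "u \<in> Lambda"
  shows "E i * W u * E i = Phi m k \<alpha> \<kappa> (polar r \<theta>) \<epsilon> i u \<cdot>\<^sub>m E i"
proof -
  have im: "i < m" using i m by simp
  have Ed [simp]: "dim_row (E i) = m" "dim_col (E i) = m" using i by auto
  obtain c P Q where PQ: "P \<in> carrier_mat m m" "Q \<in> carrier_mat m m" and E: "E i = c \<cdot>\<^sub>m (P * (LK_p m k \<alpha> i * Q))"
    using T_normal_form[OF i] by metis
  have d [simp]: "dim_row P = m" "dim_col P = m" "dim_row Q = m" "dim_col Q = m" using PQ by auto
  obtain z where z: "LK_p m k \<alpha> i * ((Q * (W u * P)) * LK_p m k \<alpha> i) = z \<cdot>\<^sub>m LK_p m k \<alpha> i"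
    using LK_p_sandwich[of "Q * (W u * P)" m i k \<alpha>] im PQ W_carrier[OF u]
    by (metis mult_carrier_mat)
  have "E i * W u * E i = (c * c) \<cdot>\<^sub>m (P * ((LK_p m k \<alpha> i * ((Q * (W u * P)) * LK_p m k \<alpha> i)) * Q))"
    using u unfolding E by (simp add: mat_smult_mult mat_smult_smult mat_assoc)
  also have "\<dots> = (c * c) \<cdot>\<^sub>m (P * ((z \<cdot>\<^sub>m LK_p m k \<alpha> i) * Q))" unfolding z ..
  also have "\<dots> = (z * c) \<cdot>\<^sub>m E i"
    unfolding E by (simp add: mat_smult_mult mat_smult_smult mult_ac)
  finally have *: "E i * W u * E i = (z * c) \<cdot>\<^sub>m E i" .
  show ?thesis
  proof (cases "E i = 0\<^sub>m m m")
    case True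
    then show ?thesis using u by (intro eq_matI) (auto simp: mat_zero_mult)
  next
    case False
    then obtain a b where ab: "a < m" "b < m" "E i $$ (a, b) \<noteq> 0"
      using eq_matI[of "E i" "0\<^sub>m m m"] by auto
    have "x = y" if "x \<cdot>\<^sub>m E i = y \<cdot>\<^sub>m E i" for x y
      using arg_cong[OF that, of "\<lambda>M. M $$ (a, b)"] ab by simp
    then have "Phi m k \<alpha> \<kappa> (polar r \<theta>) \<epsilon> i u = z * c"
      unfolding Phi_def LK_e_eq LK_word_eq by (intro the_equality) (auto simp: *)
    then show ?thesis using * by simp
  qed
qed

text \<open>For even \<open>m\<close> the basis vectors of even and of odd index span invariant subspaces.\<close>

lemma E_W_E_parity:
  assumes even: "even m" and u: "u \<in> Lambda"
  shows "E 0 * W u * E 1 = 0\<^sub>m m m" and "E 1 * W u * E 0 = 0\<^sub>m m m"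
proof -
  let ?g = "parity_mat m"
  have d [simp]: "dim_row ?g = m" "dim_col ?g = m" using parity_mat_carrier[of m] by auto
  have Ed [simp]: "dim_row (E 0) = m" "dim_col (E 0) = m" "dim_row (E 1) = m" "dim_col (E 1) = m" by auto
  have Sg: "LK_iota m (reflection m l) * ?g = ?g * LK_iota m (reflection m l)" if "l < m" for l
    using even_mirror[OF even]
    by (intro eq_matI) (simp_all add: parity_mat_mult[OF LK_carrier(1)] LK_iota_entry del: index_mult_mat(1))
  have eg: "LK_p m k \<alpha> l * ?g = ?g * LK_p m k \<alpha> l" if l: "l < m" for l
    using LK_coeff_parity[OF even _ l]
    by (intro eq_matI) (auto simp: parity_mat_mult[OF LK_carrier(2)] LK_p_entry l simp del: index_mult_mat(1))
  have 0: "LK_p m k \<alpha> 0 * ?g = 1 \<cdot>\<^sub>m LK_p m k \<alpha> 0"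
    using LK_coeff_parity[OF even, of _ 0]
    by (intro eq_matI) (auto simp: parity_mat_mult[OF LK_carrier(2)] LK_p_entry simp del: index_mult_mat(1))
  have 1: "LK_p m k \<alpha> 1 * ?g = 0 \<cdot>\<^sub>m LK_p m k \<alpha> 1"
    using LK_coeff_parity[OF even, of _ 1] m
    by (intro eq_matI) (auto simp: parity_mat_mult[OF LK_carrier(2)] LK_p_entry simp del: index_mult_mat(1))
  have E0: "E 0 * ?g = 1 \<cdot>\<^sub>m E 0" "?g * E 0 = 1 \<cdot>\<^sub>m E 0"
    by (rule E_absorb[OF _ parity_mat_carrier Sg eg 0]; simp)+
  have E1: "E 1 * ?g = 0 \<cdot>\<^sub>m E 1" "?g * E 1 = 0 \<cdot>\<^sub>m E 1"
    by (rule E_absorb[OF _ parity_mat_carrier Sg eg 1]; simp)+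
  have Wg: "W u * ?g = ?g * W u"
    by (rule W_intertwine(3)[OF generic_monodromy_axioms parity_mat_carrier Sg eg u])
  have one: "1 \<cdot>\<^sub>m M = M" and zero: "0 \<cdot>\<^sub>m M = 0\<^sub>m m m" if "dim_row M = m" "dim_col M = m" for M :: "complex mat"
    using that by (auto intro!: eq_matI)
  have "E 0 * W u * E 1 = (E 0 * ?g) * W u * E 1" unfolding E0(1) by (simp add: one)
  also have "\<dots> = E 0 * ((?g * W u) * E 1)" using u by (simp add: mat_assoc)
  also have "\<dots> = E 0 * (W u * (?g * E 1))" unfolding Wg[symmetric] using u by (simp add: mat_assoc)
  finally show "E 0 * W u * E 1 = 0\<^sub>m m m" unfolding E1(2) using u by (simp add: zero mat_zero_mult)
  have "E 1 * W u * E 0 = E 1 * (W u * (?g * E 0))" unfolding E0(2) using u by (simp add: one mat_assoc)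
  also have "\<dots> = E 1 * ((?g * W u) * E 0)" unfolding Wg[symmetric] using u by (simp add: mat_assoc)
  also have "\<dots> = (E 1 * ?g) * (W u * E 0)" using u by (simp add: mat_assoc)
  finally show "E 1 * W u * E 0 = 0\<^sub>m m m" unfolding E1(1) using u by (simp add: zero mat_zero_mult)
qed

end

locale generic_brauer_rep = brauer_rep +
  fixes \<kappa> :: complex and r \<theta> \<epsilon> :: real
  assumes \<theta>: "0 < \<theta>" "\<theta> < pi / real m" and r: "0 < r" and \<epsilon>: "0 < \<epsilon>" "\<epsilon> < 1"
    and nonresonant: "i < 2 \<Longrightarrow> nonresonant_param \<kappa> (k i) (\<alpha> i)"
    and q_square: "i < 2 \<Longrightarrow> (q_par k \<kappa> i)\<^sup>2 \<noteq> 1"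
    and semisimple: "semisimple (Br m k \<alpha>)"
begin

sublocale V: generic_monodromy m n k \<alpha> "\<lambda>t. T (reflection m t)" e \<kappa> r \<theta> \<epsilon>
  by (intro generic_monodromy.intro brauer_matrices generic_monodromy_axioms.intro \<theta> r \<epsilon>)
    (use nonresonant q_square in auto)

sublocale L: LK_monodromy m k \<alpha> \<kappa> r \<theta> \<epsilon>
  by (intro LK_monodromy.intro generic_monodromy.intro LK_brauer m k_mirror \<alpha>_mirror
      generic_monodromy_axioms.intro \<theta> r \<epsilon>)
    (use nonresonant q_square in auto)

lemma T_rho_eq: "T_rho m k \<alpha> \<kappa> (polar r \<theta>) \<epsilon> n \<rho> = V.T"
  by (simp add: fun_eq_iff T_rho_def artin_monodromy_def quotient_monodromy_def inv_reflection
      V.T_def V.sigma_monodromy_def V.res_def[abs_def] Omega_def)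

text \<open>The unit of the ideal generated by the \<open>e\<^sub>a\<close> is absorbed by the \<open>e\<^sub>i\<close> and hence by the skein
  elements. A matrix \<open>D\<close> that absorbs it with them vanishes as soon as it vanishes on all images of
  the Lawrence-Krammer representation.\<close>

lemma vanish:
  assumes D: "D \<in> carrier_mat n n"
    and f: "\<And>f. f \<in> carrier_mat n m \<Longrightarrow>
      (\<And>l. l < m \<Longrightarrow> T (reflection m l) * f = f * LK_iota m (reflection m l)) \<Longrightarrow>
      (\<And>l. l < m \<Longrightarrow> e l * f = f * LK_p m k \<alpha> l) \<Longrightarrow> D * f = 0\<^sub>m n m"
    and absorb: "\<And>z. z \<in> carrier_mat n n \<Longrightarrow> (\<And>i. i < 2 \<Longrightarrow> V.E i * z = V.E i) \<Longrightarrow> D * z = D"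
  shows "D = 0\<^sub>m n n"
proof -
  let ?A = "presented_algebra (br_gens m) (br_rels m k \<alpha>)"
  let ?c = "cls (br_gens m) (br_rels m k \<alpha>)"
  define I where "I = genideal ?A ((\<lambda>a. ?c (gen_e a)) ` {..<m})"
  have gens: "(\<lambda>a. ?c (gen_e a)) ` {..<m} \<subseteq> carrier ?A" using cls_closed gen_closed by auto
  have I: "Ideal.ideal I ?A" unfolding I_def by (rule ring.genideal_ideal[OF ring gens])
  have gen_I: "?c (gen_e a) \<in> I" if "a < m" for a
    using ring.genideal_self[OF ring gens] that unfolding I_def by blast
  obtain \<eta> where \<eta>: "\<eta> \<in> I" "\<And>x. x \<in> I \<Longrightarrow> x \<otimes>\<^bsub>?A\<^esub> \<eta> = x"
    "\<And>y. y \<in> carrier ?A \<Longrightarrow> y \<otimes>\<^bsub>?A\<^esub> \<eta> = \<eta> \<otimes>\<^bsub>?A\<^esub> y"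
    by (rule semisimple_ideal_unit[OF semisimple[unfolded Br_def] I]) (rule that)
  have \<eta>c: "\<eta> \<in> carrier ?A" using \<eta>(1) by (rule ideal.Icarr[OF I])
  define z where "z = \<rho> \<eta>"
  have z: "z \<in> carrier_mat n n" using ring_hom_closed[OF rho_hom \<eta>c] by (simp add: z_def ring_mat_simps)
  have mult: "\<rho> (X \<otimes>\<^bsub>?A\<^esub> Y) = \<rho> X * \<rho> Y" if "X \<in> carrier ?A" "Y \<in> carrier ?A" for X Y
    using ring_hom_mult[OF rho_hom that] by (simp add: ring_mat_simps)
  have comm: "R x * z = z * R x" if "x \<in> carrier (free_algebra (br_gens m))" for x
    using mult[OF cls_closed[OF that] \<eta>c] mult[OF \<eta>c cls_closed[OF that]] \<eta>(3)[OF cls_closed[OF that]]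
    by (simp add: R_def z_def)
  have ez: "e a * z = e a" if a: "a < m" for a
    using mult[OF cls_closed[OF gen_closed(2)[OF a]] \<eta>c] \<eta>(2)[OF gen_I[OF a]] by (simp add: rep_e_def z_def)
  have "V.E i * z = V.E i" if i: "i < 2" for i
  proof -
    have im: "i < m" using i m by simp
    have "V.E i * z = 1 \<cdot>\<^sub>m V.E i"
    proof (rule V.E_absorb(1)[OF i z])
      show "T (reflection m l) * z = z * T (reflection m l)" if "l < m" for l
        unfolding T_R by (rule comm[OF gen_closed(1)[OF reflection_dihedral[OF that]]])
      show "e l * z = z * e l" if "l < m" for l
        unfolding e_R by (rule comm[OF gen_closed(2)[OF that]])
      show "e i * z = 1 \<cdot>\<^sub>m e i" using ez[OF im] e_carrier[OF im] by (auto intro!: eq_matI)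
    qed
    then show ?thesis using i by (auto intro!: eq_matI)
  qed
  then have "D = D * z" using absorb[OF z] by simp
  also have "\<dots> = 0\<^sub>m n n"
    unfolding z_def by (rule kills_ideal[OF D V.kills_e[OF D f]]) (use \<eta>(1) in \<open>auto simp: I_def Br_def\<close>)
  finally show ?thesis .
qed

lemma
  assumes f: "f \<in> carrier_mat n m" "\<And>l. l < m \<Longrightarrow> T (reflection m l) * f = f * LK_iota m (reflection m l)"
    "\<And>l. l < m \<Longrightarrow> e l * f = f * LK_p m k \<alpha> l"
    and i: "i < 2" "j < 2" and u: "u \<in> Lambda"
  shows E_intertwine: "V.E i * f = f * L.E i"
    and E_W_E_intertwine: "V.E i * V.W u * V.E j * f = f * (L.E i * L.W u * L.E j)"
proof -
  have twE: "V.E i * f = f * L.E i" if "i < 2" for i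
    by (rule V.W_intertwine(2)[OF L.generic_monodromy_axioms f(1)]) (erule f(2), erule f(3), rule that)
  have twW: "V.W u * f = f * L.W u"
    by (rule V.W_intertwine(3)[OF L.generic_monodromy_axioms f(1)]) (erule f(2), erule f(3), rule u)
  have d [simp]: "dim_row f = n" "dim_col f = m" using f(1) by auto
  show "V.E i * f = f * L.E i" by (rule twE[OF i(1)])
  have "V.E i * V.W u * V.E j * f = V.E i * (V.W u * (V.E j * f))" using i u by (simp add: mat_assoc)
  also have "\<dots> = V.E i * ((V.W u * f) * L.E j)" unfolding twE[OF i(2)] using i u by (simp add: mat_assoc)
  also have "\<dots> = (V.E i * f) * (L.W u * L.E j)" unfolding twW using i u by (simp add: mat_assoc)
  also have "\<dots> = f * (L.E i * L.W u * L.E j)" unfolding twE[OF i(1)] using i u by (simp add: mat_assoc)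
  finally show "V.E i * V.W u * V.E j * f = f * (L.E i * L.W u * L.E j)" .
qed

text \<open>The defect of the relation vanishes on the images of the Lawrence-Krammer representation by
  naturality, and it ends with the factor \<open>E\<^sub>i\<close>.\<close>

lemma E_W_E:
  assumes i: "i < 2" and u: "u \<in> Lambda"
  shows "V.E i * V.W u * V.E i = Phi m k \<alpha> \<kappa> (polar r \<theta>) \<epsilon> i u \<cdot>\<^sub>m V.E i"
proof -
  define c where "c = Phi m k \<alpha> \<kappa> (polar r \<theta>) \<epsilon> i u"
  define D where "D = V.E i * V.W u * V.E i - c \<cdot>\<^sub>m V.E i"
  have "D = 0\<^sub>m n n"
  proof (rule vanish)
    show "D \<in> carrier_mat n n" using i u by (auto simp: D_def intro!: carrier_matI)
  next
    fix f assume f: "f \<in> carrier_mat n m" "\<And>l. l < m \<Longrightarrow> T (reflection m l) * f = f * LK_iota m (reflection m l)"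
      "\<And>l. l < m \<Longrightarrow> e l * f = f * LK_p m k \<alpha> l"
    have d [simp]: "dim_row f = n" "dim_col f = m" using f(1) by auto
    have tw: "V.E i * V.W u * V.E i * f = f * (L.E i * L.W u * L.E i)"
      by (rule E_W_E_intertwine[OF f i i u])
    have tw': "V.E i * f = f * L.E i" by (rule E_intertwine[OF f i i u])
    have "D * f = V.E i * V.W u * V.E i * f - c \<cdot>\<^sub>m (V.E i * f)"
      using mat_add_distrib(4)[of "V.E i * V.W u * V.E i" f "c \<cdot>\<^sub>m V.E i"] mat_smult_mult(1)[of "V.E i" f c] i u
      by (simp add: D_def)
    also have "\<dots> = c \<cdot>\<^sub>m (f * L.E i) - c \<cdot>\<^sub>m (f * L.E i)"
      unfolding tw tw' L.Phi[OF i u] c_def[symmetric]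
      using i by (simp add: mat_smult_mult)
    also have "\<dots> = 0\<^sub>m n m" using i by (intro eq_matI) (auto simp del: index_mult_mat(1))
    finally show "D * f = 0\<^sub>m n m" .
  next
    fix z assume z: "z \<in> carrier_mat n n" "\<And>i. i < 2 \<Longrightarrow> V.E i * z = V.E i"
    have d [simp]: "dim_row z = n" "dim_col z = n" using z(1) by auto
    have "V.E i * V.W u * V.E i * z = V.E i * V.W u * V.E i" using i u z(2) by (simp add: mat_assoc)
    then show "D * z = D"
      using mat_add_distrib(4)[of "V.E i * V.W u * V.E i" z "c \<cdot>\<^sub>m V.E i"] mat_smult_mult(1)[of "V.E i" z c] i u z(2)
      by (simp add: D_def)
  qed
  then have "D $$ (a, b) = 0" if "a < n" "b < n" for a b using that by simp
  then show ?thesis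
    unfolding c_def[symmetric] using i u by (intro eq_matI) (auto simp: D_def simp del: index_mult_mat(1))
qed

lemma E_W_E_zero:
  assumes even: "even m" and ij: "{i, j} = {0, 1}" and u: "u \<in> Lambda"
  shows "V.E i * V.W u * V.E j = 0\<^sub>m n n"
proof (rule vanish)
  have i: "i < 2" "j < 2" using ij by (auto simp: doubleton_eq_iff)
  have L: "L.E i * L.W u * L.E j = 0\<^sub>m m m"
    using L.E_W_E_parity[OF even u] ij by (auto simp: doubleton_eq_iff)
  show "V.E i * V.W u * V.E j \<in> carrier_mat n n" using i u by (auto intro!: carrier_matI)
  show "V.E i * V.W u * V.E j * f = 0\<^sub>m n m"
    if "f \<in> carrier_mat n m" "\<And>l. l < m \<Longrightarrow> T (reflection m l) * f = f * LK_iota m (reflection m l)"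
      "\<And>l. l < m \<Longrightarrow> e l * f = f * LK_p m k \<alpha> l" for f
  proof -
    have "V.E i * V.W u * V.E j * f = f * (L.E i * L.W u * L.E j)"
      by (rule E_W_E_intertwine[OF that i u])
    then show ?thesis unfolding L using that(1) by simp
  qed
  show "V.E i * V.W u * V.E j * z = V.E i * V.W u * V.E j"
    if "z \<in> carrier_mat n n" "\<And>i. i < 2 \<Longrightarrow> V.E i * z = V.E i" for z
  proof -
    have "dim_row z = n" using that(1) by simp
    then show ?thesis using i u that(2)[OF i(2)] by (simp add: mat_assoc)
  qed
qed

end

section \<open>The morphism from the deformed algebra\<close>

lemma alternating_eval:
  fixes A B :: "complex mat"
  assumes "A \<in> carrier_mat n n" "B \<in> carrier_mat n n" "\<phi> x = A" "\<phi> y = B"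
  shows "foldr (\<lambda>g M. \<phi> g * M) (alternating (2 * h) x y) (1\<^sub>m n) = (A * B) ^\<^sub>m h"
    and "foldr (\<lambda>g M. \<phi> g * M) (alternating (2 * h + 1) x y) (1\<^sub>m n) = (A * B) ^\<^sub>m h * A"
proof -
  have AB: "A * B \<in> carrier_mat n n" using assms by simp
  have pow: "(A * B) ^\<^sub>m Suc h = A * (B * (A * B) ^\<^sub>m h)" for h
    using pow_mat_add_dims[OF AB, of 1 h] assoc_mult_mat[OF assms(1,2) pow_carrier_mat[OF AB, of h]] AB
      carrier_matD[OF assms(1)] by simp
  show "foldr (\<lambda>g M. \<phi> g * M) (alternating (2 * h) x y) (1\<^sub>m n) = (A * B) ^\<^sub>m h"
  proof (induction h)
    case 0
    show ?case using carrier_matD[OF assms(1)] by simp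
  next
    case (Suc h)
    have "alternating (2 * Suc h) x y = x # y # alternating (2 * h) x y" by simp
    then show ?case using Suc assms unfolding pow by simp
  qed
  show "foldr (\<lambda>g M. \<phi> g * M) (alternating (2 * h + 1) x y) (1\<^sub>m n) = (A * B) ^\<^sub>m h * A"
  proof (induction h)
    case 0
    show ?case using assms carrier_matD[OF assms(1)] by simp
  next
    case (Suc h)
    have "alternating (2 * Suc h + 1) x y = x # y # alternating (2 * h + 1) x y" by simp
    then have "foldr (\<lambda>g M. \<phi> g * M) (alternating (2 * Suc h + 1) x y) (1\<^sub>m n) = A * (B * ((A * B) ^\<^sub>m h * A))"
      using Suc assms by simp
    also have "\<dots> = A * (B * (A * B) ^\<^sub>m h) * A"
    proof -
      have "A * (B * (K * A)) = A * (B * K) * A" if "K \<in> carrier_mat n n" for K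
        using carrier_matD[OF assms(1)] carrier_matD[OF assms(2)] carrier_matD[OF that] by (simp add: mat_assoc)
      then show ?thesis using pow_carrier_mat[OF AB, of h] by blast
    qed
    finally show ?case unfolding pow .
  qed
qed

lemma alternating_set: "set (alternating h x y) \<subseteq> {x, y}"
  by (induction h arbitrary: x y) auto

context generic_brauer_rep
begin

lemma b_rels_closed: "b_rels m k \<alpha> \<kappa> p \<epsilon> \<subseteq> carrier (free_algebra b_gens)"
proof -
  let ?F = "carrier (free_algebra b_gens)"
  have g: "gen_X i \<in> ?F" "gen_Xinv i \<in> ?F" "gen_E i \<in> ?F" if "i < 2" for i
  proof -
    have "i = 0 \<or> i = 1" using that by auto
    then show "gen_X i \<in> ?F" "gen_Xinv i \<in> ?F" "gen_E i \<in> ?F"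
      by (auto intro!: free_algebra_closed(5) simp: b_gens_def)
  qed
  have w: "word (map Pos u) \<in> ?F" if "u \<in> Lambda" for u
    using that by (intro free_algebra_closed(4)) (auto simp: Lambda_def b_gens_def)
  have a: "word (alternating h (Pos (GenX i)) (Pos (GenX j))) \<in> ?F" if "i < 2" "j < 2" for h i j
    using that alternating_set[of h "Pos (GenX i)" "Pos (GenX j)"]
    by (intro free_algebra_closed(4)) (auto simp: b_gens_def less_2_cases_iff)
  show ?thesis unfolding b_rels_def
    by (auto intro!: free_algebra_closed(2,3,6-9) g w a split: if_splits)
qed

theorem factors: "factors_through_B m k \<alpha> \<kappa> (polar r \<theta>) \<epsilon> n (T_rho m k \<alpha> \<kappa> (polar r \<theta>) \<epsilon> n \<rho>)"
proof -
  let ?p = "polar r \<theta>"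
  let ?S = "b_rels m k \<alpha> \<kappa> ?p \<epsilon>"
  obtain M where M: "\<And>i. i < 2 \<Longrightarrow> M i \<in> carrier_mat n n \<and> V.T i * M i = 1\<^sub>m n \<and> M i * V.T i = 1\<^sub>m n"
    using V.braid_words(3) by metis
  define \<phi> where "\<phi> g = (case g of Pos x \<Rightarrow> letter_mat V.T V.E x | Xinv i \<Rightarrow> M i)" for g
  have [simp]: "\<phi> (Pos x) = letter_mat V.T V.E x" "\<phi> (Xinv i) = M i" for x i by (simp_all add: \<phi>_def)
  have \<phi>: "\<phi> g \<in> carrier_mat n n" if "g \<in> b_gens" for g
    using that M V.letter_mat_carrier by (auto simp: b_gens_def simp del: letter_mat.simps)
  let ?ev = "eval_poly n \<phi>"
  let ?F = "carrier (free_algebra b_gens)"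
  have gens: "Pos (GenX i) \<in> b_gens" "Xinv i \<in> b_gens" "Pos (GenE i) \<in> b_gens" if "i < 2" for i
    using that by (auto simp: b_gens_def less_2_cases_iff)
  have gF: "gen_X i \<in> ?F" "gen_Xinv i \<in> ?F" "gen_E i \<in> ?F" if "i < 2" for i
    using gens[OF that] by (auto intro: free_algebra_closed(5))
  have ev_gen: "?ev (gen_X i) = V.T i" "?ev (gen_Xinv i) = M i" "?ev (gen_E i) = V.E i" if "i < 2" for i
    using eval_poly_gen[where \<phi> = \<phi> and G = b_gens and n = n, OF \<phi>] gens[OF that] by auto
  note ev = eval_poly_mult[where \<phi> = \<phi> and G = b_gens and n = n, OF \<phi>] eval_poly_diff[where \<phi> = \<phi> and G = b_gens and n = n, OF \<phi>] eval_poly_add[where \<phi> = \<phi> and G = b_gens and n = n, OF \<phi>] eval_poly_const[where \<phi> = \<phi> and G = b_gens and n = n, OF \<phi>] eval_poly_one[where \<phi> = \<phi> and G = b_gens and n = n, OF \<phi>]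
  have words: "set (map Pos u) \<subseteq> b_gens" if "u \<in> Lambda" for u
    using that by (auto simp: Lambda_def b_gens_def)
  have wF: "word (map Pos u) \<in> ?F" if "u \<in> Lambda" for u
    using words[OF that] by (rule free_algebra_closed(4))
  have ew: "?ev (word v) = foldr (\<lambda>g A. \<phi> g * A) v (1\<^sub>m n)" if "set v \<subseteq> b_gens" for v
    by (rule eval_poly_word[where \<phi> = \<phi> and G = b_gens and n = n, OF \<phi> that])
  have ev_word: "?ev (word (map Pos u)) = V.W u" if "u \<in> Lambda" for u
    using ew[OF words[OF that]] by (simp add: V.W_def word_mat_def foldr_map o_def)
  have dims: "dim_row (V.T i) = n" "dim_col (V.T i) = n" "dim_row (V.E i) = n" "dim_col (V.E i) = n" if "i < 2" for i
    using that by auto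
  have zero: "A - A = 0\<^sub>m n n" if "dim_row A = n" "dim_col A = n" for A :: "complex mat"
    using that by (intro eq_matI) auto
  have const: "(c \<cdot>\<^sub>m 1\<^sub>m n) * A = c \<cdot>\<^sub>m A" if "dim_row A = n" for c and A :: "complex mat"
    using that by (simp add: mat_smult_mult mat_one_mult)
  have braid: "?ev (word (alternating m (Pos (GenX 0)) (Pos (GenX 1)))) =
      ?ev (word (alternating m (Pos (GenX 1)) (Pos (GenX 0))))"
  proof -
    have 01: "(0::nat) < 2" "(1::nat) < 2" by simp_all
    have sub: "set (alternating m (Pos (GenX 0)) (Pos (GenX 1))) \<subseteq> b_gens"
      "set (alternating m (Pos (GenX 1)) (Pos (GenX 0))) \<subseteq> b_gens"
      using alternating_set[of m "Pos (GenX 0)" "Pos (GenX 1)"] alternating_set[of m "Pos (GenX 1)" "Pos (GenX 0)"]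
        gens[OF 01(1)] gens[OF 01(2)] by blast+
    have T: "V.T 0 \<in> carrier_mat n n" "V.T 1 \<in> carrier_mat n n" by (auto intro!: V.T_carrier)
    note alt = alternating_eval[where \<phi> = \<phi> and x = "Pos (GenX 0)" and y = "Pos (GenX 1)", OF T]
      alternating_eval[where \<phi> = \<phi> and x = "Pos (GenX 1)" and y = "Pos (GenX 0)", OF T(2,1)]
    obtain h where "m = 2 * h \<or> m = 2 * h + 1" by (metis oddE evenE)
    then show ?thesis
    proof
      assume h: "m = 2 * h"
      show ?thesis
        unfolding ew[OF sub(1)] ew[OF sub(2)]
        using alt(1)[of h] alt(3)[of h] V.braid_words(1)[OF h] h by simp
    next
      assume h: "m = 2 * h + 1"
      show ?thesis
        unfolding ew[OF sub(1)] ew[OF sub(2)]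
        using alt(2)[of h] alt(4)[of h] V.braid_words(2)[OF h] h by simp
    qed
  qed
  have "?ev x = 0\<^sub>m n n" if "x \<in> ?S" for x
    using that unfolding b_rels_def
  proof (elim UnE)
    assume "x \<in> {gen_X i * gen_Xinv i - 1 | i. i < 2}"
    then obtain i where i: "i < 2" "x = gen_X i * gen_Xinv i - 1" by blast
    show ?thesis unfolding i(2) using M[OF i(1)] gF[OF i(1)] by (simp add: ev ev_gen[OF i(1)] zero)
  next
    assume "x \<in> {gen_Xinv i * gen_X i - 1 | i. i < 2}"
    then obtain i where i: "i < 2" "x = gen_Xinv i * gen_X i - 1" by blast
    show ?thesis unfolding i(2) using M[OF i(1)] gF[OF i(1)] by (simp add: ev ev_gen[OF i(1)] zero)
  next
    assume "x \<in> {word (alternating m (Pos (GenX 0)) (Pos (GenX 1))) -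
       word (alternating m (Pos (GenX 1)) (Pos (GenX 0)))}"
    then have x: "x = word (alternating m (Pos (GenX 0)) (Pos (GenX 1))) -
       word (alternating m (Pos (GenX 1)) (Pos (GenX 0)))" by (rule singletonD)
    have "?ev x = ?ev (word (alternating m (Pos (GenX 0)) (Pos (GenX 1)))) -
       ?ev (word (alternating m (Pos (GenX 1)) (Pos (GenX 0))))"
      unfolding x by (rule ev(2))
    also have "\<dots> = 0\<^sub>m n n"
      unfolding braid by (rule zero) (simp_all add: eval_poly_def)
    finally show ?thesis .
  next
    assume "x \<in> {const (inverse (q_par k \<kappa> i) - q_par k \<kappa> i) * gen_E i -
       const (l_par k \<alpha> \<kappa> i) * (gen_X i - const (q_par k \<kappa> i)) * (gen_X i + const (inverse (q_par k \<kappa> i)))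
       | i. i < 2}"
    then obtain i where i: "i < 2" "x = const (inverse (q_par k \<kappa> i) - q_par k \<kappa> i) * gen_E i -
       const (l_par k \<alpha> \<kappa> i) * (gen_X i - const (q_par k \<kappa> i)) * (gen_X i + const (inverse (q_par k \<kappa> i)))"
      by blast
    note c = free_algebra_closed(3,6,8,9) gF[OF i(1)]
    show ?thesis
      unfolding i(2) using dims[OF i(1)] V.skein_relation[OF i(1)]
      by (simp add: ev ev_gen[OF i(1)] c const mat_smult_mult zero)
  next
    assume "x \<in> {gen_X i * gen_E i - const (inverse (l_par k \<alpha> \<kappa> i)) * gen_E i | i. i < 2}"
    then obtain i where i: "i < 2" "x = gen_X i * gen_E i - const (inverse (l_par k \<alpha> \<kappa> i)) * gen_E i" by blast
    show ?thesis unfolding i(2) using gF[OF i(1)] dims[OF i(1)]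
      by (simp add: ev ev_gen[OF i(1)] free_algebra_closed(3,9) const V.T_E[OF i(1)] zero)
  next
    assume "x \<in> {gen_E i * gen_X i - const (inverse (l_par k \<alpha> \<kappa> i)) * gen_E i | i. i < 2}"
    then obtain i where i: "i < 2" "x = gen_E i * gen_X i - const (inverse (l_par k \<alpha> \<kappa> i)) * gen_E i" by blast
    show ?thesis unfolding i(2) using gF[OF i(1)] dims[OF i(1)]
      by (simp add: ev ev_gen[OF i(1)] free_algebra_closed(3,9) const V.E_T[OF i(1)] zero)
  next
    assume "x \<in> {gen_E i * word (map Pos u) * gen_E i - const (Phi m k \<alpha> \<kappa> ?p \<epsilon> i u) * gen_E i | i u.
       i < 2 \<and> u \<in> Lambda}"
    then obtain i u where i: "i < 2" "u \<in> Lambda"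
      "x = gen_E i * word (map Pos u) * gen_E i - const (Phi m k \<alpha> \<kappa> ?p \<epsilon> i u) * gen_E i" by blast
    show ?thesis unfolding i(3) using gF[OF i(1)] dims[OF i(1)] wF[OF i(2)]
      by (simp add: ev ev_gen[OF i(1)] ev_word[OF i(2)] free_algebra_closed(3,9) const E_W_E[OF i(1,2)] zero)
  next
    assume x: "x \<in> (if even m then
      {gen_E 0 * word (map Pos u) * gen_E 1 | u. u \<in> Lambda} \<union>
      {gen_E 1 * word (map Pos u) * gen_E 0 | u. u \<in> Lambda} else {})"
    then have even: "even m" by (auto split: if_splits)
    from x obtain i j u where ij: "{i, j} = {0, 1}" "u \<in> Lambda" "x = gen_E i * word (map Pos u) * gen_E j"
      using even by auto
    have i: "i < 2" "j < 2" using ij(1) by (auto simp: doubleton_eq_iff)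
    show ?thesis unfolding ij(3) using gF[OF i(1)] gF[OF i(2)] wF[OF ij(2)]
      by (simp add: ev ev_gen[OF i(1)] ev_gen[OF i(2)] ev_word[OF ij(2)] free_algebra_closed(9)
          E_W_E_zero[OF even ij(1,2)])
  qed
  then obtain h where "matrix_rep b_gens ?S n h" "\<And>g. g \<in> b_gens \<Longrightarrow> h (cls b_gens ?S (gen g)) = \<phi> g"
    using matrix_rep_exists[where \<phi> = \<phi> and G = b_gens and n = n, OF \<phi> b_rels_closed] by metis
  then show ?thesis
    unfolding factors_through_B_def T_rho_eq using gens by (intro exI[of _ h]) simp
qed

end

section \<open>Generic parameters\<close>

lemma closed_analytic_zeros:
  assumes "f holomorphic_on UNIV"
  shows "closed_analytic {x. f x = 0}"
  unfolding closed_analytic_def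
proof (intro conjI allI)
  have "continuous_on UNIV f" by (rule holomorphic_on_imp_continuous_on[OF assms])
  then show "closed {x. f x = 0}" by (intro closed_Collect_eq) auto
  show "\<exists>U F. open U \<and> z \<in> U \<and> finite F \<and> (\<forall>f\<in>F. f holomorphic_on U) \<and>
      {x. f x = 0} \<inter> U = {x \<in> U. \<forall>f\<in>F. f x = 0}" for z
    by (rule exI[of _ UNIV], rule exI[of _ "{f}"]) (use assms in auto)
qed

text \<open>The exceptional \<open>\<kappa>\<close> are those for which some non-zero \<open>\<mu>\<close> in a finite set has
  \<open>\<kappa> \<mu>\<close> integral; for small \<open>\<kappa> \<noteq> 0\<close> this does not happen.\<close>

lemma for_generic_nonintegral:
  assumes fin: "finite M" and P: "\<And>\<kappa>. (\<And>\<mu>. \<mu> \<in> M \<Longrightarrow> \<mu> \<noteq> 0 \<Longrightarrow> \<kappa> * \<mu> \<notin> \<int>) \<Longrightarrow> P \<kappa>"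
  shows "for_generic P"
proof -
  define f where "f \<kappa> = (\<Prod>\<mu>\<in>M - {0}. sin (of_real pi * (\<kappa> * \<mu>)))" for \<kappa> :: complex
  have sin: "sin (of_real pi * z) = 0 \<longleftrightarrow> z \<in> \<int>" for z :: complex
  proof -
    have "(of_real pi * z = of_real (of_int j * pi)) \<longleftrightarrow> z = of_int j" for j
      by (simp add: mult.commute)
    then show ?thesis by (auto simp: sin_eq_0 Ints_def)
  qed
  have f0: "f \<kappa> = 0 \<longleftrightarrow> (\<exists>\<mu>\<in>M - {0}. \<kappa> * \<mu> \<in> \<int>)" for \<kappa>
    using fin by (simp add: f_def sin)
  show ?thesis
    unfolding for_generic_def
  proof (intro exI conjI allI impI)
    show "closed_analytic {\<kappa>. f \<kappa> = 0}"
      by (rule closed_analytic_zeros) (auto simp: f_def[abs_def] intro!: holomorphic_intros)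
    define s where "s = (\<Sum>\<mu>\<in>M. norm \<mu>)"
    \<comment> \<open>Small enough for \<open>0 < \<bar>\<kappa> \<mu>\<bar> < 1\<close>.\<close>
    define \<kappa> where "\<kappa> = complex_of_real (1 / (1 + s))"
    have s: "0 \<le> s" by (auto simp: s_def intro: sum_nonneg)
    have "\<kappa> * \<mu> \<notin> \<int>" if \<mu>: "\<mu> \<in> M" "\<mu> \<noteq> 0" for \<mu>
    proof
      assume "\<kappa> * \<mu> \<in> \<int>"
      then obtain j :: int where j: "\<kappa> * \<mu> = of_int j" by (auto elim: Ints_cases)
      have "norm \<mu> \<le> s" unfolding s_def by (rule member_le_sum) (use fin \<mu> in auto)
      then have "norm (\<kappa> * \<mu>) < 1"
        using s unfolding \<kappa>_def norm_mult norm_of_real by (simp add: field_simps)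
      then have "\<bar>real_of_int j\<bar> < 1" unfolding j by (simp add: norm_of_int)
      then have "j = 0" by linarith
      then show False using j \<mu> s by (auto simp: \<kappa>_def complex_eq_iff)
    qed
    then have "f \<kappa> \<noteq> 0" using f0 by auto
    then show "{\<kappa>. f \<kappa> = 0} \<noteq> UNIV" by auto
    show "P \<kappa>" if "\<kappa> \<notin> {\<kappa>. f \<kappa> = 0}" for \<kappa>
      using that f0[of \<kappa>] by (intro P) auto
  qed
qed

lemma q_par_square:
  assumes "\<kappa> * (2 * k i) \<notin> \<int>"
  shows "(q_par k \<kappa> i)\<^sup>2 \<noteq> 1"
proof
  assume "(q_par k \<kappa> i)\<^sup>2 = 1"
  then have "exp (2 * (\<kappa> * k i * of_real pi * \<i>)) = 1" by (simp add: q_par_def exp_double)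
  then obtain j :: int where "Im (2 * (\<kappa> * k i * of_real pi * \<i>)) = of_int (2 * j) * pi"
    "Re (2 * (\<kappa> * k i * of_real pi * \<i>)) = 0"
    unfolding exp_eq_1 by auto
  then have "Re (\<kappa> * k i) * 2 * pi = of_int (2 * j) * pi" "Im (\<kappa> * k i) = 0" by simp_all
  then have "\<kappa> * k i = of_int j" by (simp add: complex_eq_iff)
  then have "\<kappa> * (2 * k i) = of_int (2 * j)" by (simp add: algebra_simps)
  then show False using assms by (metis Ints_of_int)
qed

lemma generic_factors:
  assumes m: "3 \<le> m" and p: "p \<in> chamber m" and \<epsilon>: "0 < \<epsilon>" "\<epsilon> < 1"
    and k: "\<And>i. i < 2 \<Longrightarrow> k i \<noteq> 0"
    and k_mirror: "\<And>t u. t < m \<Longrightarrow> u < m \<Longrightarrow> k (mirror m t u) = k u"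
    and \<alpha>_mirror: "\<And>t u. t < m \<Longrightarrow> u < m \<Longrightarrow> \<alpha> (mirror m t u) = \<alpha> u"
    and ss: "semisimple (Br m k \<alpha>)" and rep: "Br_rep m k \<alpha> n \<rho>"
  shows "for_generic (\<lambda>\<kappa>. factors_through_B m k \<alpha> \<kappa> p \<epsilon> n (T_rho m k \<alpha> \<kappa> p \<epsilon> n \<rho>))"
proof (rule for_generic_nonintegral)
  let ?M = "\<Union>i\<in>{0, 1}. {2 * k i, \<alpha> i, 2 * k i - \<alpha> i}"
  show "finite ?M" by auto
  fix \<kappa> assume \<kappa>: "\<And>\<mu>. \<mu> \<in> ?M \<Longrightarrow> \<mu> \<noteq> 0 \<Longrightarrow> \<kappa> * \<mu> \<notin> \<int>"
  obtain r \<theta> where pol: "0 < r" "0 < \<theta>" "\<theta> < pi / real m" "p = polar r \<theta>"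
    using p by (auto simp: chamber_def polar_def)
  have nonres: "nonresonant_param \<kappa> (k i) (\<alpha> i)" if i: "i < 2" for i
    unfolding nonresonant_param_def
  proof (intro ballI allI impI)
    fix \<mu> and j :: int assume \<mu>: "\<mu> \<in> {2 * k i, \<alpha> i, 2 * k i - \<alpha> i}" and j: "j \<noteq> 0"
    have "\<mu> \<in> ?M" using \<mu> i by (auto simp: less_2_cases_iff)
    then show "\<kappa> * \<mu> \<noteq> of_int j" using \<kappa>[of \<mu>] j by (cases "\<mu> = 0") auto
  qed
  have q: "(q_par k \<kappa> i)\<^sup>2 \<noteq> 1" if i: "i < 2" for i
    by (rule q_par_square, rule \<kappa>) (use i k[OF i] in \<open>auto simp: less_2_cases_iff\<close>)
  interpret generic_brauer_rep m k \<alpha> n \<rho> \<kappa> r \<theta> \<epsilon>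
    by unfold_locales (use m rep k_mirror \<alpha>_mirror pol \<epsilon> nonres q ss in auto)
  show "factors_through_B m k \<alpha> \<kappa> p \<epsilon> n (T_rho m k \<alpha> \<kappa> p \<epsilon> n \<rho>)"
    unfolding pol(4) by (rule factors)
qed

theorem proposition4p3:
  fixes m :: nat and p :: "complex \<times> complex" and \<epsilon> :: real
  assumes "p \<in> chamber m" and "0 < \<epsilon>" and "\<epsilon> < 1"
  shows
    "(m \<ge> 3 \<and> odd m \<longrightarrow>
       (\<forall>(k::complex) (\<alpha>::complex) (n::nat) \<rho>.
         k \<noteq> 0 \<longrightarrow>
         semisimple (Br m (\<lambda>_. k) (\<lambda>_. \<alpha>)) \<longrightarrow>
         Br_rep m (\<lambda>_. k) (\<lambda>_. \<alpha>) n \<rho> \<longrightarrow>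
         for_generic (\<lambda>\<kappa>.
           factors_through_B m (\<lambda>_. k) (\<lambda>_. \<alpha>) \<kappa> p \<epsilon> n
             (T_rho m (\<lambda>_. k) (\<lambda>_. \<alpha>) \<kappa> p \<epsilon> n \<rho>))))
     \<and>
     (m \<ge> 4 \<and> even m \<longrightarrow>
       (\<forall>(k0::complex) (k1::complex) (\<alpha>0::complex) (\<alpha>1::complex) (n::nat) \<rho>.
         k0 \<noteq> 0 \<longrightarrow> k1 \<noteq> 0 \<longrightarrow>
         (let k = (\<lambda>i. if even i then k0 else k1);
              \<alpha> = (\<lambda>i. if even i then \<alpha>0 else \<alpha>1)
          in semisimple (Br m k \<alpha>) \<longrightarrow>
             Br_rep m k \<alpha> n \<rho> \<longrightarrow>
             for_generic (\<lambda>\<kappa>.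
               factors_through_B m k \<alpha> \<kappa> p \<epsilon> n (T_rho m k \<alpha> \<kappa> p \<epsilon> n \<rho>)))))"
  unfolding Let_def
proof (intro conjI impI allI)
  fix k \<alpha> :: complex and n \<rho>
  assume "3 \<le> m \<and> odd m" "k \<noteq> 0" "semisimple (Br m (\<lambda>_. k) (\<lambda>_. \<alpha>))" "Br_rep m (\<lambda>_. k) (\<lambda>_. \<alpha>) n \<rho>"
  then show "for_generic (\<lambda>\<kappa>. factors_through_B m (\<lambda>_. k) (\<lambda>_. \<alpha>) \<kappa> p \<epsilon> n
      (T_rho m (\<lambda>_. k) (\<lambda>_. \<alpha>) \<kappa> p \<epsilon> n \<rho>))"
    using assms by (intro generic_factors) auto
next
  fix k0 k1 \<alpha>0 \<alpha>1 :: complex and n \<rho>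
  assume "4 \<le> m \<and> even m" "k0 \<noteq> 0" "k1 \<noteq> 0"
    "semisimple (Br m (\<lambda>i. if even i then k0 else k1) (\<lambda>i. if even i then \<alpha>0 else \<alpha>1))"
    "Br_rep m (\<lambda>i. if even i then k0 else k1) (\<lambda>i. if even i then \<alpha>0 else \<alpha>1) n \<rho>"
  then show "for_generic (\<lambda>\<kappa>. factors_through_B m (\<lambda>i. if even i then k0 else k1)
      (\<lambda>i. if even i then \<alpha>0 else \<alpha>1) \<kappa> p \<epsilon> n
      (T_rho m (\<lambda>i. if even i then k0 else k1) (\<lambda>i. if even i then \<alpha>0 else \<alpha>1) \<kappa> p \<epsilon> n \<rho>))"
    using assms by (intro generic_factors) (auto simp: even_mirror)
qed

end
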